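(* Let $\mathsf{M}$ be a $d\times d$ real-valued invertible matrix. Let $\Phi=\{\phi^1,\ldots,\phi^r\}$, $\Psi=\{\psi^1,\ldots,\psi^s\}$, $\tilde\Phi=\{\tilde\phi^1,\ldots,\tilde\phi^r\}$, $\tilde\Psi=\{\tilde\psi^1,\ldots,\tilde\psi^s\}$ be finite subsets of $L_2(\mathbb{R}^d)$. Suppose that $(\mathsf{WS}_J(\Phi;\Psi),\mathsf{WS}_J(\tilde\Phi;\tilde\Psi))$ is a pair of nonhomogeneous biorthogonal $\mathsf{M}$-wavelet bases in $L_2(\mathbb{R}^d)$ for some integer $J$. Then it is a pair of nonhomogeneous biorthogonal $\mathsf{M}$-wavelet bases in $L_2(\mathbb{R}^d)$ for all integers $J$. Moreover, there exist $r\times r$ matrices $\mathbf{a}_k,\tilde{\mathbf{a}}_k$ and $s\times r$ matrices $\mathbf{b}_k,\tilde{\mathbf{b}}_k$, $k\in\mathbb{Z}^d$, of $2\pi\mathbb{Z}^d$-periodic measurable functions in $L_2(\mathbb{T}^d)$ such that, for a.e. $\xi\in\mathbb{R}^d$ and all $k\in\mathbb{Z}^d$, $$e^{-ik\cdot\mathsf{M}^T\xi}\hat\phi(\mathsf{M}^T\xi)=\mathbf{a}_k(\xi)\hat\phi(\xi),\qquad e^{-ik\cdot\mathsf{M}^T\xi}\hat\psi(\mathsf{M}^T\xi)=\mathbf{b}_k(\xi)\hat\phi(\xi),$$ $$e^{-ik\cdot\mathsf{M}^T\xi}\hat{\tilde\phi}(\mathsf{M}^T\xi)=\tilde{\mathbf{a}}_k(\xi)\hat{\tilde\phi}(\xi),\qquad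 e^{-ik\cdot\mathsf{M}^T\xi}\hat{\tilde\psi}(\mathsf{M}^T\xi)=\tilde{\mathbf{b}}_k(\xi)\hat{\tilde\phi}(\xi),$$ where $\phi:=[\phi^1,\ldots,\phi^r]^T$, $\psi:=[\psi^1,\ldots,\psi^s]^T$, $\tilde\phi:=[\tilde\phi^1,\ldots,\tilde\phi^r]^T$, $\tilde\psi:=[\tilde\psi^1,\ldots,\tilde\psi^s]^T$. If $\mathsf{M}$ is a $d\times d$ integer invertible matrix with $d_{\mathsf{M}}:=|\det\mathsf{M}|$, then $s=r(d_{\mathsf{M}}-1)$ and $$\overline{\mathsf{P}_{[\tilde{\mathbf{a}}_0,\tilde{\mathbf{b}}_0]}(\xi)}^{\,T}\,\mathsf{P}_{[\mathbf{a}_0,\mathbf{b}_0]}(\xi)=I_{rd_{\mathsf{M}}},\qquad\text{a.e. }\xi\in\mathbb{R}^d,$$ where $I_{rd_{\mathsf{M}}}$ is the $(rd_{\mathsf{M}})\times(rd_{\mathsf{M}})$ identity matrix, $$\mathsf{P}_{[\mathbf{a}_0,\mathbf{b}_0]}(\xi):=\begin{bmatrix}\mathbf{a}_0(\xi+2\pi\omega_0)&\mathbf{a}_0(\xi+2\pi\omega_1)&\cdots&\mathbf{a}_0(\xi+2\pi\omega_{d_{\mathsf{M}}-1})\\ \mathbf{b}_0(\xi+2\pi\omega_0)&\mathbf{b}_0(\xi+2\pi\omega_1)&\cdots&\mathbf{b}_0(\xi+2\pi\omega_{d_{\mathsf{M}}-1})\end{bmatrix},$$ $\mathsf{P}_{[\tilde{\mathbf{a}}_0,\tilde{\mathbf{b}}_0]}$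 is defined similarly, and $\{\omega_0,\ldots,\omega_{d_{\mathsf{M}}-1}\}:=[(\mathsf{M}^T)^{-1}\mathbb{Z}^d]\cap[0,1)^d$. If $\mathsf{M}$ is a $d\times d$ real-valued expansive matrix, then $(\mathsf{WS}(\Psi),\mathsf{WS}(\tilde\Psi))$ is a pair of homogeneous biorthogonal $\mathsf{M}$-wavelet bases in $L_2(\mathbb{R}^d)$, that is, each of $\mathsf{WS}(\Psi)$ and $\mathsf{WS}(\tilde\Psi)$ is a homogeneous Riesz $\mathsf{M}$-wavelet basis in $L_2(\mathbb{R}^d)$ and $\langle\psi^n_{\mathsf{M}^j;k},\tilde\psi^{n'}_{\mathsf{M}^{j'};k'}\rangle=\delta(k-k')\delta(n-n')\delta(j-j')$ for all $k,k'\in\mathbb{Z}^d$, $j,j'\in\mathbb{Z}$ and $n,n'=1,\ldots,s$.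
   Context: For $f:\mathbb{R}^d\to\mathbb{C}$, a $d\times d$ real invertible matrix $U$ and $k\in\mathbb{R}^d$, put $f_{U;k}(x):=|\det U|^{1/2}f(Ux-k)$. For subsets $\Phi,\Psi$ of $L_2(\mathbb{R}^d)$ and $J\in\mathbb{Z}$, $$\mathsf{WS}_J(\Phi;\Psi):=\{\phi_{\mathsf{M}^J;k}: k\in\mathbb{Z}^d,\phi\in\Phi\}\cup\{\psi_{\mathsf{M}^j;k}: j\ge J,\ k\in\mathbb{Z}^d,\psi\in\Psi\},\qquad \mathsf{WS}(\Psi):=\{\psi_{\mathsf{M}^j;k}: j\in\mathbb{Z},k\in\mathbb{Z}^d,\psi\in\Psi\}.$$ Elements of generator sets are counted with multiplicity (systems are indexed families). Such a system is called a (nonhomogeneous, resp. homogeneous) Riesz $\mathsf{M}$-wavelet basis in $L_2(\mathbb{R}^d)$ if it is a Riesz basis of $L_2(\mathbb{R}^d)$: its linear span is dense and there are constants $C_3,C_4>0$ such that $C_3\sum_i|c_i|^2\le\|\sum_i c_ih_i\|^2\le C_4\sum_i|c_i|^2$ for all finitely supported coefficient sequences, where $\{h_i\}$ denotes the system. $\delta$ is the Dirac sequence: $\delta(0)=1$, $\delta(k)=0$ for $k\neq0$. The pair $(\mathsf{WS}_J(\Phi;\Psi),\mathsf{WS}_J(\tilde\Phi;\tilde\Psi))$ is a pair of nonhomogeneous biorthogonal $\mathsf{M}$-wavelet bases in $L_2(\mathbb{R}^d)$ if each of the two systems is a nonhomogeneous Riesz $\mathsf{M}$-wavelet basis in $L_2(\mathbb{R}^d)$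 and $$\langle\phi^\ell_{\mathsf{M}^J;k},\tilde\phi^{\ell'}_{\mathsf{M}^J;k'}\rangle=\delta(k-k')\delta(\ell-\ell'),\quad\langle\psi^n_{\mathsf{M}^j;k},\tilde\phi^{\ell'}_{\mathsf{M}^J;k'}\rangle=0,\quad\langle\phi^\ell_{\mathsf{M}^J;k},\tilde\psi^{n'}_{\mathsf{M}^{j'};k'}\rangle=0,$$ $$\langle\psi^n_{\mathsf{M}^j;k},\tilde\psi^{n'}_{\mathsf{M}^{j'};k'}\rangle=\delta(k-k')\delta(n-n')\delta(j-j')$$ for all $k,k'\in\mathbb{Z}^d$, all integers $j,j'\ge J$, $\ell,\ell'=1,\ldots,r$ and $n,n'=1,\ldots,s$. The Fourier transform is $\hat f(\xi)=\int_{\mathbb{R}^d}f(x)e^{-ix\cdot\xi}\,dx$ (extended to $L_2$), applied entrywise to vectors. $L_2(\mathbb{T}^d)$ denotes $2\pi\mathbb{Z}^d$-periodic measurable functions square integrable on $[-\pi,\pi)^d$. A matrix is expansive if all its eigenvalues have modulus greater than one. *)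

theory Defs
  imports
    "HOL-Analysis.Analysis"
    "Jordan_Normal_Form.Matrix"
begin

text \<open>
  Points of $R^d$ and the dilation matrix are \<^typ>\<open>real^'d\<close> and \<^typ>\<open>real^'d^'d\<close>. Matrices whose size
  depends on the numbers of generators $r$ and $s$ are matrices of the entry in the
  Jordan-Normal-Form library. Both libraries use the dollar sign and the names vec and mat, hence
  the qualified names below; from here on the dollar sign denotes the Jordan-Normal-Form notation.
\<close>

unbundle no vec_syntax

definition int_lattice :: "(real^'d) set" where
  "int_lattice = {k. \<forall>i. vec_nth k i \<in> \<int>}"

definition int_matrix :: "real^'d^'d \<Rightarrow> bool" where
  "int_matrix M \<longleftrightarrow> (\<forall>i j. vec_nth (vec_nth M i) j \<in> \<int>)"

text \<open>Eigenvalues of a real matrix are understood over the complex numbers.\<close>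

definition expansive :: "real^'d^'d \<Rightarrow> bool" where
  "expansive M \<longleftrightarrow>
    (\<forall>(z::complex) v. v \<noteq> 0 \<longrightarrow> map_matrix complex_of_real M *v v = z *s v \<longrightarrow> cmod z > 1)"

text \<open>Multiplication and powers of the type class on \<^typ>\<open>real^'d^'d\<close> are componentwise, so integer
  powers with respect to the matrix product are defined here.\<close>

definition matrix_powi :: "real^'d^'d \<Rightarrow> int \<Rightarrow> real^'d^'d" where
  "matrix_powi A j =
    (if 0 \<le> j then (((**) A) ^^ nat j) (Finite_Cartesian_Product.mat 1)
     else (((**) (matrix_inv A)) ^^ nat (- j)) (Finite_Cartesian_Product.mat 1))"

text \<open>Square integrable functions are not identified when they agree almost everywhere.\<close>

definition L2 :: "('a::euclidean_space \<Rightarrow> complex) set" where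
  "L2 = {f. f \<in> borel_measurable lebesgue \<and> integrable lebesgue (\<lambda>x. (cmod (f x))\<^sup>2)}"

definition norm_L2 :: "('a::euclidean_space \<Rightarrow> complex) \<Rightarrow> real" where
  "norm_L2 f = sqrt (integral\<^sup>L lebesgue (\<lambda>x. (cmod (f x))\<^sup>2))"

definition inner_L2 :: "('a::euclidean_space \<Rightarrow> complex) \<Rightarrow> ('a \<Rightarrow> complex) \<Rightarrow> complex" where
  "inner_L2 f g = integral\<^sup>L lebesgue (\<lambda>x. f x * cnj (g x))"

definition fourier_L1 :: "('a::euclidean_space \<Rightarrow> complex) \<Rightarrow> 'a \<Rightarrow> complex" where
  "fourier_L1 f \<xi> = integral\<^sup>L lebesgue (\<lambda>x. f x * cis (- (x \<bullet> \<xi>)))"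

text \<open>The Fourier transform on \<^const>\<open>L2\<close> is the extension by continuity of \<^const>\<open>fourier_L1\<close> from
  the dense subspace of functions that are both integrable and square integrable. It is determined
  up to a null set, and \<open>fourier_L2\<close> picks a representative.\<close>

definition is_fourier_L2 ::
  "('a::euclidean_space \<Rightarrow> complex) \<Rightarrow> ('a \<Rightarrow> complex) \<Rightarrow> bool" where
  "is_fourier_L2 f g \<longleftrightarrow> g \<in> L2 \<and>
    (\<forall>u. (\<forall>n. integrable lebesgue (u n) \<and> u n \<in> L2) \<longrightarrow>
         (\<lambda>n. norm_L2 (\<lambda>x. u n x - f x)) \<longlonglongrightarrow> 0 \<longrightarrow>
         (\<lambda>n. norm_L2 (\<lambda>\<xi>. fourier_L1 (u n) \<xi> - g \<xi>)) \<longlonglongrightarrow> 0)"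

definition fourier_L2 :: "('a::euclidean_space \<Rightarrow> complex) \<Rightarrow> 'a \<Rightarrow> complex" where
  "fourier_L2 f = (SOME g. is_fourier_L2 f g)"

definition L2_torus :: "(real^'d \<Rightarrow> complex) set" where
  "L2_torus = {g. g \<in> borel_measurable lebesgue \<and>
     (\<forall>\<xi>. \<forall>k\<in>int_lattice. g (\<xi> + (2 * pi) *\<^sub>R k) = g \<xi>) \<and>
     set_integrable lebesgue {\<xi>. \<forall>i. - pi \<le> vec_nth \<xi> i \<and> vec_nth \<xi> i < pi}
       (\<lambda>\<xi>. (cmod (g \<xi>))\<^sup>2)}"

text \<open>Systems are families \<open>h\<close> over an index set \<open>I\<close>, so multiplicities count.\<close>

definition riesz_basis_L2 :: "'i set \<Rightarrow> ('i \<Rightarrow> 'a::euclidean_space \<Rightarrow> complex) \<Rightarrow> bool" where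
  "riesz_basis_L2 I h \<longleftrightarrow>
    (\<forall>i\<in>I. h i \<in> L2) \<and>
    (\<forall>f\<in>L2. \<forall>\<epsilon>>0. \<exists>F c. finite F \<and> F \<subseteq> I \<and>
       norm_L2 (\<lambda>x. f x - (\<Sum>i\<in>F. c i * h i x)) < \<epsilon>) \<and>
    (\<exists>C3>0. \<exists>C4>0. \<forall>F c. finite F \<longrightarrow> F \<subseteq> I \<longrightarrow>
       C3 * (\<Sum>i\<in>F. (cmod (c i))\<^sup>2) \<le> (norm_L2 (\<lambda>x. \<Sum>i\<in>F. c i * h i x))\<^sup>2 \<and>
       (norm_L2 (\<lambda>x. \<Sum>i\<in>F. c i * h i x))\<^sup>2 \<le> C4 * (\<Sum>i\<in>F. (cmod (c i))\<^sup>2))"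

definition dilate_shift ::
  "real^'d^'d \<Rightarrow> real^'d \<Rightarrow> (real^'d \<Rightarrow> complex) \<Rightarrow> real^'d \<Rightarrow> complex" where
  "dilate_shift U k f = (\<lambda>x. complex_of_real (sqrt \<bar>det U\<bar>) * f (U *v x - k))"

text \<open>Generators $f^1,\ldots,f^r$ are indexed by \<open>{1..r}\<close>. In the sum type below, \<open>Inl (k, l)\<close> is
  the index of the scaling element with shift \<open>k\<close> and generator \<open>l\<close>, and \<open>Inr (j, k, n)\<close> is that
  of the wavelet element with scale \<open>j\<close>, shift \<open>k\<close> and generator \<open>n\<close>.\<close>

definition WS_family ::
  "real^'d^'d \<Rightarrow> (nat \<Rightarrow> real^'d \<Rightarrow> complex) \<Rightarrow> int \<times> (real^'d) \<times> nat \<Rightarrow> real^'d \<Rightarrow> complex" where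
  "WS_family M \<psi> = (\<lambda>(j, k, n). dilate_shift (matrix_powi M j) k (\<psi> n))"

definition WS_index :: "nat \<Rightarrow> (int \<times> (real^'d) \<times> nat) set" where
  "WS_index s = UNIV \<times> int_lattice \<times> {1..s}"

definition WSJ_family ::
  "real^'d^'d \<Rightarrow> int \<Rightarrow> (nat \<Rightarrow> real^'d \<Rightarrow> complex) \<Rightarrow> (nat \<Rightarrow> real^'d \<Rightarrow> complex) \<Rightarrow>
   ((real^'d) \<times> nat) + (int \<times> (real^'d) \<times> nat) \<Rightarrow> real^'d \<Rightarrow> complex" where
  "WSJ_family M J \<phi> \<psi> =
     case_sum (\<lambda>(k, l). dilate_shift (matrix_powi M J) k (\<phi> l)) (WS_family M \<psi>)"

definition WSJ_index ::
  "int \<Rightarrow> nat \<Rightarrow> nat \<Rightarrow> (((real^'d) \<times> nat) + (int \<times> (real^'d) \<times> nat)) set" where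
  "WSJ_index J r s = (int_lattice \<times> {1..r}) <+> ({J..} \<times> int_lattice \<times> {1..s})"

definition nonhomogeneous_biorthogonal_pair ::
  "real^'d^'d \<Rightarrow> int \<Rightarrow> nat \<Rightarrow> nat \<Rightarrow>
   (nat \<Rightarrow> real^'d \<Rightarrow> complex) \<Rightarrow> (nat \<Rightarrow> real^'d \<Rightarrow> complex) \<Rightarrow>
   (nat \<Rightarrow> real^'d \<Rightarrow> complex) \<Rightarrow> (nat \<Rightarrow> real^'d \<Rightarrow> complex) \<Rightarrow> bool" where
  "nonhomogeneous_biorthogonal_pair M J r s \<phi> \<psi> \<phi>' \<psi>' \<longleftrightarrow>
    riesz_basis_L2 (WSJ_index J r s) (WSJ_family M J \<phi> \<psi>) \<and>
    riesz_basis_L2 (WSJ_index J r s) (WSJ_family M J \<phi>' \<psi>') \<and>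
    (\<forall>k\<in>int_lattice. \<forall>k'\<in>int_lattice. \<forall>l\<in>{1..r}. \<forall>l'\<in>{1..r}.
       inner_L2 (dilate_shift (matrix_powi M J) k (\<phi> l))
                (dilate_shift (matrix_powi M J) k' (\<phi>' l')) = of_bool (k = k' \<and> l = l')) \<and>
    (\<forall>k\<in>int_lattice. \<forall>k'\<in>int_lattice. \<forall>j\<ge>J. \<forall>n\<in>{1..s}. \<forall>l'\<in>{1..r}.
       inner_L2 (dilate_shift (matrix_powi M j) k (\<psi> n))
                (dilate_shift (matrix_powi M J) k' (\<phi>' l')) = 0) \<and>
    (\<forall>k\<in>int_lattice. \<forall>k'\<in>int_lattice. \<forall>l\<in>{1..r}. \<forall>j'\<ge>J. \<forall>n'\<in>{1..s}.
       inner_L2 (dilate_shift (matrix_powi M J) k (\<phi> l))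
                (dilate_shift (matrix_powi M j') k' (\<psi>' n')) = 0) \<and>
    (\<forall>k\<in>int_lattice. \<forall>k'\<in>int_lattice. \<forall>j\<ge>J. \<forall>j'\<ge>J. \<forall>n\<in>{1..s}. \<forall>n'\<in>{1..s}.
       inner_L2 (dilate_shift (matrix_powi M j) k (\<psi> n))
                (dilate_shift (matrix_powi M j') k' (\<psi>' n')) =
       of_bool (k = k' \<and> n = n' \<and> j = j'))"

definition homogeneous_biorthogonal_pair ::
  "real^'d^'d \<Rightarrow> nat \<Rightarrow> (nat \<Rightarrow> real^'d \<Rightarrow> complex) \<Rightarrow> (nat \<Rightarrow> real^'d \<Rightarrow> complex) \<Rightarrow> bool" where
  "homogeneous_biorthogonal_pair M s \<psi> \<psi>' \<longleftrightarrow>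
    riesz_basis_L2 (WS_index s) (WS_family M \<psi>) \<and>
    riesz_basis_L2 (WS_index s) (WS_family M \<psi>') \<and>
    (\<forall>k\<in>int_lattice. \<forall>k'\<in>int_lattice. \<forall>j j'. \<forall>n\<in>{1..s}. \<forall>n'\<in>{1..s}.
       inner_L2 (dilate_shift (matrix_powi M j) k (\<psi> n))
                (dilate_shift (matrix_powi M j') k' (\<psi>' n')) =
       of_bool (k = k' \<and> n = n' \<and> j = j'))"

text \<open>The column vector of Fourier transforms; component \<open>i < m\<close> belongs to generator \<open>Suc i\<close>.\<close>

definition fourier_vec ::
  "nat \<Rightarrow> (nat \<Rightarrow> real^'d \<Rightarrow> complex) \<Rightarrow> real^'d \<Rightarrow> complex Matrix.vec" where
  "fourier_vec m f \<xi> = Matrix.vec m (\<lambda>i. fourier_L2 (f (Suc i)) \<xi>)"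

definition torus_matrix :: "nat \<Rightarrow> nat \<Rightarrow> (real^'d \<Rightarrow> complex Matrix.mat) \<Rightarrow> bool" where
  "torus_matrix m n A \<longleftrightarrow> (\<forall>\<xi>. A \<xi> \<in> carrier_mat m n) \<and>
     (\<forall>i<m. \<forall>j<n. (\<lambda>\<xi>. A \<xi> $$ (i, j)) \<in> L2_torus)"

text \<open>\<open>f\<close> has masks \<open>A k\<close> with respect to \<open>\<phi>\<close>. The lattice is countable, so the order of
  \<open>AE\<close> and the quantifier over \<open>k\<close> is immaterial.\<close>

definition has_masks ::
  "real^'d^'d \<Rightarrow> nat \<Rightarrow> (nat \<Rightarrow> real^'d \<Rightarrow> complex) \<Rightarrow> nat \<Rightarrow> (nat \<Rightarrow> real^'d \<Rightarrow> complex) \<Rightarrow>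
   (real^'d \<Rightarrow> real^'d \<Rightarrow> complex Matrix.mat) \<Rightarrow> bool" where
  "has_masks M m f r \<phi> A \<longleftrightarrow>
    (AE \<xi> in lebesgue. \<forall>k\<in>int_lattice.
       cis (- (k \<bullet> (transpose M *v \<xi>))) \<cdot>\<^sub>v fourier_vec m f (transpose M *v \<xi>) =
       A k \<xi> *\<^sub>v fourier_vec r \<phi> \<xi>)"

text \<open>For an integer matrix the absolute value of the determinant is a natural number.\<close>

definition abs_det :: "real^'d^'d \<Rightarrow> nat" where
  "abs_det M = nat \<lfloor>\<bar>det M\<bar>\<rfloor>"

definition coset_reps :: "real^'d^'d \<Rightarrow> (real^'d) set" where
  "coset_reps M = ((\<lambda>k. matrix_inv (transpose M) *v k) ` int_lattice) \<inter>
     {x. \<forall>i. 0 \<le> vec_nth x i \<and> vec_nth x i < 1}"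

text \<open>Column \<open>j\<close> lies in the block with number \<open>j div r\<close>, which is evaluated at the shift by
  $2\pi\omega$ with that number.\<close>

definition polyphase ::
  "nat \<Rightarrow> nat \<Rightarrow> nat \<Rightarrow> (nat \<Rightarrow> real^'d) \<Rightarrow> (real^'d \<Rightarrow> complex Matrix.mat) \<Rightarrow>
   (real^'d \<Rightarrow> complex Matrix.mat) \<Rightarrow> real^'d \<Rightarrow> complex Matrix.mat" where
  "polyphase r s m \<omega> a b \<xi> = Matrix.mat (r + s) (r * m) (\<lambda>(i, j).
     let x = \<xi> + (2 * pi) *\<^sub>R \<omega> (j div r)
     in if i < r then a x $$ (i, j mod r) else b x $$ (i - r, j mod r))"

end

theory Submission
  imports Defs "HOL-Computational_Algebra.Fundamental_Theorem_Algebra"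
begin

text \<open>
  Dilations are unitary, and dilation by a power of \<open>M\<close> moves the system with coarsest scale \<open>J\<close> to the
  one with another coarsest scale. This gives the claim for all \<open>J\<close>
  (\<open>nonhomogeneous_biorthogonal_pair_shift\<close>), with Riesz bounds that do not depend on \<open>J\<close>.

  Masks come from comparing the bases with coarsest scales \<open>-1\<close> and \<open>0\<close>. In a biorthogonal pair of
  Riesz bases every function is the sum of its expansion with coefficients given by the dual basis
  (locale \<open>biorthogonal_riesz\<close>). A scaling function or wavelet of scale \<open>-1\<close> is orthogonal to all
  dual wavelets of nonnegative scale, hence it expands in integer translates of the scaling functions
  of scale \<open>0\<close> alone, with square summable coefficients. Under the Fourier transform an expansion in
  translates becomes multiplication by a Fourier series, which is the mask (\<open>mask_exists\<close>). This
  rests on Plancherel's theorem, which is derived here from the completeness of the characters of the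
  torus: for a function supported in the unit cube, the values of its transform on a translate of the
  dual lattice are Fourier coefficients.

  Let \<open>M\<close> be an integer matrix. Expanding translates of the scaling functions of scale \<open>0\<close> in the
  basis with coarsest scale \<open>-1\<close>, the wavelets of nonnegative scale contribute nothing, and this is a
  completeness relation for the refinement coefficients, which are the Fourier coefficients of the masks
  (\<open>completeness\<close>). The product of polyphase matrices has entries that are sums of products of masks;
  by Parseval's identity their Fourier coefficients are sums over the integer lattice. Splitting the
  lattice into the cosets of its image under \<open>M\<close>, each coset yields one instance of the completeness
  relation times the value of a character, and character orthogonality leaves \<open>\<bar>det M\<bar>\<close> times the
  identity matrix (\<open>gram_coefficients\<close>, \<open>polyphase_identity\<close>). Summing all products of corresponding
  coefficients, once over generators and once over scaling functions, gives
  \<open>r + s = r * \<bar>det M\<bar>\<close> (\<open>number_of_wavelets\<close>).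

  Let \<open>M\<close> be expansive. Finitely many wavelets always belong to one nonhomogeneous system, so the
  homogeneous system inherits the Riesz bounds and biorthogonality. For density, expand a compactly
  supported function at a very coarse scale. The coefficients of its scaling part are inner products
  with widely stretched dual scaling functions. In the stretched coordinates the support is a tiny
  cube, so the coefficients only involve the values of the dual scaling functions close to lattice
  points, and the energy of these values tends to zero
  (\<open>coarse_energy\<close>). So the wavelet part of the expansion approximates the function
  (\<open>WS_dense\<close>).
\<close>

section \<open>Square integrable functions on a measure space\<close>

text \<open>The measure is a parameter because the same facts are needed for Lebesgue measure on the whole
  space and for its restriction to the unit cube. As functions are not identified when they agree
  almost everywhere, \<open>nrm\<close> is a seminorm and limits are unique up to null sets only.\<close>

definition sqint :: "'a measure \<Rightarrow> ('a \<Rightarrow> complex) set" where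
  "sqint M = {f. f \<in> borel_measurable M \<and> integrable M (\<lambda>x. (cmod (f x))\<^sup>2)}"

definition nrm :: "'a measure \<Rightarrow> ('a \<Rightarrow> complex) \<Rightarrow> real" where
  "nrm M f = sqrt (integral\<^sup>L M (\<lambda>x. (cmod (f x))\<^sup>2))"

definition ip :: "'a measure \<Rightarrow> ('a \<Rightarrow> complex) \<Rightarrow> ('a \<Rightarrow> complex) \<Rightarrow> complex" where
  "ip M f g = integral\<^sup>L M (\<lambda>x. f x * cnj (g x))"

lemma borel_measurable_cnj [measurable]:
  "f \<in> borel_measurable M \<Longrightarrow> (\<lambda>x. cnj (f x)) \<in> borel_measurable M"
  by (rule borel_measurable_continuous_on[OF continuous_on_cnj[OF continuous_on_id]])

lemma sqint_measurable [measurable_dest]: "f \<in> sqint M \<Longrightarrow> f \<in> borel_measurable M"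
  by (simp add: sqint_def)

lemma sqint_integrable: "f \<in> sqint M \<Longrightarrow> integrable M (\<lambda>x. (cmod (f x))\<^sup>2)"
  by (simp add: sqint_def)

lemma nrm_nonneg [simp]: "0 \<le> nrm M f"
  by (simp add: nrm_def)

lemma nrm_sq: "(nrm M f)\<^sup>2 = integral\<^sup>L M (\<lambda>x. (cmod (f x))\<^sup>2)"
  by (simp add: nrm_def)

lemma sqint_zero [simp]: "(\<lambda>x. 0) \<in> sqint M"
  by (simp add: sqint_def)

lemma sqint_bound:
  assumes "g \<in> borel_measurable M" "integrable M h" "\<And>x. (cmod (g x))\<^sup>2 \<le> h x"
  shows "g \<in> sqint M"
proof -
  have "integrable M (\<lambda>x. (cmod (g x))\<^sup>2)"
    by (rule Bochner_Integration.integrable_bound[OF assms(2)])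
       (use assms(1) in measurable, use assms(3) in \<open>auto intro: order_trans[OF assms(3) abs_ge_self]\<close>)
  with assms(1) show ?thesis by (simp add: sqint_def)
qed

lemma sqint_add:
  assumes "f \<in> sqint M" "g \<in> sqint M"
  shows "(\<lambda>x. f x + g x) \<in> sqint M"
proof (rule sqint_bound)
  show "integrable M (\<lambda>x. 2 * (cmod (f x))\<^sup>2 + 2 * (cmod (g x))\<^sup>2)"
    using assms by (auto simp: sqint_def)
  fix x
  have "(cmod (f x + g x))\<^sup>2 \<le> (cmod (f x) + cmod (g x))\<^sup>2"
    by (intro power_mono norm_triangle_ineq) auto
  also have "\<dots> \<le> 2 * (cmod (f x))\<^sup>2 + 2 * (cmod (g x))\<^sup>2"
    using zero_le_power2[of "cmod (f x) - cmod (g x)"] by (simp add: power2_eq_square algebra_simps)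
  finally show "(cmod (f x + g x))\<^sup>2 \<le> 2 * (cmod (f x))\<^sup>2 + 2 * (cmod (g x))\<^sup>2" .
qed (use assms in \<open>auto simp: sqint_def\<close>)

lemma sqint_cmult: "f \<in> sqint M \<Longrightarrow> (\<lambda>x. c * f x) \<in> sqint M"
  by (auto simp: sqint_def norm_mult power_mult_distrib)

lemma sqint_uminus: "f \<in> sqint M \<Longrightarrow> (\<lambda>x. - f x) \<in> sqint M"
  by (auto simp: sqint_def)

lemma sqint_diff:
  assumes "f \<in> sqint M" "g \<in> sqint M"
  shows "(\<lambda>x. f x - g x) \<in> sqint M"
  using sqint_add[OF assms(1) sqint_uminus[OF assms(2)]] by simp

lemma sqint_sum: "(\<And>i. i \<in> F \<Longrightarrow> h i \<in> sqint M) \<Longrightarrow> (\<lambda>x. \<Sum>i\<in>F. h i x) \<in> sqint M"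
  by (induction F rule: infinite_finite_induct) (auto intro: sqint_add)

lemma sqint_lincomb: "(\<And>i. i \<in> F \<Longrightarrow> h i \<in> sqint M) \<Longrightarrow> (\<lambda>x. \<Sum>i\<in>F. c i * h i x) \<in> sqint M"
  by (intro sqint_sum sqint_cmult)

lemma sqint_unimodular_mult:
  assumes "f \<in> sqint M" "e \<in> borel_measurable M" "\<And>x. cmod (e x) = 1"
  shows "(\<lambda>x. e x * f x) \<in> sqint M"
  using assms by (auto simp: sqint_def norm_mult)

lemma integrable_prod:
  assumes "f \<in> sqint M" "g \<in> sqint M"
  shows "integrable M (\<lambda>x. f x * cnj (g x))"
proof (rule Bochner_Integration.integrable_bound)
  show "integrable M (\<lambda>x. (cmod (f x))\<^sup>2 + (cmod (g x))\<^sup>2)"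
    using assms by (auto simp: sqint_def)
  have "a * b \<le> a\<^sup>2 + b\<^sup>2" if "a \<ge> 0" "b \<ge> 0" for a b :: real
    using zero_le_power2[of "a - b"] mult_nonneg_nonneg[OF that] unfolding power2_diff by linarith
  then show "AE x in M. norm (f x * cnj (g x)) \<le> norm ((cmod (f x))\<^sup>2 + (cmod (g x))\<^sup>2)"
    by (auto simp: norm_mult)
  show "(\<lambda>x. f x * cnj (g x)) \<in> borel_measurable M"
    using assms by (auto simp: sqint_def borel_measurable_cnj)
qed

lemma ip_add_left: "f \<in> sqint M \<Longrightarrow> g \<in> sqint M \<Longrightarrow> h \<in> sqint M \<Longrightarrow>
  ip M (\<lambda>x. f x + g x) h = ip M f h + ip M g h"
  unfolding ip_def by (simp add: distrib_right integrable_prod)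

lemma ip_diff_left: "f \<in> sqint M \<Longrightarrow> g \<in> sqint M \<Longrightarrow> h \<in> sqint M \<Longrightarrow>
  ip M (\<lambda>x. f x - g x) h = ip M f h - ip M g h"
  unfolding ip_def by (simp add: left_diff_distrib integrable_prod)

lemma ip_cmult_left: "ip M (\<lambda>x. c * f x) h = c * ip M f h"
  unfolding ip_def by (simp add: mult.assoc)

lemma ip_commute: "ip M f g = cnj (ip M g f)"
proof -
  have "cnj (ip M g f) = integral\<^sup>L M (\<lambda>x. cnj (g x * cnj (f x)))"
    unfolding ip_def by (rule Bochner_Integration.integral_cnj[symmetric])
  then show ?thesis by (simp add: ip_def mult.commute)
qed

lemma ip_zero_left [simp]: "ip M (\<lambda>x. 0) h = 0"
  unfolding ip_def by simp

lemma ip_sum_left: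
  "(\<And>i. i \<in> F \<Longrightarrow> u i \<in> sqint M) \<Longrightarrow> h \<in> sqint M \<Longrightarrow>
    ip M (\<lambda>x. \<Sum>i\<in>F. u i x) h = (\<Sum>i\<in>F. ip M (u i) h)"
  by (induction F rule: infinite_finite_induct) (auto simp: ip_add_left sqint_sum)

lemma ip_lincomb_left:
  assumes "\<And>i. i \<in> F \<Longrightarrow> u i \<in> sqint M" "h \<in> sqint M"
  shows "ip M (\<lambda>x. \<Sum>i\<in>F. c i * u i x) h = (\<Sum>i\<in>F. c i * ip M (u i) h)"
  using assms by (subst ip_sum_left) (auto simp: ip_cmult_left sqint_cmult)

lemma ip_self: "ip M f f = of_real ((nrm M f)\<^sup>2)"
  unfolding nrm_sq ip_def by (simp add: complex_norm_square[symmetric] flip: integral_complex_of_real)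

lemma ennreal_nrm_sq:
  assumes "f \<in> sqint M"
  shows "ennreal ((nrm M f)\<^sup>2) = (\<integral>\<^sup>+x. ennreal ((cmod (f x))\<^sup>2) \<partial>M)"
  unfolding nrm_sq using assms by (subst nn_integral_eq_integral) (auto simp: sqint_def)

lemma sqintI_nn:
  assumes "f \<in> borel_measurable M" "(\<integral>\<^sup>+x. ennreal ((cmod (f x))\<^sup>2) \<partial>M) < \<infinity>"
  shows "f \<in> sqint M"
  using assms by (auto simp: sqint_def intro!: integrableI_nonneg)

lemma ip_Cauchy_Schwarz:
  assumes f: "f \<in> sqint M" and g: "g \<in> sqint M"
  shows "cmod (ip M f g) \<le> nrm M f * nrm M g"
proof -
  let ?I = "integral\<^sup>L M (\<lambda>x. cmod (f x * cnj (g x)))"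
  have int: "integrable M (\<lambda>x. cmod (f x * cnj (g x)))"
    using integrable_prod[OF f g] by (rule integrable_norm)
  have "ennreal (?I\<^sup>2) = (ennreal ?I)\<^sup>2"
    by (simp add: ennreal_power)
  also have "ennreal ?I = (\<integral>\<^sup>+x. ennreal (cmod (f x)) * ennreal (cmod (g x)) \<partial>M)"
    by (subst nn_integral_eq_integral[OF int, symmetric]) (auto simp: norm_mult ennreal_mult)
  also have "(\<dots>)\<^sup>2 \<le> (\<integral>\<^sup>+x. (ennreal (cmod (f x)))\<^sup>2 \<partial>M) * (\<integral>\<^sup>+x. (ennreal (cmod (g x)))\<^sup>2 \<partial>M)"
    using f g by (intro Cauchy_Schwarz_nn_integral) (auto simp: sqint_def)
  also have "\<dots> = ennreal ((nrm M f * nrm M g)\<^sup>2)"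
    by (simp add: ennreal_power ennreal_nrm_sq[OF f, symmetric] ennreal_nrm_sq[OF g, symmetric]
        power_mult_distrib ennreal_mult)
  finally have "?I\<^sup>2 \<le> (nrm M f * nrm M g)\<^sup>2"
    by simp
  then have "?I \<le> nrm M f * nrm M g"
    by (rule power2_le_imp_le) simp
  moreover have "cmod (ip M f g) \<le> ?I"
    unfolding ip_def by (rule integral_norm_bound)
  ultimately show ?thesis by simp
qed

lemma nrm_cong_AE:
  assumes "AE x in M. f x = g x" "f \<in> borel_measurable M" "g \<in> borel_measurable M"
  shows "nrm M f = nrm M g"
  unfolding nrm_def using assms by (intro arg_cong[where f=sqrt] integral_cong_AE) auto

lemma nrm_cmult: "nrm M (\<lambda>x. c * f x) = cmod c * nrm M f"
  by (simp add: nrm_def norm_mult power_mult_distrib real_sqrt_mult)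

lemma nrm_uminus: "nrm M (\<lambda>x. - f x) = nrm M f"
  by (simp add: nrm_def)

lemma nrm_minus_commute: "nrm M (\<lambda>x. f x - g x) = nrm M (\<lambda>x. g x - f x)"
  by (simp add: nrm_def norm_minus_commute)

lemma nrm_zero [simp]: "nrm M (\<lambda>x. 0) = 0"
  by (simp add: nrm_def)

lemma nrm_triangle:
  assumes f: "f \<in> sqint M" and g: "g \<in> sqint M"
  shows "nrm M (\<lambda>x. f x + g x) \<le> nrm M f + nrm M g"
proof (rule power2_le_imp_le)
  have fg: "(\<lambda>x. f x + g x) \<in> sqint M" by (intro sqint_add f g)
  have "complex_of_real ((nrm M (\<lambda>x. f x + g x))\<^sup>2) = ip M (\<lambda>x. f x + g x) (\<lambda>x. f x + g x)"
    by (simp add: ip_self)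
  also have "\<dots> = ip M f (\<lambda>x. f x + g x) + ip M g (\<lambda>x. f x + g x)"
    by (intro ip_add_left f g fg)
  also have "\<dots> = cnj (ip M f f + ip M g f) + cnj (ip M f g + ip M g g)"
    by (simp only: ip_commute[of M f "\<lambda>x. f x + g x"] ip_commute[of M g "\<lambda>x. f x + g x"] ip_add_left[OF f g f] ip_add_left[OF f g g])
  finally have "(nrm M (\<lambda>x. f x + g x))\<^sup>2 = Re (cnj (ip M f f + ip M g f) + cnj (ip M f g + ip M g g))"
    using complex_eq_iff by force
  also have "\<dots> = (nrm M f)\<^sup>2 + (nrm M g)\<^sup>2 + Re (ip M f g) + Re (ip M g f)"
    by (simp add: ip_self)
  also have "\<dots> \<le> (nrm M f)\<^sup>2 + (nrm M g)\<^sup>2 + nrm M f * nrm M g + nrm M g * nrm M f"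
    using ip_Cauchy_Schwarz[OF f g] ip_Cauchy_Schwarz[OF g f]
      complex_Re_le_cmod[of "ip M f g"] complex_Re_le_cmod[of "ip M g f"] by linarith
  also have "\<dots> = (nrm M f + nrm M g)\<^sup>2" by (simp add: power2_eq_square algebra_simps)
  finally show "(nrm M (\<lambda>x. f x + g x))\<^sup>2 \<le> (nrm M f + nrm M g)\<^sup>2" .
qed simp

lemma nrm_diff_le:
  assumes f: "f \<in> sqint M" and g: "g \<in> sqint M"
  shows "nrm M (\<lambda>x. f x - g x) \<le> nrm M f + nrm M g"
  using nrm_triangle[OF f sqint_uminus[OF g]] by (simp add: nrm_uminus)

lemma nrm_triangle_diff:
  assumes f: "f \<in> sqint M" and g: "g \<in> sqint M" and h: "h \<in> sqint M"
  shows "nrm M (\<lambda>x. f x - h x) \<le> nrm M (\<lambda>x. f x - g x) + nrm M (\<lambda>x. g x - h x)"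
  using nrm_triangle[OF sqint_diff[OF f g] sqint_diff[OF g h]] by simp

lemma nrm_le_diff:
  assumes f: "f \<in> sqint M" and g: "g \<in> sqint M"
  shows "nrm M f \<le> nrm M (\<lambda>x. f x - g x) + nrm M g"
  using nrm_triangle[OF sqint_diff[OF f g] g] by simp

lemma nrm_tendsto:
  assumes "\<And>n. f n \<in> sqint M" "g \<in> sqint M" "(\<lambda>n. nrm M (\<lambda>x. f n x - g x)) \<longlonglongrightarrow> 0"
  shows "(\<lambda>n. nrm M (f n)) \<longlonglongrightarrow> nrm M g"
proof -
  have "\<bar>nrm M (f n) - nrm M g\<bar> \<le> nrm M (\<lambda>x. f n x - g x)" for n
    using nrm_le_diff[OF assms(1,2), of n] nrm_le_diff[OF assms(2,1), of n]
    by (simp add: nrm_minus_commute[of M g])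
  then have "(\<lambda>n. nrm M (f n) - nrm M g) \<longlonglongrightarrow> 0"
    by (intro Lim_null_comparison[OF _ assms(3)]) auto
  then show ?thesis by (simp add: LIM_zero_iff)
qed

lemma ip_tendsto_left:
  assumes "\<And>n. f n \<in> sqint M" "g \<in> sqint M" "(\<lambda>n. nrm M (\<lambda>x. f n x - g x)) \<longlonglongrightarrow> 0" "h \<in> sqint M"
  shows "(\<lambda>n. ip M (f n) h) \<longlonglongrightarrow> ip M g h"
proof -
  have "cmod (ip M (f n) h - ip M g h) \<le> nrm M (\<lambda>x. f n x - g x) * nrm M h" for n
    using ip_Cauchy_Schwarz[OF sqint_diff[OF assms(1,2)] assms(4), of n] assms(1,2,4)
    by (simp add: ip_diff_left)
  then have "(\<lambda>n. ip M (f n) h - ip M g h) \<longlonglongrightarrow> 0"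
    by (intro Lim_null_comparison[OF always_eventually tendsto_mult_left_zero[OF assms(3)]] allI)
  then show ?thesis by (simp add: LIM_zero_iff)
qed

lemma nrm_eq_0_AE:
  assumes "f \<in> sqint M" "nrm M f = 0"
  shows "AE x in M. f x = 0"
proof -
  have "integral\<^sup>L M (\<lambda>x. (cmod (f x))\<^sup>2) = 0"
    using assms(2) nrm_sq[of M f] by simp
  then have "AE x in M. (cmod (f x))\<^sup>2 = 0"
    using integral_nonneg_eq_0_iff_AE[OF sqint_integrable[OF assms(1)]] by auto
  then show ?thesis by auto
qed

lemma sqint_limit_AE_unique:
  assumes "\<And>n. f n \<in> sqint M" "g \<in> sqint M" "h \<in> sqint M"
    and "(\<lambda>n. nrm M (\<lambda>x. f n x - g x)) \<longlonglongrightarrow> 0" "(\<lambda>n. nrm M (\<lambda>x. f n x - h x)) \<longlonglongrightarrow> 0"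
  shows "AE x in M. g x = h x"
proof -
  have "nrm M (\<lambda>x. g x - h x) \<le> 0"
  proof (rule LIMSEQ_le_const)
    show "(\<lambda>n. nrm M (\<lambda>x. f n x - g x) + nrm M (\<lambda>x. f n x - h x)) \<longlonglongrightarrow> 0"
      using tendsto_add[OF assms(4,5)] by simp
    show "\<exists>N. \<forall>n\<ge>N. nrm M (\<lambda>x. g x - h x) \<le> nrm M (\<lambda>x. f n x - g x) + nrm M (\<lambda>x. f n x - h x)"
      using nrm_triangle_diff[OF assms(2,1,3)] by (auto simp: nrm_minus_commute[of M g])
  qed
  then have "AE x in M. g x - h x = 0"
    by (intro nrm_eq_0_AE sqint_diff assms(2,3)) (simp add: antisym)
  then show ?thesis by simp
qed

text \<open>Convergence in mean square is $L^1$-convergence of the squared distance, so the $L^1$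
  statement about almost everywhere convergent subsequences applies.\<close>

lemma sqint_AE_subseq:
  assumes "\<And>n. f n \<in> sqint M" "g \<in> sqint M" "(\<lambda>n. nrm M (\<lambda>x. f n x - g x)) \<longlonglongrightarrow> 0"
  obtains r :: "nat \<Rightarrow> nat" where "strict_mono r" "AE x in M. (\<lambda>k. f (r k) x) \<longlonglongrightarrow> g x"
proof -
  let ?u = "\<lambda>n x. (cmod (f n x - g x))\<^sup>2"
  have "(\<lambda>n. (nrm M (\<lambda>x. f n x - g x))\<^sup>2) \<longlonglongrightarrow> 0"
    using tendsto_power[OF assms(3), of 2] by simp
  then have "(\<lambda>n. integral\<^sup>L M (\<lambda>x. norm (?u n x))) \<longlonglongrightarrow> 0"
    by (simp add: nrm_sq)
  then obtain r :: "nat \<Rightarrow> nat" where r: "strict_mono r" "AE x in M. (\<lambda>n. ?u (r n) x) \<longlonglongrightarrow> 0"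
    using tendsto_L1_AE_subseq[of M ?u] sqint_integrable[OF sqint_diff[OF assms(1,2)]] by blast
  have "(\<lambda>n. f (r n) x) \<longlonglongrightarrow> g x" if "(\<lambda>n. ?u (r n) x) \<longlonglongrightarrow> 0" for x
  proof -
    have "(\<lambda>n. sqrt (?u (r n) x)) \<longlonglongrightarrow> 0" using tendsto_real_sqrt[OF that] by simp
    then have "(\<lambda>n. f (r n) x - g x) \<longlonglongrightarrow> 0" by (simp add: tendsto_norm_zero_iff)
    then show ?thesis by (simp add: LIM_zero_iff)
  qed
  then show thesis using r by (intro that[of r]) auto
qed

lemma ennreal_term_le_suminf: "(u k :: ennreal) \<le> (\<Sum>k. u k)"
  using sum_le_suminf[OF summableI, of "{k}" u] by simp

text \<open>Riesz-Fischer. Along a subsequence whose consecutive differences have norms at most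
  $4^{-k}$, the function $\sum_k 4^k|f_{r(k+1)}-f_{r(k)}|^2$ is integrable, hence finite almost
  everywhere, which makes the differences summable there; Fatou's lemma then turns pointwise
  convergence of the subsequence into convergence in norm. The limit is literally the pointwise
  limit, so that invariance properties of all the \<open>f n\<close>, such as periodicity, carry over to it
  at every point.\<close>

lemma Riesz_Fischer:
  fixes f :: "nat \<Rightarrow> 'a \<Rightarrow> complex"
  assumes f: "\<And>n. f n \<in> sqint M"
    and cauchy: "\<And>e. e > 0 \<Longrightarrow> \<exists>N. \<forall>m\<ge>N. \<forall>n\<ge>N. nrm M (\<lambda>x. f m x - f n x) < e"
  obtains r :: "nat \<Rightarrow> nat" where "strict_mono r"
    "AE x in M. (\<lambda>k. f (r k) x) \<longlonglongrightarrow> lim (\<lambda>k. f (r k) x)"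
    "(\<lambda>x. lim (\<lambda>k. f (r k) x)) \<in> sqint M"
    "(\<lambda>n. nrm M (\<lambda>x. f n x - lim (\<lambda>k. f (r k) x))) \<longlonglongrightarrow> 0"
proof -
  have "\<exists>N. \<forall>m\<ge>N. \<forall>n\<ge>N. nrm M (\<lambda>x. f m x - f n x) < (1/4)^k" for k :: nat
    by (rule cauchy) simp
  then obtain N where N: "\<And>k m n. m \<ge> N k \<Longrightarrow> n \<ge> N k \<Longrightarrow> nrm M (\<lambda>x. f m x - f n x) < (1/4)^k"
    by metis
  define r where "r = rec_nat (N 0) (\<lambda>k x. max (Suc x) (N (Suc k)))"
  have r_Suc: "r (Suc k) = max (Suc (r k)) (N (Suc k))" for k by (simp add: r_def)
  have rN: "N k \<le> r k" for k by (cases k) (auto simp: r_def)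
  have mono: "strict_mono r" by (rule strict_monoI_Suc) (simp add: r_Suc)
  have small: "nrm M (\<lambda>x. f (r (Suc k)) x - f (r k) x) < (1/4)^k" for k
    using rN[of k] r_Suc[of k] by (intro N) auto
  note [measurable] = sqint_measurable[OF f]
  have four_pow: "((2::real)^k)\<^sup>2 = 4^k" for k
    unfolding power_mult[symmetric] mult.commute[of k 2] unfolding power_mult by simp
  let ?d = "\<lambda>k x. 4^k * (cmod (f (r (Suc k)) x - f (r k) x))\<^sup>2"
  have "(\<integral>\<^sup>+x. (\<Sum>k. ennreal (?d k x)) \<partial>M) = (\<Sum>k. \<integral>\<^sup>+x. ennreal (?d k x) \<partial>M)"
    by (rule nn_integral_suminf) measurable
  also have "\<dots> \<le> (\<Sum>k. ennreal ((1/4)^k))"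
  proof (intro suminf_le summableI)
    fix k
    have "(\<integral>\<^sup>+x. ennreal (?d k x) \<partial>M) = 4^k * (\<integral>\<^sup>+x. ennreal ((cmod (f (r (Suc k)) x - f (r k) x))\<^sup>2) \<partial>M)"
      by (subst nn_integral_cmult[symmetric]) (auto simp: ennreal_mult simp flip: ennreal_power)
    also have "\<dots> = ennreal (4^k * (nrm M (\<lambda>x. f (r (Suc k)) x - f (r k) x))\<^sup>2)"
      by (subst ennreal_nrm_sq[symmetric]) (auto intro: sqint_diff f simp: ennreal_mult simp flip: ennreal_power)
    also have "\<dots> \<le> ennreal (4^k * ((1/4)^k)\<^sup>2)"
      using small[of k] by (intro ennreal_leI mult_left_mono power_mono) auto
    also have "4^k * ((1/4)^k)\<^sup>2 = (1/4::real)^k"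
      by (simp add: power2_eq_square flip: power_mult_distrib)
    finally show "(\<integral>\<^sup>+x. ennreal (?d k x) \<partial>M) \<le> ennreal ((1/4)^k)" .
  qed
  also have "\<dots> = ennreal (\<Sum>k. (1/4)^k)"
    by (subst suminf_ennreal2) (auto intro: summable_geometric)
  also have "\<dots> < \<infinity>" by simp
  finally have "AE x in M. (\<Sum>k. ennreal (?d k x)) \<noteq> \<infinity>"
    by (intro nn_integral_PInf_AE) auto
  then have ae: "AE x in M. convergent (\<lambda>k. f (r k) x)"
  proof (rule AE_mp, intro AE_I2 impI)
    fix x assume fin: "(\<Sum>k. ennreal (?d k x)) \<noteq> \<infinity>"
    define C where "C = enn2real (\<Sum>k. ennreal (?d k x))"
    have C: "C \<ge> 0" "(\<Sum>k. ennreal (?d k x)) = ennreal C"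
      using fin unfolding C_def by (simp_all add: less_top)
    have b: "cmod (f (r (Suc k)) x - f (r k) x) \<le> sqrt C * (1/2)^k" for k
    proof -
      have "ennreal (?d k x) \<le> (\<Sum>k. ennreal (?d k x))"
        by (rule ennreal_term_le_suminf)
      then have "ennreal (?d k x) \<le> ennreal C" unfolding C(2) .
      then have "?d k x \<le> C" using C(1) ennreal_le_iff by blast
      then have "(2^k * cmod (f (r (Suc k)) x - f (r k) x))\<^sup>2 \<le> C"
        unfolding power_mult_distrib four_pow .
      then have "2^k * cmod (f (r (Suc k)) x - f (r k) x) \<le> sqrt C"
        by (intro real_le_rsqrt)
      then show ?thesis by (simp add: field_simps)
    qed
    have "summable (\<lambda>k. f (r (Suc k)) x - f (r k) x)"
      by (rule summable_comparison_test'[of "\<lambda>k. sqrt C * (1/2)^k" 0])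
         (auto intro!: summable_mult summable_geometric b)
    then have "convergent (\<lambda>n. \<Sum>k<n. f (r (Suc k)) x - f (r k) x)"
      by (simp add: summable_iff_convergent)
    then have "convergent (\<lambda>n. f (r n) x - f (r 0) x)"
      by (simp only: sum_lessThan_telescope[of "\<lambda>k. f (r k) x"])
    then have "convergent (\<lambda>n. (f (r n) x - f (r 0) x) + f (r 0) x)"
      by (intro convergent_add convergent_const)
    then show "convergent (\<lambda>k. f (r k) x)" by simp
  qed
  define h where "h = (\<lambda>x. lim (\<lambda>k. f (r k) x))"
  have ae_h: "AE x in M. (\<lambda>k. f (r k) x) \<longlonglongrightarrow> h x"
    using ae by (rule AE_mp) (auto simp: h_def convergent_LIMSEQ_iff)
  have [measurable]: "h \<in> borel_measurable M"
    unfolding h_def by (intro borel_measurable_lim_metric) measurable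
  have close: "(\<integral>\<^sup>+x. ennreal ((cmod (f n x - h x))\<^sup>2) \<partial>M) \<le> ennreal (e\<^sup>2)"
    if e: "e > 0" and n: "\<And>m. m \<ge> K \<Longrightarrow> nrm M (\<lambda>x. f n x - f m x) < e" for n e K
  proof -
    have "(\<integral>\<^sup>+x. ennreal ((cmod (f n x - h x))\<^sup>2) \<partial>M)
        = (\<integral>\<^sup>+x. liminf (\<lambda>k. ennreal ((cmod (f n x - f (r k) x))\<^sup>2)) \<partial>M)"
    proof (rule nn_integral_cong_AE, rule AE_mp[OF ae_h], intro AE_I2 impI)
      fix x assume "(\<lambda>k. f (r k) x) \<longlonglongrightarrow> h x"
      then have lm: "(\<lambda>k. ennreal ((cmod (f n x - f (r k) x))\<^sup>2)) \<longlonglongrightarrow> ennreal ((cmod (f n x - h x))\<^sup>2)"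
        by (intro tendsto_intros tendsto_ennrealI)
      show "ennreal ((cmod (f n x - h x))\<^sup>2) = liminf (\<lambda>k. ennreal ((cmod (f n x - f (r k) x))\<^sup>2))"
        by (rule lim_imp_Liminf[OF trivial_limit_sequentially lm, symmetric])
    qed
    also have "\<dots> \<le> liminf (\<lambda>k. \<integral>\<^sup>+x. ennreal ((cmod (f n x - f (r k) x))\<^sup>2) \<partial>M)"
      by (rule nn_integral_liminf) measurable
    also have "\<dots> \<le> liminf (\<lambda>k. ennreal (e\<^sup>2))"
    proof (rule Liminf_mono, rule eventually_sequentiallyI[of K])
      fix k assume "k \<ge> K"
      then have "r k \<ge> K" using seq_suble[OF mono, of k] by simp
      then have "nrm M (\<lambda>x. f n x - f (r k) x) < e" by (rule n)
      then show "(\<integral>\<^sup>+x. ennreal ((cmod (f n x - f (r k) x))\<^sup>2) \<partial>M) \<le> ennreal (e\<^sup>2)"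
        by (subst ennreal_nrm_sq[symmetric]) (auto intro!: sqint_diff f ennreal_leI power_mono)
    qed
    finally show ?thesis by (simp add: Liminf_const)
  qed
  have h: "h \<in> sqint M"
  proof -
    obtain K where K: "\<And>m n. m \<ge> K \<Longrightarrow> n \<ge> K \<Longrightarrow> nrm M (\<lambda>x. f m x - f n x) < 1"
      using cauchy[of 1] by auto
    have "(\<integral>\<^sup>+x. ennreal ((cmod (f K x - h x))\<^sup>2) \<partial>M) \<le> ennreal (1\<^sup>2)"
      by (rule close[of 1 K]) (auto intro: K)
    then have "(\<lambda>x. f K x - h x) \<in> sqint M"
      by (intro sqintI_nn) (auto intro: le_less_trans)
    from sqint_diff[OF f[of K] this] show ?thesis by simp
  qed
  have "(\<lambda>n. nrm M (\<lambda>x. f n x - h x)) \<longlonglongrightarrow> 0"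
  proof (rule LIMSEQ_I)
    fix e :: real assume e: "e > 0"
    then obtain K where K: "\<And>m n. m \<ge> K \<Longrightarrow> n \<ge> K \<Longrightarrow> nrm M (\<lambda>x. f m x - f n x) < e/2"
      using cauchy[of "e/2"] by auto
    have "nrm M (\<lambda>x. f n x - h x) \<le> e/2" if "n \<ge> K" for n
    proof (rule power2_le_imp_le)
      have "ennreal ((nrm M (\<lambda>x. f n x - h x))\<^sup>2) \<le> ennreal ((e/2)\<^sup>2)"
        by (subst ennreal_nrm_sq) (use e that in \<open>auto intro!: sqint_diff f h close K simp del: ennreal_le_iff\<close>)
      then show "(nrm M (\<lambda>x. f n x - h x))\<^sup>2 \<le> (e/2)\<^sup>2" by simp
    qed (use e in simp)
    then show "\<exists>no. \<forall>n\<ge>no. norm (nrm M (\<lambda>x. f n x - h x) - 0) < e"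
      using e by (intro exI[of _ K]) force
  qed
  then show thesis using that[OF mono] ae_h h unfolding h_def by blast
qed

section \<open>Biorthogonal Riesz bases\<close>

definition riesz_bounds :: "'a measure \<Rightarrow> 'i set \<Rightarrow> ('i \<Rightarrow> 'a \<Rightarrow> complex) \<Rightarrow> real \<Rightarrow> real \<Rightarrow> bool" where
  "riesz_bounds M I h C3 C4 \<longleftrightarrow> (\<forall>F c. finite F \<longrightarrow> F \<subseteq> I \<longrightarrow>
    C3 * (\<Sum>i\<in>F. (cmod (c i))\<^sup>2) \<le> (nrm M (\<lambda>x. \<Sum>i\<in>F. c i * h i x))\<^sup>2 \<and>
    (nrm M (\<lambda>x. \<Sum>i\<in>F. c i * h i x))\<^sup>2 \<le> C4 * (\<Sum>i\<in>F. (cmod (c i))\<^sup>2))"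

definition riesz_basis_on ::
  "'a measure \<Rightarrow> 'i set \<Rightarrow> ('i \<Rightarrow> 'a \<Rightarrow> complex) \<Rightarrow> bool" where
  "riesz_basis_on M I h \<longleftrightarrow>
    (\<forall>i\<in>I. h i \<in> sqint M) \<and>
    (\<forall>f\<in>sqint M. \<forall>\<epsilon>>0. \<exists>F c. finite F \<and> F \<subseteq> I \<and>
       nrm M (\<lambda>x. f x - (\<Sum>i\<in>F. c i * h i x)) < \<epsilon>) \<and>
    (\<exists>C3>0. \<exists>C4>0. riesz_bounds M I h C3 C4)"

text \<open>Countable index sets are exhausted by a sequence, so that unordered expansions become
  sequences to which dominated convergence and subsequence arguments apply.\<close>

lemma exhaustion:
  assumes "countable I"
  obtains F :: "nat \<Rightarrow> 'i set" where "\<And>n. finite (F n)" "\<And>n. F n \<subseteq> I" "mono F"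
    "filterlim F (finite_subsets_at_top I) sequentially"
proof -
  define F where "F n = {x \<in> I. to_nat_on I x < n}" for n
  have fin: "finite (F n)" for n
  proof (rule finite_imageD)
    show "finite (to_nat_on I ` F n)" by (rule finite_subset[of _ "{..<n}"]) (auto simp: F_def)
    show "inj_on (to_nat_on I) (F n)"
      using inj_on_to_nat_on[OF assms] by (rule inj_on_subset) (auto simp: F_def)
  qed
  have "filterlim F (finite_subsets_at_top I) sequentially"
    unfolding filterlim_finite_subsets_at_top
  proof (intro allI impI)
    fix X assume X: "finite X \<and> X \<subseteq> I"
    define N where "N = Suc (Max (insert 0 (to_nat_on I ` X)))"
    have "X \<subseteq> F n" if "n \<ge> N" for n
    proof
      fix x assume "x \<in> X"
      then have "to_nat_on I x \<le> Max (insert 0 (to_nat_on I ` X))" using X by (intro Max_ge) auto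
      then have "to_nat_on I x < n" using that unfolding N_def by linarith
      then show "x \<in> F n" using \<open>x \<in> X\<close> X by (auto simp: F_def)
    qed
    then show "\<forall>\<^sub>F n in sequentially. finite (F n) \<and> X \<subseteq> F n \<and> F n \<subseteq> I"
      by (intro eventually_sequentiallyI[of N]) (auto simp: fin, auto simp: F_def)
  qed
  then show thesis using fin by (intro that[of F]) (auto simp: F_def mono_def)
qed

locale biorthogonal_riesz =
  fixes M :: "'a measure" and I :: "'i set" and h h' :: "'i \<Rightarrow> 'a \<Rightarrow> complex"
  assumes basis: "riesz_basis_on M I h"
    and dual: "\<And>i. i \<in> I \<Longrightarrow> h' i \<in> sqint M"
    and biorth: "\<And>i j. i \<in> I \<Longrightarrow> j \<in> I \<Longrightarrow> ip M (h i) (h' j) = of_bool (i = j)"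
begin

lemma elem: "i \<in> I \<Longrightarrow> h i \<in> sqint M"
  using basis by (auto simp: riesz_basis_on_def)

lemma lower_bound:
  "\<exists>C>0. \<forall>F c. finite F \<longrightarrow> F \<subseteq> I \<longrightarrow>
    C * (\<Sum>i\<in>F. (cmod (c i))\<^sup>2) \<le> (nrm M (\<lambda>x. \<Sum>i\<in>F. c i * h i x))\<^sup>2"
  using basis unfolding riesz_basis_on_def riesz_bounds_def
  by (elim conjE exE) (rule exI, rule conjI, assumption, simp)

lemma upper_bound:
  "\<exists>C>0. \<forall>F c. finite F \<longrightarrow> F \<subseteq> I \<longrightarrow>
    (nrm M (\<lambda>x. \<Sum>i\<in>F. c i * h i x))\<^sup>2 \<le> C * (\<Sum>i\<in>F. (cmod (c i))\<^sup>2)"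
  using basis unfolding riesz_basis_on_def riesz_bounds_def
  by (elim conjE exE) (rule exI, rule conjI, assumption, simp)

lemma dense:
  "f \<in> sqint M \<Longrightarrow> \<epsilon> > 0 \<Longrightarrow>
    \<exists>F c. finite F \<and> F \<subseteq> I \<and> nrm M (\<lambda>x. f x - (\<Sum>i\<in>F. c i * h i x)) < \<epsilon>"
  using basis unfolding riesz_basis_on_def by (elim conjE) simp

definition partial :: "'i set \<Rightarrow> ('a \<Rightarrow> complex) \<Rightarrow> 'a \<Rightarrow> complex" where
  "partial F f = (\<lambda>x. \<Sum>i\<in>F. ip M f (h' i) * h i x)"

lemma partial_sqint: "F \<subseteq> I \<Longrightarrow> partial F f \<in> sqint M"
  unfolding partial_def by (intro sqint_lincomb elem) auto

lemma coeff_lincomb: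
  assumes "finite G" "G \<subseteq> I" "i \<in> I"
  shows "ip M (\<lambda>x. \<Sum>j\<in>G. b j * h j x) (h' i) = (if i \<in> G then b i else 0)"
proof -
  have "ip M (\<lambda>x. \<Sum>j\<in>G. b j * h j x) (h' i) = (\<Sum>j\<in>G. b j * ip M (h j) (h' i))"
    using assms by (intro ip_lincomb_left dual elem) auto
  also have "\<dots> = (\<Sum>j\<in>G. if j = i then b j else 0)"
    using assms by (intro sum.cong) (auto simp: biorth subset_iff)
  finally show ?thesis using assms by (simp add: sum.delta)
qed

lemma partial_lincomb:
  assumes "finite F" "F \<subseteq> I" "G \<subseteq> F"
  shows "partial F (\<lambda>x. \<Sum>j\<in>G. b j * h j x) = (\<lambda>x. \<Sum>j\<in>G. b j * h j x)"
proof
  fix x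
  have "finite G" "G \<subseteq> I" using assms finite_subset by auto
  then have "partial F (\<lambda>x. \<Sum>j\<in>G. b j * h j x) x = (\<Sum>i\<in>F. (if i \<in> G then b i else 0) * h i x)"
    unfolding partial_def using assms by (intro sum.cong) (auto simp: coeff_lincomb subset_iff)
  also have "\<dots> = (\<Sum>i\<in>F. if i \<in> G then b i * h i x else 0)"
    by (intro sum.cong) auto
  also have "\<dots> = (\<Sum>i\<in>F \<inter> G. b i * h i x)"
    using assms by (simp add: sum.inter_restrict)
  also have "F \<inter> G = G" using assms by auto
  finally show "partial F (\<lambda>x. \<Sum>j\<in>G. b j * h j x) x = (\<Sum>j\<in>G. b j * h j x)" .
qed

text \<open>On finite linear combinations this is the lower Riesz bound; both sides are continuous
  in \<open>f\<close>, and such combinations are dense.\<close>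

lemma coeff_bound:
  obtains C where "C > 0"
    "\<And>f F. f \<in> sqint M \<Longrightarrow> finite F \<Longrightarrow> F \<subseteq> I \<Longrightarrow>
       (\<Sum>i\<in>F. (cmod (ip M f (h' i)))\<^sup>2) \<le> C * (nrm M f)\<^sup>2"
proof -
  obtain C3 where C3: "C3 > 0" and low: "\<And>F c. finite F \<Longrightarrow> F \<subseteq> I \<Longrightarrow>
       C3 * (\<Sum>i\<in>F. (cmod (c i))\<^sup>2) \<le> (nrm M (\<lambda>x. \<Sum>i\<in>F. c i * h i x))\<^sup>2"
    using lower_bound by (elim exE conjE) simp
  have "C3 * (\<Sum>i\<in>F. (cmod (ip M f (h' i)))\<^sup>2) \<le> (nrm M f)\<^sup>2"
    if f: "f \<in> sqint M" and F: "finite F" "F \<subseteq> I" for f F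
  proof -
    define P where "P n G b \<longleftrightarrow> finite G \<and> G \<subseteq> I \<and>
      nrm M (\<lambda>x. f x - (\<Sum>i\<in>G. b i * h i x)) < inverse (real (Suc n))" for n G b
    have "\<forall>n. \<exists>G b. P n G b"
      unfolding P_def by (intro allI dense f) simp
    from choice[OF this] obtain G where "\<forall>n. \<exists>b. P n (G n) b" by blast
    from choice[OF this] obtain b where "\<forall>n. P n (G n) (b n)" by blast
    then have G: "\<And>n. finite (G n)" "\<And>n. G n \<subseteq> I"
      and lt: "\<And>n. nrm M (\<lambda>x. f x - (\<Sum>i\<in>G n. b n i * h i x)) < inverse (real (Suc n))"
      by (simp_all add: P_def)
    define g where "g n = (\<lambda>x. \<Sum>i\<in>G n. b n i * h i x)" for n
    have g: "g n \<in> sqint M" for n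
      unfolding g_def using G by (intro sqint_lincomb elem) auto
    have conv: "(\<lambda>n. nrm M (\<lambda>x. g n x - f x)) \<longlonglongrightarrow> 0"
    proof (rule Lim_null_comparison[OF always_eventually LIMSEQ_inverse_real_of_nat], rule allI)
      fix n show "norm (nrm M (\<lambda>x. g n x - f x)) \<le> inverse (real (Suc n))"
        using lt[of n] by (simp add: g_def nrm_minus_commute[of M f])
    qed
    have bound: "C3 * (\<Sum>i\<in>F. (cmod (ip M (g n) (h' i)))\<^sup>2) \<le> (nrm M (g n))\<^sup>2" for n
    proof -
      have "(\<Sum>i\<in>F. (cmod (ip M (g n) (h' i)))\<^sup>2) = (\<Sum>i\<in>F. if i \<in> G n then (cmod (b n i))\<^sup>2 else 0)"
        using F G by (intro sum.cong refl) (auto simp: g_def coeff_lincomb subset_iff)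
      also have "\<dots> = (\<Sum>i\<in>F \<inter> G n. (cmod (b n i))\<^sup>2)"
        using F by (simp add: sum.inter_restrict)
      also have "\<dots> \<le> (\<Sum>i\<in>G n. (cmod (b n i))\<^sup>2)"
        using G by (intro sum_mono2) auto
      finally have "C3 * (\<Sum>i\<in>F. (cmod (ip M (g n) (h' i)))\<^sup>2) \<le> C3 * (\<Sum>i\<in>G n. (cmod (b n i))\<^sup>2)"
        using C3 by simp
      also have "\<dots> \<le> (nrm M (g n))\<^sup>2"
        unfolding g_def using G by (intro low) auto
      finally show ?thesis .
    qed
    show ?thesis
    proof (rule LIMSEQ_le)
      show "(\<lambda>n. C3 * (\<Sum>i\<in>F. (cmod (ip M (g n) (h' i)))\<^sup>2)) \<longlonglongrightarrow> C3 * (\<Sum>i\<in>F. (cmod (ip M f (h' i)))\<^sup>2)"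
        using F by (intro tendsto_intros ip_tendsto_left g f conv dual) auto
      show "(\<lambda>n. (nrm M (g n))\<^sup>2) \<longlonglongrightarrow> (nrm M f)\<^sup>2"
        by (intro tendsto_intros nrm_tendsto g f conv)
    qed (use bound in auto)
  qed
  then show thesis
    using C3 by (intro that[of "1 / C3"]) (auto simp: field_simps)
qed

text \<open>The coefficient bound for \<open>f\<close> followed by the upper Riesz bound for the partial sum.\<close>

lemma partial_bound:
  obtains C where "C > 0"
    "\<And>f F. f \<in> sqint M \<Longrightarrow> finite F \<Longrightarrow> F \<subseteq> I \<Longrightarrow> nrm M (partial F f) \<le> C * nrm M f"
proof -
  obtain C where C: "C > 0" "\<And>f F. f \<in> sqint M \<Longrightarrow> finite F \<Longrightarrow> F \<subseteq> I \<Longrightarrow>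
       (\<Sum>i\<in>F. (cmod (ip M f (h' i)))\<^sup>2) \<le> C * (nrm M f)\<^sup>2"
    using coeff_bound by blast
  obtain C4 where C4: "C4 > 0" and up: "\<And>F c. finite F \<Longrightarrow> F \<subseteq> I \<Longrightarrow>
       (nrm M (\<lambda>x. \<Sum>i\<in>F. c i * h i x))\<^sup>2 \<le> C4 * (\<Sum>i\<in>F. (cmod (c i))\<^sup>2)"
    using upper_bound by (elim exE conjE) simp
  have "nrm M (partial F f) \<le> sqrt (C4 * C) * nrm M f"
    if f: "f \<in> sqint M" and F: "finite F" "F \<subseteq> I" for f F
  proof (rule power2_le_imp_le)
    have "(nrm M (partial F f))\<^sup>2 \<le> C4 * (\<Sum>i\<in>F. (cmod (ip M f (h' i)))\<^sup>2)"
      unfolding partial_def by (rule up[OF F])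
    also have "\<dots> \<le> C4 * (C * (nrm M f)\<^sup>2)"
      using C(2)[OF f F] C4 by simp
    finally show "(nrm M (partial F f))\<^sup>2 \<le> (sqrt (C4 * C) * nrm M f)\<^sup>2"
      using C4 C(1) by (simp add: power_mult_distrib)
  qed (use C C4 in simp)
  then show thesis using C C4 by (intro that[of "sqrt (C4 * C)"]) auto
qed

text \<open>The partial sums are uniformly bounded operators that fix finite linear combinations with
  smaller support, and these are dense.\<close>

lemma expansion:
  assumes f: "f \<in> sqint M"
  shows "((\<lambda>F. nrm M (\<lambda>x. partial F f x - f x)) \<longlongrightarrow> 0) (finite_subsets_at_top I)"
proof (rule tendstoI)
  fix e :: real assume e: "e > 0"
  obtain C where C: "C > 0"
    "\<And>f F. f \<in> sqint M \<Longrightarrow> finite F \<Longrightarrow> F \<subseteq> I \<Longrightarrow> nrm M (partial F f) \<le> C * nrm M f"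
    using partial_bound by blast
  have "e / (C + 1) > 0" using e C by simp
  then obtain G b where G: "finite G" "G \<subseteq> I"
    and lt: "nrm M (\<lambda>x. f x - (\<Sum>i\<in>G. b i * h i x)) < e / (C + 1)"
    using dense[OF f] by meson
  define g where "g = (\<lambda>x. \<Sum>i\<in>G. b i * h i x)"
  have g: "g \<in> sqint M" unfolding g_def using G by (intro sqint_lincomb elem) auto
  have "nrm M (\<lambda>x. partial F f x - f x) < e" if F: "finite F" "G \<subseteq> F" "F \<subseteq> I" for F
  proof -
    have fg: "(\<lambda>x. f x - g x) \<in> sqint M" by (intro sqint_diff f g)
    have "partial F (\<lambda>x. f x - g x) x = partial F f x - g x" for x
    proof -
      have "partial F (\<lambda>x. f x - g x) x = partial F f x - partial F g x"
        unfolding partial_def sum_subtractf[symmetric] using F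
        by (intro sum.cong) (auto simp: ip_diff_left[OF f g dual] left_diff_distrib subset_iff)
      also have "partial F g = g"
        unfolding g_def by (rule partial_lincomb[OF F(1,3,2)])
      finally show ?thesis .
    qed
    then have "nrm M (\<lambda>x. partial F f x - f x) = nrm M (\<lambda>x. partial F (\<lambda>x. f x - g x) x - (f x - g x))"
      by simp
    also have "\<dots> \<le> nrm M (partial F (\<lambda>x. f x - g x)) + nrm M (\<lambda>x. f x - g x)"
      by (intro nrm_diff_le partial_sqint fg F)
    also have "\<dots> \<le> C * nrm M (\<lambda>x. f x - g x) + nrm M (\<lambda>x. f x - g x)"
      using C(2)[OF fg F(1,3)] by simp
    also have "\<dots> = (C + 1) * nrm M (\<lambda>x. f x - g x)" by (simp add: algebra_simps)
    also have "\<dots> < (C + 1) * (e / (C + 1))"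
      using lt C(1) unfolding g_def by (intro mult_strict_left_mono) auto
    also have "\<dots> = e" using C(1) by simp
    finally show ?thesis .
  qed
  then show "\<forall>\<^sub>F F in finite_subsets_at_top I. dist (nrm M (\<lambda>x. partial F f x - f x)) 0 < e"
    unfolding eventually_finite_subsets_at_top using G by (intro exI[of _ G]) auto
qed

lemma expansion_seq:
  assumes "f \<in> sqint M" "filterlim F (finite_subsets_at_top I) sequentially"
  shows "(\<lambda>n. nrm M (\<lambda>x. partial (F n) f x - f x)) \<longlonglongrightarrow> 0"
  using filterlim_compose[OF expansion[OF assms(1)] assms(2)] .

text \<open>Expand \<open>f\<close> and pair with \<open>g\<close>: the inner product is continuous by the Cauchy-Schwarz
  inequality.\<close>

lemma parseval:
  assumes f: "f \<in> sqint M" and g: "g \<in> sqint M"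
  shows "((\<lambda>i. ip M f (h' i) * ip M (h i) g) has_sum ip M f g) I"
  unfolding has_sum_def
proof (rule Lim_transform2[where f="\<lambda>_. ip M f g"])
  have bound: "cmod (sum (\<lambda>i. ip M f (h' i) * ip M (h i) g) F - ip M f g) \<le> nrm M (\<lambda>x. partial F f x - f x) * nrm M g"
    if "finite F" "F \<subseteq> I" for F
  proof -
    have "sum (\<lambda>i. ip M f (h' i) * ip M (h i) g) F = ip M (partial F f) g"
      unfolding partial_def using that by (subst ip_lincomb_left) (auto intro: elem g)
    then show ?thesis
      using ip_Cauchy_Schwarz[OF sqint_diff[OF partial_sqint[OF that(2)] f] g]
      by (simp add: ip_diff_left[OF partial_sqint[OF that(2)] f g])
  qed
  show "((\<lambda>F. ip M f g - sum (\<lambda>i. ip M f (h' i) * ip M (h i) g) F) \<longlongrightarrow> 0) (finite_subsets_at_top I)"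
  proof (rule Lim_null_comparison)
    show "\<forall>\<^sub>F F in finite_subsets_at_top I. norm (ip M f g - sum (\<lambda>i. ip M f (h' i) * ip M (h i) g) F)
        \<le> nrm M (\<lambda>x. partial F f x - f x) * nrm M g"
      using bound by (intro eventually_finite_subsets_at_top_weakI) (simp add: norm_minus_commute)
    show "((\<lambda>F. nrm M (\<lambda>x. partial F f x - f x) * nrm M g) \<longlongrightarrow> 0) (finite_subsets_at_top I)"
      by (rule tendsto_mult_left_zero[OF expansion[OF f]])
  qed
qed simp

end

locale orthonormal_family =
  fixes M :: "'a measure" and I :: "'i set" and e :: "'i \<Rightarrow> 'a \<Rightarrow> complex"
  assumes e: "\<And>i. i \<in> I \<Longrightarrow> e i \<in> sqint M"
    and on: "\<And>i j. i \<in> I \<Longrightarrow> j \<in> I \<Longrightarrow> ip M (e i) (e j) = of_bool (i = j)"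
begin

lemma ip_right:
  assumes "F \<subseteq> I" "f \<in> sqint M"
  shows "ip M f (\<lambda>x. \<Sum>i\<in>F. c i * e i x) = (\<Sum>i\<in>F. cnj (c i) * ip M f (e i))"
proof -
  have "ip M (\<lambda>x. \<Sum>i\<in>F. c i * e i x) f = (\<Sum>i\<in>F. c i * ip M (e i) f)"
    using assms by (intro ip_lincomb_left) (auto intro: e)
  then have "cnj (ip M (\<lambda>x. \<Sum>i\<in>F. c i * e i x) f) = (\<Sum>i\<in>F. cnj (c i) * cnj (ip M (e i) f))"
    by simp
  then show ?thesis
    by (simp add: ip_commute[of M f, symmetric])
qed

lemma coeff:
  assumes "finite F" "F \<subseteq> I" "i \<in> I"
  shows "ip M (\<lambda>x. \<Sum>j\<in>F. c j * e j x) (e i) = (if i \<in> F then c i else 0)"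
proof -
  have "ip M (\<lambda>x. \<Sum>j\<in>F. c j * e j x) (e i) = (\<Sum>j\<in>F. c j * ip M (e j) (e i))"
    using assms by (intro ip_lincomb_left e) auto
  also have "\<dots> = (\<Sum>j\<in>F. if j = i then c j else 0)"
    using assms by (intro sum.cong) (auto simp: on subset_iff)
  finally show ?thesis using assms by (simp add: sum.delta)
qed

lemma pythagoras:
  assumes F: "finite F" "F \<subseteq> I"
  shows "(nrm M (\<lambda>x. \<Sum>i\<in>F. c i * e i x))\<^sup>2 = (\<Sum>i\<in>F. (cmod (c i))\<^sup>2)"
proof -
  have "complex_of_real ((nrm M (\<lambda>x. \<Sum>i\<in>F. c i * e i x))\<^sup>2)
      = (\<Sum>i\<in>F. cnj (c i) * ip M (\<lambda>x. \<Sum>i\<in>F. c i * e i x) (e i))"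
    unfolding ip_self[symmetric] using F by (intro ip_right sqint_lincomb e) auto
  also have "\<dots> = (\<Sum>i\<in>F. cnj (c i) * c i)"
    using F by (intro sum.cong) (auto simp: coeff subset_iff)
  also have "\<dots> = complex_of_real (\<Sum>i\<in>F. (cmod (c i))\<^sup>2)"
    by (simp add: mult.commute[of "cnj _"] complex_norm_square[symmetric])
  finally show ?thesis using of_real_eq_iff by blast
qed

lemma bessel:
  assumes f: "f \<in> sqint M" and F: "finite F" "F \<subseteq> I"
  shows "(\<Sum>i\<in>F. (cmod (ip M f (e i)))\<^sup>2) \<le> (nrm M f)\<^sup>2"
proof -
  let ?p = "\<lambda>x. \<Sum>i\<in>F. ip M f (e i) * e i x" and ?S = "\<Sum>i\<in>F. (cmod (ip M f (e i)))\<^sup>2"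
  have "?p \<in> sqint M" using F by (intro sqint_lincomb e) auto
  then have "cmod (ip M f ?p) \<le> nrm M f * nrm M ?p" by (intro ip_Cauchy_Schwarz f)
  moreover have "ip M f ?p = complex_of_real ?S"
    using ip_right[OF F(2) f] by (simp add: mult.commute[of "cnj _"] complex_norm_square[symmetric])
  moreover have "cmod (complex_of_real ?S) = ?S"
    by (simp only: norm_of_real) (simp add: sum_nonneg)
  ultimately have "(nrm M ?p)\<^sup>2 \<le> nrm M f * nrm M ?p"
    using pythagoras[OF F] by simp
  then have "nrm M ?p \<le> nrm M f"
    using mult_right_le_imp_le[of "nrm M ?p" "nrm M ?p" "nrm M f"]
    by (cases "nrm M ?p = 0") (simp_all add: power2_eq_square less_le)
  then show ?thesis using power_mono[of "nrm M ?p" "nrm M f" 2] unfolding pythagoras[OF F] by simp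
qed

text \<open>The squared distance of two partial sums is a difference of partial sums of a bounded
  increasing sequence of real numbers.\<close>

lemma series_Cauchy:
  assumes F: "\<And>n. finite (F n)" "\<And>n. F n \<subseteq> I" "mono F"
    and bound: "\<And>n::nat. (\<Sum>i\<in>F n. (cmod (c i))\<^sup>2) \<le> B" and d: "d > 0"
  shows "\<exists>N. \<forall>m\<ge>N. \<forall>n\<ge>N. nrm M (\<lambda>x. (\<Sum>i\<in>F m. c i * e i x) - (\<Sum>i\<in>F n. c i * e i x)) < d"
proof -
  define S where "S n = (\<lambda>x. \<Sum>i\<in>F n. c i * e i x)" for n
  define a where "a n = (\<Sum>i\<in>F n. (cmod (c i))\<^sup>2)" for n
  have "incseq a"
    unfolding a_def incseq_def using F by (intro allI impI sum_mono2) (simp_all add: mono_def)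
  then have "convergent a"
    using bound
    by (intro Bseq_monoseq_convergent BseqI'[where K=B] incseq_imp_monoseq)
       (auto simp: a_def sum_nonneg)
  then have cau: "Cauchy a" by (simp add: Cauchy_convergent_iff)
  have diff: "(nrm M (\<lambda>x. S m x - S n x))\<^sup>2 = a m - a n" if "n \<le> m" for m n
  proof -
    have sub: "F n \<subseteq> F m" using F(3) that by (simp add: mono_def)
    have "S m x - S n x = (\<Sum>i\<in>F m - F n. c i * e i x)" for x
      unfolding S_def using sub F(1) by (simp add: sum_diff)
    then have "(nrm M (\<lambda>x. S m x - S n x))\<^sup>2 = (\<Sum>i\<in>F m - F n. (cmod (c i))\<^sup>2)"
      using F by (simp only:) (intro pythagoras, auto)
    also have "\<dots> = a m - a n" unfolding a_def using sub F(1) by (simp add: sum_diff)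
    finally show ?thesis .
  qed
  have diff': "(nrm M (\<lambda>x. S m x - S n x))\<^sup>2 = \<bar>a m - a n\<bar>" for m n
  proof (cases "n \<le> m")
    case True
    then show ?thesis using diff[OF True] by (metis abs_of_nonneg zero_le_power2)
  next
    case False
    then have "(nrm M (\<lambda>x. S n x - S m x))\<^sup>2 = a n - a m" by (intro diff) simp
    then show ?thesis
      by (metis abs_minus_commute abs_of_nonneg zero_le_power2 nrm_minus_commute)
  qed
  obtain N where N: "\<And>m n. m \<ge> N \<Longrightarrow> n \<ge> N \<Longrightarrow> dist (a m) (a n) < d\<^sup>2"
    using cau d unfolding Cauchy_def by (meson zero_less_power)
  have "nrm M (\<lambda>x. S m x - S n x) < d" if "m \<ge> N" "n \<ge> N" for m n
    using N[OF that] d by (intro power2_less_imp_less[of _ d]) (auto simp: diff' dist_real_def)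
  then show ?thesis unfolding S_def by blast
qed

end

text \<open>By Bessel's inequality the partial sums of the expansion of \<open>f\<close> form a Cauchy sequence.
  The difference of \<open>f\<close> and their limit is orthogonal to the system, hence zero.\<close>

lemma (in orthonormal_family) total_imp_biorthogonal_riesz:
  assumes cI: "countable I"
    and total: "\<And>f. f \<in> sqint M \<Longrightarrow> (\<And>i. i \<in> I \<Longrightarrow> ip M f (e i) = 0) \<Longrightarrow> AE x in M. f x = 0"
  shows "biorthogonal_riesz M I e e"
proof -
  obtain F :: "nat \<Rightarrow> 'i set" where F: "\<And>n. finite (F n)" "\<And>n. F n \<subseteq> I" "mono F"
    and lim: "filterlim F (finite_subsets_at_top I) sequentially"
    using exhaustion[OF cI] by blast
  have dense: "\<exists>F c. finite F \<and> F \<subseteq> I \<and> nrm M (\<lambda>x. f x - (\<Sum>i\<in>F. c i * e i x)) < \<epsilon>"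
    if f: "f \<in> sqint M" and \<epsilon>: "\<epsilon> > 0" for f \<epsilon>
  proof -
    define S where "S n = (\<lambda>x. \<Sum>i\<in>F n. ip M f (e i) * e i x)" for n
    have S: "S n \<in> sqint M" for n unfolding S_def using F by (intro sqint_lincomb e) auto
    have "\<exists>N. \<forall>m\<ge>N. \<forall>n\<ge>N. nrm M (\<lambda>x. S m x - S n x) < d" if "d > 0" for d
      unfolding S_def by (rule series_Cauchy[OF F bessel[OF f F(1,2)] that])
    from Riesz_Fischer[of S M, OF S this] obtain g
      where g: "g \<in> sqint M" "(\<lambda>n. nrm M (\<lambda>x. S n x - g x)) \<longlonglongrightarrow> 0" by blast
    have "ip M g (e i) = ip M f (e i)" if i: "i \<in> I" for i
    proof (rule LIMSEQ_unique)
      show "(\<lambda>n. ip M (S n) (e i)) \<longlonglongrightarrow> ip M g (e i)"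
        by (intro ip_tendsto_left S g e i)
      have "\<forall>\<^sub>F n in sequentially. {i} \<subseteq> F n"
        using lim i unfolding filterlim_finite_subsets_at_top by (auto elim!: allE[of _ "{i}"] eventually_mono)
      then have "\<forall>\<^sub>F n in sequentially. ip M (S n) (e i) = ip M f (e i)"
        by (rule eventually_mono) (simp add: S_def coeff F i)
      then show "(\<lambda>n. ip M (S n) (e i)) \<longlonglongrightarrow> ip M f (e i)" by (rule tendsto_eventually)
    qed
    then have "AE x in M. f x - g x = 0"
      by (intro total sqint_diff f g) (simp add: ip_diff_left[OF f g(1) e])
    then have eq: "nrm M (\<lambda>x. f x - S n x) = nrm M (\<lambda>x. S n x - g x)" for n
      unfolding nrm_minus_commute[of M f]
      by (intro nrm_cong_AE sqint_measurable sqint_diff f g S) auto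
    have "\<exists>n. nrm M (\<lambda>x. S n x - g x) < \<epsilon>"
      by (rule eventually_happens'[OF sequentially_bot order_tendstoD(2)[OF g(2) \<epsilon>]])
    then obtain n where "nrm M (\<lambda>x. f x - S n x) < \<epsilon>"
      by (elim exE) (rule that, simp only: eq)
    then show ?thesis unfolding S_def using F(1,2) by (intro exI conjI)
  qed
  have "riesz_basis_on M I e"
    unfolding riesz_basis_on_def riesz_bounds_def using e dense pythagoras by (auto intro!: exI[of _ "1::real"])
  then show ?thesis using e on by unfold_locales
qed

section \<open>Affine changes of variables\<close>

lemma
  fixes U :: "real^'d^'d"
  assumes "invertible U"
  shows matrix_inv_right: "U ** matrix_inv U = Finite_Cartesian_Product.mat 1"
    and matrix_inv_left: "matrix_inv U ** U = Finite_Cartesian_Product.mat 1"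
  using someI_ex[OF assms[unfolded invertible_def]] by (simp_all add: matrix_inv_def)

lemma matrix_inv_unique:
  fixes U :: "real^'d^'d"
  assumes "U ** V = Finite_Cartesian_Product.mat 1" "V ** U = Finite_Cartesian_Product.mat 1"
  shows "matrix_inv U = V"
proof -
  have "invertible U" using assms unfolding invertible_def by blast
  from matrix_inv_left[OF this] have "matrix_inv U ** U ** V = V" by simp
  then show ?thesis by (simp add: matrix_mul_assoc[symmetric] assms(1))
qed

lemma det_matrix_inv:
  fixes U :: "real^'d^'d"
  assumes "invertible U"
  shows "det (matrix_inv U) = inverse (det U)"
proof -
  have "det (U ** matrix_inv U) = 1" by (simp add: matrix_inv_right[OF assms] det_I)
  then have "det U * det (matrix_inv U) = 1" by (simp add: det_mul)
  then show ?thesis by (metis inverse_unique)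
qed

lemma matrix_inv_mult_vec [simp]:
  fixes U :: "real^'d^'d"
  assumes "invertible U"
  shows "matrix_inv U *v (U *v x) = x" "U *v (matrix_inv U *v x) = x"
  by (simp_all add: matrix_vector_mul_assoc matrix_inv_left[OF assms] matrix_inv_right[OF assms])

lemma invertible_matrix_inv:
  fixes U :: "real^'d^'d"
  shows "invertible U \<Longrightarrow> invertible (matrix_inv U)"
  using matrix_inv_left matrix_inv_right invertible_def by blast

lemma matrix_inv_matrix_inv:
  fixes U :: "real^'d^'d"
  assumes "invertible U"
  shows "matrix_inv (matrix_inv U) = U"
  using matrix_inv_unique[OF matrix_inv_left[OF assms] matrix_inv_right[OF assms]] by simp

lemma borel_measurable_matrix_mult:
  fixes U :: "real^'d^'d"
  shows "(\<lambda>x. U *v x) \<in> borel \<rightarrow>\<^sub>M borel"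
  by (intro borel_measurable_continuous_onI linear_continuous_on matrix_vector_mul_bounded_linear)

text \<open>Fubini reduces shears to translations of the real line.\<close>

lemma nn_integral_shear:
  fixes f :: "'a::euclidean_space \<Rightarrow> ennreal"
  assumes [measurable]: "f \<in> borel_measurable borel" and ab: "a \<in> Basis" "b \<in> Basis" "a \<noteq> b"
  shows "(\<integral>\<^sup>+x. f (x + (c * (x \<bullet> b)) *\<^sub>R a) \<partial>lborel) = (\<integral>\<^sup>+x. f x \<partial>lborel)"
proof -
  interpret product_sigma_finite "\<lambda>_::'a. lborel :: real measure" ..
  let ?E = "\<lambda>g. \<Sum>i\<in>Basis. g i *\<^sub>R i :: 'a"
  let ?I = "Basis - {a}"
  have Basis: "insert a ?I = Basis" using ab by auto
  have E: "?E (x(a := y)) = ?E (x(a := 0)) + y *\<^sub>R a" for x y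
    using ab by (subst (1 2) sum.remove[of _ a]) (auto intro!: sum.cong)
  have Eb: "?E g \<bullet> b = g b" for g
    using ab by (simp add: inner_sum_left inner_Basis if_distrib sum.delta cong: if_cong)
  have split: "(\<integral>\<^sup>+x. h x \<partial>lborel) = (\<integral>\<^sup>+x. (\<integral>\<^sup>+y. h (?E (x(a := y))) \<partial>lborel) \<partial>Pi\<^sub>M ?I (\<lambda>_. lborel))"
    if [measurable]: "h \<in> borel_measurable borel" for h :: "'a \<Rightarrow> ennreal"
  proof -
    have "(\<integral>\<^sup>+x. h x \<partial>lborel) = (\<integral>\<^sup>+g. h (?E g) \<partial>Pi\<^sub>M (insert a ?I) (\<lambda>_. lborel))"
      unfolding Basis by (subst lborel_eq, subst nn_integral_distr) auto
    also have "\<dots> = (\<integral>\<^sup>+x. (\<integral>\<^sup>+y. h (?E (x(a := y))) \<partial>lborel) \<partial>Pi\<^sub>M ?I (\<lambda>_. lborel))"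
      by (subst product_nn_integral_insert) (auto simp: Basis)
    finally show ?thesis .
  qed
  have "(\<integral>\<^sup>+y. f (?E (x(a := y)) + (c * (?E (x(a := y)) \<bullet> b)) *\<^sub>R a) \<partial>lborel)
      = (\<integral>\<^sup>+y. f (?E (x(a := y))) \<partial>lborel)" for x
  proof -
    have "(\<integral>\<^sup>+y. f (?E (x(a := y)) + (c * (?E (x(a := y)) \<bullet> b)) *\<^sub>R a) \<partial>lborel)
        = (\<integral>\<^sup>+y. f (?E (x(a := 0)) + (c * x b + y) *\<^sub>R a) \<partial>lborel)"
      unfolding Eb using ab by (subst E) (simp add: algebra_simps)
    also have "\<dots> = (\<integral>\<^sup>+y. f (?E (x(a := 0)) + y *\<^sub>R a) \<partial>distr lborel borel ((+) (c * x b)))"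
      by (subst nn_integral_distr) auto
    also have "\<dots> = (\<integral>\<^sup>+y. f (?E (x(a := y))) \<partial>lborel)"
      unfolding lborel_distr_plus by (subst (2) E) simp
    finally show ?thesis .
  qed
  then show ?thesis
    using split[of "\<lambda>x. f (x + (c * (x \<bullet> b)) *\<^sub>R a)"] split[of f] by simp
qed

lemma prod_Basis_vec: "(\<Prod>b\<in>Basis. g (b :: real^'d)) = (\<Prod>i\<in>UNIV. g (axis i 1))"
proof -
  have "Basis = range (\<lambda>i. axis i (1::real) :: real^'d)" by (auto simp: Basis_vec_def)
  moreover have "inj (\<lambda>i. axis i (1::real) :: real^'d)" by (auto simp: inj_on_def axis_eq_axis)
  ultimately show ?thesis by (metis prod.reindex_cong)
qed

text \<open>Every invertible matrix is a product of elementary ones, and the claim is stable under products.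
  Diagonal matrices rescale the coordinates, transpositions of coordinates map boxes to boxes of the
  same volume, and the remaining ones are shears.\<close>

lemma nn_integral_linear:
  fixes A :: "real^'d^'d"
  assumes "invertible A" and "f \<in> borel_measurable borel"
  shows "(\<integral>\<^sup>+x. f x \<partial>lborel) = ennreal \<bar>det A\<bar> * (\<integral>\<^sup>+x. f (A *v x) \<partial>lborel)"
proof -
  let ?P = "\<lambda>A. \<forall>f\<in>borel_measurable borel.
    (\<integral>\<^sup>+x. f x \<partial>lborel) = ennreal \<bar>det A\<bar> * (\<integral>\<^sup>+x. f (A *v x) \<partial>lborel)"
  note [measurable] = borel_measurable_matrix_mult
  have "invertible A \<longrightarrow> ?P A"
  proof (rule induct_matrix_elementary[where P="\<lambda>A. invertible A \<longrightarrow> ?P A"])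
    fix A B :: "real^'d^'d"
    assume AB: "invertible A \<longrightarrow> ?P A" "invertible B \<longrightarrow> ?P B"
    show "invertible (A ** B) \<longrightarrow> ?P (A ** B)"
    proof (intro impI ballI)
      fix f :: "real^'d \<Rightarrow> ennreal"
      assume inv: "invertible (A ** B)" and f[measurable]: "f \<in> borel_measurable borel"
      have invAB: "invertible A" "invertible B" using inv by (simp_all add: invertible_det_nz det_mul)
      have A: "?P A" and B: "?P B" by (rule mp[OF AB(1) invAB(1)], rule mp[OF AB(2) invAB(2)])
      have "(\<integral>\<^sup>+x. f x \<partial>lborel) = ennreal \<bar>det A\<bar> * (\<integral>\<^sup>+x. f (A *v x) \<partial>lborel)"
        by (rule bspec[OF A f])
      also have "(\<integral>\<^sup>+x. f (A *v x) \<partial>lborel) = ennreal \<bar>det B\<bar> * (\<integral>\<^sup>+x. f (A *v (B *v x)) \<partial>lborel)"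
        by (rule bspec[OF B]) measurable
      finally show "(\<integral>\<^sup>+x. f x \<partial>lborel) = ennreal \<bar>det (A ** B)\<bar> * (\<integral>\<^sup>+x. f ((A ** B) *v x) \<partial>lborel)"
        by (simp add: det_mul abs_mult ennreal_mult mult.assoc matrix_vector_mul_assoc)
    qed
  next
    fix A :: "real^'d^'d" and i assume "Finite_Cartesian_Product.row i A = 0"
    then show "invertible A \<longrightarrow> ?P A" by (simp add: invertible_det_nz det_zero_row(1))
  next
    fix A :: "real^'d^'d" assume diag: "\<And>i j. i \<noteq> j \<Longrightarrow> vec_nth (vec_nth A i) j = 0"
    show "invertible A \<longrightarrow> ?P A"
    proof (intro impI ballI)
      fix f :: "real^'d \<Rightarrow> ennreal"
      assume inv: "invertible A" and f[measurable]: "f \<in> borel_measurable borel"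
      define c where "c b = (A *v b) \<bullet> b" for b :: "real^'d"
      have c_axis: "c (axis i 1) = vec_nth (vec_nth A i) i" for i
        by (simp add: c_def inner_axis matrix_vector_mult_basis column_def)
      have det: "det A = (\<Prod>i\<in>UNIV. vec_nth (vec_nth A i) i)" by (rule det_diagonal[OF diag])
      have nz: "c b \<noteq> 0" if "b \<in> Basis" for b
        using inv that by (auto simp: Basis_vec_def c_axis invertible_det_nz det)
      have Ax: "(\<Sum>j\<in>Basis. (c j * (x \<bullet> j)) *\<^sub>R j) = A *v x" for x
      proof (rule euclidean_eqI)
        fix b :: "real^'d" assume "b \<in> Basis"
        then obtain i where b: "b = axis i 1" by (auto simp: Basis_vec_def)
        have "(\<Sum>j\<in>Basis. (c j * (x \<bullet> j)) *\<^sub>R j) \<bullet> b = c b * (x \<bullet> b)"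
          using \<open>b \<in> Basis\<close> by (simp add: inner_sum_left inner_Basis if_distrib sum.delta cong: if_cong)
        also have "\<dots> = vec_nth (vec_nth A i) i * vec_nth x i" by (simp add: b c_axis inner_axis)
        also have "\<dots> = (\<Sum>j\<in>UNIV. vec_nth (vec_nth A i) j * vec_nth x j)"
          by (subst sum.remove[of _ i]) (auto simp: diag)
        also have "\<dots> = (A *v x) \<bullet> b" by (simp add: b inner_axis matrix_vector_mult_def)
        finally show "(\<Sum>j\<in>Basis. (c j * (x \<bullet> j)) *\<^sub>R j) \<bullet> b = (A *v x) \<bullet> b" .
      qed
      have "(\<integral>\<^sup>+x. f x \<partial>lborel) = (\<integral>\<^sup>+x. f x \<partial>density (distr lborel borel (\<lambda>x. A *v x)) (\<lambda>_. \<Prod>j\<in>Basis. \<bar>c j\<bar>))"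
        using lborel_affine_euclidean[of c 0, OF nz] by (simp add: Ax)
      also have "\<dots> = ennreal (\<Prod>j\<in>Basis. \<bar>c j\<bar>) * (\<integral>\<^sup>+x. f (A *v x) \<partial>lborel)"
        by (simp add: nn_integral_density nn_integral_cmult nn_integral_distr)
      also have "(\<Prod>j\<in>Basis. \<bar>c j\<bar>) = \<bar>det A\<bar>"
        by (simp add: prod_Basis_vec c_axis det abs_prod)
      finally show "(\<integral>\<^sup>+x. f x \<partial>lborel) = ennreal \<bar>det A\<bar> * (\<integral>\<^sup>+x. f (A *v x) \<partial>lborel)" .
    qed
  next
    fix m n :: 'd assume mn: "m \<noteq> n"
    let ?p = "Transposition.transpose m n"
    let ?A = "vec_lambda (\<lambda>i. vec_lambda (\<lambda>j. vec_nth (vec_nth (Finite_Cartesian_Product.mat 1) i) (?p j))) :: real^'d^'d"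
    have perm: "?p permutes UNIV" by (rule permutes_swap_id) auto
    have "det ?A = of_int (sign ?p) * det (Finite_Cartesian_Product.mat 1 :: real^'d^'d)"
      by (rule det_permute_columns[OF perm])
    then have det: "\<bar>det ?A\<bar> = 1" by (simp add: det_I sign_def)
    have Ax: "?A *v x = vec_lambda (\<lambda>i. vec_nth x (?p i))" for x
    proof -
      have "(\<Sum>j\<in>UNIV. (if i = ?p j then 1 else 0) * vec_nth x j) = (\<Sum>j\<in>UNIV. if j = ?p i then vec_nth x j else 0)" for i
        by (intro sum.cong refl) (auto simp: transpose_eq_iff)
      then show ?thesis
        by (simp add: matrix_vector_mult_def Finite_Cartesian_Product.vec_eq_iff Finite_Cartesian_Product.mat_def sum.delta)
    qed
    have lb: "lborel = distr lborel borel (\<lambda>x. ?A *v x)"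
    proof (rule lborel_eqI)
      fix l u :: "real^'d" assume lu: "\<And>b. b \<in> Basis \<Longrightarrow> l \<bullet> b \<le> u \<bullet> b"
      have le: "vec_nth l i \<le> vec_nth u i" for i
        using lu[of "axis i 1"] by (simp add: inner_axis)
      have "x \<in> (\<lambda>x. ?A *v x) -` box l u \<longleftrightarrow> x \<in> box (?A *v l) (?A *v u)" for x
      proof -
        have "(\<forall>i. vec_nth l i < vec_nth x (?p i) \<and> vec_nth x (?p i) < vec_nth u i)
          \<longleftrightarrow> (\<forall>i. vec_nth l (?p i) < vec_nth x i \<and> vec_nth x i < vec_nth u (?p i))"
          by (metis transpose_involutory)
        then show ?thesis by (simp add: mem_box_cart Ax)
      qed
      then have "emeasure (distr lborel borel (\<lambda>x. ?A *v x)) (box l u) = emeasure lborel (box (?A *v l) (?A *v u))"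
        by (subst emeasure_distr) (auto intro: arg_cong[where f="emeasure lborel"])
      also have "\<dots> = ennreal (\<Prod>i\<in>UNIV. vec_nth u (?p i) - vec_nth l (?p i))"
      proof -
        have "(?A *v l) \<bullet> b \<le> (?A *v u) \<bullet> b" if "b \<in> Basis" for b
          using that by (auto simp: Basis_vec_def inner_axis Ax le)
        then show ?thesis by (simp add: prod_Basis_vec inner_axis Ax)
      qed
      also have "(\<Prod>i\<in>UNIV. vec_nth u (?p i) - vec_nth l (?p i)) = (\<Prod>i\<in>UNIV. vec_nth u i - vec_nth l i)"
        using prod.permute[OF perm, of "\<lambda>i. vec_nth u i - vec_nth l i"] by (simp add: o_def)
      finally show "emeasure (distr lborel borel (\<lambda>x. ?A *v x)) (box l u) = (\<Prod>b\<in>Basis. (u - l) \<bullet> b)"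
        by (simp add: prod_Basis_vec inner_axis)
    qed simp
    show "invertible ?A \<longrightarrow> ?P ?A"
    proof (intro impI ballI)
      fix f :: "real^'d \<Rightarrow> ennreal" assume f[measurable]: "f \<in> borel_measurable borel"
      have "(\<integral>\<^sup>+x. f x \<partial>lborel) = (\<integral>\<^sup>+x. f x \<partial>distr lborel borel (\<lambda>x. ?A *v x))"
        using lb by simp
      also have "\<dots> = (\<integral>\<^sup>+x. f (?A *v x) \<partial>lborel)" by (subst nn_integral_distr) auto
      finally show "(\<integral>\<^sup>+x. f x \<partial>lborel) = ennreal \<bar>det ?A\<bar> * (\<integral>\<^sup>+x. f (?A *v x) \<partial>lborel)"
        by (simp add: det)
    qed
  next
    fix m n :: 'd and c :: real assume mn: "m \<noteq> n"
    let ?A = "vec_lambda (\<lambda>i. vec_lambda (\<lambda>j. if i = m \<and> j = n then c else of_bool (i = j))) :: real^'d^'d"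
    let ?I = "Finite_Cartesian_Product.mat 1 :: real^'d^'d"
    have "?A = vec_lambda (\<lambda>k. if k = m then Finite_Cartesian_Product.row m ?I + c *s Finite_Cartesian_Product.row n ?I else Finite_Cartesian_Product.row k ?I)"
      using mn by (auto simp: Finite_Cartesian_Product.vec_eq_iff Finite_Cartesian_Product.mat_def Finite_Cartesian_Product.row_def vector_scalar_mult_def)
    then have det: "det ?A = 1" using det_row_operation[OF mn, of ?I c] by (simp add: det_I)
    have Ax: "?A *v x = x + (c * vec_nth x n) *\<^sub>R axis m 1" for x
    proof -
      have "(\<Sum>j\<in>UNIV. (if i = m \<and> j = n then c else of_bool (i = j)) * vec_nth x j)
          = (\<Sum>j\<in>UNIV. (if j = i then vec_nth x j else 0) + (if j = n then (if i = m then c * vec_nth x j else 0) else 0))" for i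
        using mn by (intro sum.cong refl) auto
      then show ?thesis
        by (simp add: matrix_vector_mult_def Finite_Cartesian_Product.vec_eq_iff sum.distrib sum.delta axis_def)
    qed
    show "invertible ?A \<longrightarrow> ?P ?A"
    proof (intro impI ballI)
      fix f :: "real^'d \<Rightarrow> ennreal" assume f: "f \<in> borel_measurable borel"
      show "(\<integral>\<^sup>+x. f x \<partial>lborel) = ennreal \<bar>det ?A\<bar> * (\<integral>\<^sup>+x. f (?A *v x) \<partial>lborel)"
        unfolding det Ax using nn_integral_shear[OF f, of "axis m 1" "axis n 1" c] mn
        by (simp add: axis_eq_axis inner_axis)
    qed
  qed
  from bspec[OF mp[OF this assms(1)] assms(2)] show ?thesis .
qed

context
  fixes U :: "real^'d^'d" and k :: "real^'d" and T
  assumes U: "invertible U"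
  defines T_def: "T \<equiv> \<lambda>x. U *v x - k"
begin

lemma borel_measurable_affine [measurable]: "T \<in> borel \<rightarrow>\<^sub>M borel"
  unfolding T_def
  by (intro borel_measurable_continuous_onI continuous_intros linear_continuous_on
      matrix_vector_mul_bounded_linear)

lemma lborel_affine_map: "lborel = density (distr lborel borel T) (\<lambda>_. ennreal \<bar>det U\<bar>)"
proof (rule measure_eqI)
  fix A :: "(real^'d) set" assume "A \<in> sets lborel"
  then have A [measurable]: "A \<in> sets borel" by simp
  have m: "(\<lambda>x. indicator A (U *v x) :: ennreal) \<in> borel_measurable borel"
    using borel_measurable_matrix_mult[of U, measurable] by measurable
  have "emeasure lborel A = (\<integral>\<^sup>+x. indicator A x \<partial>lborel)" by simp
  also have "\<dots> = ennreal \<bar>det U\<bar> * (\<integral>\<^sup>+x. indicator A (U *v x) \<partial>lborel)"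
    by (rule nn_integral_linear[OF U]) simp
  also have "(\<integral>\<^sup>+x. indicator A (U *v x) \<partial>lborel)
      = (\<integral>\<^sup>+x. indicator A (U *v x) \<partial>distr lborel borel ((+) (- (matrix_inv U *v k))))"
    by (simp add: lborel_distr_plus)
  also have "\<dots> = (\<integral>\<^sup>+x. indicator A (T x) \<partial>lborel)"
    by (subst nn_integral_distr) (use m U in \<open>auto simp: T_def matrix_vector_right_distrib matrix_vector_mult_diff_distrib simp flip: diff_conv_add_uminus\<close>)
  finally show "emeasure lborel A = emeasure (density (distr lborel borel T) (\<lambda>_. ennreal \<bar>det U\<bar>)) A"
    by (simp add: emeasure_density nn_integral_cmult nn_integral_distr del: nn_integral_indicator)
qed simp

lemma det_pos: "\<bar>det U\<bar> > 0"
  using U by (simp add: invertible_det_nz)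

text \<open>An affine bijection preserves Borel null sets in both directions, so the change of variables
  passes from Borel measure to its completion.\<close>

lemma lebesgue_measurable_affine [measurable]: "T \<in> lebesgue \<rightarrow>\<^sub>M lebesgue"
  and lebesgue_affine_map: "lebesgue = density (distr lebesgue lebesgue T) (\<lambda>_. ennreal \<bar>det U\<bar>)"
proof -
  { fix A :: "(real^'d) set" assume A: "A \<in> sets borel"
    then have "emeasure lborel A = 0 \<longleftrightarrow> emeasure (density (distr lborel borel T) (\<lambda>_. ennreal \<bar>det U\<bar>)) A = 0"
      by (subst lborel_affine_map[symmetric]) auto
    also have "\<dots> \<longleftrightarrow> emeasure (distr lebesgue lborel T) A = 0"
      using A det_pos by (simp add: distr_completion emeasure_density nn_integral_cmult cong: distr_cong)
    finally have "emeasure lborel A = 0 \<longleftrightarrow> emeasure (distr lebesgue lborel T) A = 0" . }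
  then have eq: "null_sets lborel = null_sets (distr lebesgue lborel T)"
    by (auto simp: null_sets_def)
  show "T \<in> lebesgue \<rightarrow>\<^sub>M lebesgue"
    by (simp add: completion.measurable_completion2 eq measurable_completion)
  have "lebesgue = completion (density (distr lborel borel T) (\<lambda>_. ennreal \<bar>det U\<bar>))"
    by (subst lborel_affine_map) simp
  also have "\<dots> = density (completion (distr lebesgue lborel T)) (\<lambda>_. ennreal \<bar>det U\<bar>)"
    using det_pos by (auto intro!: always_eventually completion_density_eq simp: distr_completion cong: distr_cong)
  also have "\<dots> = density (distr lebesgue lebesgue T) (\<lambda>_. ennreal \<bar>det U\<bar>)"
    by (subst completion.completion_distr_eq) (auto simp: eq measurable_completion)
  finally show "lebesgue = density (distr lebesgue lebesgue T) (\<lambda>_. ennreal \<bar>det U\<bar>)" .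
qed

lemma nn_integral_affine:
  assumes [measurable]: "f \<in> borel_measurable lebesgue"
  shows "(\<integral>\<^sup>+x. f x \<partial>lebesgue) = ennreal \<bar>det U\<bar> * (\<integral>\<^sup>+x. f (T x) \<partial>lebesgue)"
proof -
  have "(\<integral>\<^sup>+x. f x \<partial>lebesgue) = (\<integral>\<^sup>+x. f x \<partial>(density (distr lebesgue lebesgue T) (\<lambda>_. ennreal \<bar>det U\<bar>)))"
    by (subst lebesgue_affine_map) (rule refl)
  also have "\<dots> = ennreal \<bar>det U\<bar> * (\<integral>\<^sup>+x. f (T x) \<partial>lebesgue)"
    by (simp add: nn_integral_density nn_integral_cmult nn_integral_distr)
  finally show ?thesis .
qed

lemma AE_affine:
  assumes "AE x in lebesgue. P x"
  shows "AE x in lebesgue. P (T x)"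
proof -
  have "AE x in density (distr lebesgue lebesgue T) (\<lambda>_. ennreal \<bar>det U\<bar>). P x"
    using assms by (subst lebesgue_affine_map[symmetric])
  then have "AE x in distr lebesgue lebesgue T. P x"
    using det_pos by (simp add: AE_density)
  then obtain N where N: "N \<in> null_sets (distr lebesgue lebesgue T)" "{x. \<not> P x} \<subseteq> N"
    unfolding eventually_ae_filter by auto
  then have "T -` N \<inter> space lebesgue \<in> null_sets lebesgue"
    by (auto simp: null_sets_distr_iff)
  then show ?thesis using N(2) by (auto intro: AE_I')
qed

lemma integrable_affine:
  fixes f :: "real^'d \<Rightarrow> 'b::{banach, second_countable_topology}"
  assumes "integrable lebesgue f"
  shows "integrable lebesgue (\<lambda>x. f (T x))"
proof (rule integrableI_bounded)
  note [measurable] = borel_measurable_integrable[OF assms]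
  show "(\<lambda>x. f (T x)) \<in> borel_measurable lebesgue" by measurable
  have "ennreal \<bar>det U\<bar> * (\<integral>\<^sup>+x. ennreal (norm (f (T x))) \<partial>lebesgue) < \<infinity>"
    using assms unfolding integrable_iff_bounded by (subst nn_integral_affine[symmetric]) auto
  then show "(\<integral>\<^sup>+x. ennreal (norm (f (T x))) \<partial>lebesgue) < \<infinity>"
    using det_pos by (auto simp: ennreal_mult_less_top)
qed

lemma integral_affine:
  fixes f :: "real^'d \<Rightarrow> 'b::{banach, second_countable_topology}"
  assumes [measurable]: "f \<in> borel_measurable lebesgue"
  shows "integral\<^sup>L lebesgue f = \<bar>det U\<bar> *\<^sub>R integral\<^sup>L lebesgue (\<lambda>x. f (T x))"
proof -
  have "integral\<^sup>L lebesgue f = integral\<^sup>L (density (distr lebesgue lebesgue T) (\<lambda>_. ennreal \<bar>det U\<bar>)) f"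
    by (subst lebesgue_affine_map) (rule refl)
  also have "\<dots> = \<bar>det U\<bar> *\<^sub>R integral\<^sup>L lebesgue (\<lambda>x. f (T x))"
    by (subst integral_density) (auto simp: integral_distr)
  finally show ?thesis .
qed

end

lemma dilate_shift_sqint:
  assumes U: "invertible U" and f: "f \<in> sqint lebesgue"
  shows "dilate_shift U k f \<in> sqint lebesgue"
proof -
  note [measurable] = lebesgue_measurable_affine[OF U, of k] sqint_measurable[OF f]
  have "integrable lebesgue (\<lambda>x. \<bar>det U\<bar> * (cmod (f (U *v x - k)))\<^sup>2)"
    using integrable_affine[OF U sqint_integrable[OF f], of k] by simp
  moreover have "(\<lambda>x. f (U *v x - k)) \<in> borel_measurable lebesgue" by measurable
  ultimately show ?thesis
    by (simp add: sqint_def dilate_shift_def norm_mult power_mult_distrib)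
qed

lemma ip_dilate_shift:
  assumes U: "invertible U" and f: "f \<in> sqint lebesgue" and g: "g \<in> sqint lebesgue"
  shows "ip lebesgue (dilate_shift U k f) (dilate_shift U k g) = ip lebesgue f g"
proof -
  have m: "(\<lambda>x. f x * cnj (g x)) \<in> borel_measurable lebesgue"
    using f g by (auto simp: sqint_def borel_measurable_cnj)
  have "ip lebesgue f g = \<bar>det U\<bar> *\<^sub>R (\<integral>x. f (U *v x - k) * cnj (g (U *v x - k)) \<partial>lebesgue)"
    unfolding ip_def by (rule integral_affine[OF U m])
  also have "\<dots> = (\<integral>x. \<bar>det U\<bar> *\<^sub>R (f (U *v x - k) * cnj (g (U *v x - k))) \<partial>lebesgue)"
    by (simp only: integral_scaleR_right)
  also have "\<dots> = ip lebesgue (dilate_shift U k f) (dilate_shift U k g)"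
    unfolding ip_def dilate_shift_def
    by (intro Bochner_Integration.integral_cong refl)
       (simp add: scaleR_conv_of_real mult.assoc mult.left_commute[of _ "complex_of_real (sqrt \<bar>det U\<bar>)"] flip: of_real_mult mult.assoc)
  finally show ?thesis by simp
qed

lemma nrm_dilate_shift:
  assumes U: "invertible U" and f: "f \<in> sqint lebesgue"
  shows "nrm lebesgue (dilate_shift U k f) = nrm lebesgue f"
proof -
  have "complex_of_real ((nrm lebesgue (dilate_shift U k f))\<^sup>2) = complex_of_real ((nrm lebesgue f)\<^sup>2)"
    unfolding ip_self[symmetric] by (rule ip_dilate_shift[OF U f f])
  then have "(nrm lebesgue (dilate_shift U k f))\<^sup>2 = (nrm lebesgue f)\<^sup>2"
    using of_real_eq_iff by blast
  then show ?thesis by simp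
qed

lemma dilate_shift_dilate_shift:
  "dilate_shift V m (dilate_shift U k f) = dilate_shift (U ** V) (U *v m + k) f"
  by (simp add: fun_eq_iff dilate_shift_def det_mul abs_mult real_sqrt_mult matrix_vector_mul_assoc
      matrix_vector_mult_diff_distrib algebra_simps)

lemma dilate_shift_lincomb:
  "dilate_shift U k (\<lambda>x. \<Sum>i\<in>F. c i * h i x) = (\<lambda>x. \<Sum>i\<in>F. c i * dilate_shift U k (h i) x)"
  by (simp add: fun_eq_iff dilate_shift_def sum_distrib_left mult.left_commute)

lemma dilate_shift_diff:
  "dilate_shift U k (\<lambda>x. f x - g x) = (\<lambda>x. dilate_shift U k f x - dilate_shift U k g x)"
  by (simp add: fun_eq_iff dilate_shift_def algebra_simps)

lemma dilate_shift_id: "dilate_shift (Finite_Cartesian_Product.mat 1) k f = (\<lambda>x. f (x - k))"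
  by (simp add: dilate_shift_def det_I)

lemma mat_power_commute:
  fixes A :: "real^'d^'d"
  shows "((**) A ^^ n) (Finite_Cartesian_Product.mat 1) ** A = ((**) A ^^ Suc n) (Finite_Cartesian_Product.mat 1)"
  by (induction n) (simp_all add: matrix_mul_assoc[symmetric])

lemma matrix_powi_0 [simp]: "matrix_powi M 0 = Finite_Cartesian_Product.mat 1"
  by (simp add: matrix_powi_def)

lemma matrix_powi_m1: "matrix_powi M (-1) = matrix_inv M"
  by (simp add: matrix_powi_def)

lemma matrix_powi_Suc:
  assumes "invertible M"
  shows "matrix_powi M (j + 1) = matrix_powi M j ** M"
proof (cases "j \<ge> 0")
  case True
  then have "nat (j + 1) = Suc (nat j)" by simp
  then show ?thesis using True mat_power_commute[of "nat j" M] by (simp add: matrix_powi_def)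
next
  case False
  define n where "n = nat (- j - 1)"
  have n: "nat (- j) = Suc n" "nat (- (j + 1)) = n" using False by (auto simp: n_def)
  let ?B = "matrix_inv M"
  have "matrix_powi M j ** M = ((**) ?B ^^ n) (Finite_Cartesian_Product.mat 1) ** ?B ** M"
    using False n mat_power_commute[of n ?B] by (simp add: matrix_powi_def)
  also have "\<dots> = ((**) ?B ^^ n) (Finite_Cartesian_Product.mat 1)"
    by (simp add: matrix_mul_assoc[symmetric] matrix_inv_left[OF assms])
  also have "\<dots> = matrix_powi M (j + 1)"
    using False n by (cases "j = -1") (auto simp: matrix_powi_def n_def)
  finally show ?thesis by simp
qed

lemma matrix_powi_add:
  assumes "invertible M"
  shows "matrix_powi M (i + j) = matrix_powi M i ** matrix_powi M j"
proof (induction j rule: int_induct[where k=0])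
  case base
  then show ?case by simp
next
  case (step1 j)
  have "matrix_powi M (i + (j + 1)) = matrix_powi M (i + j) ** M"
    using matrix_powi_Suc[OF assms, of "i + j"] by (simp add: add.assoc)
  then show ?case using step1 by (simp add: matrix_powi_Suc[OF assms] matrix_mul_assoc)
next
  case (step2 j)
  have "matrix_powi M (i + (j - 1)) ** M = matrix_powi M (i + j)"
    using matrix_powi_Suc[OF assms, of "i + (j - 1)"] by (simp add: algebra_simps)
  then have "matrix_powi M (i + (j - 1)) = matrix_powi M (i + j) ** matrix_inv M"
    by (metis assms matrix_inv_right matrix_mul_assoc matrix_mul_rid)
  moreover have "matrix_powi M (j - 1) = matrix_powi M j ** matrix_inv M"
    using matrix_powi_Suc[OF assms, of "j - 1"]
    by (metis assms diff_add_cancel matrix_inv_right matrix_mul_assoc matrix_mul_rid)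
  ultimately show ?case using step2 by (simp add: matrix_mul_assoc)
qed

lemma invertible_matrix_powi:
  fixes M :: "real^'d^'d"
  assumes "invertible M"
  shows "invertible (matrix_powi M j)"
  unfolding invertible_def
  using matrix_powi_add[OF assms, of j "-j"] matrix_powi_add[OF assms, of "-j" j]
  by (intro exI[of _ "matrix_powi M (-j)"]) simp

section \<open>The integer lattice and the unit cube\<close>

lemma int_lattice_0 [simp]: "0 \<in> int_lattice"
  and int_lattice_add: "x \<in> int_lattice \<Longrightarrow> y \<in> int_lattice \<Longrightarrow> x + y \<in> int_lattice"
  and int_lattice_diff: "x \<in> int_lattice \<Longrightarrow> y \<in> int_lattice \<Longrightarrow> x - y \<in> int_lattice"
  and int_lattice_uminus: "x \<in> int_lattice \<Longrightarrow> - x \<in> int_lattice"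
  by (auto simp: int_lattice_def)

lemma countable_int_lattice: "countable (int_lattice :: (real^'d) set)"
proof -
  let ?P = "Pi\<^sub>E (UNIV :: 'd set) (\<lambda>_. \<int> :: real set)"
  have "int_lattice \<subseteq> vec_lambda ` ?P"
  proof
    fix x :: "real^'d" assume "x \<in> int_lattice"
    then have "vec_nth x \<in> ?P" by (auto simp: int_lattice_def)
    then show "x \<in> vec_lambda ` ?P" by (intro image_eqI[of _ _ "vec_nth x"]) auto
  qed
  moreover have "countable ?P"
    by (intro countable_PiE) (auto simp: Ints_def)
  ultimately show ?thesis by (meson countable_image countable_subset)
qed

lemma int_matrix_mult: "int_matrix N \<Longrightarrow> k \<in> int_lattice \<Longrightarrow> N *v k \<in> int_lattice"
  by (auto simp: int_matrix_def int_lattice_def matrix_vector_mult_def intro!: Ints_sum Ints_mult)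

definition lfloor :: "real^'d \<Rightarrow> real^'d" where
  "lfloor x = vec_lambda (\<lambda>i. of_int \<lfloor>vec_nth x i\<rfloor>)"

definition unit_cube :: "(real^'d) set" where
  "unit_cube = {x. \<forall>i. 0 \<le> vec_nth x i \<and> vec_nth x i < 1}"

lemma lfloor_lattice [simp]: "lfloor x \<in> int_lattice"
  by (simp add: lfloor_def int_lattice_def)

lemma diff_lfloor_unit_cube [simp]: "x - lfloor x \<in> unit_cube"
  by (auto simp: lfloor_def unit_cube_def) linarith

lemma lfloor_unique:
  assumes "k \<in> int_lattice" "x - k \<in> unit_cube"
  shows "k = lfloor x"
proof (subst Finite_Cartesian_Product.vec_eq_iff, rule allI)
  fix i
  obtain n where n: "vec_nth k i = of_int n"
    using assms(1) by (auto simp: int_lattice_def elim!: Ints_cases dest: spec[of _ i])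
  have "0 \<le> vec_nth x i - of_int n \<and> vec_nth x i - of_int n < 1"
    using assms(2) n by (auto simp: unit_cube_def dest: spec[of _ i])
  then have "\<lfloor>vec_nth x i\<rfloor> = n" by (intro floor_unique) auto
  then show "vec_nth k i = vec_nth (lfloor x) i" by (simp add: lfloor_def n)
qed

lemma unit_cube_lattice_unique:
  assumes "x \<in> unit_cube" "y \<in> unit_cube" "x - y \<in> int_lattice"
  shows "x = y"
  using lfloor_unique[OF assms(3), of x] lfloor_unique[OF int_lattice_0, of x] assms by simp

lemma unit_cube_borel [measurable]: "(unit_cube :: (real^'d) set) \<in> sets borel"
proof -
  have "(unit_cube :: (real^'d) set) = (\<Inter>i. {x. 0 \<le> vec_nth x i} \<inter> {x. vec_nth x i < 1})"
    by (auto simp: unit_cube_def)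
  also have "\<dots> \<in> sets borel"
    by (intro sets.countable_INT'' sets.Int borel_closed closed_Collect_le borel_open open_Collect_less continuous_intros) auto
  finally show ?thesis .
qed

lemma unit_cube_lebesgue [measurable]: "(unit_cube :: (real^'d) set) \<in> sets lebesgue"
  using unit_cube_borel by (metis sets_completionI_sets sets_lborel)

lemma One_inner: "b \<in> Basis \<Longrightarrow> (One :: real^'d) \<bullet> b = 1"
  by simp

lemma box_subset_unit_cube: "box 0 One \<subseteq> (unit_cube :: (real^'d) set)"
proof
  fix x :: "real^'d" assume "x \<in> box 0 One"
  then have "0 < x \<bullet> axis i 1 \<and> x \<bullet> axis i 1 < 1" for i
    using One_inner[of "axis i 1"] unfolding mem_box by fastforce
  then have "0 < vec_nth x i \<and> vec_nth x i < 1" for i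
    by (simp add: inner_axis)
  then show "x \<in> unit_cube" by (auto simp: unit_cube_def less_imp_le)
qed

lemma unit_cube_subset_cbox: "(unit_cube :: (real^'d) set) \<subseteq> cbox 0 One"
proof
  fix x :: "real^'d" assume x: "x \<in> unit_cube"
  have "0 \<le> x \<bullet> b \<and> x \<bullet> b \<le> One \<bullet> b" if b: "b \<in> Basis" for b
  proof -
    obtain i where i: "b = axis i 1" using b by (auto simp: Basis_vec_def)
    show ?thesis using x unfolding One_inner[OF b] by (simp add: i inner_axis unit_cube_def less_imp_le)
  qed
  then show "x \<in> cbox 0 One" by (simp add: mem_box)
qed

lemma emeasure_unit_cube [simp]: "emeasure lebesgue (unit_cube :: (real^'d) set) = 1"
proof -
  have "emeasure lebesgue (box 0 (One :: real^'d)) \<le> emeasure lebesgue (unit_cube :: (real^'d) set)"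
    by (rule emeasure_mono[OF box_subset_unit_cube]) simp
  moreover have "emeasure lebesgue (unit_cube :: (real^'d) set) \<le> emeasure lebesgue (cbox 0 (One :: real^'d))"
    by (rule emeasure_mono[OF unit_cube_subset_cbox]) simp
  ultimately show ?thesis by (simp add: emeasure_lborel_box_eq emeasure_lborel_cbox_eq One_inner)
qed

lemma invertible_mat_1: "invertible (Finite_Cartesian_Product.mat 1 :: real^'d^'d)"
  unfolding invertible_def by (intro exI[of _ "Finite_Cartesian_Product.mat 1"]) simp

lemma nn_integral_translate:
  fixes f :: "real^'d \<Rightarrow> ennreal"
  assumes "f \<in> borel_measurable lebesgue"
  shows "(\<integral>\<^sup>+x. f (x + t) \<partial>lebesgue) = (\<integral>\<^sup>+x. f x \<partial>lebesgue)"
  using nn_integral_affine[OF invertible_mat_1 assms, of "-t"] by (simp add: det_I)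

lemma lebesgue_measurable_translate [measurable]:
  "(\<lambda>x::real^'d. x + t) \<in> lebesgue \<rightarrow>\<^sub>M lebesgue"
  using lebesgue_measurable_affine[OF invertible_mat_1, of "-t"] by simp

text \<open>The lattice translates of the unit cube tile space, so that integrating over space
  is integrating the periodization over the unit cube.\<close>

lemma nn_integral_tile:
  fixes f :: "real^'d \<Rightarrow> ennreal"
  assumes [measurable]: "f \<in> borel_measurable lebesgue"
  shows "(\<integral>\<^sup>+x. f x \<partial>lebesgue)
    = (\<integral>\<^sup>+x. (\<integral>\<^sup>+k. f (x + k) \<partial>count_space int_lattice) * indicator unit_cube x \<partial>lebesgue)"
proof -
  have one: "(\<integral>\<^sup>+k. f x * indicator unit_cube (x - k) \<partial>count_space int_lattice) = f x" for x
  proof -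
    have "(\<integral>\<^sup>+k. f x * indicator unit_cube (x - k) \<partial>count_space int_lattice)
        = (\<integral>\<^sup>+k. f x * indicator {lfloor x} k \<partial>count_space int_lattice)"
    proof (rule nn_integral_cong)
      fix k :: "real^'d" assume "k \<in> space (count_space int_lattice)"
      then have "x - k \<in> unit_cube \<longleftrightarrow> k = lfloor x" using lfloor_unique[of k x] by auto
      then show "f x * indicator unit_cube (x - k) = f x * indicator {lfloor x} k"
        by (auto simp: indicator_def)
    qed
    also have "\<dots> = f x" by (simp add: nn_integral_cmult)
    finally show ?thesis .
  qed
  have m: "(\<lambda>x. f x * indicator unit_cube (x - k)) \<in> borel_measurable lebesgue" for k
    using lebesgue_measurable_translate[of "-k", measurable] by simp
  have "(\<integral>\<^sup>+x. f x \<partial>lebesgue)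
      = (\<integral>\<^sup>+x. \<integral>\<^sup>+k. f x * indicator unit_cube (x - k) \<partial>count_space int_lattice \<partial>lebesgue)"
    by (simp add: one)
  also have "\<dots> = (\<integral>\<^sup>+k. \<integral>\<^sup>+x. f x * indicator unit_cube (x - k) \<partial>lebesgue \<partial>count_space int_lattice)"
    by (rule nn_integral_count_space_nn_integral[OF countable_int_lattice m])
  also have "\<dots> = (\<integral>\<^sup>+k. \<integral>\<^sup>+x. f (x + k) * indicator unit_cube x \<partial>lebesgue \<partial>count_space int_lattice)"
  proof (rule nn_integral_cong)
    fix k :: "real^'d"
    show "(\<integral>\<^sup>+x. f x * indicator unit_cube (x - k) \<partial>lebesgue) = (\<integral>\<^sup>+x. f (x + k) * indicator unit_cube x \<partial>lebesgue)"
      using nn_integral_translate[OF m, of k k] by simp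
  qed
  also have "\<dots> = (\<integral>\<^sup>+x. \<integral>\<^sup>+k. f (x + k) * indicator unit_cube x \<partial>count_space int_lattice \<partial>lebesgue)"
    by (rule nn_integral_count_space_nn_integral[OF countable_int_lattice, symmetric]) measurable
  also have "\<dots> = (\<integral>\<^sup>+x. (\<integral>\<^sup>+k. f (x + k) \<partial>count_space int_lattice) * indicator unit_cube x \<partial>lebesgue)"
    by (simp add: nn_integral_multc)
  finally show ?thesis .
qed

definition periodic :: "(real^'d \<Rightarrow> 'b) \<Rightarrow> bool" where
  "periodic f \<longleftrightarrow> (\<forall>x. \<forall>k\<in>int_lattice. f (x + k) = f x)"

lemma periodicD: "periodic f \<Longrightarrow> k \<in> int_lattice \<Longrightarrow> f (x + k) = f x"
  by (simp add: periodic_def)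

lemma periodic_diffD: "periodic f \<Longrightarrow> k \<in> int_lattice \<Longrightarrow> f (x - k) = f x"
  using periodicD[of f "-k" x] by (simp add: int_lattice_uminus)

text \<open>A translate of the unit cube is another fundamental domain of the lattice.\<close>

lemma nn_integral_periodic_translate:
  fixes f :: "real^'d \<Rightarrow> ennreal"
  assumes [measurable]: "f \<in> borel_measurable lebesgue" and per: "periodic f"
  shows "(\<integral>\<^sup>+x. f (x + t) * indicator unit_cube x \<partial>lebesgue) = (\<integral>\<^sup>+x. f x * indicator unit_cube x \<partial>lebesgue)"
proof -
  have m: "(\<lambda>x. f x * indicator unit_cube (x - t)) \<in> borel_measurable lebesgue"
    using lebesgue_measurable_translate[of "-t", measurable] by simp
  have "(\<integral>\<^sup>+x. f (x + t) * indicator unit_cube x \<partial>lebesgue) = (\<integral>\<^sup>+x. f x * indicator unit_cube (x - t) \<partial>lebesgue)"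
    using nn_integral_translate[OF m, of t] by simp
  also have "\<dots> = (\<integral>\<^sup>+x. (\<integral>\<^sup>+k. f (x + k) * indicator unit_cube (x + k - t) \<partial>count_space int_lattice) * indicator unit_cube x \<partial>lebesgue)"
    by (rule nn_integral_tile[OF m])
  also have "\<dots> = (\<integral>\<^sup>+x. f x * indicator unit_cube x \<partial>lebesgue)"
  proof (rule nn_integral_cong)
    fix x :: "real^'d"
    have "(\<integral>\<^sup>+k. f (x + k) * indicator unit_cube (x + k - t) \<partial>count_space int_lattice)
        = (\<integral>\<^sup>+k. f x * indicator {- lfloor (x - t)} k \<partial>count_space int_lattice)"
    proof (rule nn_integral_cong)
      fix k :: "real^'d" assume "k \<in> space (count_space int_lattice)"
      then have k: "k \<in> int_lattice" by simp
      have "x + k - t \<in> unit_cube \<longleftrightarrow> k = - lfloor (x - t)"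
      proof
        assume "x + k - t \<in> unit_cube"
        then have "- k = lfloor (x - t)" using k by (intro lfloor_unique int_lattice_uminus) (simp_all add: algebra_simps)
        then show "k = - lfloor (x - t)" by (metis minus_minus)
      next
        assume "k = - lfloor (x - t)"
        then show "x + k - t \<in> unit_cube" using diff_lfloor_unit_cube[of "x - t"] by (simp add: algebra_simps)
      qed
      then show "f (x + k) * indicator unit_cube (x + k - t) = f x * indicator {- lfloor (x - t)} k"
        using periodicD[OF per k] by (auto simp: indicator_def)
    qed
    also have "\<dots> = f x" by (simp add: nn_integral_cmult int_lattice_uminus)
    finally show "(\<integral>\<^sup>+k. f (x + k) * indicator unit_cube (x + k - t) \<partial>count_space int_lattice) * indicator unit_cube x
        = f x * indicator unit_cube x" by simp
  qed
  finally show ?thesis .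
qed

text \<open>A periodic property that holds almost everywhere on one fundamental domain holds almost
  everywhere on each of its countably many lattice translates.\<close>

lemma AE_periodic:
  fixes P :: "real^'d \<Rightarrow> bool"
  assumes "AE x in lebesgue. x \<in> unit_cube \<longrightarrow> P x" and per: "periodic P"
  shows "AE x in lebesgue. P x"
proof -
  have "AE x in lebesgue. x - k \<in> unit_cube \<longrightarrow> P (x - k)" for k
    using AE_affine[OF invertible_mat_1 assms(1), of k] by simp
  then have "AE x in lebesgue. \<forall>k\<in>int_lattice. x - k \<in> unit_cube \<longrightarrow> P (x - k)"
    by (intro AE_ball_countable[THEN iffD2] countable_int_lattice) auto
  then show ?thesis
  proof (rule AE_mp, intro AE_I2 impI)
    fix x assume "\<forall>k\<in>int_lattice. x - k \<in> unit_cube \<longrightarrow> P (x - k)"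
    then have "P (x - lfloor x)" by simp
    then show "P x" using periodic_diffD[OF per, of "lfloor x" x] by simp
  qed
qed

text \<open>Representatives of the cosets of the image lattice of \<open>N\<close> in the integer lattice, pulled back
  into the unit cube by the inverse of \<open>N\<close>. For the transpose of the dilation matrix these are the
  shifts in the polyphase matrix; for the dilation matrix itself they split the lattice of shifts.\<close>

definition cube_cosets :: "real^'d^'d \<Rightarrow> (real^'d) set" where
  "cube_cosets N = ((\<lambda>k. matrix_inv N *v k) ` int_lattice) \<inter> unit_cube"

text \<open>The parallelepiped \<open>N [0,1)\<^sup>d\<close> has volume \<open>\<bar>det N\<bar>\<close>, and modulo the lattice it covers
  every point of the unit cube exactly once for each coset of \<open>N \<int>\<^sup>d\<close> in \<open>\<int>\<^sup>d\<close>.\<close>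

lemma card_cube_cosets:
  fixes N :: "real^'d^'d"
  assumes N: "invertible N" "int_matrix N"
  shows "finite (cube_cosets N)" "real (card (cube_cosets N)) = \<bar>det N\<bar>"
proof -
  let ?V = "matrix_inv N"
  let ?c = "emeasure (count_space UNIV) (cube_cosets N)"
  define S where "S x = {k \<in> int_lattice. ?V *v (x + k) \<in> unit_cube}" for x
  define q where "q k = ?V *v k - lfloor (?V *v k)" for k
  have bij: "bij_betw q (S x) (cube_cosets N)" for x
    unfolding bij_betw_def
  proof (intro conjI subset_antisym subsetI)
    show "inj_on q (S x)"
    proof (rule inj_onI)
      fix k k' assume k: "k \<in> S x" "k' \<in> S x" "q k = q k'"
      then have "?V *v (x + k) - ?V *v (x + k') = lfloor (?V *v k) - lfloor (?V *v k')"
        by (simp add: q_def matrix_vector_right_distrib algebra_simps)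
      then have "?V *v (x + k) = ?V *v (x + k')"
        using k by (intro unit_cube_lattice_unique) (auto simp: S_def int_lattice_diff)
      then have "N *v (?V *v (x + k)) = N *v (?V *v (x + k'))" by simp
      then show "k = k'" using N by simp
    qed
    fix w assume "w \<in> q ` S x"
    then obtain k where k: "k \<in> int_lattice" "w = q k" by (auto simp: S_def)
    then have "w = ?V *v (k - N *v lfloor (?V *v k))"
      using N by (simp add: q_def matrix_vector_mult_diff_distrib)
    moreover have "k - N *v lfloor (?V *v k) \<in> int_lattice"
      using k N by (intro int_lattice_diff int_matrix_mult) auto
    moreover have "w \<in> unit_cube" using k by (simp add: q_def)
    ultimately show "w \<in> cube_cosets N" unfolding cube_cosets_def by blast
  next
    fix w assume "w \<in> cube_cosets N"
    then obtain k0 where k0: "k0 \<in> int_lattice" "w = ?V *v k0" and w: "w \<in> unit_cube"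
      by (auto simp: cube_cosets_def)
    define m where "m = lfloor (?V *v (x + k0))"
    have m: "m \<in> int_lattice" by (simp add: m_def)
    have "?V *v (x + (k0 - N *v m)) = ?V *v (x + k0) - m"
      using N by (simp add: matrix_vector_right_distrib matrix_vector_mult_diff_distrib algebra_simps)
    then have "k0 - N *v m \<in> S x"
      using k0 m N by (auto simp: S_def m_def intro!: int_lattice_diff int_matrix_mult)
    moreover have "q (k0 - N *v m) = w"
    proof -
      have e: "?V *v (k0 - N *v m) = w - m" using N k0 by (simp add: matrix_vector_mult_diff_distrib)
      have "- m = lfloor (w - m)" using w m by (intro lfloor_unique int_lattice_uminus) auto
      then show ?thesis unfolding q_def e by (metis diff_minus_eq_add diff_add_cancel)
    qed
    ultimately show "w \<in> q ` S x" by (metis imageI)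
  qed
  have count: "(\<integral>\<^sup>+k. indicator unit_cube (?V *v (x + k)) \<partial>count_space int_lattice) = ?c" for x
  proof -
    have "(\<integral>\<^sup>+k. indicator unit_cube (?V *v (x + k)) \<partial>count_space int_lattice)
        = (\<integral>\<^sup>+k. indicator (S x) k \<partial>count_space int_lattice)"
      by (rule nn_integral_cong) (auto simp: S_def indicator_def)
    also have "\<dots> = emeasure (count_space int_lattice) (S x)"
      by (subst nn_integral_indicator) (auto simp: S_def)
    also have "\<dots> = emeasure (count_space UNIV) (cube_cosets N)"
      using bij_betw_same_card[OF bij, of x] bij_betw_finite[OF bij, of x]
      by (subst (1 2) emeasure_count_space) (auto simp: S_def)
    finally show ?thesis .
  qed
  have m: "(\<lambda>x. indicator unit_cube (?V *v x) :: ennreal) \<in> borel_measurable lebesgue"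
    using lebesgue_measurable_affine[OF invertible_matrix_inv[OF N(1)], of 0, measurable] by simp
  have "ennreal \<bar>det N\<bar> = ennreal \<bar>det N\<bar> * (\<integral>\<^sup>+x. indicator unit_cube x \<partial>(lebesgue :: (real^'d) measure))"
    by simp
  also have "\<dots> = (\<integral>\<^sup>+x. indicator unit_cube (?V *v x) \<partial>lebesgue)"
    using nn_integral_affine[OF N(1) m, of 0] N by simp
  also have "\<dots> = (\<integral>\<^sup>+x. ?c * indicator unit_cube x \<partial>(lebesgue :: (real^'d) measure))"
    unfolding nn_integral_tile[OF m] count ..
  also have "\<dots> = ?c" by (simp add: nn_integral_cmult)
  finally have eq: "?c = ennreal \<bar>det N\<bar>" by simp
  then show fin: "finite (cube_cosets N)"
    by (metis emeasure_count_space_infinite ennreal_neq_top infinity_ennreal_def subset_UNIV)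
  have "ennreal (real (card (cube_cosets N))) = ennreal \<bar>det N\<bar>"
    using eq fin by (simp add: ennreal_of_nat_eq_real_of_nat)
  then show "real (card (cube_cosets N)) = \<bar>det N\<bar>" by simp
qed

section \<open>Fourier series on the unit cube\<close>

abbreviation torus :: "(real^'d) measure" where
  "torus \<equiv> lebesgue_on unit_cube"

text \<open>The sign and the period are those of the Fourier transform: up to the factor $2\pi$ in the
  frequency, a shift by \<open>m\<close> becomes multiplication by \<open>chr m\<close>.\<close>

definition chr :: "real^'d \<Rightarrow> real^'d \<Rightarrow> complex" where
  "chr m x = cis (- (2 * pi * (m \<bullet> x)))"

lemma chr_add_right: "chr m (x + y) = chr m x * chr m y"
  by (simp add: chr_def cis_mult inner_add_right algebra_simps)

lemma chr_diff_right: "chr m (x - y) = chr m x * cnj (chr m y)"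
  by (simp add: chr_def cis_mult cis_cnj inner_diff_right algebra_simps)

lemma chr_add_left: "chr (m + n) x = chr m x * chr n x"
  by (simp add: chr_def cis_mult inner_add_left algebra_simps)

lemma chr_uminus_left: "chr (- m) x = cnj (chr m x)"
  by (simp add: chr_def cis_cnj)

lemma chr_diff_left: "chr (m - n) x = chr m x * cnj (chr n x)"
  using chr_add_left[of m "-n" x] by (simp add: chr_uminus_left)

lemma chr_0_left [simp]: "chr 0 x = 1"
  by (simp add: chr_def)

lemma cmod_chr [simp]: "cmod (chr m x) = 1"
  by (simp add: chr_def)

lemma chr_mult_cnj [simp]: "chr m x * cnj (chr m x) = 1"
  using chr_diff_left[of m m x] by simp

lemma inner_lattice: "m \<in> int_lattice \<Longrightarrow> k \<in> int_lattice \<Longrightarrow> m \<bullet> k \<in> \<int>"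
  by (auto simp: inner_vec_def int_lattice_def intro!: Ints_sum Ints_mult)

lemma cis_int: "t \<in> \<int> \<Longrightarrow> cis (2 * pi * t) = 1"
  by (simp add: cis_multiple_2pi)

lemma chr_lattice: "m \<in> int_lattice \<Longrightarrow> k \<in> int_lattice \<Longrightarrow> chr m k = 1"
  using cis_int[of "- (m \<bullet> k)"] inner_lattice[of m k] by (simp add: chr_def)

lemma periodic_chr: "m \<in> int_lattice \<Longrightarrow> periodic (chr m)"
  by (simp add: periodic_def chr_add_right chr_lattice)

lemma chr_borel [measurable]: "chr m \<in> borel_measurable borel"
  unfolding chr_def by (intro borel_measurable_continuous_onI continuous_intros)

lemma chr_lebesgue [measurable]: "chr m \<in> borel_measurable lebesgue"
  by (rule measurable_completion) (simp add: chr_borel)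

lemma borel_measurable_torusI [measurable (raw)]:
  "f \<in> borel_measurable lebesgue \<Longrightarrow> f \<in> borel_measurable torus"
  by (rule measurable_restrict_space1)

lemma emeasure_torus [simp]: "emeasure torus (unit_cube :: (real^'d) set) = 1"
  by (simp add: emeasure_restrict_space)

lemma finite_measure_torus: "finite_measure (torus :: (real^'d) measure)"
  by (rule finite_measureI) simp

lemma nn_integral_torus: "(\<integral>\<^sup>+x. f x \<partial>torus) = (\<integral>\<^sup>+x. f x * indicator unit_cube x \<partial>lebesgue)"
  by (simp add: nn_integral_restrict_space)

lemma AE_torus_iff: "(AE x in torus. P x) \<longleftrightarrow> (AE x in lebesgue. x \<in> unit_cube \<longrightarrow> P x)"
  by (simp add: AE_restrict_space_iff)

lemma borel_measurable_translate:
  "f \<in> borel_measurable lebesgue \<Longrightarrow> (\<lambda>x::real^'d. f (x + t)) \<in> borel_measurable lebesgue"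
  by (rule measurable_compose[OF lebesgue_measurable_translate])

lemma nn_integral_torus_translate:
  fixes f :: "real^'d \<Rightarrow> ennreal"
  assumes "f \<in> borel_measurable lebesgue" "periodic f"
  shows "(\<integral>\<^sup>+x. f (x + t) \<partial>torus) = (\<integral>\<^sup>+x. f x \<partial>torus)"
  using nn_integral_periodic_translate[OF assms] by (simp add: nn_integral_torus)

lemma integrable_torus_translate:
  fixes f :: "real^'d \<Rightarrow> 'b::{banach, second_countable_topology}"
  assumes m: "f \<in> borel_measurable lebesgue" and per: "periodic f" and int: "integrable torus f"
  shows "integrable torus (\<lambda>x. f (x + t))"
proof (rule integrableI_bounded)
  note [measurable] = m borel_measurable_translate[OF m]
  show "(\<lambda>x. f (x + t)) \<in> borel_measurable torus" by measurable
  have "(\<integral>\<^sup>+x. ennreal (norm (f (x + t))) \<partial>torus) = (\<integral>\<^sup>+x. ennreal (norm (f x)) \<partial>torus)"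
    using per by (intro nn_integral_torus_translate[of "\<lambda>x. ennreal (norm (f x))"]) (auto simp: periodic_def)
  then show "(\<integral>\<^sup>+x. ennreal (norm (f (x + t))) \<partial>torus) < \<infinity>"
    using int by (simp add: integrable_iff_bounded)
qed

lemma integral_torus_translate_real:
  fixes f :: "real^'d \<Rightarrow> real"
  assumes m: "f \<in> borel_measurable lebesgue" and per: "periodic f" and int: "integrable torus f"
  shows "integral\<^sup>L torus (\<lambda>x. f (x + t)) = integral\<^sup>L torus f"
proof -
  note [measurable] = m borel_measurable_translate[OF m]
  have "(\<integral>\<^sup>+x. ennreal (f (x + t)) \<partial>torus) = (\<integral>\<^sup>+x. ennreal (f x) \<partial>torus)"
    "(\<integral>\<^sup>+x. ennreal (- f (x + t)) \<partial>torus) = (\<integral>\<^sup>+x. ennreal (- f x) \<partial>torus)"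
    using per by (intro nn_integral_torus_translate[of "\<lambda>x. ennreal (f x)"]
        nn_integral_torus_translate[of "\<lambda>x. ennreal (- f x)"]; auto simp: periodic_def)+
  then show ?thesis
    using integrable_torus_translate[OF assms, of t] int by (simp add: real_lebesgue_integral_def)
qed

lemma integral_torus_translate:
  fixes f :: "real^'d \<Rightarrow> complex"
  assumes m: "f \<in> borel_measurable lebesgue" and per: "periodic f" and int: "integrable torus f"
  shows "integral\<^sup>L torus (\<lambda>x. f (x + t)) = integral\<^sup>L torus f"
proof -
  note int' = integrable_torus_translate[OF assms, of t]
  note [measurable] = m
  have "integral\<^sup>L torus (\<lambda>x. Re (f (x + t))) = integral\<^sup>L torus (\<lambda>x. Re (f x))"
    using per int by (intro integral_torus_translate_real[of "\<lambda>x. Re (f x)"]) (auto simp: periodic_def)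
  moreover have "integral\<^sup>L torus (\<lambda>x. Im (f (x + t))) = integral\<^sup>L torus (\<lambda>x. Im (f x))"
    using per int by (intro integral_torus_translate_real[of "\<lambda>x. Im (f x)"]) (auto simp: periodic_def)
  ultimately show ?thesis
    using int int' by (simp add: complex_eq_iff)
qed

lemma sqint_torus_bounded:
  assumes "f \<in> borel_measurable (torus :: (real^'d) measure)" "\<And>x. cmod (f x) \<le> B"
  shows "f \<in> sqint torus"
proof -
  interpret finite_measure "torus :: (real^'d) measure" by (rule finite_measure_torus)
  have "integrable torus (\<lambda>x::real^'d. B\<^sup>2)" by simp
  then show ?thesis
    using assms by (intro sqint_bound[of _ _ "\<lambda>_. B\<^sup>2"]) (auto intro: power_mono)
qed

lemma chr_sqint: "chr m \<in> sqint torus"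
  by (rule sqint_torus_bounded[of _ 1]) auto

lemma integrable_torus_sqint:
  assumes "f \<in> sqint (torus :: (real^'d) measure)"
  shows "integrable torus f"
proof -
  have "(\<lambda>_::real^'d. 1) \<in> sqint torus" by (rule sqint_torus_bounded[of _ 1]) auto
  from integrable_prod[OF assms this] show ?thesis by simp
qed

text \<open>Translating a nontrivial character by a suitable vector changes its sign
  without changing its integral over a period.\<close>

lemma integral_chr:
  fixes m :: "real^'d"
  assumes m: "m \<in> int_lattice"
  shows "integral\<^sup>L torus (chr m) = of_bool (m = 0)"
proof (cases "m = 0")
  case True
  have "integral\<^sup>L torus (chr (0 :: real^'d)) = integral\<^sup>L torus (\<lambda>x::real^'d. 1)"
    by (intro Bochner_Integration.integral_cong) auto
  moreover have "integral\<^sup>L torus (\<lambda>x::real^'d. 1::complex) = 1"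
    by (simp add: Sigma_Algebra.measure_def)
  ultimately show ?thesis using True by simp
next
  case False
  then obtain i where i: "vec_nth m i \<noteq> 0" by (auto simp: Finite_Cartesian_Product.vec_eq_iff)
  define t where "t = (axis i (1 / (2 * vec_nth m i)) :: real^'d)"
  have "2 * pi * (m \<bullet> t) = pi" using i by (simp add: t_def inner_axis)
  then have t: "chr m t = -1" unfolding chr_def by (simp only:) (simp add: complex_eq_iff)
  have "integral\<^sup>L torus (chr m) = integral\<^sup>L torus (\<lambda>x. chr m (x + t))"
    using integral_torus_translate[OF chr_lebesgue periodic_chr[OF m] integrable_torus_sqint[OF chr_sqint], of t] by simp
  also have "\<dots> = - integral\<^sup>L torus (chr m)" by (simp add: chr_add_right t)
  finally show ?thesis using False by simp
qed

lemma ip_chr: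
  assumes "m \<in> int_lattice" "n \<in> int_lattice"
  shows "ip torus (chr m) (chr n) = of_bool (m = n)"
  using integral_chr[OF int_lattice_diff[OF assms]] by (simp add: ip_def chr_diff_left[abs_def])

text \<open>The cube wrapped onto the product of unit circles. Unlike the cube with its opposite faces
  identified, this is a compact subset of a Euclidean space, where Stone-Weierstrass applies.\<close>

definition circ :: "real^'d \<Rightarrow> complex^'d" where
  "circ x = vec_lambda (\<lambda>i. cis (2 * pi * vec_nth x i))"

definition uncirc :: "complex^'d \<Rightarrow> real^'d" where
  "uncirc z = vec_lambda (\<lambda>i. Arg2pi (vec_nth z i) / (2 * pi))"

lemma uncirc_circ: "x \<in> unit_cube \<Longrightarrow> uncirc (circ x) = x"
proof -
  assume x: "x \<in> unit_cube"
  have "Arg2pi (cis (2 * pi * vec_nth x i)) = 2 * pi * vec_nth x i" for i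
    using x by (intro Arg2pi_unique[of 1]) (auto simp: unit_cube_def cis_conv_exp)
  then show ?thesis by (simp add: uncirc_def circ_def Finite_Cartesian_Product.vec_eq_iff)
qed

lemma Arg2pi_borel: "Arg2pi \<in> borel_measurable borel"
proof -
  have "(\<lambda>z. if z \<in> \<real>\<^sub>\<ge>\<^sub>0 then 0 else Arg2pi z) \<in> borel_measurable borel"
    by (intro borel_measurable_continuous_on_if continuous_at_imp_continuous_on ballI continuous_at_Arg2pi)
       (auto intro: borel_closed)
  moreover have "(\<lambda>z. if z \<in> \<real>\<^sub>\<ge>\<^sub>0 then 0 else Arg2pi z) = Arg2pi"
  proof
    fix z
    have "Arg2pi z = 0" if "z \<in> \<real>\<^sub>\<ge>\<^sub>0"
      using that by (simp add: Arg2pi_eq_0 complex_nonneg_Reals_iff complex_is_Real_iff)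
    then show "(if z \<in> \<real>\<^sub>\<ge>\<^sub>0 then 0 else Arg2pi z) = Arg2pi z" by simp
  qed
  ultimately show ?thesis by simp
qed

lemma uncirc_borel: "(uncirc :: complex^'d \<Rightarrow> _) \<in> borel_measurable borel"
proof (subst borel_measurable_euclidean_space, rule ballI)
  fix b :: "real^'d" assume "b \<in> Basis"
  then obtain i where b: "b = axis i 1" by (auto simp: Basis_vec_def)
  have "(\<lambda>z::complex^'d. vec_nth z i) \<in> borel_measurable borel"
    by (intro borel_measurable_continuous_onI continuous_intros)
  from measurable_compose[OF this Arg2pi_borel]
  show "(\<lambda>z::complex^'d. uncirc z \<bullet> b) \<in> borel_measurable borel"
    by (simp add: b inner_axis uncirc_def)
qed

lemma continuous_circ: "continuous_on UNIV (circ :: real^'d \<Rightarrow> _)"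
  unfolding circ_def by (intro continuous_intros)

lemma circ_borel: "(circ :: real^'d \<Rightarrow> _) \<in> borel_measurable borel"
  by (rule borel_measurable_continuous_onI[OF continuous_circ])

lemma circ_torus: "(circ :: real^'d \<Rightarrow> _) \<in> borel_measurable torus"
  by (intro borel_measurable_torusI measurable_completion) (simp add: circ_borel)

lemma axis_lattice: "axis i 1 \<in> int_lattice"
  by (auto simp: int_lattice_def axis_def)

text \<open>Real and imaginary parts of a coordinate are half sums and half differences of a character
  and its conjugate.\<close>

lemma Basis_circ:
  assumes "b \<in> (Basis :: (complex^'d) set)"
  obtains i where "\<And>x. complex_of_real (circ x \<bullet> b) = (1/2) * (chr (axis i 1) x + chr (- axis i 1) x)"
  | i where "\<And>x. complex_of_real (circ x \<bullet> b) = (\<i>/2) * chr (axis i 1) x - (\<i>/2) * chr (- axis i 1) x"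
proof -
  obtain i u where b: "b = axis i u" and u: "u = 1 \<or> u = \<i>"
    using assms by (auto simp: Basis_vec_def Basis_complex_def)
  have c: "chr (axis i 1) x = cis (- (2 * pi * vec_nth x i))" "chr (- axis i 1) x = cis (2 * pi * vec_nth x i)" for x
    by (simp_all add: chr_def inner_axis inner_axis')
  show thesis
    using u
  proof
    assume "u = 1"
    then show thesis
      by (intro that(1)[of i] complex_eqI) (simp_all add: b c inner_axis circ_def inner_complex_def)
  next
    assume "u = \<i>"
    then show thesis
      by (intro that(2)[of i] complex_eqI) (simp_all add: b c inner_axis circ_def inner_complex_def)
  qed
qed

text \<open>Uniqueness of Fourier coefficients. Wrapping the cube onto the product of unit circles
  turns trigonometric polynomials into the restrictions of polynomials, so by Stone-Weierstrass
  \<open>f\<close> integrates to zero against all continuous functions on the product of circles, hence against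
  indicators of open sets, hence against indicators of all Borel sets.\<close>

context
  fixes f :: "real^'d \<Rightarrow> complex"
  assumes f: "integrable torus f"
    and zero: "\<And>m. m \<in> int_lattice \<Longrightarrow> integral\<^sup>L torus (\<lambda>x. f x * cnj (chr m x)) = 0"
begin

lemma f_torus [measurable]: "f \<in> borel_measurable torus"
  using f by simp

lemma integrable_mult_bounded:
  assumes "h \<in> borel_measurable torus" "\<And>x. cmod (h x) \<le> B"
  shows "integrable torus (\<lambda>x. f x * h x)"
proof (rule Bochner_Integration.integrable_bound)
  show "integrable torus (\<lambda>x. B * cmod (f x))" using f by simp
  have "B \<ge> 0" using assms(2)[of undefined] norm_ge_zero order_trans by blast
  show "AE x in torus. norm (f x * h x) \<le> norm (B * cmod (f x))"
  proof (rule AE_I2)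
    fix x
    show "norm (f x * h x) \<le> norm (B * cmod (f x))"
      using mult_left_mono[OF assms(2)[of x] norm_ge_zero[of "f x"]] \<open>B \<ge> 0\<close>
      by (simp add: norm_mult abs_mult mult.commute)
  qed
qed (use assms(1) in measurable)

text \<open>The multipliers that keep all Fourier coefficients zero.\<close>

definition ann :: "(real^'d \<Rightarrow> complex) set" where
  "ann = {h. h \<in> borel_measurable torus \<and> (\<exists>B. \<forall>x. cmod (h x) \<le> B) \<and>
    (\<forall>m\<in>int_lattice. integral\<^sup>L torus (\<lambda>x. f x * (chr m x * h x)) = 0)}"

lemma ann_integrable:
  assumes "h \<in> ann" shows "integrable torus (\<lambda>x. f x * (chr m x * h x))"
proof -
  obtain B where B: "\<And>x. cmod (h x) \<le> B" and [measurable]: "h \<in> borel_measurable torus"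
    using assms by (auto simp: ann_def)
  show ?thesis
    by (rule integrable_mult_bounded[of _ B]) (auto simp: norm_mult B)
qed

lemma ann_1: "(\<lambda>_. 1) \<in> ann"
  using zero[OF int_lattice_uminus] by (auto simp: ann_def chr_uminus_left intro!: exI[of _ 1])

lemma ann_add: assumes "g \<in> ann" "h \<in> ann" shows "(\<lambda>x. g x + h x) \<in> ann"
proof -
  obtain B C where B: "\<And>x. cmod (g x) \<le> B" and C: "\<And>x. cmod (h x) \<le> C"
    and m[measurable]: "g \<in> borel_measurable torus" "h \<in> borel_measurable torus"
    using assms by (auto simp: ann_def)
  have "cmod (g x + h x) \<le> B + C" for x
    using norm_triangle_ineq[of "g x" "h x"] B[of x] C[of x] by linarith
  then show ?thesis
    using assms ann_integrable[OF assms(1)] ann_integrable[OF assms(2)]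
    by (auto simp: ann_def distrib_left)
qed

lemma ann_cmult: assumes "h \<in> ann" shows "(\<lambda>x. c * h x) \<in> ann"
proof -
  obtain C where C: "\<And>x. cmod (h x) \<le> C" and [measurable]: "h \<in> borel_measurable torus"
    using assms by (auto simp: ann_def)
  have "cmod (c * h x) \<le> cmod c * C" for x by (simp add: norm_mult mult_left_mono C)
  moreover have "integral\<^sup>L torus (\<lambda>x. f x * (chr m x * (c * h x))) = c * integral\<^sup>L torus (\<lambda>x. f x * (chr m x * h x))" for m
    by (subst integral_mult_right_zero[symmetric]) (simp add: mult_ac)
  ultimately show ?thesis using assms by (auto simp: ann_def)
qed

lemma ann_chr: assumes "h \<in> ann" "n \<in> int_lattice" shows "(\<lambda>x. chr n x * h x) \<in> ann"
proof -
  have "f x * (chr m x * (chr n x * h x)) = f x * (chr (m + n) x * h x)" for m x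
    by (simp only: chr_add_left mult.assoc)
  then have "integral\<^sup>L torus (\<lambda>x. f x * (chr m x * (chr n x * h x))) = integral\<^sup>L torus (\<lambda>x. f x * (chr (m + n) x * h x))" for m
    by presburger
  then show ?thesis using assms by (auto simp: ann_def norm_mult int_lattice_add)
qed

lemma ann_sum: "(\<And>i. i \<in> F \<Longrightarrow> h i \<in> ann) \<Longrightarrow> (\<lambda>x. \<Sum>i\<in>F. h i x) \<in> ann"
  using ann_cmult[OF ann_1, of 0] by (induction F rule: infinite_finite_induct) (auto intro: ann_add)

text \<open>The multipliers form a module over the trigonometric polynomials, and the coordinates of
  \<open>circ\<close> are trigonometric polynomials.\<close>

lemma ann_polynomial:
  assumes "real_polynomial_function (p :: complex^'d \<Rightarrow> real)" "h \<in> ann"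
  shows "(\<lambda>x. complex_of_real (p (circ x)) * h x) \<in> ann"
  using assms
proof (induction p arbitrary: h rule: real_polynomial_function.induct)
  case (linear L)
  have comp: "(\<lambda>x. complex_of_real (circ x \<bullet> b) * h x) \<in> ann" if "b \<in> Basis" for b
  proof (rule Basis_circ[OF that])
    fix i assume eq: "\<And>x. complex_of_real (circ x \<bullet> b) = (1/2) * (chr (axis i 1) x + chr (- axis i 1) x)"
    have "(\<lambda>x. (1/2) * (chr (axis i 1) x * h x + chr (- axis i 1) x * h x)) \<in> ann"
      by (intro ann_cmult ann_add ann_chr linear.prems axis_lattice int_lattice_uminus)
    then show ?thesis unfolding eq by (simp add: distrib_right)
  next
    fix i assume eq: "\<And>x. complex_of_real (circ x \<bullet> b) = (\<i>/2) * chr (axis i 1) x - (\<i>/2) * chr (- axis i 1) x"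
    have "(\<lambda>x. (\<i>/2) * (chr (axis i 1) x * h x) + (- \<i>/2) * (chr (- axis i 1) x * h x)) \<in> ann"
      by (intro ann_cmult ann_add ann_chr linear.prems axis_lattice int_lattice_uminus)
    then show ?thesis unfolding eq by (simp add: algebra_simps)
  qed
  have "L z = (\<Sum>b\<in>Basis. (z \<bullet> b) * L b)" for z
  proof -
    have "L z = L (\<Sum>b\<in>Basis. (z \<bullet> b) *\<^sub>R b)" by (simp add: euclidean_representation)
    also have "\<dots> = (\<Sum>b\<in>Basis. (z \<bullet> b) * L b)"
      by (simp add: linear_sum[OF bounded_linear.linear[OF linear.hyps]] linear_scale[OF bounded_linear.linear[OF linear.hyps]])
    finally show ?thesis .
  qed
  then have "(\<lambda>x. complex_of_real (L (circ x)) * h x) = (\<lambda>x. complex_of_real (\<Sum>b\<in>Basis. (circ x \<bullet> b) * L b) * h x)"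
    by (rule_tac ext) (rule arg_cong)
  also have "\<dots> = (\<lambda>x. \<Sum>b\<in>Basis. complex_of_real (L b) * (complex_of_real (circ x \<bullet> b) * h x))"
    by (simp only: of_real_sum of_real_mult sum_distrib_right sum_distrib_left mult_ac)
  also have "\<dots> \<in> ann" by (intro ann_sum ann_cmult comp)
  finally show ?case .
next
  case (const c)
  then show ?case by (rule ann_cmult)
next
  case (add p q)
  then show ?case using ann_add[of "\<lambda>x. complex_of_real (p (circ x)) * h x" "\<lambda>x. complex_of_real (q (circ x)) * h x"]
    by (simp add: distrib_right)
next
  case (mult p q)
  from mult.IH(1)[OF mult.IH(2)[OF mult.prems]] show ?case by (simp add: mult.assoc)
qed

lemma integral_continuous_zero:
  fixes g :: "complex^'d \<Rightarrow> real"
  assumes g: "continuous_on UNIV g"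
  shows "integral\<^sup>L torus (\<lambda>x. f x * complex_of_real (g (circ x))) = 0"
proof -
  let ?K = "range circ :: (complex^'d) set"
  have K: "compact ?K"
  proof -
    have "?K = circ ` cbox 0 One"
    proof (intro subset_antisym subsetI)
      fix z :: "complex^'d" assume "z \<in> ?K"
      then obtain x where z: "z = circ x" by auto
      have "circ x = circ (x - lfloor x)"
        using cis_int[of "- of_int _"] by (auto simp: circ_def Finite_Cartesian_Product.vec_eq_iff lfloor_def right_diff_distrib cis_divide[symmetric] cis_int)
      moreover have "x - lfloor x \<in> cbox 0 One"
        using unit_cube_subset_cbox diff_lfloor_unit_cube by blast
      ultimately show "z \<in> circ ` cbox 0 One" using z by blast
    qed auto
    then show ?thesis
      using compact_continuous_image[OF continuous_on_subset[OF continuous_circ] compact_cbox] by auto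
  qed
  let ?I = "integral\<^sup>L torus (\<lambda>x. f x * complex_of_real (g (circ x)))"
  let ?N = "integral\<^sup>L torus (\<lambda>x. cmod (f x))"
  note [measurable] = circ_torus borel_measurable_continuous_onI[OF g]
  have "compact (g ` ?K)" by (rule compact_continuous_image[OF continuous_on_subset[OF g] K]) simp
  then obtain B where B: "\<And>x. \<bar>g (circ x)\<bar> \<le> B"
    using compact_imp_bounded[of "g ` ?K"] unfolding bounded_iff by (force simp: image_iff)
  have intg: "integrable torus (\<lambda>x. f x * complex_of_real (g (circ x)))"
    by (rule integrable_mult_bounded[of _ B]) (auto simp: B)
  have "cmod ?I \<le> e * ?N" if e: "e > 0" for e
  proof -
    obtain p where p: "real_polynomial_function p" and close: "\<And>z. z \<in> ?K \<Longrightarrow> \<bar>g z - p z\<bar> < e"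
      using Stone_Weierstrass_real_polynomial_function[OF K continuous_on_subset[OF g] e] by blast
    have pann: "(\<lambda>x. complex_of_real (p (circ x)) * 1) \<in> ann" by (rule ann_polynomial[OF p ann_1])
    then have p0: "integral\<^sup>L torus (\<lambda>x. f x * complex_of_real (p (circ x))) = 0"
      by (auto simp: ann_def dest: bspec[of _ _ 0])
    have intp: "integrable torus (\<lambda>x. f x * complex_of_real (p (circ x)))"
      using ann_integrable[OF pann, of 0] by simp
    have "?I = integral\<^sup>L torus (\<lambda>x. f x * complex_of_real (g (circ x)) - f x * complex_of_real (p (circ x)))"
      using intg intp p0 by simp
    also have "cmod \<dots> \<le> integral\<^sup>L torus (\<lambda>x. e * cmod (f x))"
    proof (rule order_trans[OF integral_norm_bound], rule integral_mono)
      show "integrable torus (\<lambda>x. norm (f x * complex_of_real (g (circ x)) - f x * complex_of_real (p (circ x))))"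
        using intg intp by (intro integrable_norm Bochner_Integration.integrable_diff)
      fix x
      have "norm (f x * complex_of_real (g (circ x)) - f x * complex_of_real (p (circ x))) = cmod (f x) * \<bar>g (circ x) - p (circ x)\<bar>"
        by (simp add: norm_mult flip: right_diff_distrib of_real_diff)
      also have "\<dots> \<le> cmod (f x) * e" using close[of "circ x"] by (intro mult_left_mono) auto
      finally show "norm (f x * complex_of_real (g (circ x)) - f x * complex_of_real (p (circ x))) \<le> e * cmod (f x)"
        by (simp add: mult.commute)
    qed (use f in simp)
    also have "\<dots> = e * ?N" by simp
    finally show ?thesis .
  qed
  note bound = this
  have "cmod ?I \<le> 0"
  proof (rule field_le_epsilon)
    fix e :: real assume e: "e > 0"
    have N: "?N \<ge> 0" by simp
    have "cmod ?I \<le> (e / (?N + 1)) * ?N" using e N by (intro bound) (simp add: add_nonneg_pos)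
    also have "\<dots> = e * (?N / (?N + 1))" by simp
    also have "\<dots> \<le> e * 1"
      using e N by (intro mult_left_mono divide_le_eq_1[THEN iffD2] disjI1 conjI add_nonneg_pos) auto
    finally show "cmod ?I \<le> 0 + e" by simp
  qed
  then show ?thesis by simp
qed

text \<open>The indicator of an open set is an increasing limit of continuous functions of the distance
  to its complement.\<close>

lemma integral_open_zero:
  fixes U :: "(complex^'d) set"
  assumes U: "open U"
  shows "integral\<^sup>L torus (\<lambda>x. f x * indicator U (circ x)) = 0"
proof (cases "U = UNIV")
  case True
  then show ?thesis using integral_continuous_zero[of "\<lambda>_. 1"] by simp
next
  case False
  define g where "g n z = min 1 (real n * infdist z (- U))" for n z
  have cont: "continuous_on UNIV (g n)" for n
    unfolding g_def by (intro continuous_intros)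
  note [measurable] = circ_torus borel_measurable_continuous_onI[OF cont]
  have U'[measurable]: "U \<in> sets borel" using U by simp
  have g01: "0 \<le> g n z" "g n z \<le> 1" for n z by (auto simp: g_def infdist_nonneg)
  have lim: "(\<lambda>n. g n z) \<longlonglongrightarrow> indicator U z" for z
  proof (cases "z \<in> U")
    case True
    then have "infdist z (- U) \<noteq> 0"
      using in_closed_iff_infdist_zero[of "- U" z] U False by (auto simp: closed_def)
    then have d: "infdist z (- U) > 0" using infdist_nonneg[of z "- U"] by simp
    obtain N :: nat where N: "1 / infdist z (- U) \<le> real N" using real_arch_simple by blast
    have "g n z = 1" if "n \<ge> N" for n
    proof -
      have "1 \<le> real N * infdist z (- U)" using N d by (simp add: field_simps)
      also have "\<dots> \<le> real n * infdist z (- U)" using that d by (intro mult_right_mono) auto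
      finally show ?thesis by (simp add: g_def)
    qed
    then have "\<forall>\<^sub>F n in sequentially. g n z = 1" by (auto simp: eventually_sequentially)
    then show ?thesis using True by (simp add: tendsto_eventually)
  next
    case False
    then show ?thesis by (simp add: g_def)
  qed
  have "(\<lambda>n. integral\<^sup>L torus (\<lambda>x. f x * complex_of_real (g n (circ x)))) \<longlonglongrightarrow> integral\<^sup>L torus (\<lambda>x. f x * indicator U (circ x))"
  proof (rule integral_dominated_convergence[where w="\<lambda>x. cmod (f x)"])
    show "AE x in torus. (\<lambda>n. f x * complex_of_real (g n (circ x))) \<longlonglongrightarrow> f x * indicator U (circ x)"
    proof (rule AE_I2)
      fix x
      have "(\<lambda>n. complex_of_real (g n (circ x))) \<longlonglongrightarrow> complex_of_real (indicator U (circ x))"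
        by (intro tendsto_of_real lim)
      then show "(\<lambda>n. f x * complex_of_real (g n (circ x))) \<longlonglongrightarrow> f x * indicator U (circ x)"
        by (intro tendsto_mult_left) (cases "circ x \<in> U"; simp)
    qed
    show "AE x in torus. norm (f x * complex_of_real (g n (circ x))) \<le> cmod (f x)" for n
      using g01 by (auto simp: norm_mult mult_left_le)
  qed (use f in \<open>auto intro!: borel_measurable_times measurable_compose[OF circ_torus borel_measurable_indicator]\<close>)
  then show ?thesis
    by (simp add: integral_continuous_zero[OF cont] LIMSEQ_const_iff)
qed

lemma integral_borel_zero:
  fixes B :: "(complex^'d) set"
  assumes "B \<in> sets borel"
  shows "integral\<^sup>L torus (\<lambda>x. f x * indicator B (circ x)) = 0"
proof -
  have ind: "(\<lambda>x. indicator A (circ x) :: complex) \<in> borel_measurable torus" if "A \<in> sets borel" for A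
    using measurable_compose[OF circ_torus borel_measurable_indicator[OF that]] .
  have int: "integrable torus (\<lambda>x. f x * indicator A (circ x))" if "A \<in> sets borel" for A
    by (rule integrable_mult_bounded[OF ind[OF that], of 1]) (auto simp: indicator_def)
  have "Int_stable {U :: (complex^'d) set. open U}" "{U :: (complex^'d) set. open U} \<subseteq> Pow UNIV"
    "B \<in> sigma_sets UNIV {U. open U}"
    using assms by (auto simp: borel_def Int_stable_def)
  then show ?thesis
  proof (induction rule: sigma_sets_induct_disjoint)
    case (basic A)
    then show ?case by (intro integral_open_zero) simp
  next
    case (compl A)
    have A: "A \<in> sets borel" using compl by (simp add: borel_def)
    have "integral\<^sup>L torus (\<lambda>x. f x * indicator (UNIV - A) (circ x))
        = integral\<^sup>L torus (\<lambda>x. f x * indicator UNIV (circ x) - f x * indicator A (circ x))"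
      by (intro Bochner_Integration.integral_cong refl) (auto simp: indicator_def)
    also have "\<dots> = 0"
      using int[OF A] int[of UNIV] compl integral_open_zero[of UNIV] by (subst Bochner_Integration.integral_diff) auto
    finally show ?case .
  next
    case (union A)
    have A: "A n \<in> sets borel" for n using union(2) by (auto simp: borel_def)
    have partial: "integral\<^sup>L torus (\<lambda>x. f x * indicator (\<Union>i<n. A i) (circ x)) = 0" for n
    proof -
      have "integral\<^sup>L torus (\<lambda>x. f x * indicator (\<Union>i<n. A i) (circ x))
          = integral\<^sup>L torus (\<lambda>x. \<Sum>i<n. f x * indicator (A i) (circ x))"
      proof (intro Bochner_Integration.integral_cong refl)
        fix x
        have "disjoint_family_on A {..<n}" using union(1) by (rule disjoint_family_on_mono[rotated]) simp
        then show "f x * indicator (\<Union>i<n. A i) (circ x) = (\<Sum>i<n. f x * indicator (A i) (circ x))"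
          by (simp add: indicator_UN_disjoint sum_distrib_left)
      qed
      also have "\<dots> = (\<Sum>i<n. integral\<^sup>L torus (\<lambda>x. f x * indicator (A i) (circ x)))"
        by (rule Bochner_Integration.integral_sum) (rule int[OF A])
      also have "\<dots> = 0" using union(3) by simp
      finally show ?thesis .
    qed
    have "(\<lambda>n. integral\<^sup>L torus (\<lambda>x. f x * indicator (\<Union>i<n. A i) (circ x)))
        \<longlonglongrightarrow> integral\<^sup>L torus (\<lambda>x. f x * indicator (\<Union>i. A i) (circ x))"
    proof (rule integral_dominated_convergence[where w="\<lambda>x. cmod (f x)"])
      show "AE x in torus. (\<lambda>n. f x * indicator (\<Union>i<n. A i) (circ x)) \<longlonglongrightarrow> f x * indicator (\<Union>i. A i) (circ x)"
        by (intro AE_I2 tendsto_mult_left LIMSEQ_indicator_UN)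
      show "AE x in torus. norm (f x * indicator (\<Union>i<n. A i) (circ x)) \<le> cmod (f x)" for n
        by (auto simp: indicator_def)
    qed (use f A in \<open>auto intro!: borel_measurable_times ind\<close>)
    then show ?case unfolding partial by (simp add: LIMSEQ_const_iff)
  qed simp
qed

lemma fourier_coefficients_zero: "AE x in torus. f x = 0"
proof -
  interpret finite_measure "torus :: (real^'d) measure" by (rule finite_measure_torus)
  show ?thesis
  proof (rule density_zero[OF f])
    fix A assume "A \<in> sets (torus :: (real^'d) measure)"
    then obtain A' where A': "A' \<in> sets lebesgue" and A: "A = unit_cube \<inter> A'"
      by (auto simp: sets_restrict_space)
    obtain C N where C: "fsigma C" and N: "N \<in> null_sets lebesgue" and CN: "C \<union> N = A'"
      using lebesgue_set_almost_fsigma[OF A'] by blast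
    have Cb[measurable]: "C \<in> sets borel"
      using C by cases (auto intro!: sets.countable_UN)
    define B where "B = uncirc -` C"
    have B[measurable]: "B \<in> sets borel"
      using measurable_sets[OF uncirc_borel Cb] by (simp add: B_def)
    have Cl: "C \<in> sets lebesgue" using Cb by simp
    note [measurable] = A' Cl
    have "set_lebesgue_integral torus A f = integral\<^sup>L torus (\<lambda>x. f x * indicator B (circ x))"
      unfolding set_lebesgue_integral_def
    proof (rule integral_cong_AE)
      have "AE x in lebesgue. x \<notin> N" using N by (rule AE_not_in)
      then show "AE x in torus. indicator A x *\<^sub>R f x = f x * indicator B (circ x)"
        unfolding AE_torus_iff
      proof (rule AE_mp, intro AE_I2 impI)
        fix x assume "x \<notin> N" and x: "x \<in> unit_cube"
        then have "x \<in> A \<longleftrightarrow> circ x \<in> B"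
          using CN A uncirc_circ[OF x] by (auto simp: B_def)
        then show "indicator A x *\<^sub>R f x = f x * indicator B (circ x)" by (simp add: indicator_def)
      qed
      show "(\<lambda>x. indicator A x *\<^sub>R f x) \<in> borel_measurable torus"
        using \<open>A \<in> sets torus\<close> by measurable
      show "(\<lambda>x. f x * indicator B (circ x)) \<in> borel_measurable torus"
        by (intro borel_measurable_times f_torus measurable_compose[OF circ_torus borel_measurable_indicator] B)
    qed
    then show "set_lebesgue_integral torus A f = 0" by (simp add: integral_borel_zero[OF B])
  qed
qed

end

interpretation chr: orthonormal_family "torus :: (real^'d) measure" int_lattice chr
  by unfold_locales (auto simp: chr_sqint ip_chr)

lemma chr_basis: "biorthogonal_riesz (torus :: (real^'d) measure) int_lattice chr chr"
proof (rule chr.total_imp_biorthogonal_riesz)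
  fix f :: "real^'d \<Rightarrow> complex"
  assume "f \<in> sqint torus" "\<And>m. m \<in> int_lattice \<Longrightarrow> ip torus f (chr m) = 0"
  then show "AE x in torus. f x = 0"
    by (intro fourier_coefficients_zero integrable_torus_sqint) (auto simp: ip_def)
qed (rule countable_int_lattice)

section \<open>Plancherel's theorem\<close>

lemma L2_eq_sqint: "L2 = sqint lebesgue"
  by (simp add: L2_def sqint_def)

lemma norm_L2_eq_nrm: "norm_L2 f = nrm lebesgue f"
  by (simp add: norm_L2_def nrm_def)

lemma inner_L2_eq_ip: "inner_L2 f g = ip lebesgue f g"
  by (simp add: inner_L2_def ip_def)

text \<open>Sums over lattices arise as integrals from the tiling of space and as unordered sums from
  Parseval's identity.\<close>

lemma nn_integral_count_space_has_sum:
  fixes f :: "'i \<Rightarrow> real"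
  assumes A: "countable A" and nonneg: "\<And>i. f i \<ge> 0" and sum: "(f has_sum S) A"
  shows "(\<integral>\<^sup>+i. ennreal (f i) \<partial>count_space A) = ennreal S"
proof -
  obtain F :: "nat \<Rightarrow> 'i set" where F: "\<And>n. finite (F n)" "\<And>n. F n \<subseteq> A" "mono F"
    and lim: "filterlim F (finite_subsets_at_top A) sequentially"
    using exhaustion[OF A] by blast
  have inc: "incseq (\<lambda>n i. ennreal (f i) * indicator (F n) i)"
    using F(3) by (auto simp: incseq_def le_fun_def mono_def indicator_def)
  have sup: "(SUP n. ennreal (f i) * indicator (F n) i) = ennreal (f i)" if "i \<in> A" for i
  proof (rule antisym)
    show "(SUP n. ennreal (f i) * indicator (F n) i) \<le> ennreal (f i)"
      by (intro SUP_least) (auto simp: indicator_def)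
    have "\<forall>\<^sub>F n in sequentially. {i} \<subseteq> F n"
      using lim that unfolding filterlim_finite_subsets_at_top by (auto elim!: allE[of _ "{i}"] eventually_mono)
    then obtain n where "i \<in> F n" unfolding eventually_sequentially by auto
    then show "ennreal (f i) \<le> (SUP n. ennreal (f i) * indicator (F n) i)"
      by (intro SUP_upper2[of n]) auto
  qed
  have "(\<integral>\<^sup>+i. ennreal (f i) \<partial>count_space A) = (\<integral>\<^sup>+i. (SUP n. ennreal (f i) * indicator (F n) i) \<partial>count_space A)"
    by (intro nn_integral_cong) (simp add: sup)
  also have "\<dots> = (SUP n. \<integral>\<^sup>+i. ennreal (f i) * indicator (F n) i \<partial>count_space A)"
    by (rule nn_integral_monotone_convergence_SUP[OF inc]) simp
  also have "(\<lambda>n. \<integral>\<^sup>+i. ennreal (f i) * indicator (F n) i \<partial>count_space A) = (\<lambda>n. ennreal (\<Sum>i\<in>F n. f i))"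
  proof
    fix n
    have "(\<integral>\<^sup>+i. ennreal (f i) * indicator (F n) i \<partial>count_space A) = (\<Sum>i\<in>F n. ennreal (f i) * indicator (F n) i)"
      using F by (intro nn_integral_count_space') auto
    also have "\<dots> = (\<Sum>i\<in>F n. ennreal (f i))" by (intro sum.cong) auto
    finally show "(\<integral>\<^sup>+i. ennreal (f i) * indicator (F n) i \<partial>count_space A) = ennreal (\<Sum>i\<in>F n. f i)"
      by (simp add: sum_ennreal nonneg)
  qed
  also have "(SUP n. ennreal (\<Sum>i\<in>F n. f i)) = ennreal S"
  proof (rule LIMSEQ_unique)
    have "incseq (\<lambda>n. ennreal (\<Sum>i\<in>F n. f i))"
      using F(1,3) by (auto simp: incseq_def mono_def intro!: ennreal_leI sum_mono2 nonneg)
    then show "(\<lambda>n. ennreal (\<Sum>i\<in>F n. f i)) \<longlonglongrightarrow> (SUP n. ennreal (\<Sum>i\<in>F n. f i))"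
      by (rule LIMSEQ_SUP)
    have "(\<lambda>n. sum f (F n)) \<longlonglongrightarrow> S"
      using filterlim_compose[OF sum[unfolded has_sum_def] lim] .
    then show "(\<lambda>n. ennreal (\<Sum>i\<in>F n. f i)) \<longlonglongrightarrow> ennreal S" by (rule tendsto_ennrealI)
  qed
  finally show ?thesis .
qed

lemma matrix_inner_transpose:
  fixes A :: "real^'d^'d"
  shows "(A *v x) \<bullet> y = x \<bullet> (transpose A *v y)"
  by (metis dot_lmul_matrix inner_commute transpose_matrix_vector)

lemma cis_inner_borel [measurable]: "(\<lambda>x::real^'d. cis (- (x \<bullet> \<xi>))) \<in> borel_measurable lebesgue"
proof (rule measurable_completion)
  have "(\<lambda>x::real^'d. cis (- (x \<bullet> \<xi>))) \<in> borel_measurable borel"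
    by (intro borel_measurable_continuous_onI continuous_intros)
  then show "(\<lambda>x::real^'d. cis (- (x \<bullet> \<xi>))) \<in> borel_measurable lborel" by simp
qed

lemma integrable_unimodular:
  fixes f g :: "'a \<Rightarrow> complex"
  assumes f: "integrable M f" and g: "g \<in> borel_measurable M" "\<And>x. cmod (g x) = 1"
  shows "integrable M (\<lambda>x. f x * g x)"
proof (rule Bochner_Integration.integrable_bound[OF f])
  show "(\<lambda>x. f x * g x) \<in> borel_measurable M" using f g(1) by (intro borel_measurable_times) auto
qed (simp add: norm_mult g)

lemma fourier_L1_integrable:
  "integrable lebesgue f \<Longrightarrow> integrable lebesgue (\<lambda>x::real^'d. f x * cis (- (x \<bullet> \<xi>)))"
  by (rule integrable_unimodular) auto

lemma fourier_L1_diff: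
  assumes "integrable lebesgue f" "integrable lebesgue g"
  shows "fourier_L1 (\<lambda>x::real^'d. f x - g x) = (\<lambda>\<xi>. fourier_L1 f \<xi> - fourier_L1 g \<xi>)"
  unfolding fourier_L1_def using fourier_L1_integrable[OF assms(1)] fourier_L1_integrable[OF assms(2)]
  by (simp add: fun_eq_iff left_diff_distrib)

lemma fourier_L1_lincomb:
  assumes "\<And>i. i \<in> F \<Longrightarrow> integrable lebesgue (h i)"
  shows "fourier_L1 (\<lambda>x::real^'d. \<Sum>i\<in>F. c i * h i x) \<xi> = (\<Sum>i\<in>F. c i * fourier_L1 (h i) \<xi>)"
proof -
  have "fourier_L1 (\<lambda>x. \<Sum>i\<in>F. c i * h i x) \<xi> = integral\<^sup>L lebesgue (\<lambda>x. \<Sum>i\<in>F. c i * (h i x * cis (- (x \<bullet> \<xi>))))"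
    unfolding fourier_L1_def by (simp add: sum_distrib_right mult.assoc)
  also have "\<dots> = (\<Sum>i\<in>F. c i * fourier_L1 (h i) \<xi>)"
    unfolding fourier_L1_def
    by (subst Bochner_Integration.integral_sum) (auto intro!: fourier_L1_integrable assms)
  finally show ?thesis .
qed

lemma continuous_fourier_L1:
  fixes f :: "real^'d \<Rightarrow> complex"
  assumes f: "integrable lebesgue f"
  shows "continuous_on UNIV (fourier_L1 f)"
proof (rule continuous_at_imp_continuous_on, rule ballI)
  fix \<xi> :: "real^'d"
  show "isCont (fourier_L1 f) \<xi>"
    unfolding continuous_at_sequentially comp_def fourier_L1_def
  proof (intro allI impI)
    fix u :: "nat \<Rightarrow> real^'d" assume u: "u \<longlonglongrightarrow> \<xi>"
    show "(\<lambda>n. integral\<^sup>L lebesgue (\<lambda>x. f x * cis (- (x \<bullet> u n)))) \<longlonglongrightarrow> integral\<^sup>L lebesgue (\<lambda>x. f x * cis (- (x \<bullet> \<xi>)))"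
    proof (rule integral_dominated_convergence[where w="\<lambda>x. cmod (f x)"])
      show "AE x in lebesgue. (\<lambda>n. f x * cis (- (x \<bullet> u n))) \<longlonglongrightarrow> f x * cis (- (x \<bullet> \<xi>))"
        by (intro AE_I2 tendsto_intros u)
      show "AE x in lebesgue. norm (f x * cis (- (x \<bullet> u n))) \<le> cmod (f x)" for n
        by (simp add: norm_mult)
    qed (use f fourier_L1_integrable[OF f] in auto)
  qed
qed

lemma fourier_L1_measurable:
  fixes f :: "real^'d \<Rightarrow> complex"
  assumes "integrable lebesgue f"
  shows "fourier_L1 f \<in> borel_measurable lebesgue"
  by (rule measurable_completion) (simp add: borel_measurable_continuous_onI[OF continuous_fourier_L1[OF assms]])

lemma integrable_dilate_shift:
  assumes "invertible U" "integrable lebesgue f"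
  shows "integrable lebesgue (dilate_shift U k f)"
  unfolding dilate_shift_def using integrable_affine[OF assms] by simp

lemma invertible_transpose: "invertible (A :: real^'d^'d) \<Longrightarrow> invertible (transpose A)"
  by (simp add: invertible_det_nz det_transpose)

text \<open>Substitution turns the dilation by \<open>U\<close> into the one by its inverse transpose, with the
  normalizing factors matching, and the shift into a modulation.\<close>

lemma fourier_L1_dilate_shift:
  fixes u :: "real^'d \<Rightarrow> complex"
  assumes U: "invertible U" and u: "integrable lebesgue u"
  shows "fourier_L1 (dilate_shift U k u) \<xi>
    = cis (- ((matrix_inv U *v k) \<bullet> \<xi>)) * dilate_shift (transpose (matrix_inv U)) 0 (fourier_L1 u) \<xi>"
proof -
  let ?V = "matrix_inv U" and ?d = "\<bar>det U\<bar>"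
  define h where "h y = u y * cis (- ((?V *v (y + k)) \<bullet> \<xi>))" for y
  have h_eq: "h y = cis (- ((?V *v k) \<bullet> \<xi>)) * (u y * cis (- (y \<bullet> (transpose ?V *v \<xi>))))" for y
  proof -
    have "(?V *v (y + k)) \<bullet> \<xi> = (?V *v k) \<bullet> \<xi> + y \<bullet> (transpose ?V *v \<xi>)"
      by (simp only: matrix_vector_right_distrib inner_add_left matrix_inner_transpose[of ?V y] add.commute)
    moreover have "cis (- (a + b)) = cis (- a) * cis (- b)" for a b by (simp add: cis_mult)
    ultimately show ?thesis by (simp only: h_def mult_ac)
  qed
  have m: "h \<in> borel_measurable lebesgue"
    unfolding h_eq[abs_def] using u by (intro borel_measurable_times) auto
  have T: "h (U *v x - k) = u (U *v x - k) * cis (- (x \<bullet> \<xi>))" for x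
    by (simp add: h_def U)
  have "integral\<^sup>L lebesgue h = ?d *\<^sub>R integral\<^sup>L lebesgue (\<lambda>x. u (U *v x - k) * cis (- (x \<bullet> \<xi>)))"
    using integral_affine[OF U m, of k] by (simp add: T)
  moreover have "integral\<^sup>L lebesgue h = cis (- ((?V *v k) \<bullet> \<xi>)) * fourier_L1 u (transpose ?V *v \<xi>)"
    by (simp add: h_eq[abs_def] fourier_L1_def)
  moreover have "fourier_L1 (dilate_shift U k u) \<xi>
      = complex_of_real (sqrt ?d) * integral\<^sup>L lebesgue (\<lambda>x. u (U *v x - k) * cis (- (x \<bullet> \<xi>)))"
    by (simp add: fourier_L1_def dilate_shift_def mult.assoc)
  moreover have "sqrt ?d = sqrt (inverse ?d) * ?d"
  proof -
    have "?d * inverse (sqrt ?d) = sqrt ?d"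
      using real_div_sqrt[of ?d] by (simp only: divide_inverse abs_ge_zero)
    then show ?thesis by (simp only: real_sqrt_inverse mult.commute)
  qed
  ultimately have "fourier_L1 (dilate_shift U k u) \<xi>
      = complex_of_real (sqrt (inverse ?d)) * (cis (- ((?V *v k) \<bullet> \<xi>)) * fourier_L1 u (transpose ?V *v \<xi>))"
    by (simp add: scaleR_conv_of_real mult.assoc)
  then show ?thesis
    by (simp add: dilate_shift_def det_transpose det_matrix_inv[OF U] abs_inverse mult_ac)
qed

text \<open>Scalar multiplication as a matrix, so that it is an instance of an affine change of
  variables.\<close>

definition scale_mat :: "real \<Rightarrow> real^'d^'d" where
  "scale_mat c = c *\<^sub>R Finite_Cartesian_Product.mat 1"

lemma scale_mat_mult [simp]: "scale_mat c *v x = c *\<^sub>R x"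
  by (simp add: scale_mat_def scaleR_matrix_vector_assoc[symmetric])

lemma invertible_scale_mat: "c \<noteq> 0 \<Longrightarrow> invertible (scale_mat c :: real^'d^'d)"
  unfolding invertible_def
  by (intro exI[of _ "scale_mat (inverse c)"]) (auto simp: matrix_eq matrix_vector_mul_assoc[symmetric])

text \<open>The Plancherel constant $(2\pi)^d$.\<close>

definition plancherel_const :: "'d::finite itself \<Rightarrow> real" where
  "plancherel_const (_ :: 'd itself) = \<bar>det (scale_mat (2 * pi) :: real^'d^'d)\<bar>"

lemma plancherel_const_pos: "plancherel_const TYPE('d::finite) > 0"
  using invertible_scale_mat[of "2 * pi", where 'd='d]
  by (simp add: plancherel_const_def invertible_det_nz)

text \<open>For a function supported in the unit cube, the values of its Fourier transform on a translate
  of the dual lattice are the Fourier coefficients of a modulation of it. Parseval's identity gives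
  their square sum, which does not depend on the translate, and averaging over all translates
  gives the integral over the whole space.\<close>

lemma plancherel_unit_cube:
  fixes f :: "real^'d \<Rightarrow> complex"
  assumes f: "f \<in> sqint lebesgue" "integrable lebesgue f" and supp: "\<And>x. x \<notin> unit_cube \<Longrightarrow> f x = 0"
  shows "(\<integral>\<^sup>+\<xi>. ennreal ((cmod (fourier_L1 f \<xi>))\<^sup>2) \<partial>lebesgue) = ennreal (plancherel_const TYPE('d) * (nrm lebesgue f)\<^sup>2)"
proof -
  note [measurable] = fourier_L1_measurable[OF f(2)] sqint_measurable[OF f(1)]
  have restr: "integral\<^sup>L torus h = integral\<^sup>L lebesgue h" if "\<And>x. x \<notin> unit_cube \<Longrightarrow> h x = 0"
    for h :: "real^'d \<Rightarrow> 'b::{banach, second_countable_topology}"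
    by (subst integral_restrict_space) (auto intro!: Bochner_Integration.integral_cong simp: indicator_def that)
  define g where "g \<eta> = (\<lambda>x. f x * chr \<eta> x)" for \<eta>
  have g: "g \<eta> \<in> sqint torus" for \<eta>
  proof -
    have "(\<lambda>x. indicator unit_cube x *\<^sub>R (cmod (f x))\<^sup>2) = (\<lambda>x. (cmod (f x))\<^sup>2)"
      by (auto simp: fun_eq_iff indicator_def supp)
    then have "integrable torus (\<lambda>x. (cmod (f x))\<^sup>2)"
      using sqint_integrable[OF f(1)] by (simp add: integrable_restrict_space)
    then show ?thesis by (auto simp: sqint_def g_def norm_mult)
  qed
  have ng: "nrm torus (g \<eta>) = nrm lebesgue f" for \<eta>
    unfolding nrm_def g_def by (simp add: norm_mult restr supp)
  have coeff: "fourier_L1 f ((2 * pi) *\<^sub>R (\<eta> + k)) = ip torus (g \<eta>) (chr (- k))" for \<eta> k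
  proof -
    have "ip torus (g \<eta>) (chr (- k)) = integral\<^sup>L lebesgue (\<lambda>x. g \<eta> x * cnj (chr (- k) x))"
      unfolding ip_def by (rule restr) (simp add: g_def supp)
    also have "\<dots> = fourier_L1 f ((2 * pi) *\<^sub>R (\<eta> + k))"
      unfolding fourier_L1_def
      by (intro Bochner_Integration.integral_cong refl)
         (simp add: g_def chr_uminus_left mult.assoc chr_add_left[symmetric], simp add: chr_def inner_commute mult_ac)
    finally show ?thesis by simp
  qed
  have parseval: "(\<integral>\<^sup>+k. ennreal ((cmod (fourier_L1 f ((2 * pi) *\<^sub>R (\<eta> + k))))\<^sup>2) \<partial>count_space int_lattice) = ennreal ((nrm lebesgue f)\<^sup>2)" for \<eta>
  proof (rule nn_integral_count_space_has_sum[OF countable_int_lattice])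
    interpret B: biorthogonal_riesz torus int_lattice chr "chr :: real^'d \<Rightarrow> _" by (rule chr_basis)
    have "((\<lambda>k. ip torus (g \<eta>) (chr k) * ip torus (chr k) (g \<eta>)) has_sum ip torus (g \<eta>) (g \<eta>)) int_lattice"
      by (rule B.parseval[OF g g])
    then have "((\<lambda>k. complex_of_real ((cmod (ip torus (g \<eta>) (chr k)))\<^sup>2)) has_sum complex_of_real ((nrm lebesgue f)\<^sup>2)) int_lattice"
      unfolding ip_self ng complex_norm_square ip_commute[of torus "chr _" "g \<eta>"] .
    then have "((\<lambda>k. (cmod (ip torus (g \<eta>) (chr k)))\<^sup>2) has_sum (nrm lebesgue f)\<^sup>2) int_lattice"
      by (simp only: has_sum_of_real_iff)
    also have "?this \<longleftrightarrow> ((\<lambda>k. (cmod (ip torus (g \<eta>) (chr (- k))))\<^sup>2) has_sum (nrm lebesgue f)\<^sup>2) int_lattice"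
      by (intro has_sum_reindex_bij_witness[of _ uminus uminus]) (auto simp: int_lattice_uminus)
    finally show "((\<lambda>k. (cmod (fourier_L1 f ((2 * pi) *\<^sub>R (\<eta> + k))))\<^sup>2) has_sum (nrm lebesgue f)\<^sup>2) int_lattice"
      by (simp add: coeff)
  qed simp
  have inv: "invertible (scale_mat (2 * pi) :: real^'d^'d)" by (intro invertible_scale_mat) simp
  have m2: "(\<lambda>\<eta>. ennreal ((cmod (fourier_L1 f ((2 * pi) *\<^sub>R \<eta>)))\<^sup>2)) \<in> borel_measurable lebesgue"
    using measurable_compose[OF lebesgue_measurable_affine[OF inv, of 0] fourier_L1_measurable[OF f(2)]] by simp
  have "(\<integral>\<^sup>+\<xi>. ennreal ((cmod (fourier_L1 f \<xi>))\<^sup>2) \<partial>lebesgue)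
      = ennreal (plancherel_const TYPE('d)) * (\<integral>\<^sup>+\<eta>. ennreal ((cmod (fourier_L1 f ((2 * pi) *\<^sub>R \<eta>)))\<^sup>2) \<partial>lebesgue)"
    using nn_integral_affine[OF inv, of "\<lambda>\<xi>. ennreal ((cmod (fourier_L1 f \<xi>))\<^sup>2)" 0]
    by (simp add: plancherel_const_def)
  also have "(\<integral>\<^sup>+\<eta>. ennreal ((cmod (fourier_L1 f ((2 * pi) *\<^sub>R \<eta>)))\<^sup>2) \<partial>lebesgue)
      = (\<integral>\<^sup>+\<eta>. ennreal ((nrm lebesgue f)\<^sup>2) * indicator (unit_cube :: (real^'d) set) \<eta> \<partial>lebesgue)"
    unfolding nn_integral_tile[OF m2] parseval ..
  also have "\<dots> = ennreal ((nrm lebesgue f)\<^sup>2)" by (simp add: nn_integral_cmult)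
  finally show ?thesis
    using plancherel_const_pos[where 'd='d] by (simp add: ennreal_mult')
qed

definition half_open_cube :: "real \<Rightarrow> (real^'d) set" where
  "half_open_cube R = {x. \<forall>i. - R \<le> vec_nth x i \<and> vec_nth x i < R}"

lemma half_open_cube_unit_cube:
  assumes "R > 0"
  shows "x \<in> half_open_cube R \<longleftrightarrow> (1 / (2 * R)) *\<^sub>R x + vec_lambda (\<lambda>_. 1/2) \<in> unit_cube"
proof -
  have "(1 / (2 * R)) * t + 1/2 = (t + R) / (2 * R)" for t
    using assms by (simp add: field_simps)
  then have "- R \<le> t \<and> t < R \<longleftrightarrow> 0 \<le> (1 / (2 * R)) * t + 1/2 \<and> (1 / (2 * R)) * t + 1/2 < 1" for t
    using assms by (auto simp: zero_le_divide_iff)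
  then show ?thesis by (simp add: half_open_cube_def unit_cube_def)
qed

lemma half_open_cube_mono: "R \<le> S \<Longrightarrow> x \<in> half_open_cube R \<Longrightarrow> x \<in> half_open_cube S"
  unfolding half_open_cube_def by (auto intro: order_trans less_le_trans) (meson neg_le_iff_le order_trans)

lemma half_open_cube_lebesgue [measurable]: "half_open_cube R \<in> sets lebesgue"
proof -
  have "half_open_cube R = (\<Inter>i. {x. - R \<le> vec_nth x i} \<inter> {x. vec_nth x i < R})"
    by (auto simp: half_open_cube_def)
  also have "\<dots> \<in> sets borel"
    by (intro sets.countable_INT'' sets.Int borel_closed closed_Collect_le borel_open open_Collect_less continuous_intros) auto
  finally show ?thesis by (metis sets_completionI_sets sets_lborel)
qed

text \<open>A dilation and a shift move the support into the unit cube. They are unitary both before and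
  after the Fourier transform.\<close>

lemma plancherel_bounded_support:
  fixes u :: "real^'d \<Rightarrow> complex"
  assumes u: "u \<in> sqint lebesgue" "integrable lebesgue u" and R: "R > 0"
    and supp: "\<And>x. x \<notin> half_open_cube R \<Longrightarrow> u x = 0"
  shows "fourier_L1 u \<in> sqint lebesgue"
    and "(nrm lebesgue (fourier_L1 u))\<^sup>2 = plancherel_const TYPE('d) * (nrm lebesgue u)\<^sup>2"
proof -
  let ?U = "scale_mat (2 * R) :: real^'d^'d" and ?c = "vec_lambda (\<lambda>_. R) :: real^'d"
  let ?W = "transpose (matrix_inv ?U)"
  define v where "v = dilate_shift ?U ?c u"
  have U: "invertible ?U" using R by (intro invertible_scale_mat) simp
  have W: "invertible ?W" using invertible_matrix_inv[OF U] invertible_transpose by blast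
  have v: "v \<in> sqint lebesgue" "integrable lebesgue v"
    unfolding v_def by (intro dilate_shift_sqint integrable_dilate_shift U u)+
  have vsupp: "v x = 0" if "x \<notin> unit_cube" for x
  proof -
    have "(2 * R) *\<^sub>R x - ?c \<notin> half_open_cube R"
      using that R unfolding half_open_cube_unit_cube[OF R]
      by (simp add: scaleR_diff_right) (simp add: unit_cube_def)
    then show ?thesis by (simp add: v_def dilate_shift_def supp)
  qed
  let ?g = "\<lambda>\<xi>. ennreal ((cmod (fourier_L1 u \<xi>))\<^sup>2)"
  have Fv: "(cmod (fourier_L1 v \<xi>))\<^sup>2 = \<bar>det ?W\<bar> * (cmod (fourier_L1 u (?W *v \<xi>)))\<^sup>2" for \<xi>
    unfolding v_def fourier_L1_dilate_shift[OF U u(2)]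
    by (simp add: dilate_shift_def norm_mult power_mult_distrib)
  note [measurable] = fourier_L1_measurable[OF u(2)]
  have "(\<integral>\<^sup>+\<xi>. ?g \<xi> \<partial>lebesgue) = ennreal \<bar>det ?W\<bar> * (\<integral>\<^sup>+\<xi>. ?g (?W *v \<xi>) \<partial>lebesgue)"
    using nn_integral_affine[OF W, of ?g 0] by simp
  also have "\<dots> = (\<integral>\<^sup>+\<xi>. ennreal \<bar>det ?W\<bar> * ?g (?W *v \<xi>) \<partial>lebesgue)"
    using measurable_compose[OF lebesgue_measurable_affine[OF W, of 0] fourier_L1_measurable[OF u(2)]]
    by (subst nn_integral_cmult) auto
  also have "\<dots> = (\<integral>\<^sup>+\<xi>. ennreal ((cmod (fourier_L1 v \<xi>))\<^sup>2) \<partial>lebesgue)"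
    by (simp only: Fv ennreal_mult abs_ge_zero zero_le_power2)
  also have "\<dots> = ennreal (plancherel_const TYPE('d) * (nrm lebesgue u)\<^sup>2)"
    using plancherel_unit_cube[OF v vsupp] by (simp add: v_def nrm_dilate_shift[OF U u(1)])
  finally have eq: "(\<integral>\<^sup>+\<xi>. ?g \<xi> \<partial>lebesgue) = ennreal (plancherel_const TYPE('d) * (nrm lebesgue u)\<^sup>2)" .
  show F: "fourier_L1 u \<in> sqint lebesgue"
    by (rule sqintI_nn) (auto simp: eq)
  show "(nrm lebesgue (fourier_L1 u))\<^sup>2 = plancherel_const TYPE('d) * (nrm lebesgue u)\<^sup>2"
    using ennreal_nrm_sq[OF F] plancherel_const_pos[where 'd='d] unfolding eq by simp
qed

definition cutoff :: "nat \<Rightarrow> (real^'d \<Rightarrow> complex) \<Rightarrow> real^'d \<Rightarrow> complex" where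
  "cutoff n f = (\<lambda>x. indicator (half_open_cube (real (Suc n))) x * f x)"

lemma indicator_half_open_cube_sqint: "(\<lambda>x::real^'d. indicator (half_open_cube R) x) \<in> sqint lebesgue"
proof -
  have "(half_open_cube R :: (real^'d) set) \<subseteq> cbox (vec_lambda (\<lambda>_. - R)) (vec_lambda (\<lambda>_. R))"
    by (auto simp: half_open_cube_def mem_box_cart less_imp_le)
  then have "(half_open_cube R :: (real^'d) set) \<in> lmeasurable"
    using half_open_cube_lebesgue bounded_cbox bounded_subset by (blast intro: bounded_set_imp_lmeasurable)
  then have "integrable lebesgue (indicator (half_open_cube R) :: real^'d \<Rightarrow> real)"
    by (simp add: lmeasurable_iff_integrable)
  moreover have "(cmod (indicator (half_open_cube R) x))\<^sup>2 = indicator (half_open_cube R) x" for x :: "real^'d"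
    by (simp add: indicator_def)
  ultimately show ?thesis by (auto simp: sqint_def)
qed

lemma cutoff_sqint:
  assumes "f \<in> sqint lebesgue" shows "cutoff n f \<in> sqint lebesgue"
proof (rule sqint_bound)
  show "cutoff n f \<in> borel_measurable lebesgue"
    using sqint_measurable[OF assms, measurable] unfolding cutoff_def by measurable
  show "(cmod (cutoff n f x))\<^sup>2 \<le> (cmod (f x))\<^sup>2" for x
    by (auto simp: cutoff_def indicator_def)
qed (rule sqint_integrable[OF assms])

lemma cutoff_integrable:
  assumes "f \<in> sqint lebesgue" shows "integrable lebesgue (cutoff n f)"
proof -
  have "cutoff n f = (\<lambda>x. f x * cnj (indicator (half_open_cube (real (Suc n))) x))"
    by (auto simp: cutoff_def fun_eq_iff indicator_def)
  then show ?thesis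
    using integrable_prod[OF assms indicator_half_open_cube_sqint[of "real (Suc n)"]] by (simp only:)
qed

lemma cutoff_support: "x \<notin> half_open_cube (real (Suc n)) \<Longrightarrow> cutoff n f x = 0"
  by (simp add: cutoff_def)

lemma cutoff_eventually: "\<forall>\<^sub>F n in sequentially. cutoff n f x = f x"
proof -
  define B where "B = (\<Sum>i\<in>UNIV. \<bar>vec_nth x i\<bar>)"
  have B: "\<bar>vec_nth x i\<bar> \<le> B" for i unfolding B_def by (rule member_le_sum) auto
  obtain N :: nat where N: "B \<le> real N" using real_arch_simple by blast
  have "cutoff n f x = f x" if "n \<ge> N" for n
  proof -
    have "B < real (Suc n)" using N that by simp
    then have "- real (Suc n) \<le> vec_nth x i \<and> vec_nth x i < real (Suc n)" for i
      using B[of i] by linarith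
    then show ?thesis by (simp add: cutoff_def half_open_cube_def)
  qed
  then show ?thesis by (auto simp: eventually_sequentially)
qed

lemma cutoff_tendsto:
  fixes f :: "real^'d \<Rightarrow> complex"
  assumes f: "f \<in> sqint lebesgue"
  shows "(\<lambda>n. nrm lebesgue (\<lambda>x. cutoff n f x - f x)) \<longlonglongrightarrow> 0"
proof -
  have "(\<lambda>n. integral\<^sup>L lebesgue (\<lambda>x. (cmod (cutoff n f x - f x))\<^sup>2)) \<longlonglongrightarrow> integral\<^sup>L lebesgue (\<lambda>x::real^'d. 0)"
  proof (rule integral_dominated_convergence[where w="\<lambda>x. (cmod (f x))\<^sup>2"])
    show "AE x in lebesgue. (\<lambda>n. (cmod (cutoff n f x - f x))\<^sup>2) \<longlonglongrightarrow> 0"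
    proof (rule AE_I2)
      fix x
      have "\<forall>\<^sub>F n in sequentially. (cmod (cutoff n f x - f x))\<^sup>2 = 0"
        using cutoff_eventually[of f x] by (rule eventually_mono) simp
      then show "(\<lambda>n. (cmod (cutoff n f x - f x))\<^sup>2) \<longlonglongrightarrow> 0" by (rule tendsto_eventually)
    qed
    show "AE x in lebesgue. norm ((cmod (cutoff n f x - f x))\<^sup>2) \<le> (cmod (f x))\<^sup>2" for n
      by (rule AE_I2) (auto simp: cutoff_def indicator_def)
    show "(\<lambda>x. (cmod (cutoff n f x - f x))\<^sup>2) \<in> borel_measurable lebesgue" for n
      using sqint_integrable[OF sqint_diff[OF cutoff_sqint[OF f] f]] by (rule borel_measurable_integrable)
  qed (use sqint_integrable[OF f] in auto)
  then have "(\<lambda>n. sqrt (integral\<^sup>L lebesgue (\<lambda>x. (cmod (cutoff n f x - f x))\<^sup>2))) \<longlonglongrightarrow> sqrt 0"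
    by (intro tendsto_real_sqrt) simp
  then show ?thesis by (simp add: nrm_def)
qed

lemma eq_sqrt_mult:
  assumes "a\<^sup>2 = c * b\<^sup>2" "a \<ge> 0" "b \<ge> 0" "c \<ge> (0::real)"
  shows "a = sqrt c * b"
  by (rule power2_eq_imp_eq) (simp_all add: assms power_mult_distrib)

lemma plancherel_cutoff_diff:
  fixes f :: "real^'d \<Rightarrow> complex"
  assumes f: "f \<in> sqint lebesgue"
  shows "nrm lebesgue (\<lambda>\<xi>. fourier_L1 (cutoff m f) \<xi> - fourier_L1 (cutoff n f) \<xi>)
    = sqrt (plancherel_const TYPE('d)) * nrm lebesgue (\<lambda>x. cutoff m f x - cutoff n f x)"
proof -
  let ?u = "\<lambda>x. cutoff m f x - cutoff n f x"
  let ?R = "real (Suc (max m n))"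
  have supp: "?u x = 0" if "x \<notin> half_open_cube ?R" for x
  proof -
    have n: "x \<notin> half_open_cube (real (Suc m))" "x \<notin> half_open_cube (real (Suc n))"
      using that half_open_cube_mono[of "real (Suc m)" ?R x] half_open_cube_mono[of "real (Suc n)" ?R x] by auto
    show ?thesis by (simp only: cutoff_support[OF n(1)] cutoff_support[OF n(2)] diff_self)
  qed
  have "(nrm lebesgue (fourier_L1 ?u))\<^sup>2 = plancherel_const TYPE('d) * (nrm lebesgue ?u)\<^sup>2"
  proof (rule plancherel_bounded_support(2))
    show "?u \<in> sqint lebesgue" by (intro sqint_diff cutoff_sqint f)
    show "integrable lebesgue ?u" by (intro Bochner_Integration.integrable_diff cutoff_integrable f)
    show "?R > 0" by simp
  qed (rule supp)
  also have "fourier_L1 ?u = (\<lambda>\<xi>. fourier_L1 (cutoff m f) \<xi> - fourier_L1 (cutoff n f) \<xi>)"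
    by (intro fourier_L1_diff cutoff_integrable f)
  finally show ?thesis
    by (rule eq_sqrt_mult) (use plancherel_const_pos[where 'd='d] in simp_all)
qed

lemma cutoff_cauchy:
  fixes f :: "real^'d \<Rightarrow> complex"
  assumes f: "f \<in> sqint lebesgue" and e: "e > 0"
  shows "\<exists>N. \<forall>m\<ge>N. \<forall>n\<ge>N. nrm lebesgue (\<lambda>\<xi>. fourier_L1 (cutoff m f) \<xi> - fourier_L1 (cutoff n f) \<xi>) < e"
proof -
  let ?c = "sqrt (plancherel_const TYPE('d))"
  have c: "?c > 0" using plancherel_const_pos by simp
  have "e / (2 * ?c) > 0" using e c by simp
  from order_tendstoD(2)[OF cutoff_tendsto[OF f] this]
  obtain N where N: "\<And>n. n \<ge> N \<Longrightarrow> nrm lebesgue (\<lambda>x. cutoff n f x - f x) < e / (2 * ?c)"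
    unfolding eventually_sequentially by blast
  have "nrm lebesgue (\<lambda>\<xi>. fourier_L1 (cutoff m f) \<xi> - fourier_L1 (cutoff n f) \<xi>) < e" if "m \<ge> N" "n \<ge> N" for m n
  proof -
    have "nrm lebesgue (\<lambda>x. cutoff m f x - cutoff n f x)
        \<le> nrm lebesgue (\<lambda>x. cutoff m f x - f x) + nrm lebesgue (\<lambda>x. f x - cutoff n f x)"
      by (intro nrm_triangle_diff cutoff_sqint f)
    also have "\<dots> < e / (2 * ?c) + e / (2 * ?c)"
      using N[OF that(1)] N[OF that(2)] by (simp add: nrm_minus_commute[of lebesgue f])
    finally have "?c * nrm lebesgue (\<lambda>x. cutoff m f x - cutoff n f x) < ?c * (e / (2 * ?c) + e / (2 * ?c))"
      using c by (rule mult_strict_left_mono)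
    also have "\<dots> = e" using c by (simp add: field_simps)
    finally show ?thesis by (simp add: plancherel_cutoff_diff[OF f])
  qed
  then show ?thesis by blast
qed

lemma fourier_L1_cutoff_sqint:
  assumes "f \<in> sqint lebesgue" shows "fourier_L1 (cutoff n f) \<in> sqint lebesgue"
  by (rule plancherel_bounded_support(1)[of _ "real (Suc n)"])
     (auto intro: cutoff_sqint cutoff_integrable assms cutoff_support)

text \<open>Plancherel for integrable square integrable functions. The transforms of the truncations
  converge pointwise by dominated convergence, and by the compactly supported case they converge
  in mean square; both limits agree because the mean square limit is a pointwise one along a
  subsequence.\<close>

lemma plancherel_L1_L2:
  fixes u :: "real^'d \<Rightarrow> complex"
  assumes u: "u \<in> sqint lebesgue" "integrable lebesgue u"
  shows "fourier_L1 u \<in> sqint lebesgue"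
    and "nrm lebesgue (fourier_L1 u) = sqrt (plancherel_const TYPE('d)) * nrm lebesgue u"
proof -
  let ?F = "\<lambda>n. fourier_L1 (cutoff n u)"
  have F: "?F n \<in> sqint lebesgue" for n by (rule fourier_L1_cutoff_sqint[OF u(1)])
  have pt: "(\<lambda>n. ?F n \<xi>) \<longlonglongrightarrow> fourier_L1 u \<xi>" for \<xi>
    unfolding fourier_L1_def
  proof (rule integral_dominated_convergence[where w="\<lambda>x. cmod (u x)"])
    show "AE x in lebesgue. (\<lambda>n. cutoff n u x * cis (- (x \<bullet> \<xi>))) \<longlonglongrightarrow> u x * cis (- (x \<bullet> \<xi>))"
      by (intro AE_I2 tendsto_mult_right tendsto_eventually cutoff_eventually)
    show "AE x in lebesgue. norm (cutoff n u x * cis (- (x \<bullet> \<xi>))) \<le> cmod (u x)" for n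
      by (rule AE_I2) (auto simp: cutoff_def indicator_def norm_mult)
  qed (use u fourier_L1_integrable[OF u(2)] fourier_L1_integrable[OF cutoff_integrable[OF u(1)]] in auto)
  from Riesz_Fischer[of ?F lebesgue, OF F cutoff_cauchy[OF u(1)]] obtain r :: "nat \<Rightarrow> nat"
    where r: "strict_mono r" and l: "(\<lambda>\<xi>. lim (\<lambda>k. ?F (r k) \<xi>)) \<in> sqint lebesgue"
      "(\<lambda>n. nrm lebesgue (\<lambda>\<xi>. ?F n \<xi> - lim (\<lambda>k. ?F (r k) \<xi>))) \<longlonglongrightarrow> 0" by blast
  have "lim (\<lambda>k. ?F (r k) \<xi>) = fourier_L1 u \<xi>" for \<xi>
    using LIMSEQ_subseq_LIMSEQ[OF pt r] by (intro limI) (simp add: o_def)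
  then have 1: "fourier_L1 u \<in> sqint lebesgue" and 2: "(\<lambda>n. nrm lebesgue (\<lambda>\<xi>. ?F n \<xi> - fourier_L1 u \<xi>)) \<longlonglongrightarrow> 0"
    using l by simp_all
  show "fourier_L1 u \<in> sqint lebesgue" by (rule 1)
  have n: "nrm lebesgue (?F n) = sqrt (plancherel_const TYPE('d)) * nrm lebesgue (cutoff n u)" for n
  proof -
    have "(nrm lebesgue (?F n))\<^sup>2 = plancherel_const TYPE('d) * (nrm lebesgue (cutoff n u))\<^sup>2"
      by (rule plancherel_bounded_support(2)[of _ "real (Suc n)"])
         (auto intro: cutoff_sqint cutoff_integrable u cutoff_support)
    then show ?thesis
      by (rule eq_sqrt_mult) (use plancherel_const_pos[where 'd='d] in simp_all)
  qed
  show "nrm lebesgue (fourier_L1 u) = sqrt (plancherel_const TYPE('d)) * nrm lebesgue u"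
  proof (rule LIMSEQ_unique)
    show "(\<lambda>n. nrm lebesgue (?F n)) \<longlonglongrightarrow> nrm lebesgue (fourier_L1 u)"
      by (rule nrm_tendsto[OF F 1 2])
    show "(\<lambda>n. nrm lebesgue (?F n)) \<longlonglongrightarrow> sqrt (plancherel_const TYPE('d)) * nrm lebesgue u"
      unfolding n by (intro tendsto_mult_left nrm_tendsto cutoff_sqint u cutoff_tendsto)
  qed
qed

text \<open>The transforms of the truncations of \<open>f\<close> form a Cauchy sequence by Plancherel's identity; their
  limit serves for every other approximating sequence as well, because Plancherel's identity bounds
  the distance of its transforms to those of the truncations.\<close>

lemma is_fourier_L2_exists:
  fixes f :: "real^'d \<Rightarrow> complex"
  assumes f: "f \<in> sqint lebesgue"
  shows "\<exists>g. is_fourier_L2 f g"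
proof -
  let ?F = "\<lambda>n. fourier_L1 (cutoff n f)" and ?c = "sqrt (plancherel_const TYPE('d))"
  have F: "?F n \<in> sqint lebesgue" for n by (rule fourier_L1_cutoff_sqint[OF f])
  from Riesz_Fischer[of ?F lebesgue, OF F cutoff_cauchy[OF f]] obtain g
    where g: "g \<in> sqint lebesgue" "(\<lambda>n. nrm lebesgue (\<lambda>\<xi>. ?F n \<xi> - g \<xi>)) \<longlonglongrightarrow> 0" by blast
  have "(\<lambda>n. nrm lebesgue (\<lambda>\<xi>. fourier_L1 (u n) \<xi> - g \<xi>)) \<longlonglongrightarrow> 0"
    if u: "\<And>n. integrable lebesgue (u n)" "\<And>n. u n \<in> sqint lebesgue"
      and lim: "(\<lambda>n. nrm lebesgue (\<lambda>x. u n x - f x)) \<longlonglongrightarrow> 0" for u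
  proof (rule Lim_null_comparison)
    have Fu: "fourier_L1 (u n) \<in> sqint lebesgue" for n by (rule plancherel_L1_L2(1)[OF u(2,1)])
    have "nrm lebesgue (\<lambda>\<xi>. fourier_L1 (u n) \<xi> - g \<xi>)
      \<le> ?c * (nrm lebesgue (\<lambda>x. u n x - f x) + nrm lebesgue (\<lambda>x. cutoff n f x - f x)) + nrm lebesgue (\<lambda>\<xi>. ?F n \<xi> - g \<xi>)" for n
    proof -
      have "nrm lebesgue (\<lambda>\<xi>. fourier_L1 (u n) \<xi> - g \<xi>)
          \<le> nrm lebesgue (\<lambda>\<xi>. fourier_L1 (u n) \<xi> - ?F n \<xi>) + nrm lebesgue (\<lambda>\<xi>. ?F n \<xi> - g \<xi>)"
        by (intro nrm_triangle_diff Fu F g)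
      also have "nrm lebesgue (\<lambda>\<xi>. fourier_L1 (u n) \<xi> - ?F n \<xi>) = ?c * nrm lebesgue (\<lambda>x. u n x - cutoff n f x)"
        using plancherel_L1_L2(2)[OF sqint_diff[OF u(2) cutoff_sqint[OF f]]
            Bochner_Integration.integrable_diff[OF u(1) cutoff_integrable[OF f]], of n n]
        by (simp add: fourier_L1_diff[OF u(1) cutoff_integrable[OF f]] )
      also have "nrm lebesgue (\<lambda>x. u n x - cutoff n f x)
          \<le> nrm lebesgue (\<lambda>x. u n x - f x) + nrm lebesgue (\<lambda>x. f x - cutoff n f x)"
        by (intro nrm_triangle_diff u cutoff_sqint f)
      finally show ?thesis
        using plancherel_const_pos[where 'd='d] by (simp add: nrm_minus_commute[of lebesgue f] mult_left_mono)
    qed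
    then show "\<forall>\<^sub>F n in sequentially. norm (nrm lebesgue (\<lambda>\<xi>. fourier_L1 (u n) \<xi> - g \<xi>))
      \<le> ?c * (nrm lebesgue (\<lambda>x. u n x - f x) + nrm lebesgue (\<lambda>x. cutoff n f x - f x)) + nrm lebesgue (\<lambda>\<xi>. ?F n \<xi> - g \<xi>)"
      by (intro always_eventually allI) simp
    show "(\<lambda>n. ?c * (nrm lebesgue (\<lambda>x. u n x - f x) + nrm lebesgue (\<lambda>x. cutoff n f x - f x)) + nrm lebesgue (\<lambda>\<xi>. ?F n \<xi> - g \<xi>)) \<longlonglongrightarrow> 0"
      using tendsto_add[OF tendsto_mult_left[OF tendsto_add[OF lim cutoff_tendsto[OF f]], of ?c] g(2)] by simp
  qed
  then show ?thesis
    using g(1) unfolding is_fourier_L2_def L2_eq_sqint norm_L2_eq_nrm by blast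
qed

lemma
  fixes f :: "real^'d \<Rightarrow> complex"
  assumes f: "f \<in> sqint lebesgue"
  shows fourier_L2_sqint: "fourier_L2 f \<in> sqint lebesgue"
    and fourier_L2_tendsto: "\<And>u. (\<And>n. integrable lebesgue (u n)) \<Longrightarrow> (\<And>n. u n \<in> sqint lebesgue) \<Longrightarrow>
      (\<lambda>n. nrm lebesgue (\<lambda>x. u n x - f x)) \<longlonglongrightarrow> 0 \<Longrightarrow>
      (\<lambda>n. nrm lebesgue (\<lambda>\<xi>. fourier_L1 (u n) \<xi> - fourier_L2 f \<xi>)) \<longlonglongrightarrow> 0"
proof -
  have "is_fourier_L2 f (fourier_L2 f)"
    unfolding fourier_L2_def by (rule someI_ex[OF is_fourier_L2_exists[OF f]])
  then show "fourier_L2 f \<in> sqint lebesgue" "\<And>u. (\<And>n. integrable lebesgue (u n)) \<Longrightarrow> (\<And>n. u n \<in> sqint lebesgue) \<Longrightarrow>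
      (\<lambda>n. nrm lebesgue (\<lambda>x. u n x - f x)) \<longlonglongrightarrow> 0 \<Longrightarrow>
      (\<lambda>n. nrm lebesgue (\<lambda>\<xi>. fourier_L1 (u n) \<xi> - fourier_L2 f \<xi>)) \<longlonglongrightarrow> 0"
    unfolding is_fourier_L2_def L2_eq_sqint norm_L2_eq_nrm by blast+
qed

lemma fourier_L2_cutoff:
  assumes "f \<in> sqint lebesgue"
  shows "(\<lambda>n. nrm lebesgue (\<lambda>\<xi>. fourier_L1 (cutoff n f) \<xi> - fourier_L2 f \<xi>)) \<longlonglongrightarrow> 0"
  by (intro fourier_L2_tendsto cutoff_integrable cutoff_sqint cutoff_tendsto assms)

lemma nrm_lincomb_tendsto:
  assumes "finite F" "\<And>i n. i \<in> F \<Longrightarrow> u i n \<in> sqint M" "\<And>i. i \<in> F \<Longrightarrow> v i \<in> sqint M"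
    and "\<And>i. i \<in> F \<Longrightarrow> (\<lambda>n. nrm M (\<lambda>x. u i n x - v i x)) \<longlonglongrightarrow> 0"
  shows "(\<lambda>n. nrm M (\<lambda>x. (\<Sum>i\<in>F. c i * u i n x) - (\<Sum>i\<in>F. c i * v i x))) \<longlonglongrightarrow> 0"
  using assms
proof (induction F rule: finite_induct)
  case (insert j F)
  show ?case
  proof (rule Lim_null_comparison[OF always_eventually], rule allI)
    fix n
    have "(\<lambda>x. (\<Sum>i\<in>insert j F. c i * u i n x) - (\<Sum>i\<in>insert j F. c i * v i x))
        = (\<lambda>x. c j * (u j n x - v j x) + ((\<Sum>i\<in>F. c i * u i n x) - (\<Sum>i\<in>F. c i * v i x)))"
      using insert.hyps by (simp add: fun_eq_iff algebra_simps)
    moreover have "(\<lambda>x. c j * (u j n x - v j x)) \<in> sqint M"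
      "(\<lambda>x. (\<Sum>i\<in>F. c i * u i n x) - (\<Sum>i\<in>F. c i * v i x)) \<in> sqint M"
      using insert.prems by (auto intro!: sqint_cmult sqint_diff sqint_lincomb)
    ultimately have "nrm M (\<lambda>x. (\<Sum>i\<in>insert j F. c i * u i n x) - (\<Sum>i\<in>insert j F. c i * v i x))
        \<le> nrm M (\<lambda>x. c j * (u j n x - v j x)) + nrm M (\<lambda>x. (\<Sum>i\<in>F. c i * u i n x) - (\<Sum>i\<in>F. c i * v i x))"
      by (simp only: nrm_triangle)
    then show "norm (nrm M (\<lambda>x. (\<Sum>i\<in>insert j F. c i * u i n x) - (\<Sum>i\<in>insert j F. c i * v i x)))
        \<le> cmod (c j) * nrm M (\<lambda>x. u j n x - v j x) + nrm M (\<lambda>x. (\<Sum>i\<in>F. c i * u i n x) - (\<Sum>i\<in>F. c i * v i x))"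
      by (simp only: nrm_cmult real_norm_def abs_of_nonneg nrm_nonneg)
  next
    have "(\<lambda>n. nrm M (\<lambda>x. (\<Sum>i\<in>F. c i * u i n x) - (\<Sum>i\<in>F. c i * v i x))) \<longlonglongrightarrow> 0"
      by (rule insert.IH) (use insert.prems in auto)
    moreover have "(\<lambda>n. cmod (c j) * nrm M (\<lambda>x. u j n x - v j x)) \<longlonglongrightarrow> 0"
      by (rule tendsto_mult_right_zero) (use insert.prems in auto)
    ultimately show "(\<lambda>n. cmod (c j) * nrm M (\<lambda>x. u j n x - v j x)
        + nrm M (\<lambda>x. (\<Sum>i\<in>F. c i * u i n x) - (\<Sum>i\<in>F. c i * v i x))) \<longlonglongrightarrow> 0"
      by (rule tendsto_add_zero[rotated])
  qed
qed simp

text \<open>Linearity and the dilation rule hold for the transforms of truncations; in the limit they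
  hold almost everywhere, as limits in mean square are unique up to null sets.\<close>

lemma fourier_L2_lincomb:
  fixes h :: "'i \<Rightarrow> real^'d \<Rightarrow> complex"
  assumes F: "finite F" and h: "\<And>i. i \<in> F \<Longrightarrow> h i \<in> sqint lebesgue"
  shows "AE \<xi> in lebesgue. fourier_L2 (\<lambda>x. \<Sum>i\<in>F. c i * h i x) \<xi> = (\<Sum>i\<in>F. c i * fourier_L2 (h i) \<xi>)"
proof -
  let ?g = "\<lambda>x. \<Sum>i\<in>F. c i * h i x"
  have g: "?g \<in> sqint lebesgue" by (intro sqint_lincomb h)
  have tr: "cutoff n ?g = (\<lambda>x. \<Sum>i\<in>F. c i * cutoff n (h i) x)" for n
    by (simp add: cutoff_def fun_eq_iff sum_distrib_left mult.left_commute)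
  have ft: "fourier_L1 (cutoff n ?g) = (\<lambda>\<xi>. \<Sum>i\<in>F. c i * fourier_L1 (cutoff n (h i)) \<xi>)" for n
    unfolding tr by (intro ext fourier_L1_lincomb cutoff_integrable h)
  show ?thesis
  proof (rule sqint_limit_AE_unique[of "\<lambda>n. fourier_L1 (cutoff n ?g)"])
    show "fourier_L1 (cutoff n ?g) \<in> sqint lebesgue" for n by (rule fourier_L1_cutoff_sqint[OF g])
    show "fourier_L2 ?g \<in> sqint lebesgue" by (rule fourier_L2_sqint[OF g])
    show "(\<lambda>\<xi>. \<Sum>i\<in>F. c i * fourier_L2 (h i) \<xi>) \<in> sqint lebesgue"
      by (intro sqint_lincomb fourier_L2_sqint h)
    show "(\<lambda>n. nrm lebesgue (\<lambda>\<xi>. fourier_L1 (cutoff n ?g) \<xi> - fourier_L2 ?g \<xi>)) \<longlonglongrightarrow> 0"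
      by (rule fourier_L2_cutoff[OF g])
    show "(\<lambda>n. nrm lebesgue (\<lambda>\<xi>. fourier_L1 (cutoff n ?g) \<xi> - (\<Sum>i\<in>F. c i * fourier_L2 (h i) \<xi>))) \<longlonglongrightarrow> 0"
      unfolding ft by (intro nrm_lincomb_tendsto F fourier_L1_cutoff_sqint fourier_L2_sqint fourier_L2_cutoff h)
  qed
qed

lemma nrm_fourier_L2_diff:
  fixes f g :: "real^'d \<Rightarrow> complex"
  assumes f: "f \<in> sqint lebesgue" and g: "g \<in> sqint lebesgue"
  shows "nrm lebesgue (\<lambda>\<xi>. fourier_L2 f \<xi> - fourier_L2 g \<xi>)
    = sqrt (plancherel_const TYPE('d)) * nrm lebesgue (\<lambda>x. f x - g x)"
proof (rule LIMSEQ_unique)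
  let ?u = "\<lambda>n \<xi>. fourier_L1 (cutoff n f) \<xi> - fourier_L1 (cutoff n g) \<xi>"
  have tri: "nrm M (\<lambda>x. (a x - b x) - (a' x - b' x)) \<le> nrm M (\<lambda>x. a x - a' x) + nrm M (\<lambda>x. b x - b' x)"
    if "a \<in> sqint M" "b \<in> sqint M" "a' \<in> sqint M" "b' \<in> sqint M"
    for a b a' b' :: "real^'d \<Rightarrow> complex" and M
    using nrm_diff_le[OF sqint_diff[OF that(1,3)] sqint_diff[OF that(2,4)]] by (simp add: algebra_simps)
  show "(\<lambda>n. nrm lebesgue (?u n)) \<longlonglongrightarrow> nrm lebesgue (\<lambda>\<xi>. fourier_L2 f \<xi> - fourier_L2 g \<xi>)"
  proof (rule nrm_tendsto)
    show "(\<lambda>n. nrm lebesgue (\<lambda>x. ?u n x - (fourier_L2 f x - fourier_L2 g x))) \<longlonglongrightarrow> 0"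
    proof (rule Lim_null_comparison[OF always_eventually], rule allI)
      fix n
      show "norm (nrm lebesgue (\<lambda>x. ?u n x - (fourier_L2 f x - fourier_L2 g x)))
          \<le> nrm lebesgue (\<lambda>\<xi>. fourier_L1 (cutoff n f) \<xi> - fourier_L2 f \<xi>) + nrm lebesgue (\<lambda>\<xi>. fourier_L1 (cutoff n g) \<xi> - fourier_L2 g \<xi>)"
        using tri[OF fourier_L1_cutoff_sqint[OF f] fourier_L1_cutoff_sqint[OF g] fourier_L2_sqint[OF f] fourier_L2_sqint[OF g]] by simp
    qed (use tendsto_add[OF fourier_L2_cutoff[OF f] fourier_L2_cutoff[OF g]] in simp)
  qed (intro sqint_diff fourier_L1_cutoff_sqint fourier_L2_sqint f g)+
  have eq: "nrm lebesgue (?u n) = sqrt (plancherel_const TYPE('d)) * nrm lebesgue (\<lambda>x. cutoff n f x - cutoff n g x)" for n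
    using plancherel_L1_L2(2)[OF sqint_diff[OF cutoff_sqint[OF f] cutoff_sqint[OF g]]
        Bochner_Integration.integrable_diff[OF cutoff_integrable[OF f] cutoff_integrable[OF g]], of n n]
    by (simp add: fourier_L1_diff[OF cutoff_integrable[OF f] cutoff_integrable[OF g]])
  show "(\<lambda>n. nrm lebesgue (?u n)) \<longlonglongrightarrow> sqrt (plancherel_const TYPE('d)) * nrm lebesgue (\<lambda>x. f x - g x)"
    unfolding eq
  proof (intro tendsto_mult_left nrm_tendsto)
    show "(\<lambda>n. nrm lebesgue (\<lambda>x. cutoff n f x - cutoff n g x - (f x - g x))) \<longlonglongrightarrow> 0"
    proof (rule Lim_null_comparison[OF always_eventually], rule allI)
      fix n
      show "norm (nrm lebesgue (\<lambda>x. cutoff n f x - cutoff n g x - (f x - g x)))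
          \<le> nrm lebesgue (\<lambda>x. cutoff n f x - f x) + nrm lebesgue (\<lambda>x. cutoff n g x - g x)"
        using tri[OF cutoff_sqint[OF f] cutoff_sqint[OF g] f g] by simp
    qed (use tendsto_add[OF cutoff_tendsto[OF f] cutoff_tendsto[OF g]] in simp)
  qed (intro sqint_diff cutoff_sqint f g)+
qed

lemma fourier_L2_dilate_shift:
  fixes f :: "real^'d \<Rightarrow> complex"
  assumes U: "invertible U" and f: "f \<in> sqint lebesgue"
  shows "AE \<xi> in lebesgue. fourier_L2 (dilate_shift U k f) \<xi>
    = cis (- ((matrix_inv U *v k) \<bullet> \<xi>)) * dilate_shift (transpose (matrix_inv U)) 0 (fourier_L2 f) \<xi>"
proof -
  let ?W = "transpose (matrix_inv U)" and ?e = "\<lambda>\<xi>. cis (- ((matrix_inv U *v k) \<bullet> \<xi>))"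
  let ?u = "\<lambda>n. cutoff n f"
  have W: "invertible ?W" using invertible_matrix_inv[OF U] invertible_transpose by blast
  have e: "?e \<in> borel_measurable lebesgue" using cis_inner_borel[of "matrix_inv U *v k"] by (simp add: inner_commute)
  have df: "dilate_shift U k f \<in> sqint lebesgue" by (rule dilate_shift_sqint[OF U f])
  have du: "dilate_shift U k (?u n) \<in> sqint lebesgue" for n by (intro dilate_shift_sqint U cutoff_sqint f)
  have di: "integrable lebesgue (dilate_shift U k (?u n))" for n
    by (intro integrable_dilate_shift U cutoff_integrable f)
  have ft: "fourier_L1 (dilate_shift U k (?u n)) = (\<lambda>\<xi>. ?e \<xi> * dilate_shift ?W 0 (fourier_L1 (?u n)) \<xi>)" for n
    by (intro ext fourier_L1_dilate_shift U cutoff_integrable f)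
  show ?thesis
  proof (rule sqint_limit_AE_unique[of "\<lambda>n. fourier_L1 (dilate_shift U k (?u n))"])
    show "fourier_L1 (dilate_shift U k (?u n)) \<in> sqint lebesgue" for n
      by (rule plancherel_L1_L2(1)[OF du di])
    show "fourier_L2 (dilate_shift U k f) \<in> sqint lebesgue" by (rule fourier_L2_sqint[OF df])
    show "(\<lambda>\<xi>. ?e \<xi> * dilate_shift ?W 0 (fourier_L2 f) \<xi>) \<in> sqint lebesgue"
      by (intro sqint_unimodular_mult e dilate_shift_sqint W fourier_L2_sqint f) simp
    show "(\<lambda>n. nrm lebesgue (\<lambda>\<xi>. fourier_L1 (dilate_shift U k (?u n)) \<xi> - fourier_L2 (dilate_shift U k f) \<xi>)) \<longlonglongrightarrow> 0"
    proof (intro fourier_L2_tendsto df di du)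
      have "nrm lebesgue (\<lambda>x. dilate_shift U k (?u n) x - dilate_shift U k f x) = nrm lebesgue (\<lambda>x. ?u n x - f x)" for n
        by (simp add: dilate_shift_diff[symmetric] nrm_dilate_shift[OF U] sqint_diff cutoff_sqint f)
      then show "(\<lambda>n. nrm lebesgue (\<lambda>x. dilate_shift U k (?u n) x - dilate_shift U k f x)) \<longlonglongrightarrow> 0"
        using cutoff_tendsto[OF f] by simp
    qed
    have "nrm lebesgue (\<lambda>\<xi>. fourier_L1 (dilate_shift U k (?u n)) \<xi> - ?e \<xi> * dilate_shift ?W 0 (fourier_L2 f) \<xi>)
        = nrm lebesgue (\<lambda>\<xi>. fourier_L1 (?u n) \<xi> - fourier_L2 f \<xi>)" for n
    proof -
      have "nrm lebesgue (\<lambda>\<xi>. fourier_L1 (dilate_shift U k (?u n)) \<xi> - ?e \<xi> * dilate_shift ?W 0 (fourier_L2 f) \<xi>)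
          = nrm lebesgue (\<lambda>\<xi>. ?e \<xi> * (dilate_shift ?W 0 (fourier_L1 (?u n)) \<xi> - dilate_shift ?W 0 (fourier_L2 f) \<xi>))"
        unfolding ft by (simp only: right_diff_distrib)
      also have "\<dots> = nrm lebesgue (\<lambda>\<xi>. dilate_shift ?W 0 (fourier_L1 (?u n)) \<xi> - dilate_shift ?W 0 (fourier_L2 f) \<xi>)"
        by (simp add: nrm_def norm_mult)
      also have "\<dots> = nrm lebesgue (\<lambda>\<xi>. fourier_L1 (?u n) \<xi> - fourier_L2 f \<xi>)"
        unfolding dilate_shift_diff[symmetric]
        by (intro nrm_dilate_shift W sqint_diff fourier_L1_cutoff_sqint fourier_L2_sqint f)
      finally show ?thesis .
    qed
    then show "(\<lambda>n. nrm lebesgue (\<lambda>\<xi>. fourier_L1 (dilate_shift U k (?u n)) \<xi> - ?e \<xi> * dilate_shift ?W 0 (fourier_L2 f) \<xi>)) \<longlonglongrightarrow> 0"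
      using fourier_L2_cutoff[OF f] by simp
  qed
qed

section \<open>Biorthogonal wavelet bases at all scales\<close>

lemma riesz_basis_L2_iff: "riesz_basis_L2 I h \<longleftrightarrow> riesz_basis_on lebesgue I h"
  unfolding riesz_basis_L2_def riesz_basis_on_def riesz_bounds_def L2_eq_sqint norm_L2_eq_nrm ..

lemma WSJ_index_iff [simp]:
  "Inl (k, l) \<in> WSJ_index J r s \<longleftrightarrow> k \<in> int_lattice \<and> l \<in> {1..r}"
  "Inr (j, k, n) \<in> WSJ_index J r s \<longleftrightarrow> J \<le> j \<and> k \<in> int_lattice \<and> n \<in> {1..s}"
  by (auto simp: WSJ_index_def)

lemma WSJ_index_cases:
  assumes "i \<in> WSJ_index J r s"
  obtains k l where "i = Inl (k, l)" "k \<in> int_lattice" "l \<in> {1..r}"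
  | j k n where "i = Inr (j, k, n)" "J \<le> j" "k \<in> int_lattice" "n \<in> {1..s}"
  using assms by (auto simp: WSJ_index_def)

lemma WSJ_family_simps [simp]:
  "WSJ_family M J \<phi> \<psi> (Inl (k, l)) = dilate_shift (matrix_powi M J) k (\<phi> l)"
  "WSJ_family M J \<phi> \<psi> (Inr (j, k, n)) = dilate_shift (matrix_powi M j) k (\<psi> n)"
  by (simp_all add: WSJ_family_def WS_family_def)

text \<open>The four orthogonality relations are the blocks of a single biorthogonality relation over the
  index set.\<close>

lemma nonhomogeneous_biorthogonal_pair_iff:
  fixes M :: "real^'d^'d"
  shows
  "nonhomogeneous_biorthogonal_pair M J r s \<phi> \<psi> \<phi>' \<psi>' \<longleftrightarrow>
    riesz_basis_on lebesgue (WSJ_index J r s) (WSJ_family M J \<phi> \<psi>) \<and>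
    riesz_basis_on lebesgue (WSJ_index J r s) (WSJ_family M J \<phi>' \<psi>') \<and>
    (\<forall>i\<in>WSJ_index J r s. \<forall>i'\<in>WSJ_index J r s.
      ip lebesgue (WSJ_family M J \<phi> \<psi> i) (WSJ_family M J \<phi>' \<psi>' i') = of_bool (i = i'))"
  (is "?L \<longleftrightarrow> ?R \<and> ?R' \<and> ?B")
proof
  assume L: ?L
  have "ip lebesgue (WSJ_family M J \<phi> \<psi> i) (WSJ_family M J \<phi>' \<psi>' i') = of_bool (i = i')"
    if "i \<in> WSJ_index J r s" "i' \<in> WSJ_index J r s" for i i'
    using that L unfolding nonhomogeneous_biorthogonal_pair_def inner_L2_eq_ip
    by (elim WSJ_index_cases) (simp_all, auto)
  moreover have ?R ?R'
    using L unfolding nonhomogeneous_biorthogonal_pair_def riesz_basis_L2_iff by (simp_all only: simp_thms)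
  ultimately show "?R \<and> ?R' \<and> ?B" by (intro conjI ballI)
next
  assume R: "?R \<and> ?R' \<and> ?B"
  then have B: "ip lebesgue (WSJ_family M J \<phi> \<psi> i) (WSJ_family M J \<phi>' \<psi>' i') = of_bool (i = i')"
    if "i \<in> WSJ_index J r s" "i' \<in> WSJ_index J r s" for i i'
    using that by blast
  show ?L
    unfolding nonhomogeneous_biorthogonal_pair_def inner_L2_eq_ip riesz_basis_L2_iff
  proof (intro conjI ballI allI impI)
    fix k k' :: "real^'d" and l l' assume "k \<in> int_lattice" "k' \<in> int_lattice" "l \<in> {1..r}" "l' \<in> {1..r}"
    then show "ip lebesgue (dilate_shift (matrix_powi M J) k (\<phi> l)) (dilate_shift (matrix_powi M J) k' (\<phi>' l')) = of_bool (k = k' \<and> l = l')"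
      using B[of "Inl (k, l)" "Inl (k', l')"] by simp
  next
    fix k k' :: "real^'d" and j n l' assume "k \<in> int_lattice" "k' \<in> int_lattice" "J \<le> j" "n \<in> {1..s}" "l' \<in> {1..r}"
    then show "ip lebesgue (dilate_shift (matrix_powi M j) k (\<psi> n)) (dilate_shift (matrix_powi M J) k' (\<phi>' l')) = 0"
      using B[of "Inr (j, k, n)" "Inl (k', l')"] by simp
  next
    fix k k' :: "real^'d" and l j' n' assume "k \<in> int_lattice" "k' \<in> int_lattice" "l \<in> {1..r}" "J \<le> j'" "n' \<in> {1..s}"
    then show "ip lebesgue (dilate_shift (matrix_powi M J) k (\<phi> l)) (dilate_shift (matrix_powi M j') k' (\<psi>' n')) = 0"
      using B[of "Inl (k, l)" "Inr (j', k', n')"] by simp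
  next
    fix k k' :: "real^'d" and j j' n n'
    assume "k \<in> int_lattice" "k' \<in> int_lattice" "J \<le> j" "J \<le> j'" "n \<in> {1..s}" "n' \<in> {1..s}"
    then show "ip lebesgue (dilate_shift (matrix_powi M j) k (\<psi> n)) (dilate_shift (matrix_powi M j') k' (\<psi>' n'))
        = of_bool (k = k' \<and> n = n' \<and> j = j')"
      using B[of "Inr (j, k, n)" "Inr (j', k', n')"] by (auto simp: of_bool_def)
  qed (use R in auto)
qed

lemma dilate_shift_inverse:
  assumes "invertible V"
  shows "dilate_shift V 0 (dilate_shift (matrix_inv V) 0 f) = f"
  by (simp add: dilate_shift_dilate_shift matrix_inv_left[OF assms] dilate_shift_id)

lemma dilate_reindex_lincomb:
  assumes p: "inj_on p F" and g: "\<And>i. i \<in> F \<Longrightarrow> g i = dilate_shift V 0 (h (p i))"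
  shows "(\<lambda>x. \<Sum>i\<in>F. c (p i) * g i x) = dilate_shift V 0 (\<lambda>x. \<Sum>j\<in>p ` F. c j * h j x)"
proof -
  have "(\<lambda>x. \<Sum>i\<in>F. c (p i) * g i x) = (\<lambda>x. \<Sum>i\<in>F. c (p i) * dilate_shift V 0 (h (p i)) x)"
    by (intro ext sum.cong) (auto simp: g)
  also have "\<dots> = dilate_shift V 0 (\<lambda>x. \<Sum>i\<in>F. c (p i) * h (p i) x)"
    by (rule dilate_shift_lincomb[symmetric])
  also have "(\<lambda>x. \<Sum>i\<in>F. c (p i) * h (p i) x) = (\<lambda>x. \<Sum>j\<in>p ` F. c j * h j x)"
    by (simp add: sum.reindex[OF p])
  finally show ?thesis .
qed

text \<open>Dilation by an invertible matrix is unitary, so it preserves Riesz bounds and maps Riesz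
  bases to Riesz bases.\<close>

lemma riesz_bounds_dilate:
  assumes V: "invertible V" and h: "\<And>i. i \<in> I \<Longrightarrow> h i \<in> sqint lebesgue" and p: "inj_on p I'" "p ` I' \<subseteq> I"
    and g: "\<And>i. i \<in> I' \<Longrightarrow> g i = dilate_shift V 0 (h (p i))" and b: "riesz_bounds lebesgue I h C3 C4"
  shows "riesz_bounds lebesgue I' g C3 C4"
  unfolding riesz_bounds_def
proof (intro allI impI)
  fix F and c :: "_ \<Rightarrow> complex" assume F: "finite F" "F \<subseteq> I'"
  define q where "q = inv_into I' p"
  have qp: "q (p i) = i" if "i \<in> F" for i
    using that p F by (auto simp: q_def)
  have inj: "inj_on p F" using p(1) F(2) by (rule inj_on_subset)
  have pF: "finite (p ` F)" "p ` F \<subseteq> I" using F p by auto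
  have "(\<lambda>x. \<Sum>i\<in>F. c i * g i x) = (\<lambda>x. \<Sum>i\<in>F. c (q (p i)) * g i x)"
    by (intro ext sum.cong) (auto simp: qp)
  also have "\<dots> = dilate_shift V 0 (\<lambda>x. \<Sum>j\<in>p ` F. c (q j) * h j x)"
    by (rule dilate_reindex_lincomb[where c="\<lambda>j. c (q j)" and h=h, OF inj]) (use g F in auto)
  finally have gh: "(\<lambda>x. \<Sum>i\<in>F. c i * g i x) = dilate_shift V 0 (\<lambda>x. \<Sum>j\<in>p ` F. c (q j) * h j x)" .
  have "nrm lebesgue (\<lambda>x. \<Sum>i\<in>F. c i * g i x) = nrm lebesgue (\<lambda>x. \<Sum>j\<in>p ` F. c (q j) * h j x)"
    unfolding gh by (rule nrm_dilate_shift[OF V sqint_lincomb[OF h]]) (use pF in auto)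
  moreover have "(\<Sum>j\<in>p ` F. (cmod (c (q j)))\<^sup>2) = (\<Sum>i\<in>F. (cmod (c i))\<^sup>2)"
    unfolding sum.reindex[OF inj] o_def by (intro sum.cong) (auto simp: qp)
  ultimately show "C3 * (\<Sum>i\<in>F. (cmod (c i))\<^sup>2) \<le> (nrm lebesgue (\<lambda>x. \<Sum>i\<in>F. c i * g i x))\<^sup>2 \<and>
    (nrm lebesgue (\<lambda>x. \<Sum>i\<in>F. c i * g i x))\<^sup>2 \<le> C4 * (\<Sum>i\<in>F. (cmod (c i))\<^sup>2)"
    using b[unfolded riesz_bounds_def, rule_format, OF pF, of "\<lambda>j. c (q j)"] by (simp only:)
qed

lemma riesz_basis_on_dilate:
  assumes V: "invertible V" and h: "riesz_basis_on lebesgue I h" and p: "bij_betw p I' I"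
    and g: "\<And>i. i \<in> I' \<Longrightarrow> g i = dilate_shift V 0 (h (p i))"
  shows "riesz_basis_on lebesgue I' g"
proof -
  define q where "q = inv_into I' p"
  have pq: "p (q j) = j" "q j \<in> I'" if "j \<in> I" for j
    using that p by (auto simp: q_def bij_betw_def f_inv_into_f inv_into_into)
  have pI: "inj_on p I'" "p ` I' \<subseteq> I" using p by (auto simp: bij_betw_def)
  have hL: "h i \<in> sqint lebesgue" if "i \<in> I" for i using h that by (auto simp: riesz_basis_on_def)
  obtain C3 C4 where C: "C3 > 0" "C4 > 0" and b: "riesz_bounds lebesgue I h C3 C4"
    using h unfolding riesz_basis_on_def by (elim conjE exE)
  have b': "riesz_bounds lebesgue I' g C3 C4"
    by (rule riesz_bounds_dilate[OF V hL pI g b])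
  show ?thesis
    unfolding riesz_basis_on_def
  proof (intro conjI ballI allI impI)
    fix i assume "i \<in> I'"
    then show "g i \<in> sqint lebesgue" using pI by (auto simp: g intro!: dilate_shift_sqint V hL)
  next
    fix f :: "real^'a \<Rightarrow> complex" and \<epsilon> :: real assume f: "f \<in> sqint lebesgue" and \<epsilon>: "\<epsilon> > 0"
    let ?f = "dilate_shift (matrix_inv V) 0 f"
    have f': "?f \<in> sqint lebesgue" by (intro dilate_shift_sqint invertible_matrix_inv V f)
    obtain F c where F: "finite F" "F \<subseteq> I" and lt: "nrm lebesgue (\<lambda>x. ?f x - (\<Sum>i\<in>F. c i * h i x)) < \<epsilon>"
      using h f' \<epsilon> unfolding riesz_basis_on_def by meson
    have pqF: "p ` q ` F = F" using F pq by (force simp: image_iff subset_iff)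
    have sub: "q ` F \<subseteq> I'" using F pq by auto
    have "(\<lambda>x. \<Sum>i\<in>q ` F. c (p i) * g i x) = dilate_shift V 0 (\<lambda>x. \<Sum>j\<in>p ` q ` F. c j * h j x)"
      by (rule dilate_reindex_lincomb[where h=h, OF inj_on_subset[OF pI(1) sub]]) (use g sub in auto)
    then have "(\<lambda>x. f x - (\<Sum>i\<in>q ` F. c (p i) * g i x)) = dilate_shift V 0 (\<lambda>x. ?f x - (\<Sum>i\<in>F. c i * h i x))"
      unfolding pqF dilate_shift_diff dilate_shift_inverse[OF V] by (simp add: fun_eq_iff)
    then have "nrm lebesgue (\<lambda>x. f x - (\<Sum>i\<in>q ` F. c (p i) * g i x)) < \<epsilon>"
      using lt F by (simp add: nrm_dilate_shift V sqint_diff f' sqint_lincomb hL subset_iff)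
    then show "\<exists>F c. finite F \<and> F \<subseteq> I' \<and> nrm lebesgue (\<lambda>x. f x - (\<Sum>i\<in>F. c i * g i x)) < \<epsilon>"
      using F(1) sub by (intro exI[of _ "q ` F"] exI[of _ "\<lambda>i. c (p i)"]) auto
  next
    show "\<exists>C3>0. \<exists>C4>0. riesz_bounds lebesgue I' g C3 C4" using C b' by blast
  qed
qed

text \<open>Relabels the element with scale \<open>j\<close> as the element with scale \<open>j - d\<close>. Dilation by the power
  with exponent \<open>d\<close> of the dilation matrix maps the system of scale \<open>J\<close> to that of scale \<open>J + d\<close> along
  this relabelling.\<close>

definition scale_shift :: "int \<Rightarrow> 'a + int \<times> 'b \<Rightarrow> 'a + int \<times> 'b" where
  "scale_shift d = map_sum id (\<lambda>(j, x). (j - d, x))"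

lemma scale_shift_bij: "bij_betw (scale_shift d) (WSJ_index (J + d) r s) (WSJ_index J r s)"
  by (rule bij_betw_byWitness[where f'="scale_shift (- d)"])
     (auto simp: scale_shift_def WSJ_index_def)

lemma WSJ_family_scale_shift:
  assumes "invertible M"
  shows "WSJ_family M (J + d) \<phi> \<psi> i = dilate_shift (matrix_powi M d) 0 (WSJ_family M J \<phi> \<psi> (scale_shift d i))"
proof (cases i)
  case (Inl x)
  then show ?thesis
    by (cases x) (simp add: scale_shift_def dilate_shift_dilate_shift matrix_powi_add[OF assms])
next
  case (Inr x)
  obtain j k n where "x = (j, k, n)" by (cases x)
  then show ?thesis
    using Inr matrix_powi_add[OF assms, of "j - d" d]
    by (simp add: scale_shift_def dilate_shift_dilate_shift)
qed

text \<open>The dilation preserves inner products and Riesz bases.\<close>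

lemma nonhomogeneous_biorthogonal_pair_shift:
  assumes M: "invertible M" and pair: "nonhomogeneous_biorthogonal_pair M J r s \<phi> \<psi> \<phi>' \<psi>'"
  shows "nonhomogeneous_biorthogonal_pair M (J + d) r s \<phi> \<psi> \<phi>' \<psi>'"
proof -
  let ?V = "matrix_powi M d"
  have V: "invertible ?V" by (rule invertible_matrix_powi[OF M])
  have R: "riesz_basis_on lebesgue (WSJ_index J r s) (WSJ_family M J \<phi> \<psi>)"
    "riesz_basis_on lebesgue (WSJ_index J r s) (WSJ_family M J \<phi>' \<psi>')"
    and B: "\<And>i i'. i \<in> WSJ_index J r s \<Longrightarrow> i' \<in> WSJ_index J r s \<Longrightarrow>
      ip lebesgue (WSJ_family M J \<phi> \<psi> i) (WSJ_family M J \<phi>' \<psi>' i') = of_bool (i = i')"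
    using pair unfolding nonhomogeneous_biorthogonal_pair_iff by simp_all
  have "ip lebesgue (WSJ_family M (J + d) \<phi> \<psi> i) (WSJ_family M (J + d) \<phi>' \<psi>' i') = of_bool (i = i')"
    if i: "i \<in> WSJ_index (J + d) r s" "i' \<in> WSJ_index (J + d) r s" for i i'
  proof -
    have p: "scale_shift d i \<in> WSJ_index J r s" "scale_shift d i' \<in> WSJ_index J r s"
      using i scale_shift_bij[of d J r s] by (auto simp: bij_betw_def)
    have L: "WSJ_family M J \<phi> \<psi> (scale_shift d i) \<in> sqint lebesgue" "WSJ_family M J \<phi>' \<psi>' (scale_shift d i') \<in> sqint lebesgue"
      using R p by (auto simp: riesz_basis_on_def)
    have "ip lebesgue (WSJ_family M (J + d) \<phi> \<psi> i) (WSJ_family M (J + d) \<phi>' \<psi>' i')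
        = of_bool (scale_shift d i = scale_shift d i')"
      unfolding WSJ_family_scale_shift[OF M] ip_dilate_shift[OF V L] by (rule B[OF p])
    also have "scale_shift d i = scale_shift d i' \<longleftrightarrow> i = i'"
      using i scale_shift_bij[of d J r s] by (auto simp: bij_betw_def inj_on_def)
    finally show ?thesis .
  qed
  then show ?thesis
    unfolding nonhomogeneous_biorthogonal_pair_iff
    using riesz_basis_on_dilate[OF V R(1) scale_shift_bij WSJ_family_scale_shift[OF M]]
      riesz_basis_on_dilate[OF V R(2) scale_shift_bij WSJ_family_scale_shift[OF M]] by blast
qed

text \<open>Assuming the basis property at all scales is no loss by the previous lemma. Exchanging the two
  systems gives another instance, so that every statement about one system applies to the other.\<close>

locale biorthogonal_wavelets =
  fixes M :: "real^'d^'d" and r s :: nat and \<phi> \<psi> \<phi>' \<psi>' :: "nat \<Rightarrow> real^'d \<Rightarrow> complex"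
  assumes invM: "invertible M"
    and phi: "\<And>l. l \<in> {1..r} \<Longrightarrow> \<phi> l \<in> sqint lebesgue" and psi: "\<And>n. n \<in> {1..s} \<Longrightarrow> \<psi> n \<in> sqint lebesgue"
    and phi': "\<And>l. l \<in> {1..r} \<Longrightarrow> \<phi>' l \<in> sqint lebesgue" and psi': "\<And>n. n \<in> {1..s} \<Longrightarrow> \<psi>' n \<in> sqint lebesgue"
    and pair: "\<And>J. nonhomogeneous_biorthogonal_pair M J r s \<phi> \<psi> \<phi>' \<psi>'"
begin

abbreviation "W J \<equiv> WSJ_family M J \<phi> \<psi>"
abbreviation "W' J \<equiv> WSJ_family M J \<phi>' \<psi>'"

lemma riesz: "riesz_basis_on lebesgue (WSJ_index J r s) (W J)" "riesz_basis_on lebesgue (WSJ_index J r s) (W' J)"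
  using pair[of J] unfolding nonhomogeneous_biorthogonal_pair_iff by blast+

lemma W_sqint: "i \<in> WSJ_index J r s \<Longrightarrow> W J i \<in> sqint lebesgue"
  and W'_sqint: "i \<in> WSJ_index J r s \<Longrightarrow> W' J i \<in> sqint lebesgue"
  using riesz[of J] by (simp_all add: riesz_basis_on_def)

lemma biorth: "i \<in> WSJ_index J r s \<Longrightarrow> i' \<in> WSJ_index J r s \<Longrightarrow> ip lebesgue (W J i) (W' J i') = of_bool (i = i')"
  using pair[of J] unfolding nonhomogeneous_biorthogonal_pair_iff by blast

lemma basis: "biorthogonal_riesz lebesgue (WSJ_index J r s) (W J) (W' J)"
  by unfold_locales (use riesz W'_sqint biorth in auto)

lemma swap: "biorthogonal_wavelets M r s \<phi>' \<psi>' \<phi> \<psi>"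
proof unfold_locales
  fix J
  have "ip lebesgue (W' J i) (W J i') = of_bool (i = i')"
    if "i \<in> WSJ_index J r s" "i' \<in> WSJ_index J r s" for i i'
    using biorth[OF that(2,1)] by (subst ip_commute) auto
  then show "nonhomogeneous_biorthogonal_pair M J r s \<phi>' \<psi>' \<phi> \<psi>"
    unfolding nonhomogeneous_biorthogonal_pair_iff using riesz by blast
qed (use invM phi psi phi' psi' in auto)

end

section \<open>Masks\<close>

lemma fourier_L2_translate:
  fixes f :: "real^'d \<Rightarrow> complex"
  assumes "f \<in> sqint lebesgue"
  shows "AE \<xi> in lebesgue. fourier_L2 (dilate_shift (Finite_Cartesian_Product.mat 1) m f) \<xi>
    = chr m ((1 / (2 * pi)) *\<^sub>R \<xi>) * fourier_L2 f \<xi>"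
proof -
  have inv: "matrix_inv (Finite_Cartesian_Product.mat 1 :: real^'d^'d) = Finite_Cartesian_Product.mat 1"
    by (rule matrix_inv_unique) simp_all
  show ?thesis
    using fourier_L2_dilate_shift[OF invertible_mat_1 assms, of m]
    by (simp add: inv dilate_shift_id chr_def)
qed

lemma AE_scale:
  assumes "AE x in (lebesgue :: (real^'d) measure). P x" "c \<noteq> 0"
  shows "AE x in (lebesgue :: (real^'d) measure). P (c *\<^sub>R x)"
  using AE_affine[OF invertible_scale_mat[OF assms(2)] assms(1), of 0] by simp

text \<open>A periodic function with prescribed square summable Fourier coefficients, together
  with the fact that its Fourier series converges in mean square. It is an everywhere
  periodic function and not just periodic up to a null set.\<close>

lemma fourier_series:
  fixes c :: "real^'d \<Rightarrow> complex"
  assumes L: "\<And>n. finite (L n)" "\<And>n::nat. L n \<subseteq> int_lattice" "mono L" "filterlim L (finite_subsets_at_top int_lattice) sequentially"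
    and bound: "\<And>n. (\<Sum>m\<in>L n. (cmod (c m))\<^sup>2) \<le> B"
  obtains A where "A \<in> borel_measurable lebesgue" "periodic A" "A \<in> sqint torus"
    "\<And>m. m \<in> int_lattice \<Longrightarrow> ip torus A (chr m) = c m"
    "(\<lambda>n. nrm torus (\<lambda>x. (\<Sum>m\<in>L n. c m * chr m x) - A x)) \<longlonglongrightarrow> 0"
proof -
  let ?S = "\<lambda>n x. \<Sum>m\<in>L n. c m * chr m x"
  have S: "?S n \<in> sqint torus" for n by (intro sqint_lincomb chr_sqint)
  have "\<exists>N. \<forall>m\<ge>N. \<forall>n\<ge>N. nrm torus (\<lambda>x. ?S m x - ?S n x) < d" if "d > 0" for d
    by (rule chr.series_Cauchy[OF L(1-3) bound that])
  from Riesz_Fischer[of ?S torus, OF S this] obtain \<rho> :: "nat \<Rightarrow> nat"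
    where lim: "(\<lambda>x. lim (\<lambda>k. ?S (\<rho> k) x)) \<in> sqint torus"
      "(\<lambda>n. nrm torus (\<lambda>x. ?S n x - lim (\<lambda>k. ?S (\<rho> k) x))) \<longlonglongrightarrow> 0" by blast
  show thesis
  proof (rule that[of "\<lambda>x. lim (\<lambda>k. ?S (\<rho> k) x)"])
    show "(\<lambda>x. lim (\<lambda>k. ?S (\<rho> k) x)) \<in> borel_measurable lebesgue"
      by (intro borel_measurable_lim_metric) measurable
    have "?S n (x + k) = ?S n x" if "k \<in> int_lattice" for n x k
      using that L(2)[of n] by (intro sum.cong refl) (auto simp: periodicD[OF periodic_chr])
    then show "periodic (\<lambda>x. lim (\<lambda>k. ?S (\<rho> k) x))" by (simp add: periodic_def)
    show "ip torus (\<lambda>x. lim (\<lambda>k. ?S (\<rho> k) x)) (chr m) = c m" if m: "m \<in> int_lattice" for m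
    proof (rule LIMSEQ_unique)
      show "(\<lambda>n. ip torus (?S n) (chr m)) \<longlonglongrightarrow> ip torus (\<lambda>x. lim (\<lambda>k. ?S (\<rho> k) x)) (chr m)"
        by (rule ip_tendsto_left[OF S lim chr_sqint])
      have "\<forall>\<^sub>F n in sequentially. {m} \<subseteq> L n"
        using L(4) m unfolding filterlim_finite_subsets_at_top by (auto elim!: allE[of _ "{m}"] eventually_mono)
      then have "\<forall>\<^sub>F n in sequentially. ip torus (?S n) (chr m) = c m"
        by (rule eventually_mono) (simp add: chr.coeff L(1,2) m)
      then show "(\<lambda>n. ip torus (?S n) (chr m)) \<longlonglongrightarrow> c m" by (rule tendsto_eventually)
    qed
  qed (fact lim)+
qed

context biorthogonal_wavelets
begin

abbreviation "T m f \<equiv> dilate_shift (Finite_Cartesian_Product.mat 1 :: real^'d^'d) m f"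

text \<open>A function orthogonal to all dual wavelets of nonnegative scale has an expansion in the
  integer translates of the scaling functions only. Its Fourier transform is therefore a linear
  combination of the transforms of the scaling functions whose coefficients are Fourier series with
  square summable coefficients.\<close>

lemma mask_exists:
  assumes f: "f \<in> sqint lebesgue"
    and orth: "\<And>j k n. 0 \<le> j \<Longrightarrow> k \<in> int_lattice \<Longrightarrow> n \<in> {1..s} \<Longrightarrow>
      ip lebesgue f (dilate_shift (matrix_powi M j) k (\<psi>' n)) = 0"
  obtains A where
    "\<And>l. l \<in> {1..r} \<Longrightarrow> A l \<in> borel_measurable lebesgue" "\<And>l. l \<in> {1..r} \<Longrightarrow> periodic (A l)"
    "\<And>l. l \<in> {1..r} \<Longrightarrow> A l \<in> sqint torus"
    "\<And>l m. l \<in> {1..r} \<Longrightarrow> m \<in> int_lattice \<Longrightarrow> ip torus (A l) (chr m) = ip lebesgue f (T m (\<phi>' l))"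
    "AE \<xi> in lebesgue. fourier_L2 f \<xi> = (\<Sum>l\<in>{1..r}. A l ((1 / (2 * pi)) *\<^sub>R \<xi>) * fourier_L2 (\<phi> l) \<xi>)"
proof -
  interpret B: biorthogonal_riesz lebesgue "WSJ_index 0 r s" "W 0" "W' 0" by (rule basis)
  define c where "c m l = ip lebesgue f (T m (\<phi>' l))" for m l
  have c_Inl: "ip lebesgue f (W' 0 (Inl (m, l))) = c m l" for m l by (simp add: c_def)
  have c_Inr: "ip lebesgue f (W' 0 (Inr y)) = 0" if "Inr y \<in> WSJ_index 0 r s" for y
    using that orth by (cases y) simp
  obtain L :: "nat \<Rightarrow> (real^'d) set" where L: "\<And>n. finite (L n)" "\<And>n. L n \<subseteq> int_lattice" "mono L"
    "filterlim L (finite_subsets_at_top int_lattice) sequentially"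
    using exhaustion[OF countable_int_lattice] by blast
  let ?Y = "{0..} \<times> int_lattice \<times> {1..s} :: (int \<times> (real^'d) \<times> nat) set"
  have "countable ?Y" by (intro countable_SIGMA countable_int_lattice) auto
  then obtain G :: "nat \<Rightarrow> (int \<times> (real^'d) \<times> nat) set" where G: "\<And>n. finite (G n)" "\<And>n. G n \<subseteq> ?Y"
    "mono G" "filterlim G (finite_subsets_at_top ?Y) sequentially" by (rule exhaustion) (rule that)
  define E where "E n = Inl ` (L n \<times> {1..r}) \<union> Inr ` G n" for n
  have E: "finite (E n)" "E n \<subseteq> WSJ_index 0 r s" for n
    using L(1,2)[of n] G(1,2)[of n] by (auto simp: E_def WSJ_index_def)
  have limE: "filterlim E (finite_subsets_at_top (WSJ_index 0 r s)) sequentially"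
    unfolding filterlim_finite_subsets_at_top
  proof (intro allI impI)
    fix X :: "((real^'d) \<times> nat + int \<times> (real^'d) \<times> nat) set"
    assume X: "finite X \<and> X \<subseteq> WSJ_index 0 r s"
    let ?X1 = "fst ` (Inl -` X)" and ?X2 = "Inr -` X"
    have X1: "finite ?X1" "?X1 \<subseteq> int_lattice" and X2: "finite ?X2" "?X2 \<subseteq> ?Y"
      using X by (auto simp: WSJ_index_def intro!: finite_imageI finite_vimageI)
    have "\<forall>\<^sub>F n in sequentially. finite (L n) \<and> ?X1 \<subseteq> L n \<and> L n \<subseteq> int_lattice"
      using L(4) X1 unfolding filterlim_finite_subsets_at_top by blast
    moreover have "\<forall>\<^sub>F n in sequentially. finite (G n) \<and> ?X2 \<subseteq> G n \<and> G n \<subseteq> ?Y"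
      using G(4) X2 unfolding filterlim_finite_subsets_at_top by blast
    ultimately show "\<forall>\<^sub>F n in sequentially. finite (E n) \<and> X \<subseteq> E n \<and> E n \<subseteq> WSJ_index 0 r s"
    proof eventually_elim
      case (elim n)
      have "x \<in> E n" if "x \<in> X" for x
      proof -
        have "x \<in> WSJ_index 0 r s" using X that by blast
        then show ?thesis
          by (rule WSJ_index_cases) (use elim that in \<open>force simp: E_def\<close>)+
      qed
      then show ?case using E[of n] by auto
    qed
  qed
  have partial: "B.partial (E n) f = (\<lambda>x. \<Sum>p\<in>L n \<times> {1..r}. c (fst p) (snd p) * T (fst p) (\<phi> (snd p)) x)" for n
  proof
    fix x
    let ?h = "\<lambda>i. ip lebesgue f (W' 0 i) * W 0 i x"
    have "B.partial (E n) f x = sum ?h (Inl ` (L n \<times> {1..r})) + sum ?h (Inr ` G n)"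
      unfolding B.partial_def E_def using L(1) G(1) by (intro sum.union_disjoint) auto
    also have "sum ?h (Inr ` G n) = 0"
    proof (intro sum.neutral ballI)
      fix i :: "(real^'d) \<times> nat + int \<times> (real^'d) \<times> nat" assume "i \<in> Inr ` G n"
      then obtain y where y: "i = Inr y" "Inr y \<in> WSJ_index 0 r s" using E(2)[of n] by (auto simp: E_def)
      show "?h i = 0" unfolding y(1) c_Inr[OF y(2)] by (rule mult_zero_left)
    qed
    also have "sum ?h (Inl ` (L n \<times> {1..r})) = (\<Sum>p\<in>L n \<times> {1..r}. ?h (Inl p))"
      by (subst sum.reindex) (auto simp: inj_on_def)
    also have "\<dots> = (\<Sum>p\<in>L n \<times> {1..r}. c (fst p) (snd p) * T (fst p) (\<phi> (snd p)) x)"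
      by (intro sum.cong) (auto simp: c_def)
    finally show "B.partial (E n) f x = (\<Sum>p\<in>L n \<times> {1..r}. c (fst p) (snd p) * T (fst p) (\<phi> (snd p)) x)" by simp
  qed
  have conv: "(\<lambda>n. nrm lebesgue (\<lambda>x. B.partial (E n) f x - f x)) \<longlonglongrightarrow> 0"
    by (rule B.expansion_seq[OF f limE])
  have Pn: "B.partial (E n) f \<in> sqint lebesgue" for n by (rule B.partial_sqint[OF E(2)])
  obtain C where C: "\<And>F. finite F \<Longrightarrow> F \<subseteq> WSJ_index 0 r s \<Longrightarrow>
      (\<Sum>i\<in>F. (cmod (ip lebesgue f (W' 0 i)))\<^sup>2) \<le> C * (nrm lebesgue f)\<^sup>2"
  proof (rule B.coeff_bound)
    fix C assume "\<And>f F. f \<in> sqint lebesgue \<Longrightarrow> finite F \<Longrightarrow> F \<subseteq> WSJ_index 0 r s \<Longrightarrow>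
      (\<Sum>i\<in>F. (cmod (ip lebesgue f (W' 0 i)))\<^sup>2) \<le> C * (nrm lebesgue f)\<^sup>2"
    from this[OF f] show thesis by (rule that)
  qed
  have bound: "(\<Sum>m\<in>L n. (cmod (c m l))\<^sup>2) \<le> C * (nrm lebesgue f)\<^sup>2" if "l \<in> {1..r}" for l n
  proof -
    have "(\<Sum>m\<in>L n. (cmod (c m l))\<^sup>2) = (\<Sum>i\<in>(\<lambda>m. Inl (m, l)) ` L n. (cmod (ip lebesgue f (W' 0 i)))\<^sup>2)"
      by (subst sum.reindex) (auto simp: inj_on_def c_def)
    also have "\<dots> \<le> C * (nrm lebesgue f)\<^sup>2"
      using L(1,2)[of n] that by (intro C) auto
    finally show ?thesis .
  qed
  define P where "P l A \<longleftrightarrow> A \<in> borel_measurable lebesgue \<and> periodic A \<and> A \<in> sqint torus \<and>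
    (\<forall>m\<in>int_lattice. ip torus A (chr m) = c m l) \<and>
    (\<lambda>n. nrm torus (\<lambda>x. (\<Sum>m\<in>L n. c m l * chr m x) - A x)) \<longlonglongrightarrow> 0" for l and A :: "real^'d \<Rightarrow> complex"
  have "\<exists>A. P l A" if "l \<in> {1..r}" for l
    by (rule fourier_series[OF L bound[OF that]]) (auto simp: P_def)
  then obtain A where "\<forall>l\<in>{1..r}. P l (A l)"
    using bchoice[of "{1..r}" P] by blast
  then have A: "A l \<in> borel_measurable lebesgue" "periodic (A l)" "A l \<in> sqint torus"
    "\<And>m. m \<in> int_lattice \<Longrightarrow> ip torus (A l) (chr m) = c m l"
    "(\<lambda>n. nrm torus (\<lambda>x. (\<Sum>m\<in>L n. c m l * chr m x) - A l x)) \<longlonglongrightarrow> 0" if "l \<in> {1..r}" for l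
    using that by (auto simp: P_def)
  define S where "S n l = (\<lambda>x. \<Sum>m\<in>L n. c m l * chr m x)" for n l
  define sc where "sc \<xi> = (1 / (2 * pi)) *\<^sub>R \<xi>" for \<xi> :: "real^'d"
  have S: "S n l \<in> sqint torus" for n l unfolding S_def by (intro sqint_lincomb chr_sqint)
  have perS: "S n l (x + k) = S n l x" if "k \<in> int_lattice" for n l x k
    unfolding S_def using that L(2)[of n] by (intro sum.cong refl) (auto simp: periodicD[OF periodic_chr])
  have Fpartial: "AE \<xi> in lebesgue. \<forall>n. fourier_L2 (B.partial (E n) f) \<xi> = (\<Sum>l\<in>{1..r}. S n l (sc \<xi>) * fourier_L2 (\<phi> l) \<xi>)"
  proof (subst AE_all_countable, rule allI)
    fix n
    have fin: "finite (L n \<times> {1..r})" using L(1) by simp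
    have 1: "AE \<xi> in lebesgue. fourier_L2 (B.partial (E n) f) \<xi>
        = (\<Sum>p\<in>L n \<times> {1..r}. c (fst p) (snd p) * fourier_L2 (T (fst p) (\<phi> (snd p))) \<xi>)"
      unfolding partial by (rule fourier_L2_lincomb[OF fin]) (auto intro!: dilate_shift_sqint invertible_mat_1 phi)
    have 2: "AE \<xi> in lebesgue. \<forall>p\<in>L n \<times> {1..r}. fourier_L2 (T (fst p) (\<phi> (snd p))) \<xi> = chr (fst p) (sc \<xi>) * fourier_L2 (\<phi> (snd p)) \<xi>"
      unfolding sc_def by (rule AE_finite_allI[OF fin]) (auto intro!: fourier_L2_translate phi)
    from 1 2 show "AE \<xi> in lebesgue. fourier_L2 (B.partial (E n) f) \<xi> = (\<Sum>l\<in>{1..r}. S n l (sc \<xi>) * fourier_L2 (\<phi> l) \<xi>)"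
    proof eventually_elim
      case (elim \<xi>)
      have "fourier_L2 (B.partial (E n) f) \<xi> = (\<Sum>p\<in>L n \<times> {1..r}. c (fst p) (snd p) * (chr (fst p) (sc \<xi>) * fourier_L2 (\<phi> (snd p)) \<xi>))"
        unfolding elim(1) using elim(2) by (intro sum.cong refl) auto
      also have "\<dots> = (\<Sum>m\<in>L n. \<Sum>l\<in>{1..r}. c m l * (chr m (sc \<xi>) * fourier_L2 (\<phi> l) \<xi>))"
        by (simp add: sum.cartesian_product case_prod_unfold)
      also have "\<dots> = (\<Sum>l\<in>{1..r}. \<Sum>m\<in>L n. c m l * (chr m (sc \<xi>) * fourier_L2 (\<phi> l) \<xi>))"
        by (rule sum.swap)
      also have "\<dots> = (\<Sum>l\<in>{1..r}. S n l (sc \<xi>) * fourier_L2 (\<phi> l) \<xi>)"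
        by (simp add: S_def sum_distrib_right mult.assoc)
      finally show ?case .
    qed
  qed
  have "(\<lambda>n. nrm lebesgue (\<lambda>\<xi>. fourier_L2 (B.partial (E n) f) \<xi> - fourier_L2 f \<xi>)) \<longlonglongrightarrow> 0"
    unfolding nrm_fourier_L2_diff[OF Pn f] by (rule tendsto_mult_right_zero[OF conv])
  then obtain \<rho> :: "nat \<Rightarrow> nat" where \<rho>: "strict_mono \<rho>"
    "AE \<xi> in lebesgue. (\<lambda>k. fourier_L2 (B.partial (E (\<rho> k)) f) \<xi>) \<longlonglongrightarrow> fourier_L2 f \<xi>"
    by (rule sqint_AE_subseq[of "\<lambda>n. fourier_L2 (B.partial (E n) f)", OF fourier_L2_sqint[OF Pn] fourier_L2_sqint[OF f]])
  \<comment> \<open>One further subsequence makes the Fourier series of all coefficients converge almost everywhere.\<close>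
  define u where "u k x = (\<Sum>l\<in>{1..r}. (cmod (S (\<rho> k) l x - A l x))\<^sup>2)" for k x
  have u_int: "integrable torus (u k)" for k
    unfolding u_def by (intro Bochner_Integration.integrable_sum sqint_integrable sqint_diff S A(3))
  have "(\<lambda>k. \<Sum>l\<in>{1..r}. (nrm torus (\<lambda>x. S (\<rho> k) l x - A l x))\<^sup>2) \<longlonglongrightarrow> (\<Sum>l\<in>{1..r}. 0\<^sup>2)"
  proof (intro tendsto_sum tendsto_power)
    fix l assume "l \<in> {1..r}"
    from LIMSEQ_subseq_LIMSEQ[OF A(5)[OF this] \<rho>(1)]
    show "(\<lambda>k. nrm torus (\<lambda>x. S (\<rho> k) l x - A l x)) \<longlonglongrightarrow> 0" by (simp add: o_def S_def)
  qed
  also have "(\<lambda>k. \<Sum>l\<in>{1..r}. (nrm torus (\<lambda>x. S (\<rho> k) l x - A l x))\<^sup>2) = (\<lambda>k. integral\<^sup>L torus (\<lambda>x. norm (u k x)))"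
  proof
    fix k
    have "integral\<^sup>L torus (\<lambda>x. norm (u k x)) = integral\<^sup>L torus (u k)"
      by (intro Bochner_Integration.integral_cong refl) (simp add: u_def sum_nonneg)
    also have "\<dots> = (\<Sum>l\<in>{1..r}. (nrm torus (\<lambda>x. S (\<rho> k) l x - A l x))\<^sup>2)"
      unfolding u_def nrm_sq by (intro Bochner_Integration.integral_sum sqint_integrable sqint_diff S A(3))
    finally show "(\<Sum>l\<in>{1..r}. (nrm torus (\<lambda>x. S (\<rho> k) l x - A l x))\<^sup>2) = integral\<^sup>L torus (\<lambda>x. norm (u k x))" by simp
  qed
  finally have u_lim: "(\<lambda>k. integral\<^sup>L torus (\<lambda>x. norm (u k x))) \<longlonglongrightarrow> 0" by simp
  obtain \<sigma> :: "nat \<Rightarrow> nat" where \<sigma>: "strict_mono \<sigma>" "AE x in torus. (\<lambda>k. u (\<sigma> k) x) \<longlonglongrightarrow> 0"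
    using tendsto_L1_AE_subseq[OF u_int u_lim] by blast
  have "AE x in lebesgue. (\<lambda>k. u (\<sigma> k) x) \<longlonglongrightarrow> 0"
  proof (rule AE_periodic)
    show "AE x in lebesgue. x \<in> unit_cube \<longrightarrow> (\<lambda>k. u (\<sigma> k) x) \<longlonglongrightarrow> 0" using \<sigma>(2) by (simp add: AE_torus_iff)
    have "u k (x + m) = u k x" if "m \<in> int_lattice" for k x m
      unfolding u_def using that by (intro sum.cong refl) (simp add: perS periodicD[OF A(2)])
    then show "periodic (\<lambda>x. (\<lambda>k. u (\<sigma> k) x) \<longlonglongrightarrow> 0)" by (simp add: periodic_def)
  qed
  from AE_scale[OF this, of "1 / (2 * pi)"]
  have u_AE: "AE \<xi> in lebesgue. (\<lambda>k. u (\<sigma> k) (sc \<xi>)) \<longlonglongrightarrow> 0" by (simp add: sc_def)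
  have "AE \<xi> in lebesgue. fourier_L2 f \<xi> = (\<Sum>l\<in>{1..r}. A l (sc \<xi>) * fourier_L2 (\<phi> l) \<xi>)"
    using Fpartial \<rho>(2) u_AE
  proof eventually_elim
    case (elim \<xi>)
    show ?case
    proof (rule LIMSEQ_unique)
      show "(\<lambda>k. fourier_L2 (B.partial (E (\<rho> (\<sigma> k))) f) \<xi>) \<longlonglongrightarrow> fourier_L2 f \<xi>"
        using LIMSEQ_subseq_LIMSEQ[OF elim(2) \<sigma>(1)] by (simp add: o_def)
      have "(\<lambda>k. S (\<rho> (\<sigma> k)) l (sc \<xi>)) \<longlonglongrightarrow> A l (sc \<xi>)" if l: "l \<in> {1..r}" for l
      proof -
        have "(\<lambda>k. (cmod (S (\<rho> (\<sigma> k)) l (sc \<xi>) - A l (sc \<xi>)))\<^sup>2) \<longlonglongrightarrow> 0"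
        proof (rule Lim_null_comparison[OF always_eventually elim(3)], rule allI)
          fix k
          have "(cmod (S (\<rho> (\<sigma> k)) l (sc \<xi>) - A l (sc \<xi>)))\<^sup>2 \<le> u (\<sigma> k) (sc \<xi>)"
            unfolding u_def using l by (intro member_le_sum) auto
          then show "norm ((cmod (S (\<rho> (\<sigma> k)) l (sc \<xi>) - A l (sc \<xi>)))\<^sup>2) \<le> u (\<sigma> k) (sc \<xi>)" by simp
        qed
        from tendsto_real_sqrt[OF this] have "(\<lambda>k. S (\<rho> (\<sigma> k)) l (sc \<xi>) - A l (sc \<xi>)) \<longlonglongrightarrow> 0"
          by (simp add: tendsto_norm_zero_iff)
        then show ?thesis by (simp add: LIM_zero_iff)
      qed
      then show "(\<lambda>k. fourier_L2 (B.partial (E (\<rho> (\<sigma> k))) f) \<xi>) \<longlonglongrightarrow> (\<Sum>l\<in>{1..r}. A l (sc \<xi>) * fourier_L2 (\<phi> l) \<xi>)"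
        unfolding elim(1)[rule_format] by (intro tendsto_sum tendsto_mult_right) auto
    qed
  qed
  with A show thesis by (intro that[of A]) (auto simp: c_def sc_def)
qed

end

lemma half_open_cube_pi:
  "(2 * pi) *\<^sub>R x \<in> half_open_cube pi \<longleftrightarrow> x + vec_lambda (\<lambda>_. 1/2) \<in> unit_cube"
  by (simp add: half_open_cube_unit_cube)

text \<open>Fourier series are taken with period one, masks have period $2\pi$. The half open cube of
  side $2\pi$ around the origin and the rescaled unit cube are both fundamental domains.\<close>

lemma L2_torus_rescale:
  fixes A :: "real^'d \<Rightarrow> complex"
  assumes m: "A \<in> borel_measurable lebesgue" and per: "periodic A" and A: "A \<in> sqint torus"
  shows "(\<lambda>\<xi>. c * A ((1 / (2 * pi)) *\<^sub>R \<xi>)) \<in> L2_torus"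
proof -
  let ?g = "\<lambda>\<xi>. c * A ((1 / (2 * pi)) *\<^sub>R \<xi>)" and ?t = "vec_lambda (\<lambda>_. 1/2) :: real^'d"
  have inv: "invertible (scale_mat (1 / (2 * pi)) :: real^'d^'d)" "invertible (scale_mat (2 * pi) :: real^'d^'d)"
    by (intro invertible_scale_mat; simp)+
  have g: "?g \<in> borel_measurable lebesgue"
    using measurable_compose[OF lebesgue_measurable_affine[OF inv(1), of 0] m] by simp
  have C: "{\<xi>. \<forall>i. - pi \<le> vec_nth \<xi> i \<and> vec_nth \<xi> i < pi} = (half_open_cube pi :: (real^'d) set)"
    by (simp add: half_open_cube_def)
  have "set_integrable lebesgue (half_open_cube pi) (\<lambda>\<xi>. (cmod (?g \<xi>))\<^sup>2)"
    unfolding set_integrable_def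
  proof (rule integrableI_bounded)
    show meas: "(\<lambda>x. indicat_real (half_open_cube pi) x *\<^sub>R (cmod (?g x))\<^sup>2) \<in> borel_measurable lebesgue"
      using g by measurable
    have "(\<integral>\<^sup>+\<xi>. ennreal (norm (indicat_real (half_open_cube pi) \<xi> *\<^sub>R (cmod (?g \<xi>))\<^sup>2)) \<partial>lebesgue)
        = ennreal (plancherel_const TYPE('d)) * (\<integral>\<^sup>+x. ennreal ((cmod c)\<^sup>2 * (cmod (A x))\<^sup>2) * indicator unit_cube (x + ?t) \<partial>lebesgue)"
    proof (subst nn_integral_affine[OF inv(2), of _ 0])
      show "(\<lambda>\<xi>. ennreal (norm (indicat_real (half_open_cube pi) \<xi> *\<^sub>R (cmod (?g \<xi>))\<^sup>2))) \<in> borel_measurable lebesgue"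
        using g by measurable
    qed (auto simp: plancherel_const_def half_open_cube_pi indicator_def norm_mult power_mult_distrib
           intro!: arg_cong2[where f="(*)"] nn_integral_cong)
    also have "(\<integral>\<^sup>+x. ennreal ((cmod c)\<^sup>2 * (cmod (A x))\<^sup>2) * indicator unit_cube (x + ?t) \<partial>lebesgue)
        = (\<integral>\<^sup>+x. ennreal ((cmod c)\<^sup>2 * (cmod (A (x - ?t)))\<^sup>2) * indicator unit_cube x \<partial>lebesgue)"
    proof -
      have h: "(\<lambda>x. ennreal ((cmod c)\<^sup>2 * (cmod (A (x - ?t)))\<^sup>2) * indicator unit_cube x) \<in> borel_measurable lebesgue"
        using borel_measurable_translate[OF m, of "- ?t"] by simp
      show ?thesis using nn_integral_translate[OF h, of ?t] by simp
    qed
    also have "\<dots> = (\<integral>\<^sup>+x. ennreal ((cmod c)\<^sup>2 * (cmod (A (x + - ?t)))\<^sup>2) \<partial>torus)"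
      by (simp add: nn_integral_torus)
    also have "\<dots> = (\<integral>\<^sup>+x. ennreal ((cmod c)\<^sup>2 * (cmod (A x))\<^sup>2) \<partial>torus)"
      using m per by (intro nn_integral_torus_translate[of "\<lambda>x. ennreal ((cmod c)\<^sup>2 * (cmod (A x))\<^sup>2)"]) (auto simp: periodic_def)
    also have "ennreal (plancherel_const TYPE('d)) * \<dots> < \<infinity>"
    proof -
      have "integrable torus (\<lambda>x. (cmod c)\<^sup>2 * (cmod (A x))\<^sup>2)" using sqint_integrable[OF A] by simp
      from nn_integral_eq_integral[OF this] show ?thesis
        by (simp only: AE_I2 mult_nonneg_nonneg zero_le_power2) (simp add: ennreal_mult_less_top)
    qed
    finally show "(\<integral>\<^sup>+\<xi>. ennreal (norm (indicat_real (half_open_cube pi) \<xi> *\<^sub>R (cmod (?g \<xi>))\<^sup>2)) \<partial>lebesgue) < \<infinity>" .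
  qed
  moreover have "?g (\<xi> + (2 * pi) *\<^sub>R k) = ?g \<xi>" if "k \<in> int_lattice" for \<xi> k
    using periodicD[OF per that] by (simp add: scaleR_add_right)
  ultimately show ?thesis using g unfolding L2_torus_def C by simp
qed

context biorthogonal_wavelets
begin

text \<open>Scaling functions and wavelets are treated alike as the \<open>r + s\<close> generators of scale \<open>-1\<close>.\<close>

definition gen :: "nat \<Rightarrow> real^'d \<Rightarrow> complex" where
  "gen i = (if i < r then \<phi> (Suc i) else \<psi> (Suc (i - r)))"

definition gen' :: "nat \<Rightarrow> real^'d \<Rightarrow> complex" where
  "gen' i = (if i < r then \<phi>' (Suc i) else \<psi>' (Suc (i - r)))"

definition gen_index :: "real^'d \<Rightarrow> nat \<Rightarrow> ((real^'d) \<times> nat) + (int \<times> (real^'d) \<times> nat)" where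
  "gen_index k i = (if i < r then Inl (k, Suc i) else Inr (- 1, k, Suc (i - r)))"

abbreviation "D k f \<equiv> dilate_shift (matrix_inv M) k f"

lemma gen_index: "k \<in> int_lattice \<Longrightarrow> i < r + s \<Longrightarrow> gen_index k i \<in> WSJ_index (- 1) r s"
  by (auto simp: gen_index_def)

lemma gen_index_inj: "i < r + s \<Longrightarrow> j < r + s \<Longrightarrow> gen_index k i = gen_index k' j \<longleftrightarrow> k = k' \<and> i = j"
  by (auto simp: gen_index_def split: if_splits)

lemma D_gen: "D k (gen i) = W (- 1) (gen_index k i)" "D k (gen' i) = W' (- 1) (gen_index k i)"
  by (auto simp: gen_def gen'_def gen_index_def matrix_powi_m1)

lemma gen_sqint: "i < r + s \<Longrightarrow> gen i \<in> sqint lebesgue" "i < r + s \<Longrightarrow> gen' i \<in> sqint lebesgue"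
  by (auto simp: gen_def gen'_def intro!: phi psi phi' psi')

lemma D_sqint: "f \<in> sqint lebesgue \<Longrightarrow> D k f \<in> sqint lebesgue"
  by (intro dilate_shift_sqint invertible_matrix_inv invM)

text \<open>An element of scale \<open>-1\<close> and a dual wavelet of nonnegative scale are different members of the
  biorthogonal systems of scale \<open>-1\<close>. This is the hypothesis under which masks exist.\<close>

lemma gen_orth:
  assumes "i < r + s" "k \<in> int_lattice" "0 \<le> j" "k' \<in> int_lattice" "n \<in> {1..s}"
  shows "ip lebesgue (D k (gen i)) (dilate_shift (matrix_powi M j) k' (\<psi>' n)) = 0"
    and "ip lebesgue (dilate_shift (matrix_powi M j) k' (\<psi> n)) (D k (gen' i)) = 0"
  using biorth[of "gen_index k i" "- 1" "Inr (j, k', n)"] biorth[of "Inr (j, k', n)" "- 1" "gen_index k i"]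
    assms gen_index[of k i] by (auto simp: D_gen gen_index_def)

text \<open>In \<open>A k i l\<close> the shift is \<open>k\<close>, the dilated generator is \<open>gen i\<close> with \<open>i\<close> counted from zero, and
  \<open>l\<close> is the scaling function, counted from one. The prescribed Fourier coefficients link the masks
  of the two systems.\<close>

definition mask_family :: "(real^'d \<Rightarrow> nat \<Rightarrow> nat \<Rightarrow> real^'d \<Rightarrow> complex) \<Rightarrow> bool" where
  "mask_family A \<longleftrightarrow> (\<forall>k\<in>int_lattice. \<forall>i<r + s.
    (\<forall>l\<in>{1..r}. A k i l \<in> borel_measurable lebesgue \<and> periodic (A k i l) \<and> A k i l \<in> sqint torus \<and>
      (\<forall>m\<in>int_lattice. ip torus (A k i l) (chr m) = ip lebesgue (D k (gen i)) (T m (\<phi>' l)))) \<and>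
    (AE \<xi> in lebesgue. fourier_L2 (D k (gen i)) \<xi> = (\<Sum>l\<in>{1..r}. A k i l ((1 / (2 * pi)) *\<^sub>R \<xi>) * fourier_L2 (\<phi> l) \<xi>)))"

lemma mask_family_exists: "\<exists>A. mask_family A"
proof -
  define P where "P k i A \<longleftrightarrow> (\<forall>l\<in>{1..r}. A l \<in> borel_measurable lebesgue \<and> periodic (A l) \<and> A l \<in> sqint torus \<and>
      (\<forall>m\<in>int_lattice. ip torus (A l) (chr m) = ip lebesgue (D k (gen i)) (T m (\<phi>' l)))) \<and>
    (AE \<xi> in lebesgue. fourier_L2 (D k (gen i)) \<xi> = (\<Sum>l\<in>{1..r}. A l ((1 / (2 * pi)) *\<^sub>R \<xi>) * fourier_L2 (\<phi> l) \<xi>))"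
    for k i and A :: "nat \<Rightarrow> real^'d \<Rightarrow> complex"
  have ex: "\<exists>A. P k i A" if ki: "k \<in> int_lattice" "i < r + s" for k i
  proof (rule mask_exists[of "D k (gen i)"])
    show "D k (gen i) \<in> sqint lebesgue" by (intro D_sqint gen_sqint ki)
    show "ip lebesgue (D k (gen i)) (dilate_shift (matrix_powi M j) k' (\<psi>' n)) = 0"
      if "0 \<le> j" "k' \<in> int_lattice" "n \<in> {1..s}" for j k' n
      using gen_orth(1)[OF ki(2,1) that] .
    fix A :: "nat \<Rightarrow> real^'d \<Rightarrow> complex"
    assume "\<And>l. l \<in> {1..r} \<Longrightarrow> A l \<in> borel_measurable lebesgue" "\<And>l. l \<in> {1..r} \<Longrightarrow> periodic (A l)"
      "\<And>l. l \<in> {1..r} \<Longrightarrow> A l \<in> sqint torus"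
      "\<And>l m. l \<in> {1..r} \<Longrightarrow> m \<in> int_lattice \<Longrightarrow> ip torus (A l) (chr m) = ip lebesgue (D k (gen i)) (T m (\<phi>' l))"
      "AE \<xi> in lebesgue. fourier_L2 (D k (gen i)) \<xi> = (\<Sum>l\<in>{1..r}. A l ((1 / (2 * pi)) *\<^sub>R \<xi>) * fourier_L2 (\<phi> l) \<xi>)"
    then have "P k i A" unfolding P_def by (intro conjI ballI)
    then show "\<exists>A. P k i A" by blast
  qed
  have "\<forall>p\<in>int_lattice \<times> {..<r + s}. \<exists>A. P (fst p) (snd p) A" using ex by auto
  from bchoice[OF this] obtain A where "\<forall>p\<in>int_lattice \<times> {..<r + s}. P (fst p) (snd p) (A p)" by blast
  then have "P k i (A (k, i))" if "k \<in> int_lattice" "i < r + s" for k i using that by auto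
  then have "mask_family (\<lambda>k i. A (k, i))" unfolding mask_family_def P_def by blast
  then show ?thesis by blast
qed

text \<open>On the Fourier side, dilation by the inverse of \<open>M\<close> carries the factor \<open>sqrt \<bar>det M\<bar>\<close>, which is
  divided out here.\<close>

definition mask_const :: complex where
  "mask_const = complex_of_real (1 / sqrt \<bar>det M\<bar>)"

lemma sqrt_det_mask_const: "complex_of_real (sqrt \<bar>det M\<bar>) * mask_const = 1"
  using invM by (simp add: mask_const_def invertible_det_nz flip: of_real_mult)

text \<open>The rows belong to the \<open>m\<close> generators from number \<open>off\<close> on: \<open>off = 0\<close> and \<open>m = r\<close> give the masks of
  the scaling functions, \<open>off = r\<close> and \<open>m = s\<close> those of the wavelets.\<close>

definition mask_mat :: "(real^'d \<Rightarrow> nat \<Rightarrow> nat \<Rightarrow> real^'d \<Rightarrow> complex) \<Rightarrow> nat \<Rightarrow> nat \<Rightarrow> real^'d \<Rightarrow> real^'d \<Rightarrow> complex Matrix.mat" where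
  "mask_mat A off m k \<xi> = Matrix.mat m r (\<lambda>(i, j). mask_const * A k (off + i) (Suc j) ((1 / (2 * pi)) *\<^sub>R \<xi>))"

lemma mask_mat_torus:
  assumes A: "mask_family A" and "off + m \<le> r + s" "k \<in> int_lattice"
  shows "torus_matrix m r (mask_mat A off m k)"
  unfolding torus_matrix_def
proof (intro conjI allI impI)
  fix i j assume "i < m" "j < r"
  then have "(\<lambda>\<xi>. mask_mat A off m k \<xi> $$ (i, j)) = (\<lambda>\<xi>. mask_const * A k (off + i) (Suc j) ((1 / (2 * pi)) *\<^sub>R \<xi>))"
    by (simp add: mask_mat_def)
  moreover have oj: "off + i < r + s" "Suc j \<in> {1..r}" using assms \<open>i < m\<close> \<open>j < r\<close> by auto
  have "A k (off + i) (Suc j) \<in> borel_measurable lebesgue \<and> periodic (A k (off + i) (Suc j)) \<and> A k (off + i) (Suc j) \<in> sqint torus"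
    using A assms(3) oj unfolding mask_family_def by blast
  then have "(\<lambda>\<xi>. mask_const * A k (off + i) (Suc j) ((1 / (2 * pi)) *\<^sub>R \<xi>)) \<in> L2_torus"
    by (intro L2_torus_rescale) simp_all
  ultimately show "(\<lambda>\<xi>. mask_mat A off m k \<xi> $$ (i, j)) \<in> L2_torus" by (simp only:)
qed (simp add: mask_mat_def)

text \<open>The transform of a shifted generator of scale \<open>-1\<close> is given by the dilation rule on the one hand
  and by its masks on the other; equating the two gives the refinement equation. The lattice is
  countable, so one null set serves for all shifts.\<close>

lemma mask_mat_has_masks:
  assumes A: "mask_family A" and off: "off + m \<le> r + s" and f: "\<And>i. i < m \<Longrightarrow> f (Suc i) = gen (off + i)"
  shows "has_masks M m f r \<phi> (mask_mat A off m)"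
proof -
  have inv: "invertible (matrix_inv M)" by (rule invertible_matrix_inv[OF invM])
  have "AE \<xi> in lebesgue. \<forall>k\<in>int_lattice. \<forall>i\<in>{..<m}.
      cis (- (k \<bullet> (transpose M *v \<xi>))) * fourier_L2 (f (Suc i)) (transpose M *v \<xi>)
      = (\<Sum>j<r. mask_const * A k (off + i) (Suc j) ((1 / (2 * pi)) *\<^sub>R \<xi>) * fourier_L2 (\<phi> (Suc j)) \<xi>)"
  proof (intro AE_ball_countable[THEN iffD2] countable_int_lattice AE_finite_allI ballI)
    fix k :: "real^'d" and i assume k: "k \<in> int_lattice" and i: "i \<in> {..<m}"
    then have oi: "off + i < r + s" using off by simp
    have 1: "AE \<xi> in lebesgue. fourier_L2 (D k (gen (off + i))) \<xi>
        = cis (- ((M *v k) \<bullet> \<xi>)) * dilate_shift (transpose M) 0 (fourier_L2 (gen (off + i))) \<xi>"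
      using fourier_L2_dilate_shift[OF inv gen_sqint(1)[OF oi], of k]
      by (simp add: matrix_inv_matrix_inv[OF invM])
    have 2: "AE \<xi> in lebesgue. fourier_L2 (D k (gen (off + i))) \<xi>
        = (\<Sum>l\<in>{1..r}. A k (off + i) l ((1 / (2 * pi)) *\<^sub>R \<xi>) * fourier_L2 (\<phi> l) \<xi>)"
      using A k oi unfolding mask_family_def by blast
    from 1 2 show "AE \<xi> in lebesgue. cis (- (k \<bullet> (transpose M *v \<xi>))) * fourier_L2 (f (Suc i)) (transpose M *v \<xi>)
      = (\<Sum>j<r. mask_const * A k (off + i) (Suc j) ((1 / (2 * pi)) *\<^sub>R \<xi>) * fourier_L2 (\<phi> (Suc j)) \<xi>)"
    proof eventually_elim
      case (elim \<xi>)
      have "cis (- (k \<bullet> (transpose M *v \<xi>))) * fourier_L2 (f (Suc i)) (transpose M *v \<xi>)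
          = (complex_of_real (sqrt \<bar>det M\<bar>) * mask_const) * (cis (- ((M *v k) \<bullet> \<xi>)) * fourier_L2 (gen (off + i)) (transpose M *v \<xi>))"
        using i by (simp only: sqrt_det_mask_const f matrix_inner_transpose lessThan_iff mult_1)
      also have "\<dots> = mask_const * (cis (- ((M *v k) \<bullet> \<xi>)) * dilate_shift (transpose M) 0 (fourier_L2 (gen (off + i))) \<xi>)"
        by (simp only: dilate_shift_def det_transpose diff_zero mult_ac)
      also have "\<dots> = mask_const * (\<Sum>l\<in>{1..r}. A k (off + i) l ((1 / (2 * pi)) *\<^sub>R \<xi>) * fourier_L2 (\<phi> l) \<xi>)"
        using elim by simp
      also have "(\<Sum>l\<in>{1..r}. A k (off + i) l ((1 / (2 * pi)) *\<^sub>R \<xi>) * fourier_L2 (\<phi> l) \<xi>)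
          = (\<Sum>j<r. A k (off + i) (Suc j) ((1 / (2 * pi)) *\<^sub>R \<xi>) * fourier_L2 (\<phi> (Suc j)) \<xi>)"
        by (rule sum.reindex_bij_witness[of _ Suc "\<lambda>l. l - 1"]) auto
      finally show ?case by (simp add: sum_distrib_left mult.assoc)
    qed
  qed simp
  then show ?thesis
    unfolding has_masks_def
  proof (rule AE_mp, intro AE_I2 impI ballI)
    fix \<xi> k :: "real^'d"
    assume "\<forall>k\<in>int_lattice. \<forall>i\<in>{..<m}.
      cis (- (k \<bullet> (transpose M *v \<xi>))) * fourier_L2 (f (Suc i)) (transpose M *v \<xi>)
      = (\<Sum>j<r. mask_const * A k (off + i) (Suc j) ((1 / (2 * pi)) *\<^sub>R \<xi>) * fourier_L2 (\<phi> (Suc j)) \<xi>)"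
      and k: "k \<in> int_lattice"
    then have eq: "cis (- (k \<bullet> (transpose M *v \<xi>))) * fourier_L2 (f (Suc i)) (transpose M *v \<xi>)
      = (\<Sum>j<r. mask_const * A k (off + i) (Suc j) ((1 / (2 * pi)) *\<^sub>R \<xi>) * fourier_L2 (\<phi> (Suc j)) \<xi>)" if "i < m" for i
      using that by blast
    show "cis (- (k \<bullet> (transpose M *v \<xi>))) \<cdot>\<^sub>v fourier_vec m f (transpose M *v \<xi>) = mask_mat A off m k \<xi> *\<^sub>v fourier_vec r \<phi> \<xi>"
    proof (rule eq_vecI)
      fix i assume "i < dim_vec (mask_mat A off m k \<xi> *\<^sub>v fourier_vec r \<phi> \<xi>)"
      then have i: "i < m" by (simp add: mask_mat_def)
      have "(mask_mat A off m k \<xi> *\<^sub>v fourier_vec r \<phi> \<xi>) $ i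
          = (\<Sum>j<r. mask_const * A k (off + i) (Suc j) ((1 / (2 * pi)) *\<^sub>R \<xi>) * fourier_L2 (\<phi> (Suc j)) \<xi>)"
        using i by (simp add: mask_mat_def fourier_vec_def scalar_prod_def lessThan_atLeast0)
      also have "\<dots> = (cis (- (k \<bullet> (transpose M *v \<xi>))) \<cdot>\<^sub>v fourier_vec m f (transpose M *v \<xi>)) $ i"
        unfolding eq[OF i, symmetric] using i by (simp add: fourier_vec_def)
      finally show "(cis (- (k \<bullet> (transpose M *v \<xi>))) \<cdot>\<^sub>v fourier_vec m f (transpose M *v \<xi>)) $ i
          = (mask_mat A off m k \<xi> *\<^sub>v fourier_vec r \<phi> \<xi>) $ i" by simp
    qed (simp add: mask_mat_def fourier_vec_def)
  qed
qed

end

section \<open>Integer dilation matrices\<close>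

lemma coset_reps_eq: "coset_reps M = cube_cosets (transpose M)"
  by (simp add: coset_reps_def cube_cosets_def unit_cube_def)

text \<open>The shifts of the polyphase matrix represent characters that are trivial on the image of
  \<open>N\<close>.\<close>

lemma chr_int_matrix:
  fixes N :: "real^'d^'d"
  assumes "w \<in> cube_cosets (transpose N)" "w' \<in> cube_cosets (transpose N)" "invertible N" "k \<in> int_lattice"
  shows "chr (N *v k) (w' - w) = 1"
proof -
  obtain m m' where m: "m \<in> int_lattice" "m' \<in> int_lattice"
    "w = matrix_inv (transpose N) *v m" "w' = matrix_inv (transpose N) *v m'"
    using assms by (auto simp: cube_cosets_def)
  have "transpose N *v (w' - w) = m' - m"
    using invertible_transpose[OF assms(3)]
    by (simp add: m(3,4) matrix_vector_mult_diff_distrib del: transpose_matrix_vector)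
  then have "(N *v k) \<bullet> (w' - w) = k \<bullet> (m' - m)" by (simp only: matrix_inner_transpose)
  then show ?thesis
    using chr_lattice[OF assms(4) int_lattice_diff[OF m(2,1)]] by (simp only: chr_def)
qed

text \<open>Orthogonality of the characters of the finite group $Z^d / N Z^d$: translation by a group
  element on which a nontrivial character is not one permutes the group.\<close>

lemma sum_characters:
  fixes N :: "real^'d^'d"
  assumes N: "invertible N" "int_matrix N" and w: "w \<in> cube_cosets (transpose N)" "w' \<in> cube_cosets (transpose N)"
  shows "(\<Sum>\<mu>\<in>cube_cosets N. chr (N *v \<mu>) (w' - w)) = of_bool (w = w') * complex_of_real \<bar>det N\<bar>"
proof (cases "w = w'")
  case True
  then show ?thesis
  proof -
    have "(\<Sum>\<mu>\<in>cube_cosets N. chr (N *v \<mu>) (w' - w)) = complex_of_real (real (card (cube_cosets N)))"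
      using True by (simp add: chr_def)
    then show ?thesis unfolding card_cube_cosets(2)[OF N] using True by simp
  qed
next
  case False
  let ?\<nu> = "w' - w" and ?C = "cube_cosets N"
  have "?\<nu> \<notin> int_lattice"
    using unit_cube_lattice_unique[of w' w] w False by (auto simp: cube_cosets_def)
  then obtain i where i: "vec_nth ?\<nu> i \<notin> \<int>" by (auto simp: int_lattice_def)
  let ?e = "axis i 1 :: real^'d"
  have ne1: "chr ?e ?\<nu> \<noteq> 1"
  proof
    assume "chr ?e ?\<nu> = 1"
    then have "cos (2 * pi * vec_nth ?\<nu> i) = 1"
      by (simp add: chr_def complex_eq_iff inner_axis' )
    then obtain n :: int where "2 * pi * vec_nth ?\<nu> i = of_int n * 2 * pi"
      by (auto simp: cos_one_2pi_int)
    then show False using i by simp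
  qed
  define v where "v = matrix_inv N *v ?e"
  define \<pi> where "\<pi> \<mu> = (\<mu> + v) - lfloor (\<mu> + v)" for \<mu>
  have into: "\<pi> \<mu> \<in> ?C" if mu: "\<mu> \<in> ?C" for \<mu>
  proof -
    obtain m where m: "m \<in> int_lattice" "\<mu> = matrix_inv N *v m" using mu by (auto simp: cube_cosets_def)
    have "\<pi> \<mu> = matrix_inv N *v (m + ?e - N *v lfloor (\<mu> + v))"
      using N by (simp add: \<pi>_def v_def m matrix_vector_mult_diff_distrib matrix_vector_right_distrib)
    moreover have "m + ?e - N *v lfloor (\<mu> + v) \<in> int_lattice"
      by (intro int_lattice_diff int_lattice_add m axis_lattice int_matrix_mult N) simp
    moreover have "\<pi> \<mu> \<in> unit_cube" by (simp add: \<pi>_def)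
    ultimately show ?thesis unfolding cube_cosets_def by blast
  qed
  have inj: "inj_on \<pi> ?C"
  proof (rule inj_onI)
    fix x y assume xy: "x \<in> ?C" "y \<in> ?C" "\<pi> x = \<pi> y"
    then have "x - y = lfloor (x + v) - lfloor (y + v)" by (simp add: \<pi>_def algebra_simps)
    then show "x = y" using xy by (intro unit_cube_lattice_unique) (auto simp: cube_cosets_def int_lattice_diff)
  qed
  have fin: "finite ?C" by (rule card_cube_cosets(1)[OF N])
  have surj: "\<pi> ` ?C = ?C" using endo_inj_surj[OF fin _ inj] into by blast
  have "(\<Sum>\<mu>\<in>?C. chr (N *v \<mu>) ?\<nu>) = (\<Sum>\<mu>\<in>\<pi> ` ?C. chr (N *v \<mu>) ?\<nu>)" by (simp add: surj)
  also have "\<dots> = (\<Sum>\<mu>\<in>?C. chr (N *v \<pi> \<mu>) ?\<nu>)" by (simp add: sum.reindex[OF inj])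
  also have "\<dots> = (\<Sum>\<mu>\<in>?C. chr ?e ?\<nu> * chr (N *v \<mu>) ?\<nu>)"
  proof (rule sum.cong[OF refl])
    fix \<mu> assume "\<mu> \<in> ?C"
    have "N *v \<pi> \<mu> = (N *v \<mu> + ?e) - N *v lfloor (\<mu> + v)"
      using N by (simp add: \<pi>_def v_def matrix_vector_mult_diff_distrib matrix_vector_right_distrib)
    then show "chr (N *v \<pi> \<mu>) ?\<nu> = chr ?e ?\<nu> * chr (N *v \<mu>) ?\<nu>"
      using chr_int_matrix[OF w N(1) lfloor_lattice] by (simp add: chr_diff_left chr_add_left)
  qed
  finally have "(1 - chr ?e ?\<nu>) * (\<Sum>\<mu>\<in>?C. chr (N *v \<mu>) ?\<nu>) = 0"
    by (simp add: sum_distrib_left[symmetric] algebra_simps)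
  then show ?thesis using ne1 False by simp
qed

context biorthogonal_wavelets
begin

text \<open>Coefficients of the generators of scale \<open>-1\<close> in the integer translates of the scaling
  functions.\<close>

definition coef :: "nat \<Rightarrow> real^'d \<Rightarrow> nat \<Rightarrow> complex" where
  "coef i m l = ip lebesgue (D 0 (gen i)) (T m (\<phi>' l))"

definition coef' :: "nat \<Rightarrow> real^'d \<Rightarrow> nat \<Rightarrow> complex" where
  "coef' i m l = ip lebesgue (D 0 (gen' i)) (T m (\<phi> l))"

lemma T_T: "T a (T b f) = T (a + b) f"
  by (simp add: dilate_shift_dilate_shift)

lemma ip_T_shift:
  assumes "f \<in> sqint lebesgue" "g \<in> sqint lebesgue"
  shows "ip lebesgue (D k f) (T m g) = ip lebesgue (D 0 f) (T (m - M *v k) g)"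
proof -
  have "D k f = T (M *v k) (D 0 f)" by (simp add: dilate_shift_dilate_shift invM)
  moreover have "T m g = T (M *v k) (T (m - M *v k) g)" by (simp add: T_T)
  ultimately show ?thesis
    using ip_dilate_shift[OF invertible_mat_1 D_sqint[OF assms(1)] dilate_shift_sqint[OF invertible_mat_1 assms(2)]]
    by simp
qed

text \<open>Expanding a translate of a scaling function in the basis of coarsest scale \<open>-1\<close> and pairing
  with a dual translate gives the completeness relation for the refinement coefficients. For the
  elements of scale \<open>-1\<close> the shift by \<open>k\<close> acts on the coefficients as a shift by \<open>M k\<close>.\<close>

lemma completeness:
  assumes m: "m \<in> int_lattice" "m' \<in> int_lattice" and l: "l \<in> {1..r}" "l' \<in> {1..r}"
  shows "((\<lambda>(i, k). cnj (coef' i (m - M *v k) l) * coef i (m' - M *v k) l') has_sum of_bool (m = m' \<and> l = l'))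
    ({..<r + s} \<times> int_lattice)"
proof -
  interpret B: biorthogonal_riesz lebesgue "WSJ_index (- 1) r s" "W (- 1)" "W' (- 1)" by (rule basis)
  let ?f = "T m (\<phi> l)" and ?g = "T m' (\<phi>' l')"
  let ?t = "\<lambda>x. ip lebesgue ?f (W' (- 1) x) * ip lebesgue (W (- 1) x) ?g"
  have L2: "?f \<in> sqint lebesgue" "?g \<in> sqint lebesgue"
    by (intro dilate_shift_sqint invertible_mat_1 phi phi' l)+
  have fg: "ip lebesgue ?f ?g = of_bool (m = m' \<and> l = l')"
    using biorth[of "Inl (m, l)" 0 "Inl (m', l')"] m l by simp
  let ?q = "\<lambda>(i, k). gen_index k i"
  have inj: "inj_on ?q ({..<r + s} \<times> int_lattice)"
    by (auto simp: inj_on_def gen_index_inj)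
  have zero: "?t x = 0" if "x \<in> WSJ_index (- 1) r s - ?q ` ({..<r + s} \<times> int_lattice)" for x
  proof -
    have x: "x \<in> WSJ_index (- 1) r s" "x \<notin> ?q ` ({..<r + s} \<times> int_lattice)" using that by auto
    from x(1) show ?thesis
    proof (cases rule: WSJ_index_cases)
      case (1 k l0)
      then have "x \<in> ?q ` ({..<r + s} \<times> int_lattice)"
        by (intro image_eqI[of _ _ "(l0 - 1, k)"]) (auto simp: gen_index_def)
      then show ?thesis using x(2) by blast
    next
      case (2 j k n)
      show ?thesis
      proof (cases "j = - 1")
        case True
        then have "x \<in> ?q ` ({..<r + s} \<times> int_lattice)"
          using 2 by (intro image_eqI[of _ _ "(r + (n - 1), k)"]) (auto simp: gen_index_def)
        then show ?thesis using x(2) by blast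
      next
        case False
        then have "0 \<le> j" using 2 by simp
        then show ?thesis
          using biorth[of "Inl (m, l)" 0 "Inr (j, k, n)"] 2 m l by simp
      qed
    qed
  qed
  have "(?t has_sum of_bool (m = m' \<and> l = l')) (WSJ_index (- 1) r s)"
    using B.parseval[OF L2] by (simp only: fg)
  also have "?this \<longleftrightarrow> (?t has_sum of_bool (m = m' \<and> l = l')) (?q ` ({..<r + s} \<times> int_lattice))"
    by (rule has_sum_cong_neutral) (use zero in \<open>auto simp: gen_index\<close>)
  also have "\<dots> \<longleftrightarrow> ((?t \<circ> ?q) has_sum of_bool (m = m' \<and> l = l')) ({..<r + s} \<times> int_lattice)"
    by (rule has_sum_reindex[OF inj])
  also have "\<dots> \<longleftrightarrow> ((\<lambda>(i, k). cnj (coef' i (m - M *v k) l) * coef i (m' - M *v k) l') has_sum of_bool (m = m' \<and> l = l'))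
    ({..<r + s} \<times> int_lattice)"
  proof (rule has_sum_cong)
    fix p assume "p \<in> {..<r + s} \<times> (int_lattice :: (real^'d) set)"
    then obtain i k where p: "p = (i, k)" "i < r + s" "k \<in> int_lattice" by auto
    have "ip lebesgue ?f (D k (gen' i)) = cnj (coef' i (m - M *v k) l)"
      using ip_T_shift[OF gen_sqint(2)[OF p(2)] phi[OF l(1)], of k m] ip_commute[of lebesgue ?f]
      by (simp add: coef'_def)
    moreover have "ip lebesgue (D k (gen i)) ?g = coef i (m' - M *v k) l'"
      using ip_T_shift[OF gen_sqint(1)[OF p(2)] phi'[OF l(2)], of k m'] by (simp add: coef_def)
    ultimately show "(?t \<circ> ?q) p = (case p of (i, k) \<Rightarrow> cnj (coef' i (m - M *v k) l) * coef i (m' - M *v k) l')"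
      by (simp add: p(1) D_gen)
  qed
  finally show ?thesis .
qed

text \<open>A generator of scale \<open>-1\<close> and its dual have inner product one. Expanding the generator in the
  basis of scale \<open>0\<close> leaves only the scaling functions.\<close>

lemma coefficients_dual:
  assumes i: "i < r + s"
  shows "((\<lambda>(m, l). coef i m l * cnj (coef' i m l)) has_sum 1) (int_lattice \<times> {1..r})"
proof -
  interpret B: biorthogonal_riesz lebesgue "WSJ_index 0 r s" "W 0" "W' 0" by (rule basis)
  let ?f = "D 0 (gen i)" and ?g = "D 0 (gen' i)"
  let ?t = "\<lambda>x. ip lebesgue ?f (W' 0 x) * ip lebesgue (W 0 x) ?g"
  have L2: "?f \<in> sqint lebesgue" "?g \<in> sqint lebesgue" by (intro D_sqint gen_sqint i)+
  have fg: "ip lebesgue ?f ?g = 1"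
    using biorth[OF gen_index gen_index, OF int_lattice_0 i int_lattice_0 i] by (simp add: D_gen)
  have "(?t has_sum 1) (WSJ_index 0 r s)"
    using B.parseval[OF L2] by (simp only: fg)
  also have "?this \<longleftrightarrow> (?t has_sum 1) (Inl ` (int_lattice \<times> {1..r}))"
  proof (rule has_sum_cong_neutral)
    fix x :: "(real^'d) \<times> nat + int \<times> (real^'d) \<times> nat"
    assume x: "x \<in> WSJ_index 0 r s - Inl ` (int_lattice \<times> {1..r})"
    then have "x \<in> WSJ_index 0 r s" by simp
    then show "?t x = 0"
      by (cases rule: WSJ_index_cases) (use x i in \<open>auto simp: gen_orth\<close>)
  qed auto
  also have "\<dots> \<longleftrightarrow> ((?t \<circ> Inl) has_sum 1) (int_lattice \<times> {1..r})"
    by (rule has_sum_reindex) (simp add: inj_on_def)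
  also have "\<dots> \<longleftrightarrow> ((\<lambda>(m, l). coef i m l * cnj (coef' i m l)) has_sum 1) (int_lattice \<times> {1..r})"
    by (rule has_sum_cong) (auto simp: coef_def coef'_def ip_commute[of lebesgue _ ?g])
  finally show ?thesis .
qed

end

text \<open>Every lattice point is \<open>N \<mu> - N k\<close> for exactly one coset representative \<open>N \<mu>\<close> and one lattice
  point \<open>k\<close>.\<close>

lemma lattice_cosets:
  fixes N :: "real^'d^'d"
  assumes N: "invertible N" "int_matrix N"
  shows "(\<Union>\<mu>\<in>cube_cosets N. (\<lambda>k. N *v \<mu> - N *v k) ` int_lattice) = int_lattice"
    and "\<mu> \<in> cube_cosets N \<Longrightarrow> \<mu>' \<in> cube_cosets N \<Longrightarrow> \<mu> \<noteq> \<mu>' \<Longrightarrow>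
      (\<lambda>k. N *v \<mu> - N *v k) ` int_lattice \<inter> (\<lambda>k. N *v \<mu>' - N *v k) ` int_lattice = {}"
    and "inj (\<lambda>k. N *v \<mu> - N *v k)"
    and "\<mu> \<in> cube_cosets N \<Longrightarrow> N *v \<mu> \<in> int_lattice"
proof -
  show lat: "N *v \<mu> \<in> int_lattice" if "\<mu> \<in> cube_cosets N" for \<mu>
    using that N by (auto simp: cube_cosets_def)
  have Ninj: "x = y" if "N *v x = N *v y" for x y
  proof -
    have "matrix_inv N *v (N *v x) = matrix_inv N *v (N *v y)" using that by simp
    then show ?thesis by (simp add: N)
  qed
  show "inj (\<lambda>k. N *v \<mu> - N *v k)" by (auto simp: inj_def intro: Ninj)
  show "(\<Union>\<mu>\<in>cube_cosets N. (\<lambda>k. N *v \<mu> - N *v k) ` int_lattice) = int_lattice"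
  proof (intro subset_antisym subsetI)
    fix m assume "m \<in> (\<Union>\<mu>\<in>cube_cosets N. (\<lambda>k. N *v \<mu> - N *v k) ` int_lattice)"
    then obtain \<mu> k where "\<mu> \<in> cube_cosets N" "k \<in> int_lattice" "m = N *v \<mu> - N *v k" by blast
    then show "m \<in> int_lattice" using int_lattice_diff[OF lat int_matrix_mult[OF N(2)]] by simp
  next
    fix m :: "real^'d" assume m: "m \<in> int_lattice"
    let ?x = "matrix_inv N *v m"
    let ?\<mu> = "?x - lfloor ?x"
    have "?\<mu> = matrix_inv N *v (m - N *v lfloor ?x)" using N by (simp add: matrix_vector_mult_diff_distrib)
    moreover have "m - N *v lfloor ?x \<in> int_lattice" by (intro int_lattice_diff m int_matrix_mult N) simp
    moreover have "?\<mu> \<in> unit_cube" by simp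
    ultimately have "?\<mu> \<in> cube_cosets N" unfolding cube_cosets_def by blast
    moreover have "m = N *v ?\<mu> - N *v (- lfloor ?x)"
      using N matrix_vector_mult_diff_distrib[of N 0 "lfloor ?x"] by (simp add: matrix_vector_mult_diff_distrib)
    ultimately show "m \<in> (\<Union>\<mu>\<in>cube_cosets N. (\<lambda>k. N *v \<mu> - N *v k) ` int_lattice)"
      by (blast intro: int_lattice_uminus lfloor_lattice)
  qed
  show "(\<lambda>k. N *v \<mu> - N *v k) ` int_lattice \<inter> (\<lambda>k. N *v \<mu>' - N *v k) ` int_lattice = {}"
    if mu: "\<mu> \<in> cube_cosets N" "\<mu>' \<in> cube_cosets N" "\<mu> \<noteq> \<mu>'"
  proof (rule ccontr)
    assume "\<not> ?thesis"
    then obtain k k' where k: "k \<in> int_lattice" "k' \<in> int_lattice" "N *v \<mu> - N *v k = N *v \<mu>' - N *v k'" by auto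
    then have "N *v (\<mu> - k) = N *v (\<mu>' - k')" by (simp add: matrix_vector_mult_diff_distrib)
    then have "\<mu> - k = \<mu>' - k'" by (rule Ninj)
    then have "\<mu> - \<mu>' = k - k'" by (simp add: algebra_simps)
    then have "\<mu> = \<mu>'"
      using mu k by (intro unit_cube_lattice_unique) (auto simp: cube_cosets_def int_lattice_diff)
    with mu(3) show False by simp
  qed
qed

lemma sqint_torus_translate:
  fixes f :: "real^'d \<Rightarrow> complex"
  assumes m: "f \<in> borel_measurable lebesgue" and per: "periodic f" and f: "f \<in> sqint torus"
  shows "(\<lambda>x. f (x + t)) \<in> sqint torus"
proof -
  note [measurable] = borel_measurable_translate[OF m]
  have "integrable torus (\<lambda>x. (cmod (f (x + t)))\<^sup>2)"
    using m per sqint_integrable[OF f]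
    by (intro integrable_torus_translate[of "\<lambda>x. (cmod (f x))\<^sup>2"]) (auto simp: periodic_def)
  moreover have "(\<lambda>x. f (x + t)) \<in> borel_measurable torus" by measurable
  ultimately show ?thesis by (simp add: sqint_def)
qed

lemma ip_translate_chr:
  fixes f :: "real^'d \<Rightarrow> complex"
  assumes m: "f \<in> borel_measurable lebesgue" and per: "periodic f" and f: "f \<in> sqint torus"
    and k: "k \<in> int_lattice"
  shows "ip torus (\<lambda>x. f (x + t)) (chr k) = chr k t * ip torus f (chr k)"
proof -
  let ?h = "\<lambda>x. f x * cnj (chr k x)"
  note [measurable] = m
  have h: "integrable torus ?h" by (rule integrable_prod[OF f chr_sqint])
  have hp: "periodic ?h" using periodicD[OF per] periodicD[OF periodic_chr[OF k]] by (simp add: periodic_def)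
  have hm: "?h \<in> borel_measurable lebesgue" by (intro borel_measurable_times m borel_measurable_cnj chr_lebesgue)
  have "f (x + t) * cnj (chr k x) = chr k t * ?h (x + t)" for x
  proof -
    have "chr k t * ?h (x + t) = (chr k t * cnj (chr k t)) * (f (x + t) * cnj (chr k x))"
      by (simp only: chr_add_right complex_cnj_mult mult_ac)
    then show ?thesis by (simp only: chr_mult_cnj mult_1)
  qed
  then have "ip torus (\<lambda>x. f (x + t)) (chr k) = integral\<^sup>L torus (\<lambda>x. chr k t * ?h (x + t))"
    unfolding ip_def by (simp only:)
  also have "\<dots> = chr k t * integral\<^sup>L torus (\<lambda>x. ?h (x + t))" by simp
  also have "integral\<^sup>L torus (\<lambda>x. ?h (x + t)) = integral\<^sup>L torus ?h"
    by (rule integral_torus_translate[OF hm hp h])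
  finally show ?thesis by (simp add: ip_def)
qed

context biorthogonal_wavelets
begin

definition has_coefficients :: "(nat \<Rightarrow> real^'d \<Rightarrow> nat \<Rightarrow> complex) \<Rightarrow> (nat \<Rightarrow> nat \<Rightarrow> real^'d \<Rightarrow> complex) \<Rightarrow> bool" where
  "has_coefficients c A \<longleftrightarrow> (\<forall>i<r + s. \<forall>l\<in>{1..r}. A i l \<in> borel_measurable lebesgue \<and> periodic (A i l) \<and>
    A i l \<in> sqint torus \<and> (\<forall>m\<in>int_lattice. ip torus (A i l) (chr m) = c i m l))"

lemma has_coefficientsD:
  assumes "has_coefficients c A" "i < r + s" "l \<in> {1..r}"
  shows "A i l \<in> borel_measurable lebesgue" "periodic (A i l)" "A i l \<in> sqint torus"
    "m \<in> int_lattice \<Longrightarrow> ip torus (A i l) (chr m) = c i m l"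
  using assms unfolding has_coefficients_def by blast+

text \<open>By Parseval's identity the Fourier coefficients of these products are sums over the lattice.
  Splitting the lattice into the cosets of the image of \<open>M\<close>, each coset contributes a value of a
  character of the finite quotient group times an instance of the completeness relation.\<close>

lemma gram_coefficients:
  fixes A A' :: "nat \<Rightarrow> nat \<Rightarrow> real^'d \<Rightarrow> complex"
  assumes M: "int_matrix M" and A: "has_coefficients coef A" and A': "has_coefficients coef' A'"
    and w: "w \<in> cube_cosets (transpose M)" "w' \<in> cube_cosets (transpose M)"
    and l: "l \<in> {1..r}" "l' \<in> {1..r}" and n: "n \<in> int_lattice"
  shows "(\<Sum>i<r + s. ip torus (\<lambda>x. A i l' (x + w') * cnj (chr n x)) (\<lambda>x. A' i l (x + w)))
    = of_bool (n = 0 \<and> w = w' \<and> l = l') * complex_of_real \<bar>det M\<bar>"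
proof -
  interpret C: biorthogonal_riesz torus int_lattice chr "chr :: real^'d \<Rightarrow> _" by (rule chr_basis)
  let ?I = "{..<r + s}" and ?Z = "int_lattice :: (real^'d) set"
  define E where "E i = (\<lambda>x. A i l' (x + w') * cnj (chr n x))" for i
  define B where "B i = (\<lambda>x. A' i l (x + w))" for i
  define t where "t = (\<lambda>(i, m). chr (n + m) w' * coef i (n + m) l' * cnj (chr m w * coef' i m l))"
  have Aw: "(\<lambda>x. A i l' (x + w')) \<in> sqint torus" if "i < r + s" for i
    by (intro sqint_torus_translate has_coefficientsD[OF A that l(2)])
  have E: "E i \<in> sqint torus" if "i < r + s" for i
    unfolding E_def using sqint_unimodular_mult[OF Aw[OF that], of "\<lambda>x. cnj (chr n x)"]
    by (simp add: mult.commute borel_measurable_cnj)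
  have B: "B i \<in> sqint torus" if "i < r + s" for i
    unfolding B_def by (intro sqint_torus_translate has_coefficientsD[OF A' that l(1)])
  have "((\<lambda>m. t (i, m)) has_sum ip torus (E i) (B i)) ?Z" if i: "i < r + s" for i
  proof -
    have "ip torus (E i) (chr m) = chr (n + m) w' * coef i (n + m) l'" if m: "m \<in> ?Z" for m
    proof -
      have "ip torus (E i) (chr m) = ip torus (\<lambda>x. A i l' (x + w')) (chr (n + m))"
        unfolding ip_def E_def by (simp add: chr_add_left mult.assoc)
      also have "\<dots> = chr (n + m) w' * ip torus (A i l') (chr (n + m))"
        by (intro ip_translate_chr has_coefficientsD[OF A i l(2)] int_lattice_add n m)
      finally show ?thesis
        by (simp add: has_coefficientsD(4)[OF A i l(2)] int_lattice_add n m)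
    qed
    moreover have "ip torus (chr m) (B i) = cnj (chr m w * coef' i m l)" if m: "m \<in> ?Z" for m
    proof -
      have "ip torus (B i) (chr m) = chr m w * ip torus (A' i l) (chr m)"
        unfolding B_def by (intro ip_translate_chr has_coefficientsD[OF A' i l(1)] m)
      then show ?thesis
        by (simp add: ip_commute[of torus "chr m"] has_coefficientsD(4)[OF A' i l(1) m])
    qed
    ultimately have "ip torus (E i) (chr m) * ip torus (chr m) (B i) = t (i, m)" if "m \<in> ?Z" for m
      using that by (simp add: t_def)
    then show ?thesis
      using C.parseval[OF E[OF i] B[OF i]] by (subst has_sum_cong[symmetric]) auto
  qed
  then have rows: "(t has_sum ip torus (E i) (B i)) (Pair i ` ?Z)" if "i \<in> ?I" for i
    using that by (subst has_sum_reindex) (auto simp: inj_on_def o_def)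
  have "(t has_sum (\<Sum>i\<in>?I. ip torus (E i) (B i))) (\<Union>i\<in>?I. Pair i ` ?Z)"
    by (rule sum_has_sum[OF _ rows]) auto
  also have "(\<Union>i\<in>?I. Pair i ` ?Z) = ?I \<times> ?Z" by auto
  finally have sum1: "(t has_sum (\<Sum>i\<in>?I. ip torus (E i) (B i))) (?I \<times> ?Z)" .
  define \<kappa> where "\<kappa> \<mu> = chr n w' * chr (M *v \<mu>) (w' - w)" for \<mu>
  define S where "S \<mu> = (\<lambda>k. M *v \<mu> - M *v k) ` ?Z" for \<mu>
  have coset: "(t has_sum \<kappa> \<mu> * of_bool (n = 0 \<and> l = l')) (?I \<times> S \<mu>)" if mu: "\<mu> \<in> cube_cosets M" for \<mu>
  proof -
    let ?a = "M *v \<mu>"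
    have a: "?a \<in> ?Z" by (rule lattice_cosets(4)[OF invM M mu])
    let ?q = "\<lambda>(i, k). (i :: nat, ?a - M *v k)"
    have inj: "inj_on ?q (?I \<times> ?Z)"
      using lattice_cosets(3)[OF invM M, of \<mu>] by (auto simp: inj_on_def inj_def)
    have tq: "(t \<circ> ?q) p = \<kappa> \<mu> * (case p of (i, k) \<Rightarrow> cnj (coef' i (?a - M *v k) l) * coef i ((n + ?a) - M *v k) l')"
      if pIZ: "p \<in> ?I \<times> ?Z" for p
    proof -
      obtain i k where p: "p = (i, k)" "k \<in> ?Z" using pIZ by auto
      have "chr (n + (?a - M *v k)) w' * cnj (chr (?a - M *v k) w) = chr n w' * chr (?a - M *v k) (w' - w)"
        by (simp add: chr_add_left chr_diff_right)
      also have "\<dots> = \<kappa> \<mu>"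
        using chr_int_matrix[OF w invM p(2)] by (simp add: chr_diff_left \<kappa>_def)
      finally have "chr (n + (?a - M *v k)) w' * cnj (chr (?a - M *v k) w) = \<kappa> \<mu>" .
      moreover have "(t \<circ> ?q) p = (chr (n + (?a - M *v k)) w' * cnj (chr (?a - M *v k) w))
          * (cnj (coef' i (?a - M *v k) l) * coef i (n + (?a - M *v k)) l')"
        by (simp add: p(1) t_def mult_ac)
      ultimately show ?thesis by (simp add: p(1) add_diff_eq)
    qed
    have "((\<lambda>p. \<kappa> \<mu> * (case p of (i, k) \<Rightarrow> cnj (coef' i (?a - M *v k) l) * coef i ((n + ?a) - M *v k) l'))
        has_sum \<kappa> \<mu> * of_bool (?a = n + ?a \<and> l = l')) (?I \<times> ?Z)"
      by (intro has_sum_cmult_right completeness a int_lattice_add n l)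
    then have "((t \<circ> ?q) has_sum \<kappa> \<mu> * of_bool (n = 0 \<and> l = l')) (?I \<times> ?Z)"
      by (subst has_sum_cong[OF tq]) (auto simp: add_0_iff)
    then have "(t has_sum \<kappa> \<mu> * of_bool (n = 0 \<and> l = l')) (?q ` (?I \<times> ?Z))"
      by (subst has_sum_reindex[OF inj])
    also have "?q ` (?I \<times> ?Z) = ?I \<times> S \<mu>" by (auto simp: S_def)
    finally show ?thesis .
  qed
  have "(t has_sum (\<Sum>\<mu>\<in>cube_cosets M. \<kappa> \<mu> * of_bool (n = 0 \<and> l = l'))) (\<Union>\<mu>\<in>cube_cosets M. ?I \<times> S \<mu>)"
  proof (rule sum_has_sum[OF card_cube_cosets(1)[OF invM M] coset])
    fix \<mu> \<mu>' assume "\<mu> \<in> cube_cosets M" "\<mu>' \<in> cube_cosets M" "\<mu> \<noteq> \<mu>'"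
    then show "?I \<times> S \<mu> \<inter> ?I \<times> S \<mu>' = {}"
      using lattice_cosets(2)[OF invM M] unfolding S_def by blast
  qed
  also have "(\<Union>\<mu>\<in>cube_cosets M. ?I \<times> S \<mu>) = ?I \<times> ?Z"
    using lattice_cosets(1)[OF invM M] unfolding S_def by blast
  finally have "(\<Sum>i\<in>?I. ip torus (E i) (B i)) = (\<Sum>\<mu>\<in>cube_cosets M. \<kappa> \<mu> * of_bool (n = 0 \<and> l = l'))"
    by (rule has_sum_unique[OF sum1])
  also have "\<dots> = chr n w' * (\<Sum>\<mu>\<in>cube_cosets M. chr (M *v \<mu>) (w' - w)) * of_bool (n = 0 \<and> l = l')"
    by (simp add: \<kappa>_def sum_distrib_left sum_distrib_right)
  also have "\<dots> = of_bool (n = 0 \<and> w = w' \<and> l = l') * complex_of_real \<bar>det M\<bar>"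
    unfolding sum_characters[OF invM M w] by (auto simp: of_bool_def)
  finally show ?thesis unfolding E_def B_def .
qed

text \<open>The sum has the Fourier coefficients of a constant, so it is that constant.\<close>

lemma gram_identity:
  fixes A A' :: "nat \<Rightarrow> nat \<Rightarrow> real^'d \<Rightarrow> complex"
  assumes M: "int_matrix M" and A: "has_coefficients coef A" and A': "has_coefficients coef' A'"
    and w: "w \<in> cube_cosets (transpose M)" "w' \<in> cube_cosets (transpose M)"
    and l: "l \<in> {1..r}" "l' \<in> {1..r}"
  shows "AE x in lebesgue. (\<Sum>i<r + s. cnj (A' i l (x + w)) * A i l' (x + w'))
    = of_bool (w = w' \<and> l = l') * complex_of_real \<bar>det M\<bar>"
proof (rule AE_periodic)
  let ?d = "of_bool (w = w' \<and> l = l') * complex_of_real \<bar>det M\<bar>"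
  let ?G = "\<lambda>x. \<Sum>i<r + s. A i l' (x + w') * cnj (A' i l (x + w))"
  interpret finite_measure "torus :: (real^'d) measure" by (rule finite_measure_torus)
  have Aw: "(\<lambda>x. A i l' (x + w')) \<in> sqint torus" "(\<lambda>x. A' i l (x + w)) \<in> sqint torus" if "i < r + s" for i
    by (intro sqint_torus_translate has_coefficientsD[OF A that l(2)] has_coefficientsD[OF A' that l(1)])+
  have int: "integrable torus (\<lambda>x. ?G x - ?d)"
    by (intro Bochner_Integration.integrable_diff Bochner_Integration.integrable_sum integrable_prod Aw) auto
  have "integral\<^sup>L torus (\<lambda>x. (?G x - ?d) * cnj (chr n x)) = 0" if n: "n \<in> int_lattice" for n
  proof -
    have E: "(\<lambda>x. A i l' (x + w') * cnj (chr n x)) \<in> sqint torus" if "i < r + s" for i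
      using sqint_unimodular_mult[OF Aw(1)[OF that], of "\<lambda>x. cnj (chr n x)"]
      by (simp add: mult.commute borel_measurable_cnj)
    have one: "(\<lambda>_. 1) \<in> sqint (torus :: (real^'d) measure)" by (rule sqint_torus_bounded[of _ 1]) auto
    have "integral\<^sup>L torus (\<lambda>x. (?G x - ?d) * cnj (chr n x))
        = integral\<^sup>L torus (\<lambda>x. (\<Sum>i<r + s. (A i l' (x + w') * cnj (chr n x)) * cnj (A' i l (x + w))) - ?d * (1 * cnj (chr n x)))"
      by (intro Bochner_Integration.integral_cong refl) (simp only: left_diff_distrib right_diff_distrib sum_distrib_left sum_distrib_right mult_ac mult_1_left)
    also have "\<dots> = (\<Sum>i<r + s. ip torus (\<lambda>x. A i l' (x + w') * cnj (chr n x)) (\<lambda>x. A' i l (x + w))) - ?d * ip torus (\<lambda>_. 1) (chr n)"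
    proof (subst Bochner_Integration.integral_diff)
      show "integrable torus (\<lambda>x. \<Sum>i<r + s. (A i l' (x + w') * cnj (chr n x)) * cnj (A' i l (x + w)))"
        by (intro Bochner_Integration.integrable_sum integrable_prod E Aw) auto
      show "integrable torus (\<lambda>x. ?d * (1 * cnj (chr n x)))"
        using integrable_prod[OF one chr_sqint] by simp
      have "integral\<^sup>L torus (\<lambda>x. \<Sum>i<r + s. (A i l' (x + w') * cnj (chr n x)) * cnj (A' i l (x + w)))
          = (\<Sum>i<r + s. ip torus (\<lambda>x. A i l' (x + w') * cnj (chr n x)) (\<lambda>x. A' i l (x + w)))"
        unfolding ip_def by (intro Bochner_Integration.integral_sum integrable_prod E Aw) auto
      then show "integral\<^sup>L torus (\<lambda>x. \<Sum>i<r + s. (A i l' (x + w') * cnj (chr n x)) * cnj (A' i l (x + w)))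
          - integral\<^sup>L torus (\<lambda>x. ?d * (1 * cnj (chr n x)))
          = (\<Sum>i<r + s. ip torus (\<lambda>x. A i l' (x + w') * cnj (chr n x)) (\<lambda>x. A' i l (x + w))) - ?d * ip torus (\<lambda>_. 1) (chr n)"
        by (simp add: ip_def)
    qed
    also have "ip torus (\<lambda>_. 1) (chr n) = of_bool (n = 0)"
    proof -
      have "(\<lambda>_. 1) = chr (0 :: real^'d)" by (simp add: fun_eq_iff)
      then show ?thesis using ip_chr[OF int_lattice_0 n] by auto
    qed
    finally show ?thesis
      unfolding gram_coefficients[OF M A A' w l n] by (auto simp: of_bool_def)
  qed
  from fourier_coefficients_zero[OF int this]
  have "AE x in torus. ?G x - ?d = 0" by simp
  then show "AE x in lebesgue. x \<in> unit_cube \<longrightarrow> (\<Sum>i<r + s. cnj (A' i l (x + w)) * A i l' (x + w')) = ?d"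
    unfolding AE_torus_iff by (rule AE_mp) (auto simp: mult.commute)
  have per: "A' i l (x + k + w) = A' i l (x + w)" "A i l' (x + k + w') = A i l' (x + w')"
    if "i < r + s" "k \<in> int_lattice" for i k x
    using periodicD[OF has_coefficientsD(2)[OF A' that(1) l(1)] that(2), of "x + w"]
      periodicD[OF has_coefficientsD(2)[OF A that(1) l(2)] that(2), of "x + w'"]
    by (simp_all add: add_ac)
  show "periodic (\<lambda>x. (\<Sum>i<r + s. cnj (A' i l (x + w)) * A i l' (x + w')) = ?d)"
    unfolding periodic_def
  proof (intro allI ballI)
    fix x k :: "real^'d" assume k: "k \<in> int_lattice"
    have "(\<Sum>i<r + s. cnj (A' i l (x + k + w)) * A i l' (x + k + w')) = (\<Sum>i<r + s. cnj (A' i l (x + w)) * A i l' (x + w'))"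
      by (intro sum.cong refl) (simp only: lessThan_iff per[OF _ k])
    then show "((\<Sum>i<r + s. cnj (A' i l (x + k + w)) * A i l' (x + k + w')) = ?d)
      = ((\<Sum>i<r + s. cnj (A' i l (x + w)) * A i l' (x + w')) = ?d)" by (simp only:)
  qed
qed

text \<open>Both sides count the sum of all products of corresponding refinement coefficients: for each
  generator of scale \<open>-1\<close> they add up to one, for each scaling function to the index of the
  image lattice.\<close>

lemma number_of_wavelets:
  fixes A A' :: "nat \<Rightarrow> nat \<Rightarrow> real^'d \<Rightarrow> complex"
  assumes M: "int_matrix M" and A: "has_coefficients coef A" and A': "has_coefficients coef' A'"
  shows "real (r + s) = real r * \<bar>det M\<bar>"
proof -
  interpret C: biorthogonal_riesz torus int_lattice chr "chr :: real^'d \<Rightarrow> _" by (rule chr_basis)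
  have zero: "0 \<in> cube_cosets (transpose M)"
    by (auto simp: cube_cosets_def unit_cube_def intro!: image_eqI[of _ _ 0])
  have "(\<Sum>l\<in>{1..r}. ip torus (A i l) (A' i l)) = 1" if i: "i < r + s" for i
  proof -
    let ?f = "\<lambda>(m, l). coef i m l * cnj (coef' i m l)"
    have "(?f has_sum ip torus (A i l) (A' i l)) ((\<lambda>m. (m, l)) ` int_lattice)" if l: "l \<in> {1..r}" for l
    proof -
      have "((\<lambda>m. ip torus (A i l) (chr m) * ip torus (chr m) (A' i l)) has_sum ip torus (A i l) (A' i l)) int_lattice"
        by (intro C.parseval has_coefficientsD[OF A i l] has_coefficientsD[OF A' i l])
      also have "?this \<longleftrightarrow> ((?f \<circ> (\<lambda>m. (m, l))) has_sum ip torus (A i l) (A' i l)) int_lattice"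
        by (rule has_sum_cong)
           (simp add: has_coefficientsD(4)[OF A i l] has_coefficientsD(4)[OF A' i l] ip_commute[of torus "chr _"])
      finally show ?thesis by (subst has_sum_reindex) (auto simp: inj_on_def)
    qed
    then have "(?f has_sum (\<Sum>l\<in>{1..r}. ip torus (A i l) (A' i l))) (\<Union>l\<in>{1..r}. (\<lambda>m. (m, l)) ` int_lattice)"
      by (intro sum_has_sum) auto
    also have "(\<Union>l\<in>{1..r}. (\<lambda>m. (m, l)) ` int_lattice) = int_lattice \<times> {1..r}" by auto
    finally show ?thesis using coefficients_dual[OF i] by (rule has_sum_unique)
  qed
  then have "complex_of_nat (r + s) = (\<Sum>i<r + s. \<Sum>l\<in>{1..r}. ip torus (A i l) (A' i l))" by simp
  also have "\<dots> = (\<Sum>l\<in>{1..r}. \<Sum>i<r + s. ip torus (A i l) (A' i l))" by (rule sum.swap)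
  also have "\<dots> = (\<Sum>l\<in>{1..r}. complex_of_real \<bar>det M\<bar>)"
  proof (rule sum.cong[OF refl])
    fix l assume l: "l \<in> {1..r}"
    from gram_coefficients[OF M A A' zero zero l l int_lattice_0]
    show "(\<Sum>i<r + s. ip torus (A i l) (A' i l)) = complex_of_real \<bar>det M\<bar>" by simp
  qed
  also have "\<dots> = complex_of_real (real r * \<bar>det M\<bar>)" by simp
  finally have "complex_of_real (real (r + s)) = complex_of_real (real r * \<bar>det M\<bar>)" by simp
  then show ?thesis using of_real_eq_iff by blast
qed

text \<open>The absolute value of the determinant is an integer because it counts cosets.\<close>

lemma abs_det_eq:
  assumes "int_matrix M"
  shows "real (abs_det M) = \<bar>det M\<bar>" "0 < abs_det M"
proof -
  have "real (abs_det M) = real (card (cube_cosets M))"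
    unfolding abs_det_def card_cube_cosets(2)[OF invM assms, symmetric] by simp
  then show "real (abs_det M) = \<bar>det M\<bar>" by (simp add: card_cube_cosets(2)[OF invM assms])
  moreover have "0 < \<bar>det M\<bar>" using invM by (simp add: invertible_det_nz)
  ultimately show "0 < abs_det M" by linarith
qed

lemma number_of_wavelets_nat:
  assumes M: "int_matrix M" and A: "has_coefficients coef A" and A': "has_coefficients coef' A'"
  shows "s = r * (abs_det M - 1)"
proof -
  have "real (r + s) = real (r * abs_det M)"
    using number_of_wavelets[OF assms] abs_det_eq(1)[OF M] by simp
  then have "r + s = r * abs_det M" by (simp only: of_nat_eq_iff)
  then show ?thesis by (simp add: diff_mult_distrib2)
qed

lemma polyphase_entry:
  assumes "i < r + s" "p < r * m"
  shows "polyphase r s m \<omega> (mask_mat A 0 r k) (mask_mat A r s k) \<xi> $$ (i, p)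
    = mask_const * A k i (Suc (p mod r)) ((1 / (2 * pi)) *\<^sub>R \<xi> + \<omega> (p div r))"
proof -
  have "p mod r < r" using assms(2) by (cases r) auto
  then show ?thesis
    using assms by (simp add: polyphase_def Let_def mask_mat_def scaleR_add_right)
qed

text \<open>The entries of the product are the sums of \<open>gram_identity\<close>, where row and column determine a
  pair of a shift and a scaling function. The two mask constants cancel the determinant.\<close>

lemma polyphase_identity:
  fixes A A' :: "real^'d \<Rightarrow> nat \<Rightarrow> nat \<Rightarrow> real^'d \<Rightarrow> complex"
  assumes M: "int_matrix M" and A: "has_coefficients coef (A 0)" and A': "has_coefficients coef' (A' 0)"
    and \<omega>: "bij_betw \<omega> {..<abs_det M} (coset_reps M)"
  shows "AE \<xi> in lebesgue.
    transpose_mat (map_mat cnj (polyphase r s (abs_det M) \<omega> (mask_mat A' 0 r 0) (mask_mat A' r s 0) \<xi>)) *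
    polyphase r s (abs_det M) \<omega> (mask_mat A 0 r 0) (mask_mat A r s 0) \<xi> = 1\<^sub>m (r * abs_det M)"
proof -
  let ?m = "abs_det M"
  have \<omega>C: "\<omega> j \<in> cube_cosets (transpose M)" if "j < ?m" for j
    using \<omega> that by (auto simp: bij_betw_def coset_reps_eq)
  have \<omega>inj: "\<omega> j = \<omega> j' \<longleftrightarrow> j = j'" if "j < ?m" "j' < ?m" for j j'
    using \<omega> that by (auto simp: bij_betw_def inj_on_def)
  have cc: "cnj mask_const * mask_const = complex_of_real (1 / \<bar>det M\<bar>)"
    by (simp add: mask_const_def flip: of_real_mult)
  have "AE x in lebesgue. \<forall>p\<in>{..<r * ?m}. \<forall>q\<in>{..<r * ?m}.
      (\<Sum>i<r + s. cnj (A' 0 i (Suc (p mod r)) (x + \<omega> (p div r))) * A 0 i (Suc (q mod r)) (x + \<omega> (q div r)))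
      = of_bool (p = q) * complex_of_real \<bar>det M\<bar>"
  proof (intro AE_finite_allI)
    fix p q assume "p \<in> {..<r * ?m}" "q \<in> {..<r * ?m}"
    then have r: "0 < r" and pq: "p div r < ?m" "q div r < ?m"
      by (auto simp: less_mult_imp_div_less mult.commute intro: gr0I)
    have "\<omega> (p div r) = \<omega> (q div r) \<and> Suc (p mod r) = Suc (q mod r) \<longleftrightarrow> p = q"
      unfolding \<omega>inj[OF pq] by (metis Suc_inject div_mult_mod_eq)
    then show "AE x in lebesgue.
      (\<Sum>i<r + s. cnj (A' 0 i (Suc (p mod r)) (x + \<omega> (p div r))) * A 0 i (Suc (q mod r)) (x + \<omega> (q div r)))
      = of_bool (p = q) * complex_of_real \<bar>det M\<bar>"
      using gram_identity[OF M A A' \<omega>C[OF pq(1)] \<omega>C[OF pq(2)], of "Suc (p mod r)" "Suc (q mod r)"] r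
      by (simp add: Suc_le_eq)
  qed auto
  from AE_scale[OF this, of "1 / (2 * pi)"]
  have "AE \<xi> in lebesgue. \<forall>p\<in>{..<r * ?m}. \<forall>q\<in>{..<r * ?m}.
      (\<Sum>i<r + s. cnj (A' 0 i (Suc (p mod r)) ((1 / (2 * pi)) *\<^sub>R \<xi> + \<omega> (p div r))) * A 0 i (Suc (q mod r)) ((1 / (2 * pi)) *\<^sub>R \<xi> + \<omega> (q div r)))
      = of_bool (p = q) * complex_of_real \<bar>det M\<bar>" by simp
  then show ?thesis
  proof (rule AE_mp, intro AE_I2 impI)
    fix \<xi> :: "real^'d"
    assume H: "\<forall>p\<in>{..<r * ?m}. \<forall>q\<in>{..<r * ?m}.
      (\<Sum>i<r + s. cnj (A' 0 i (Suc (p mod r)) ((1 / (2 * pi)) *\<^sub>R \<xi> + \<omega> (p div r))) * A 0 i (Suc (q mod r)) ((1 / (2 * pi)) *\<^sub>R \<xi> + \<omega> (q div r)))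
      = of_bool (p = q) * complex_of_real \<bar>det M\<bar>"
    let ?P = "polyphase r s ?m \<omega> (mask_mat A 0 r 0) (mask_mat A r s 0) \<xi>"
    let ?P' = "polyphase r s ?m \<omega> (mask_mat A' 0 r 0) (mask_mat A' r s 0) \<xi>"
    have dim: "dim_row ?P = r + s" "dim_col ?P = r * ?m" "dim_row ?P' = r + s" "dim_col ?P' = r * ?m"
      by (simp_all add: polyphase_def)
    show "transpose_mat (map_mat cnj ?P') * ?P = 1\<^sub>m (r * ?m)"
    proof (rule eq_matI)
      fix p q assume "p < dim_row (1\<^sub>m (r * ?m) :: complex Matrix.mat)" "q < dim_col (1\<^sub>m (r * ?m) :: complex Matrix.mat)"
      then have pq: "p < r * ?m" "q < r * ?m" by simp_all
      have "(transpose_mat (map_mat cnj ?P') * ?P) $$ (p, q) = (\<Sum>i<r + s. cnj (?P' $$ (i, p)) * ?P $$ (i, q))"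
        using pq dim by (simp add: scalar_prod_def lessThan_atLeast0)
      also have "\<dots> = (cnj mask_const * mask_const) *
        (\<Sum>i<r + s. cnj (A' 0 i (Suc (p mod r)) ((1 / (2 * pi)) *\<^sub>R \<xi> + \<omega> (p div r))) * A 0 i (Suc (q mod r)) ((1 / (2 * pi)) *\<^sub>R \<xi> + \<omega> (q div r)))"
        unfolding sum_distrib_left using pq by (intro sum.cong refl) (simp add: polyphase_entry mult_ac)
      also have "\<dots> = complex_of_real (1 / \<bar>det M\<bar>) * (of_bool (p = q) * complex_of_real \<bar>det M\<bar>)"
        using H pq by (simp only: cc) simp
      also have "\<dots> = of_bool (p = q)"
        using invM by (simp add: invertible_det_nz)
      finally show "(transpose_mat (map_mat cnj ?P') * ?P) $$ (p, q) = 1\<^sub>m (r * ?m) $$ (p, q)"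
        using pq by simp
    qed (simp_all add: dim)
  qed
qed

end

section \<open>Powers of the inverse of an expansive matrix\<close>

text \<open>Once the perturbation is small, the distance to a small fixed bound contracts geometrically.\<close>

lemma recurrence_tendsto_0:
  fixes x e :: "nat \<Rightarrow> real"
  assumes q: "0 \<le> q" "q < 1" and x: "\<And>n. 0 \<le> x n" and rec: "\<And>n. x (Suc n) \<le> q * x n + e n" and e: "e \<longlonglongrightarrow> 0"
  shows "x \<longlonglongrightarrow> 0"
proof (rule LIMSEQ_I)
  fix d :: real assume d: "d > 0"
  \<comment> \<open>chosen such that \<open>q * (d / 2) + b = d / 2\<close>\<close>
  define b where "b = d * (1 - q) / 2"
  have b: "b > 0" using d q by (simp add: b_def)
  obtain N where N: "\<And>n. n \<ge> N \<Longrightarrow> e n < b"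
    using order_tendstoD(2)[OF e b] unfolding eventually_sequentially by blast
  have ind: "x (N + m) \<le> q ^ m * x N + d / 2" for m
  proof (induction m)
    case (Suc m)
    have "x (N + Suc m) \<le> q * x (N + m) + b"
      using rec[of "N + m"] N[of "N + m"] by simp
    also have "\<dots> \<le> q * (q ^ m * x N + d / 2) + b"
      using Suc q by (intro add_right_mono mult_left_mono) auto
    also have "\<dots> = q ^ Suc m * x N + d / 2" by (simp add: b_def field_simps)
    finally show ?case .
  qed (use d in simp)
  have "(\<lambda>m. q ^ m * x N) \<longlonglongrightarrow> 0"
    using q by (intro tendsto_mult_left_zero LIMSEQ_power_zero) auto
  then obtain K where K: "\<And>m. m \<ge> K \<Longrightarrow> q ^ m * x N < d / 2"
    using order_tendstoD(2)[of _ 0 sequentially "d / 2"] d unfolding eventually_sequentially by auto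
  have "norm (x n - 0) < d" if "n \<ge> N + K" for n
  proof -
    have "x n \<le> q ^ (n - N) * x N + d / 2" using ind[of "n - N"] that by simp
    moreover have "q ^ (n - N) * x N < d / 2" using that by (intro K) simp
    ultimately show ?thesis using x[of n] by simp
  qed
  then show "\<exists>no. \<forall>n\<ge>no. norm (x n - 0) < d" by blast
qed

lemma matrix_vector_mult_scaleR_complex:
  fixes N :: "complex^'d^'d"
  shows "N *v (c *\<^sub>R x) = c *\<^sub>R (N *v x)"
  by (simp add: matrix_vector_mult_def Finite_Cartesian_Product.vec_eq_iff scaleR_sum_right)

lemma matrix_vector_mult_smult_complex:
  fixes N :: "complex^'d^'d"
  shows "N *v (c *s x) = c *s (N *v x)"
  by (simp add: matrix_vector_mult_def Finite_Cartesian_Product.vec_eq_iff sum_distrib_left mult_ac)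

definition matpow :: "complex^'d^'d \<Rightarrow> nat \<Rightarrow> complex^'d \<Rightarrow> complex^'d" where
  "matpow N n = ((*v) N ^^ n)"

lemma matpow_0 [simp]: "matpow N 0 v = v"
  and matpow_Suc: "matpow N (Suc n) v = N *v matpow N n v"
  and matpow_Suc': "matpow N (Suc n) v = matpow N n (N *v v)"
  by (simp_all add: matpow_def funpow_swap1)

lemma matpow_diff: "matpow N n (v - w) = matpow N n v - matpow N n w"
  by (induction n) (simp_all add: matpow_Suc matrix_vector_mult_diff_distrib)

lemma matpow_smult: "matpow N n (c *s v) = c *s matpow N n v"
  by (induction n) (simp_all add: matpow_Suc matrix_vector_mult_smult_complex)

definition poly_apply :: "complex^'d^'d \<Rightarrow> complex poly \<Rightarrow> complex^'d \<Rightarrow> complex^'d" where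
  "poly_apply N p v = (\<Sum>i\<le>degree p. coeff p i *s matpow N i v)"

lemma poly_apply_bound:
  assumes "degree p \<le> k"
  shows "poly_apply N p v = (\<Sum>i\<le>k. coeff p i *s matpow N i v)"
  unfolding poly_apply_def using assms
  by (intro sum.mono_neutral_left) (auto simp: coeff_eq_0)

text \<open>Applying a product of polynomials is applying the factors successively.\<close>

lemma poly_apply_linear_factor:
  "poly_apply N ([:- z, 1:] * q) v = poly_apply N q (N *v v - z *s v)"
proof -
  let ?k = "degree q"
  have p: "[:- z, 1:] * q = pCons 0 q - Polynomial.smult z q" by simp
  have "degree ([:- z, 1:] * q) \<le> Suc ?k"
    using degree_mult_le[of "[:- z, 1:]" q] by simp
  then have "poly_apply N ([:- z, 1:] * q) v = (\<Sum>i\<le>Suc ?k. coeff (pCons 0 q - Polynomial.smult z q) i *s matpow N i v)"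
    unfolding p[symmetric] by (rule poly_apply_bound)
  also have "\<dots> = (\<Sum>i\<le>Suc ?k. coeff (pCons 0 q) i *s matpow N i v) - (\<Sum>i\<le>Suc ?k. (z * coeff q i) *s matpow N i v)"
    by (simp only: coeff_diff coeff_smult vec.scale_left_diff_distrib sum_subtractf)
  also have "(\<Sum>i\<le>Suc ?k. coeff (pCons 0 q) i *s matpow N i v) = (\<Sum>i\<le>?k. coeff q i *s matpow N (Suc i) v)"
    by (subst sum.atMost_Suc_shift) simp
  also have "(\<Sum>i\<le>Suc ?k. (z * coeff q i) *s matpow N i v) = (\<Sum>i\<le>?k. (z * coeff q i) *s matpow N i v)"
    by (simp add: coeff_eq_0)
  also have "(\<Sum>i\<le>?k. coeff q i *s matpow N (Suc i) v) - (\<Sum>i\<le>?k. (z * coeff q i) *s matpow N i v)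
      = (\<Sum>i\<le>?k. coeff q i *s matpow N i (N *v v - z *s v))"
    unfolding sum_subtractf[symmetric]
    by (intro sum.cong refl)
       (simp add: matpow_diff matpow_smult matpow_Suc' vec.scale_right_diff_distrib mult.commute)
  finally show ?thesis by (simp add: poly_apply_def)
qed

text \<open>Every vector is annihilated by a nonzero polynomial in \<open>N\<close>, because the first \<open>d + 1\<close>
  iterates are linearly dependent.\<close>

lemma annihilating_polynomial:
  fixes N :: "complex^'d^'d"
  shows "\<exists>p. p \<noteq> 0 \<and> poly_apply N p v = 0"
proof -
  let ?w = "\<lambda>i. matpow N i v" and ?K = "{..CARD('d)}"
  have "\<exists>c. (\<exists>i\<in>?K. c i \<noteq> 0) \<and> (\<Sum>i\<in>?K. c i *s ?w i) = 0"
  proof (cases "inj_on ?w ?K")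
    case True
    then have "card (?w ` ?K) = Suc (CARD('d))" by (simp add: card_image)
    then have "vec.dependent (?w ` ?K)"
      using vec.independent_bound_general[of "?w ` ?K"] dim_subset_UNIV_cart_gen[of "?w ` ?K"] by auto
    then obtain u where u: "\<exists>x\<in>?w ` ?K. u x \<noteq> 0" "(\<Sum>x\<in>?w ` ?K. u x *s x) = 0"
      unfolding vec.dependent_finite[OF finite_imageI[OF finite_atMost]] by blast
    then show ?thesis
      using True by (intro exI[of _ "\<lambda>i. u (?w i)"]) (auto simp: sum.reindex)
  next
    case False
    then obtain i j where ij: "i \<in> ?K" "j \<in> ?K" "i \<noteq> j" "?w i = ?w j" by (auto simp: inj_on_def)
    let ?c = "\<lambda>k. if k = i then 1 else if k = j then - 1 else (0::complex)"
    have "(\<Sum>k\<in>?K. ?c k *s ?w k) = (\<Sum>k\<in>{i, j}. ?c k *s ?w k)"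
      using ij by (intro sum.mono_neutral_right) auto
    also have "\<dots> = 0" using ij by simp
    finally show ?thesis using ij(1) by (intro exI[of _ ?c]) auto
  qed
  then obtain c where c: "\<exists>i\<in>?K. c i \<noteq> 0" "(\<Sum>i\<in>?K. c i *s ?w i) = 0" by blast
  define p where "p = (\<Sum>i\<in>?K. monom (c i) i)"
  have cf: "coeff p i = (if i \<in> ?K then c i else 0)" for i
    by (simp add: p_def coeff_sum sum.delta)
  have "degree p \<le> CARD('d)" by (rule degree_le) (simp add: cf)
  then have "poly_apply N p v = (\<Sum>i\<in>?K. c i *s ?w i)"
    by (subst poly_apply_bound) (auto simp: cf)
  moreover have "p \<noteq> 0" using c(1) cf by (metis coeff_0)
  ultimately show ?thesis using c(2) by auto
qed

text \<open>Induction on an annihilating polynomial: split off a linear factor with root \<open>z\<close>. The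
  iterates of \<open>w = N v - z v\<close> tend to zero. If \<open>z\<close> is in the unit disc, those of \<open>v\<close> satisfy a
  contracting recurrence with vanishing perturbation; otherwise \<open>z\<close> is no eigenvalue, and \<open>N - z\<close>
  is bounded below.\<close>

lemma matpow_tendsto_0:
  fixes N :: "complex^'d^'d"
  assumes ev: "\<And>z v. v \<noteq> 0 \<Longrightarrow> N *v v = z *s v \<Longrightarrow> cmod z < 1"
  shows "(\<lambda>n. matpow N n v) \<longlonglongrightarrow> 0"
proof -
  have "(\<lambda>n. matpow N n v) \<longlonglongrightarrow> 0" if "p \<noteq> 0" "poly_apply N p v = 0" for p v
    using that
  proof (induction "degree p" arbitrary: p v rule: less_induct)
    case less
    show ?case
    proof (cases "degree p = 0")
      case True
      then obtain c where "p = [:c:]" by (rule degree_eq_zeroE)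
      then have "v = 0" using less.prems by (auto simp: poly_apply_def)
      moreover have "matpow N n 0 = 0" for n by (induction n) (simp_all add: matpow_Suc)
      ultimately show ?thesis by simp
    next
      case False
      then obtain z where z: "poly p z = 0" using alg_closed_imp_poly_has_root by blast
      then obtain q where q: "p = [:- z, 1:] * q" by (auto simp: poly_eq_0_iff_dvd)
      have "q \<noteq> 0" using less.prems(1) q by auto
      have "degree p = degree [:- z, 1:] + degree q"
        unfolding q by (rule degree_mult_eq) (use \<open>q \<noteq> 0\<close> in auto)
      then have deg: "degree q < degree p" by simp
      define w where "w = N *v v - z *s v"
      have w: "(\<lambda>n. matpow N n w) \<longlonglongrightarrow> 0"
        unfolding w_def
        by (rule less.hyps[OF deg \<open>q \<noteq> 0\<close>]) (use less.prems(2) in \<open>simp only: q poly_apply_linear_factor\<close>)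
      have wn: "matpow N n w = N *v matpow N n v - z *s matpow N n v" for n
        by (simp add: w_def matpow_diff matpow_smult matpow_Suc'[symmetric] matpow_Suc)
      show ?thesis
      proof (cases "cmod z < 1")
        case True
        have "(\<lambda>n. norm (matpow N n v)) \<longlonglongrightarrow> 0"
        proof (rule recurrence_tendsto_0[OF norm_ge_zero True norm_ge_zero])
          fix n
          have "matpow N (Suc n) v = z *s matpow N n v + matpow N n w"
            by (simp add: wn matpow_Suc)
          then have "norm (matpow N (Suc n) v) \<le> norm (z *s matpow N n v) + norm (matpow N n w)"
            by (simp add: norm_triangle_ineq)
          also have "norm (z *s matpow N n v) = cmod z * norm (matpow N n v)"
            by (simp add: norm_vec_def L2_set_right_distrib norm_mult)
          finally show "norm (matpow N (Suc n) v) \<le> cmod z * norm (matpow N n v) + norm (matpow N n w)" .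
        qed (use tendsto_norm[OF w] in simp)
        then show ?thesis by (simp add: tendsto_norm_zero_iff)
      next
        case False
        let ?g = "\<lambda>u. N *v u - z *s u"
        have lin: "linear ?g"
        proof (rule linearI)
          show "?g (a + b) = ?g a + ?g b" for a b
            by (simp add: matrix_vector_right_distrib vec.scale_right_distrib)
          show "?g (c *\<^sub>R b) = c *\<^sub>R ?g b" for c b
            by (simp add: matrix_vector_mult_scaleR_complex scaleR_diff_right Finite_Cartesian_Product.vec_eq_iff)
        qed
        have "inj ?g"
          unfolding linear_injective_0[OF lin] using ev[of _ z] False by auto
        obtain B where B: "B > 0" "\<forall>x. B * norm x \<le> norm (?g x)"
          by (rule linear_inj_bounded_below_pos[OF lin \<open>inj ?g\<close>]) (rule that, assumption, rule allI)
        have "(\<lambda>n. norm (matpow N n v)) \<longlonglongrightarrow> 0"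
        proof (rule Lim_null_comparison[OF always_eventually], rule allI)
          fix n
          show "norm (norm (matpow N n v)) \<le> norm (matpow N n w) / B"
            using B(2)[rule_format, of "matpow N n v"] B(1) by (simp add: wn field_simps)
          show "(\<lambda>n. norm (matpow N n w) / B) \<longlonglongrightarrow> 0"
            using tendsto_divide[OF tendsto_norm[OF w] tendsto_const, of B] B(1) by simp
        qed
        then show ?thesis by (simp add: tendsto_norm_zero_iff)
      qed
    qed
  qed
  then show ?thesis using annihilating_polynomial[of N v] by blast
qed

definition complexify :: "real^'d \<Rightarrow> complex^'d" where
  "complexify x = vec_lambda (\<lambda>i. complex_of_real (vec_nth x i))"

lemma complexify_mult:
  fixes A :: "real^'d^'d"
  shows "map_matrix complex_of_real A *v complexify x = complexify (A *v x)"
  by (simp add: complexify_def matrix_vector_mult_def Finite_Cartesian_Product.vec_eq_iff)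

lemma map_matrix_complex_inverse:
  fixes A B :: "real^'d^'d"
  assumes "A ** B = Finite_Cartesian_Product.mat 1"
  shows "map_matrix complex_of_real A *v (map_matrix complex_of_real B *v v) = v"
proof -
  have "vec_nth (vec_nth (map_matrix complex_of_real A ** map_matrix complex_of_real B) i) j
      = complex_of_real (vec_nth (vec_nth (A ** B) i) j)" for i j
    by (simp add: matrix_matrix_mult_def)
  then have "map_matrix complex_of_real A ** map_matrix complex_of_real B = Finite_Cartesian_Product.mat 1"
    unfolding assms by (simp add: Finite_Cartesian_Product.vec_eq_iff Finite_Cartesian_Product.mat_def)
  then show ?thesis by (simp add: matrix_vector_mul_assoc)
qed

text \<open>An eigenvalue of the inverse is the inverse of an eigenvalue of \<open>M\<close>, hence has modulus less
  than one. The argument takes place in complex space, where there are enough eigenvalues.\<close>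

lemma expansive_inverse_powers_tendsto_0:
  fixes M :: "real^'d^'d"
  assumes M: "invertible M" and ex: "expansive M"
  shows "(\<lambda>n. matrix_powi M (- int n) *v x) \<longlonglongrightarrow> 0"
proof -
  let ?N = "map_matrix complex_of_real (matrix_inv M)" and ?M = "map_matrix complex_of_real M"
  have ev: "cmod z < 1" if v: "v \<noteq> 0" "?N *v v = z *s v" for z v
  proof -
    have "?M *v (?N *v v) = v" by (rule map_matrix_complex_inverse[OF matrix_inv_right[OF M]])
    then have eq: "z *s (?M *v v) = v" unfolding v(2) matrix_vector_mult_smult_complex .
    then have "z \<noteq> 0" using v(1) by auto
    then have "?M *v v = inverse z *s (z *s (?M *v v))" by simp
    then have "?M *v v = inverse z *s v" unfolding eq .
    then have "cmod (inverse z) > 1" using ex v(1) unfolding expansive_def by blast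
    then show ?thesis using \<open>z \<noteq> 0\<close> by (simp add: norm_inverse one_less_inverse_iff)
  qed
  have pow: "matpow ?N n (complexify x) = complexify (matrix_powi M (- int n) *v x)" for n
  proof (induction n)
    case (Suc n)
    have "matrix_powi M (- int (Suc n)) = matrix_inv M ** matrix_powi M (- int n)"
      using matrix_powi_add[OF M, of "- 1" "- int n"] by (simp add: matrix_powi_m1)
    then show ?case
      by (simp only: matpow_Suc Suc complexify_mult matrix_vector_mul_assoc)
  qed simp
  have lim: "(\<lambda>n. complexify (matrix_powi M (- int n) *v x)) \<longlonglongrightarrow> 0"
    unfolding pow[symmetric] by (rule matpow_tendsto_0) (rule ev)
  show ?thesis
  proof (rule vec_tendstoI)
    fix i
    have "(\<lambda>n. complex_of_real (vec_nth (matrix_powi M (- int n) *v x) i)) \<longlonglongrightarrow> 0"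
      using tendsto_vec_nth[OF lim, of i] by (simp add: complexify_def)
    then show "(\<lambda>n. vec_nth (matrix_powi M (- int n) *v x) i) \<longlonglongrightarrow> vec_nth 0 i"
      using tendsto_of_real_iff[where 'a=complex, of _ 0 sequentially] by simp
  qed
qed

lemma expansive_shrinks_cubes:
  fixes M :: "real^'d^'d"
  assumes M: "invertible M" and ex: "expansive M" and \<rho>: "\<rho> > 0" and R: "R > 0"
  shows "\<exists>n. \<forall>x\<in>half_open_cube R. \<forall>i. \<bar>vec_nth (matrix_powi M (- int n) *v x) i\<bar> < \<rho>"
proof -
  let ?s = "\<lambda>n. \<Sum>j\<in>UNIV. norm (matrix_powi M (- int n) *v axis j 1)"
  have "?s \<longlonglongrightarrow> (\<Sum>j\<in>(UNIV :: 'd set). 0)"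
    by (intro tendsto_sum tendsto_norm_zero expansive_inverse_powers_tendsto_0 M ex)
  then have "\<forall>\<^sub>F n in sequentially. ?s n < \<rho> / R"
    using \<rho> R by (intro order_tendstoD(2)) auto
  then obtain n where n: "?s n < \<rho> / R" by (auto simp: eventually_sequentially)
  have "\<bar>vec_nth (matrix_powi M (- int n) *v x) i\<bar> < \<rho>" if x: "x \<in> half_open_cube R" for x :: "real^'d" and i
  proof -
    let ?U = "matrix_powi M (- int n)"
    have xj: "\<bar>vec_nth x j\<bar> \<le> R" for j using x by (auto simp: half_open_cube_def abs_le_iff dest!: spec[of _ j])
    have col: "vec_nth (?U *v axis j 1) i = vec_nth (vec_nth ?U i) j" for j
      by (simp add: matrix_vector_mult_basis column_def)
    have "vec_nth (?U *v x) i = (\<Sum>j\<in>UNIV. vec_nth x j * vec_nth (?U *v axis j 1) i)"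
      unfolding col by (simp add: matrix_vector_mult_def mult.commute)
    then have "\<bar>vec_nth (?U *v x) i\<bar> \<le> (\<Sum>j\<in>UNIV. \<bar>vec_nth x j\<bar> * \<bar>vec_nth (?U *v axis j 1) i\<bar>)"
      by (simp add: sum_abs[THEN order_trans] abs_mult)
    also have "\<dots> \<le> (\<Sum>j\<in>UNIV. R * norm (?U *v axis j 1))"
      using xj R by (intro sum_mono mult_mono component_le_norm_cart) auto
    also have "\<dots> = R * ?s n" by (simp add: sum_distrib_left)
    also have "\<dots> < \<rho>" using n R by (simp add: field_simps)
    finally show ?thesis .
  qed
  then show ?thesis by blast
qed

section \<open>Homogeneous wavelet bases\<close>

text \<open>A union of small cubes around the lattice points. These sets shrink to the lattice, a null
  set, so an integrable function has little mass on them.\<close>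

definition near_lattice :: "real \<Rightarrow> (real^'d) set" where
  "near_lattice \<rho> = {y. \<exists>k\<in>int_lattice. \<forall>i. \<bar>vec_nth y i + vec_nth k i\<bar> < \<rho>}"

lemma near_lattice_lebesgue [measurable]: "(near_lattice \<rho> :: (real^'d) set) \<in> sets lebesgue"
proof -
  have "(near_lattice \<rho> :: (real^'d) set) = (\<Union>k\<in>int_lattice. \<Inter>i. {y. \<bar>vec_nth y i + vec_nth k i\<bar> < \<rho>})"
    by (auto simp: near_lattice_def)
  also have "open \<dots>"
    by (intro open_UN ballI open_INT open_Collect_less continuous_intros) auto
  finally show ?thesis by (intro sets_completionI_sets) (simp add: borel_open)
qed

lemma near_lattice_eventually:
  assumes "y \<notin> int_lattice"
  shows "\<forall>\<^sub>F n in sequentially. y \<notin> near_lattice (1 / real (Suc n))"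
proof -
  obtain i where i: "vec_nth y i \<notin> \<int>" using assms by (auto simp: int_lattice_def)
  let ?t = "vec_nth y i"
  define \<delta> where "\<delta> = min (frac ?t) (1 - frac ?t)"
  have \<delta>: "\<delta> > 0" using i frac_lt_1[of ?t] by (simp add: \<delta>_def frac_gt_0_iff)
  have far: "\<delta> \<le> \<bar>?t + of_int m\<bar>" for m :: int
  proof (cases "m + \<lfloor>?t\<rfloor> \<ge> 0")
    case True
    then have "frac ?t \<le> ?t + of_int m"
      unfolding frac_def by (smt (verit) of_int_0_le_iff of_int_add)
    then show ?thesis by (simp add: \<delta>_def)
  next
    case False
    then have "m + \<lfloor>?t\<rfloor> \<le> - 1" by simp
    then have "real_of_int (m + \<lfloor>?t\<rfloor>) \<le> - 1" by linarith
    then have "?t + of_int m \<le> frac ?t - 1" unfolding frac_def by simp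
    then have "1 - frac ?t \<le> \<bar>?t + of_int m\<bar>" by linarith
    then show ?thesis by (simp add: \<delta>_def)
  qed
  obtain N :: nat where N: "inverse (real (Suc N)) < \<delta>" using reals_Archimedean[OF \<delta>] by blast
  have "y \<notin> near_lattice (1 / real (Suc n))" if "n \<ge> N" for n
  proof
    assume "y \<in> near_lattice (1 / real (Suc n))"
    then obtain k where k: "k \<in> int_lattice" "\<bar>?t + vec_nth k i\<bar> < 1 / real (Suc n)"
      by (auto simp: near_lattice_def)
    obtain m where "vec_nth k i = of_int m"
      using k(1) by (auto simp: int_lattice_def elim!: Ints_cases dest: spec[of _ i])
    then have "\<delta> < 1 / real (Suc n)" using far[of m] k(2) by simp
    also have "\<dots> \<le> inverse (real (Suc N))" using that by (simp add: field_simps)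
    finally show False using N by simp
  qed
  then show ?thesis by (auto simp: eventually_sequentially)
qed

lemma near_lattice_energy_tendsto_0:
  fixes h :: "real^'d \<Rightarrow> complex"
  assumes h: "h \<in> sqint lebesgue"
  shows "(\<lambda>n. integral\<^sup>L lebesgue (\<lambda>y. indicator (near_lattice (1 / real (Suc n))) y * (cmod (h y))\<^sup>2)) \<longlonglongrightarrow> 0"
proof -
  have "(\<lambda>n. integral\<^sup>L lebesgue (\<lambda>y. indicator (near_lattice (1 / real (Suc n))) y * (cmod (h y))\<^sup>2)) \<longlonglongrightarrow> integral\<^sup>L lebesgue (\<lambda>y::real^'d. 0)"
  proof (rule integral_dominated_convergence[where w="\<lambda>y. (cmod (h y))\<^sup>2"])
    have "(int_lattice :: (real^'d) set) \<in> null_sets lborel"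
      by (rule countable_imp_null_set_lborel[OF countable_int_lattice])
    then have "AE y in lebesgue. y \<notin> (int_lattice :: (real^'d) set)"
      by (intro AE_not_in null_sets_completionI)
    then show "AE y in lebesgue. (\<lambda>n. indicator (near_lattice (1 / real (Suc n))) y * (cmod (h y))\<^sup>2) \<longlonglongrightarrow> 0"
    proof (rule AE_mp, intro AE_I2 impI)
      fix y :: "real^'d" assume "y \<notin> int_lattice"
      from near_lattice_eventually[OF this]
      have "\<forall>\<^sub>F n in sequentially. indicator (near_lattice (1 / real (Suc n))) y * (cmod (h y))\<^sup>2 = 0"
        by (rule eventually_mono) simp
      then show "(\<lambda>n. indicator (near_lattice (1 / real (Suc n))) y * (cmod (h y))\<^sup>2) \<longlonglongrightarrow> 0"
        by (rule tendsto_eventually)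
    qed
    show "AE y in lebesgue. norm (indicator (near_lattice (1 / real (Suc n))) y * (cmod (h y))\<^sup>2) \<le> (cmod (h y))\<^sup>2" for n
      by (rule AE_I2) (auto simp: indicator_def)
    show "(\<lambda>y. indicator (near_lattice (1 / real (Suc n))) y * (cmod (h y))\<^sup>2) \<in> borel_measurable lebesgue" for n
      using sqint_measurable[OF h, measurable] by measurable
  qed (use sqint_integrable[OF h] in auto)
  then show ?thesis by simp
qed

text \<open>If \<open>U\<close> maps the support of \<open>f\<close> into a small cube around the origin, the inner products with
  all lattice translates of the dilate of \<open>h\<close> by \<open>U\<close> see only the part of \<open>h\<close> close to the lattice,
  and they see disjoint pieces of it.\<close>

lemma coarse_energy:
  fixes f h :: "real^'d \<Rightarrow> complex"
  assumes U: "invertible U" and f: "f \<in> sqint lebesgue" and h: "h \<in> sqint lebesgue"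
    and supp: "\<And>x. x \<notin> C \<Longrightarrow> f x = 0" and C: "C \<in> sets lebesgue"
    and \<rho>: "\<rho> \<le> 1 / 2" and small: "\<And>x i. x \<in> C \<Longrightarrow> \<bar>vec_nth (U *v x) i\<bar> < \<rho>"
    and K: "finite K" "K \<subseteq> int_lattice"
  shows "(\<Sum>k\<in>K. (cmod (ip lebesgue f (dilate_shift U k h)))\<^sup>2)
    \<le> (nrm lebesgue f)\<^sup>2 * integral\<^sup>L lebesgue (\<lambda>y. indicator (near_lattice \<rho>) y * (cmod (h y))\<^sup>2)"
proof -
  let ?V = "matrix_inv U"
  note [measurable] = C sqint_measurable[OF h]
  define H where "H k = (\<lambda>y. indicator C (?V *v (y + k)) * (cmod (h y))\<^sup>2)" for k
  have mC: "(\<lambda>y. indicator C (?V *v (y + k)) :: real) \<in> borel_measurable lebesgue" for k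
  proof -
    have "(\<lambda>y. ?V *v y - - (?V *v k)) \<in> lebesgue \<rightarrow>\<^sub>M lebesgue"
      by (rule lebesgue_measurable_affine[OF invertible_matrix_inv[OF U]])
    from measurable_compose[OF this borel_measurable_indicator[OF C]]
    show ?thesis by (simp add: matrix_vector_right_distrib)
  qed
  have mH: "H k \<in> borel_measurable lebesgue" for k
    unfolding H_def using mC by measurable
  have intH: "integrable lebesgue (H k)" for k
    by (rule Bochner_Integration.integrable_bound[OF sqint_integrable[OF h] mH]) (auto simp: H_def indicator_def)
  have single: "(cmod (ip lebesgue f (dilate_shift U k h)))\<^sup>2 \<le> (nrm lebesgue f)\<^sup>2 * integral\<^sup>L lebesgue (H k)" for k
  proof -
    let ?g = "dilate_shift U k h" and ?g' = "\<lambda>x. indicator C x * dilate_shift U k h x"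
    have g: "?g \<in> sqint lebesgue" by (rule dilate_shift_sqint[OF U h])
    have g': "?g' \<in> sqint lebesgue"
    proof (rule sqint_bound[OF _ sqint_integrable[OF g]])
      show "?g' \<in> borel_measurable lebesgue" using sqint_measurable[OF g, measurable] by measurable
    qed (auto simp: indicator_def)
    have "ip lebesgue f ?g = ip lebesgue f ?g'"
      unfolding ip_def
      by (intro Bochner_Integration.integral_cong refl) (auto simp: indicator_def supp)
    then have "cmod (ip lebesgue f ?g) \<le> nrm lebesgue f * nrm lebesgue ?g'"
      using ip_Cauchy_Schwarz[OF f g'] by simp
    then have "(cmod (ip lebesgue f ?g))\<^sup>2 \<le> (nrm lebesgue f)\<^sup>2 * (nrm lebesgue ?g')\<^sup>2"
      unfolding power_mult_distrib[symmetric] by (intro power_mono) auto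
    also have "(nrm lebesgue ?g')\<^sup>2 = \<bar>det U\<bar> * integral\<^sup>L lebesgue (\<lambda>x. H k (U *v x - k))"
    proof -
      have "(cmod (?g' x))\<^sup>2 = \<bar>det U\<bar> * H k (U *v x - k)" for x
        by (auto simp: H_def U dilate_shift_def norm_mult power_mult_distrib indicator_def)
      then show ?thesis unfolding nrm_sq by simp
    qed
    also have "\<dots> = integral\<^sup>L lebesgue (H k)"
      using integral_affine[OF U mH[of k], of k] by simp
    finally show ?thesis .
  qed
  have "(\<Sum>k\<in>K. (cmod (ip lebesgue f (dilate_shift U k h)))\<^sup>2) \<le> (\<Sum>k\<in>K. (nrm lebesgue f)\<^sup>2 * integral\<^sup>L lebesgue (H k))"
    by (intro sum_mono single)
  also have "\<dots> = (nrm lebesgue f)\<^sup>2 * integral\<^sup>L lebesgue (\<lambda>y. \<Sum>k\<in>K. H k y)"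
    using intH by (simp add: sum_distrib_left)
  also have "\<dots> \<le> (nrm lebesgue f)\<^sup>2 * integral\<^sup>L lebesgue (\<lambda>y. indicator (near_lattice \<rho>) y * (cmod (h y))\<^sup>2)"
  proof (intro mult_left_mono integral_mono)
    show "integrable lebesgue (\<lambda>y. \<Sum>k\<in>K. H k y)" using intH by simp
    show "integrable lebesgue (\<lambda>y. indicator (near_lattice \<rho>) y * (cmod (h y))\<^sup>2)"
      by (rule Bochner_Integration.integrable_bound[OF sqint_integrable[OF h]]) (auto simp: indicator_def)
    fix y
    let ?K = "{k \<in> K. ?V *v (y + k) \<in> C}"
    have near: "\<bar>vec_nth y i + vec_nth k i\<bar> < \<rho>" if "k \<in> ?K" for k i
      using small[of "?V *v (y + k)" i] that U by simp
    have one: "k = k'" if k: "k \<in> ?K" "k' \<in> ?K" for k k'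
    proof (subst Finite_Cartesian_Product.vec_eq_iff, rule allI)
      fix i
      have "k \<in> int_lattice" "k' \<in> int_lattice" using k K(2) by blast+
      then have "vec_nth k i \<in> \<int>" "vec_nth k' i \<in> \<int>" by (simp_all add: int_lattice_def)
      then obtain m m' where m: "vec_nth k i = of_int m" "vec_nth k' i = of_int m'"
        by (elim Ints_cases)
      have "\<bar>vec_nth y i + of_int m\<bar> < 1 / 2" "\<bar>vec_nth y i + of_int m'\<bar> < 1 / 2"
        using near[OF k(1), of i] near[OF k(2), of i] \<rho> unfolding m by linarith+
      then have "\<bar>real_of_int (m - m')\<bar> < 1"
        unfolding of_int_diff abs_less_iff by (elim conjE, intro conjI) linarith+
      then have "m = m'" by linarith
      then show "vec_nth k i = vec_nth k' i" by (simp add: m)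
    qed
    have "(\<Sum>k\<in>K. H k y) = (\<Sum>k\<in>?K. (cmod (h y))\<^sup>2)"
      using K(1) by (simp add: H_def sum.inter_filter indicator_def Int_def if_distrib cong: if_cong)
    also have "\<dots> = real (card ?K) * (cmod (h y))\<^sup>2" by simp
    also have "\<dots> \<le> indicator (near_lattice \<rho>) y * (cmod (h y))\<^sup>2"
    proof (rule mult_right_mono)
      show "real (card ?K) \<le> indicator (near_lattice \<rho>) y"
      proof (cases "?K = {}")
        case False
        then obtain k where k: "k \<in> ?K" by blast
        then have "?K = {k}" using one by blast
        then have "card ?K = 1" by simp
        moreover have "y \<in> near_lattice \<rho>" using near[OF k] k K(2) by (auto simp: near_lattice_def)
        ultimately show ?thesis by simp
      next
        case True
        show ?thesis unfolding True by simp
      qed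
    qed simp
    finally show "(\<Sum>k\<in>K. H k y) \<le> indicator (near_lattice \<rho>) y * (cmod (h y))\<^sup>2" .
  qed simp
  finally show ?thesis .
qed

context biorthogonal_wavelets
begin

text \<open>The bases of all scales are unitary images of one another, so they share their Riesz bounds.\<close>

lemma uniform_riesz_bounds:
  "\<exists>C3>0. \<exists>C4>0. \<forall>J. riesz_bounds lebesgue (WSJ_index J r s) (W J) C3 C4"
proof -
  obtain C3 C4 where C: "C3 > 0" "C4 > 0" and b: "riesz_bounds lebesgue (WSJ_index 0 r s) (W 0) C3 C4"
    using riesz(1)[of 0] unfolding riesz_basis_on_def by (elim conjE exE)
  have "riesz_bounds lebesgue (WSJ_index J r s) (W J) C3 C4" for J
  proof (rule riesz_bounds_dilate[OF invertible_matrix_powi[OF invM] W_sqint _ _ _ b])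
    show "inj_on (scale_shift J) (WSJ_index J r s)" "scale_shift J ` WSJ_index J r s \<subseteq> WSJ_index 0 r s"
      using scale_shift_bij[of J 0 r s] by (auto simp: bij_betw_def)
    show "W J i = dilate_shift (matrix_powi M J) 0 (W 0 (scale_shift J i))" for i
      using WSJ_family_scale_shift[OF invM, of 0 J \<phi> \<psi> i] by simp
  qed
  with C show ?thesis by blast
qed

lemma WS_eq_W: "WS_family M \<psi> y = W J (Inr y)"
  by (simp add: WSJ_family_def)

text \<open>Finitely many wavelets belong to the system whose scale is the smallest of theirs.\<close>

lemma WS_riesz_bounds:
  assumes b: "\<And>J. riesz_bounds lebesgue (WSJ_index J r s) (W J) C3 C4"
  shows "riesz_bounds lebesgue (WS_index s) (WS_family M \<psi>) C3 C4"
  unfolding riesz_bounds_def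
proof (intro allI impI)
  fix F :: "(int \<times> (real^'d) \<times> nat) set" and c :: "int \<times> (real^'d) \<times> nat \<Rightarrow> complex"
  assume F: "finite F" "F \<subseteq> WS_index s"
  define J where "J = Min (insert 0 (fst ` F))"
  have J: "J \<le> fst y" if "y \<in> F" for y using F(1) that by (auto simp: J_def intro!: Min_le)
  have sub: "finite (Inr ` F)" "Inr ` F \<subseteq> WSJ_index J r s"
    using F J by (auto simp: WS_index_def WSJ_index_def)
  have inj: "inj_on Inr F" by (simp add: inj_on_def)
  from b[of J, unfolded riesz_bounds_def, rule_format, OF sub, of "\<lambda>i. c (projr i)"]
  show "C3 * (\<Sum>i\<in>F. (cmod (c i))\<^sup>2) \<le> (nrm lebesgue (\<lambda>x. \<Sum>i\<in>F. c i * WS_family M \<psi> i x))\<^sup>2 \<and>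
    (nrm lebesgue (\<lambda>x. \<Sum>i\<in>F. c i * WS_family M \<psi> i x))\<^sup>2 \<le> C4 * (\<Sum>i\<in>F. (cmod (c i))\<^sup>2)"
    by (simp add: sum.reindex[OF inj] WS_eq_W[symmetric])
qed

lemma WS_sqint: "y \<in> WS_index s \<Longrightarrow> WS_family M \<psi> y \<in> sqint lebesgue"
  by (auto simp: WS_index_def WS_family_def intro!: dilate_shift_sqint invertible_matrix_powi invM psi)

text \<open>Expand a compactly supported function in the basis of a very coarse scale. The part of the
  expansion along the scaling functions is small, because by the coarse energy estimate its
  coefficients are; what remains is a combination of wavelets.\<close>

lemma WS_dense:
  assumes ex: "expansive M" and f: "f \<in> sqint lebesgue" and \<epsilon>: "\<epsilon> > 0"
  shows "\<exists>F c. finite F \<and> F \<subseteq> WS_index s \<and> nrm lebesgue (\<lambda>x. f x - (\<Sum>i\<in>F. c i * WS_family M \<psi> i x)) < \<epsilon>"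
proof -
  obtain C3 C4 where C: "C3 > 0" "C4 > 0" "\<forall>J. riesz_bounds lebesgue (WSJ_index J r s) (W J) C3 C4"
    using uniform_riesz_bounds by blast
  have "\<epsilon> / 3 > 0" using \<epsilon> by simp
  then have "\<exists>m. nrm lebesgue (\<lambda>x. cutoff m f x - f x) < \<epsilon> / 3"
    by (rule eventually_happens'[OF sequentially_bot order_tendstoD(2)[OF cutoff_tendsto[OF f]]])
  then obtain m where m: "nrm lebesgue (\<lambda>x. cutoff m f x - f x) < \<epsilon> / 3" by blast
  define f0 where "f0 = cutoff m f"
  have f0: "f0 \<in> sqint lebesgue" unfolding f0_def by (rule cutoff_sqint[OF f])
  let ?R = "real (Suc m)"
  let ?en = "\<lambda>n l. integral\<^sup>L lebesgue (\<lambda>y. indicator (near_lattice (1 / real (Suc n))) y * (cmod (\<phi>' l y))\<^sup>2)"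
  have "(\<lambda>n. C4 * (\<Sum>l\<in>{1..r}. (nrm lebesgue f0)\<^sup>2 * ?en n l)) \<longlonglongrightarrow> C4 * (\<Sum>l\<in>{1..r}. (nrm lebesgue f0)\<^sup>2 * 0)"
    by (intro tendsto_mult_left tendsto_sum near_lattice_energy_tendsto_0 phi')
  then have "\<forall>\<^sub>F n in sequentially. C4 * (\<Sum>l\<in>{1..r}. (nrm lebesgue f0)\<^sup>2 * ?en n l) < (\<epsilon> / 3)\<^sup>2"
    using \<epsilon> by (intro order_tendstoD(2)) auto
  moreover have "\<forall>\<^sub>F n in sequentially. n \<ge> (1::nat)" by (rule eventually_ge_at_top)
  ultimately have "\<exists>n. C4 * (\<Sum>l\<in>{1..r}. (nrm lebesgue f0)\<^sup>2 * ?en n l) < (\<epsilon> / 3)\<^sup>2 \<and> n \<ge> 1"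
    by (intro eventually_happens'[OF sequentially_bot] eventually_conj)
  then obtain n where n: "C4 * (\<Sum>l\<in>{1..r}. (nrm lebesgue f0)\<^sup>2 * ?en n l) < (\<epsilon> / 3)\<^sup>2" "n \<ge> 1" by blast
  let ?\<rho> = "1 / real (Suc n)"
  have \<rho>: "?\<rho> \<le> 1 / 2" using n(2) by (simp add: field_simps)
  have "\<exists>j. \<forall>x\<in>half_open_cube ?R. \<forall>i. \<bar>vec_nth (matrix_powi M (- int j) *v x) i\<bar> < ?\<rho>"
    by (rule expansive_shrinks_cubes[OF invM ex]) simp_all
  then obtain j where j: "\<And>x i. x \<in> half_open_cube ?R \<Longrightarrow> \<bar>vec_nth (matrix_powi M (- int j) *v x) i\<bar> < ?\<rho>" by blast
  let ?J = "- int j"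
  interpret B: biorthogonal_riesz lebesgue "WSJ_index ?J r s" "W ?J" "W' ?J" by (rule basis)
  have "\<forall>\<^sub>F F in finite_subsets_at_top (WSJ_index ?J r s). nrm lebesgue (\<lambda>x. B.partial F f0 x - f0 x) < \<epsilon> / 3"
    using order_tendstoD(2)[OF B.expansion[OF f0] \<open>\<epsilon> / 3 > 0\<close>] .
  then obtain F where F: "finite F" "F \<subseteq> WSJ_index ?J r s" "nrm lebesgue (\<lambda>x. B.partial F f0 x - f0 x) < \<epsilon> / 3"
    unfolding eventually_finite_subsets_at_top by blast
  define FL where "FL = F \<inter> range Inl"
  define G where "G = Inr -` F"
  have FL: "finite FL" "FL \<subseteq> WSJ_index ?J r s" "FL \<subseteq> F" using F by (auto simp: FL_def)
  have G: "finite G" "G \<subseteq> WS_index s"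
    using F by (auto simp: G_def WS_index_def WSJ_index_def intro!: finite_vimageI)
  have FG: "F - FL = Inr ` G"
  proof (intro subset_antisym subsetI)
    fix i assume "i \<in> F - FL"
    then show "i \<in> Inr ` G" by (cases i) (auto simp: FL_def G_def)
  qed (auto simp: FL_def G_def)
  define c where "c y = ip lebesgue f0 (W' ?J (Inr y))" for y
  have split: "B.partial F f0 x = B.partial FL f0 x + (\<Sum>y\<in>G. c y * WS_family M \<psi> y x)" for x
  proof -
    have inj: "inj_on Inr G" by (simp add: inj_on_def)
    have "B.partial F f0 x = B.partial FL f0 x + (\<Sum>i\<in>F - FL. ip lebesgue f0 (W' ?J i) * W ?J i x)"
      unfolding B.partial_def using F(1) FL(3) by (simp add: sum.subset_diff[of FL F] add.commute)
    also have "(\<Sum>i\<in>F - FL. ip lebesgue f0 (W' ?J i) * W ?J i x) = (\<Sum>y\<in>G. c y * WS_family M \<psi> y x)"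
      unfolding FG sum.reindex[OF inj] by (simp add: c_def WS_eq_W[of _ ?J])
    finally show ?thesis .
  qed
  have coarse: "nrm lebesgue (B.partial FL f0) < \<epsilon> / 3"
  proof (rule power2_less_imp_less)
    let ?a = "\<lambda>i. (cmod (ip lebesgue f0 (W' ?J i)))\<^sup>2"
    define K where "K = fst ` (Inl -` FL)"
    have K: "finite K" "K \<subseteq> int_lattice"
      using FL by (auto simp: K_def WSJ_index_def intro!: finite_imageI finite_vimageI)
    have FLK: "FL \<subseteq> Inl ` (K \<times> {1..r})"
    proof
      fix i assume i: "i \<in> FL"
      then have "i \<in> WSJ_index ?J r s" "i \<in> range Inl" using FL(2) by (auto simp: FL_def)
      then show "i \<in> Inl ` (K \<times> {1..r})"
        by (cases rule: WSJ_index_cases) (use i in \<open>force simp: K_def\<close>)+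
    qed
    have "(nrm lebesgue (B.partial FL f0))\<^sup>2 \<le> C4 * (\<Sum>i\<in>FL. ?a i)"
      unfolding B.partial_def using C(3)[rule_format, of ?J, unfolded riesz_bounds_def, rule_format, OF FL(1,2), of "\<lambda>i. ip lebesgue f0 (W' ?J i)"]
      by (rule conjunct2)
    also have "(\<Sum>i\<in>FL. ?a i) \<le> (\<Sum>i\<in>Inl ` (K \<times> {1..r}). ?a i)"
      using K(1) by (intro sum_mono2 FLK) auto
    also have "\<dots> = (\<Sum>p\<in>K \<times> {1..r}. ?a (Inl p))" by (subst sum.reindex) (auto simp: inj_on_def)
    also have "\<dots> = (\<Sum>k\<in>K. \<Sum>l\<in>{1..r}. ?a (Inl (k, l)))" by (simp only: sum.cartesian_product case_prod_unfold prod.collapse)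
    also have "\<dots> = (\<Sum>l\<in>{1..r}. \<Sum>k\<in>K. ?a (Inl (k, l)))" by (rule sum.swap)
    also have "\<dots> \<le> (\<Sum>l\<in>{1..r}. (nrm lebesgue f0)\<^sup>2 * ?en n l)"
    proof (rule sum_mono)
      fix l assume l: "l \<in> {1..r}"
      have "(\<Sum>k\<in>K. (cmod (ip lebesgue f0 (dilate_shift (matrix_powi M ?J) k (\<phi>' l))))\<^sup>2) \<le> (nrm lebesgue f0)\<^sup>2 * ?en n l"
        by (rule coarse_energy[OF invertible_matrix_powi[OF invM] f0 phi'[OF l] _ half_open_cube_lebesgue \<rho> j K])
           (unfold f0_def, rule cutoff_support)
      then show "(\<Sum>k\<in>K. ?a (Inl (k, l))) \<le> (nrm lebesgue f0)\<^sup>2 * ?en n l" by simp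
    qed
    finally have "(nrm lebesgue (B.partial FL f0))\<^sup>2 \<le> C4 * (\<Sum>l\<in>{1..r}. (nrm lebesgue f0)\<^sup>2 * ?en n l)"
      using C(2) by simp
    with n(1) show "(nrm lebesgue (B.partial FL f0))\<^sup>2 < (\<epsilon> / 3)\<^sup>2" by simp
  qed (use \<epsilon> in simp)
  let ?g = "\<lambda>x. \<Sum>y\<in>G. c y * WS_family M \<psi> y x"
  have g: "?g \<in> sqint lebesgue" using G by (intro sqint_lincomb WS_sqint) auto
  have P: "B.partial F f0 \<in> sqint lebesgue" by (rule B.partial_sqint[OF F(2)])
  have "nrm lebesgue (\<lambda>x. f x - ?g x) \<le> nrm lebesgue (\<lambda>x. f x - f0 x) + nrm lebesgue (\<lambda>x. f0 x - ?g x)"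
    by (intro nrm_triangle_diff f f0 g)
  moreover have "nrm lebesgue (\<lambda>x. f0 x - ?g x) \<le> nrm lebesgue (\<lambda>x. f0 x - B.partial F f0 x) + nrm lebesgue (\<lambda>x. B.partial F f0 x - ?g x)"
    by (intro nrm_triangle_diff f0 P g)
  moreover have "(\<lambda>x. B.partial F f0 x - ?g x) = B.partial FL f0" by (simp add: fun_eq_iff split)
  moreover have "nrm lebesgue (\<lambda>x. f x - f0 x) < \<epsilon> / 3"
    by (subst nrm_minus_commute) (use m in \<open>simp only: f0_def\<close>)
  moreover have "nrm lebesgue (\<lambda>x. f0 x - B.partial F f0 x) < \<epsilon> / 3"
    by (subst nrm_minus_commute) (rule F(3))
  ultimately have "nrm lebesgue (\<lambda>x. f x - ?g x) < \<epsilon>" using coarse by simp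
  then show ?thesis using G by blast
qed

lemma WS_riesz:
  assumes "expansive M"
  shows "riesz_basis_on lebesgue (WS_index s) (WS_family M \<psi>)"
proof -
  obtain C3 C4 where C: "C3 > 0" "C4 > 0" "\<forall>J. riesz_bounds lebesgue (WSJ_index J r s) (W J) C3 C4"
    using uniform_riesz_bounds by blast
  have "\<exists>C3>0. \<exists>C4>0. riesz_bounds lebesgue (WS_index s) (WS_family M \<psi>) C3 C4"
    using C(1,2) WS_riesz_bounds[OF C(3)[rule_format]] by blast
  then show ?thesis
    unfolding riesz_basis_on_def
    using WS_sqint WS_dense[OF assms] by (intro conjI ballI allI impI)
qed

text \<open>Two wavelets belong to the system whose scale is the smaller one of theirs.\<close>

lemma homogeneous:
  assumes "expansive M"
  shows "homogeneous_biorthogonal_pair M s \<psi> \<psi>'"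
  unfolding homogeneous_biorthogonal_pair_def riesz_basis_L2_iff inner_L2_eq_ip
proof (intro conjI ballI allI)
  show "riesz_basis_on lebesgue (WS_index s) (WS_family M \<psi>)" by (rule WS_riesz[OF assms])
  show "riesz_basis_on lebesgue (WS_index s) (WS_family M \<psi>')"
    by (rule biorthogonal_wavelets.WS_riesz[OF swap assms])
  fix k k' :: "real^'d" and j j' n n'
  assume "k \<in> int_lattice" "k' \<in> int_lattice" "n \<in> {1..s}" "n' \<in> {1..s}"
  then show "ip lebesgue (dilate_shift (matrix_powi M j) k (\<psi> n)) (dilate_shift (matrix_powi M j') k' (\<psi>' n'))
      = of_bool (k = k' \<and> n = n' \<and> j = j')"
    using biorth[of "Inr (j, k, n)" "min j j'" "Inr (j', k', n')"] by (auto simp: of_bool_def)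
qed

end

theorem theorem7:
  fixes M :: "real^'d^'d" and J :: int and r s :: nat
    and \<phi> \<psi> \<phi>' \<psi>' :: "nat \<Rightarrow> real^'d \<Rightarrow> complex"
  assumes "invertible M"
    and "\<And>l. l \<in> {1..r} \<Longrightarrow> \<phi> l \<in> L2" and "\<And>n. n \<in> {1..s} \<Longrightarrow> \<psi> n \<in> L2"
    and "\<And>l. l \<in> {1..r} \<Longrightarrow> \<phi>' l \<in> L2" and "\<And>n. n \<in> {1..s} \<Longrightarrow> \<psi>' n \<in> L2"
    and "nonhomogeneous_biorthogonal_pair M J r s \<phi> \<psi> \<phi>' \<psi>'"
  shows "(\<forall>J'. nonhomogeneous_biorthogonal_pair M J' r s \<phi> \<psi> \<phi>' \<psi>') \<and>
    (\<exists>a b a' b' :: real^'d \<Rightarrow> real^'d \<Rightarrow> complex Matrix.mat.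
       (\<forall>k\<in>int_lattice. torus_matrix r r (a k) \<and> torus_matrix s r (b k) \<and>
                        torus_matrix r r (a' k) \<and> torus_matrix s r (b' k)) \<and>
       has_masks M r \<phi> r \<phi> a \<and> has_masks M s \<psi> r \<phi> b \<and>
       has_masks M r \<phi>' r \<phi>' a' \<and> has_masks M s \<psi>' r \<phi>' b' \<and>
       (int_matrix M \<longrightarrow>
          s = r * (abs_det M - 1) \<and>
          (\<forall>\<omega>. bij_betw \<omega> {..<abs_det M} (coset_reps M) \<longrightarrow>
             (AE \<xi> in lebesgue.
                transpose_mat (map_mat cnj (polyphase r s (abs_det M) \<omega> (a' 0) (b' 0) \<xi>)) *
                polyphase r s (abs_det M) \<omega> (a 0) (b 0) \<xi> = 1\<^sub>m (r * abs_det M))))) \<and>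
    (expansive M \<longrightarrow> homogeneous_biorthogonal_pair M s \<psi> \<psi>')"
proof -
  have all: "nonhomogeneous_biorthogonal_pair M J' r s \<phi> \<psi> \<phi>' \<psi>'" for J'
    using nonhomogeneous_biorthogonal_pair_shift[OF assms(1,6), of "J' - J"] by simp
  interpret biorthogonal_wavelets M r s \<phi> \<psi> \<phi>' \<psi>'
    by unfold_locales (use assms(1-5) all in \<open>auto simp: L2_eq_sqint\<close>)
  interpret S: biorthogonal_wavelets M r s \<phi>' \<psi>' \<phi> \<psi> by (rule swap)
  have Sgen: "S.gen = gen'" "S.gen' = gen"
    by (simp_all add: fun_eq_iff S.gen_def gen_def S.gen'_def gen'_def)
  obtain A where A: "mask_family A" using mask_family_exists by blast
  obtain A' where A': "S.mask_family A'" using S.mask_family_exists by blast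
  have coefA: "has_coefficients coef (A 0)"
    using A unfolding mask_family_def has_coefficients_def coef_def by (auto simp: int_lattice_0)
  have coefA': "has_coefficients coef' (A' 0)"
    using A' unfolding S.mask_family_def has_coefficients_def coef'_def Sgen by (auto simp: int_lattice_0)
  have masks: "has_masks M r \<phi> r \<phi> (mask_mat A 0 r)" "has_masks M s \<psi> r \<phi> (mask_mat A r s)"
    "has_masks M r \<phi>' r \<phi>' (mask_mat A' 0 r)" "has_masks M s \<psi>' r \<phi>' (mask_mat A' r s)"
    by (rule mask_mat_has_masks[OF A] S.mask_mat_has_masks[OF A']; simp add: gen_def S.gen_def)+
  have torus: "torus_matrix r r (mask_mat A 0 r k)" "torus_matrix s r (mask_mat A r s k)"
    "torus_matrix r r (mask_mat A' 0 r k)" "torus_matrix s r (mask_mat A' r s k)" if "k \<in> int_lattice" for k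
    using mask_mat_torus[OF A _ that] S.mask_mat_torus[OF A' _ that] by auto
  have int: "s = r * (abs_det M - 1)" if "int_matrix M"
    by (rule number_of_wavelets_nat[OF that coefA coefA'])
  have poly: "AE \<xi> in lebesgue.
      transpose_mat (map_mat cnj (polyphase r s (abs_det M) \<omega> (mask_mat A' 0 r 0) (mask_mat A' r s 0) \<xi>)) *
      polyphase r s (abs_det M) \<omega> (mask_mat A 0 r 0) (mask_mat A r s 0) \<xi> = 1\<^sub>m (r * abs_det M)"
    if "int_matrix M" "bij_betw \<omega> {..<abs_det M} (coset_reps M)" for \<omega>
    by (rule polyphase_identity[where A=A and A'=A', OF that(1) coefA coefA' that(2)])
  show ?thesis
    apply (intro conjI allI impI)
      apply (rule all)
     apply (rule exI[of _ "mask_mat A 0 r"], rule exI[of _ "mask_mat A r s"],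
            rule exI[of _ "mask_mat A' 0 r"], rule exI[of _ "mask_mat A' r s"])
    subgoal by (intro conjI ballI impI allI) (use torus masks int poly in blast)+
    subgoal by (rule homogeneous)
    done
qed

end
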